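(* Let $n\ge 3$, let $\Omega\subset\mathbb{R}^n$ be a bounded $C^2$-domain, let $\frac12<\alpha<1$, $1<p<\infty$ and $-2\alpha+1-\frac1p<s<0$. For $\phi\in B^s_p(\partial\Omega)$ let $$u(x)=\mathcal{S}_{2\alpha}\phi(x)=\langle\phi,\Gamma_{2\alpha}(x-\cdot)\rangle,\qquad x\in\mathbb{R}^n\setminus\partial\Omega,$$ be its layer potential. Then $u\in B^{s+2\alpha-1+\frac1p}_{loc,p}(\mathbb{R}^n)$, and for every open ball $B_R\subset\mathbb{R}^n$ of radius $R$ centered at the origin with $\Omega\subset B_R$ there is a constant $c_R$, independent of $\phi$, such that $$\|u\|_{B^{s+2\alpha-1+\frac1p}_p(B_R)}\le c_R\,\|\phi\|_{B^s_p(\partial\Omega)}.$$ Moreover, if $p>\frac{n-1}{n+s-1}$, then $u\in\dot B^{s+2\alpha-1+\frac1p}_p(\mathbb{R}^n)$ and there is a constant $c$, independent of $\phi$, such that $$\|u\|_{\dot B^{s+2\alpha-1+\frac1p}_p(\mathbb{R}^n)}\le c\,\|\phi\|_{B^s_p(\partial\Omega)}.$$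
   Context: $\Gamma_{2\alpha}(x)=c(n,2\alpha)\,|x|^{-(n-2\alpha)}$ is the Riesz kernel of order $2\alpha$ in $\mathbb{R}^n$, where $c(n,2\alpha)>0$ is the normalizing constant; one takes $c(n,2\alpha)=\pi^{2\alpha-n/2}\,\Gamma(\frac n2-\alpha)/\Gamma(\alpha)$ (here $\Gamma(\cdot)$ is the Gamma function). Besov spaces (all are of type $B^\sigma_{p,p}$). For $k<\sigma<k+1$ with $k\ge0$ an integer, $$\|f\|_{\dot B^\sigma_p(\mathbb{R}^m)}=\Big(\sum_{|\beta|=k}\iint_{\mathbb{R}^m\times\mathbb{R}^m}\frac{|D^\beta f(x)-D^\beta f(y)|^p}{|x-y|^{m+p(\sigma-k)}}\,dy\,dx\Big)^{1/p},\qquad \|f\|_{B^\sigma_p}=\|f\|_{H^k_p}+\|f\|_{\dot B^\sigma_p},$$ where $H^k_p$ is the usual Sobolev space of functions with derivatives up to order $k$ in $L^p$; $B^\sigma_p(\mathbb{R}^m)$ and $\dot B^\sigma_p(\mathbb{R}^m)$ are the spaces of tempered distributions for which these quantities are finite. For integer $\sigma\ge1$ they are the standard spaces $B^\sigma_{p,p}$ and $\dot B^\sigma_{p,p}$ (for $\sigma=1$ one may use the seminorm $(\iint|f(x+h)-2f(x)+f(x-h)|^p|h|^{-m-p}\,dx\,dh)^{1/p}$). For an open set $U\subset\mathbb{R}^m$ and $\sigma>0$, $B^\sigma_p(U)$ is the space of restrictions to $U$ of elements of $B^\sigma_p(\mathbb{R}^m)$ with the quotient (infimum) norm. $B^\sigma_{loc,p}(\mathbb{R}^n)$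 is the set of $u$ with $u|_{B_R}\in B^\sigma_p(B_R)$ for every $R>0$. Spaces on $\partial\Omega$. There are $r_0>0$, finitely many points $P_1,\dots,P_N\in\partial\Omega$ and bijective $C^2$ parametrizations $\Psi_i:B'(0,r_0)\to B(P_i,r_0)\cap\partial\Omega$ ($B'(0,r_0)$ a ball in $\mathbb{R}^{n-1}$) whose images cover $\partial\Omega$. For $0<\sigma<2$, $\phi\in B^\sigma_p(\partial\Omega)$ means $\phi\circ\Psi_i\in B^\sigma_p(B'(0,r_0))$ for all $i$, with norm $\sum_i\|\phi\circ\Psi_i\|_{B^\sigma_p(B'(0,r_0))}$. For $-2<s<0$, $B^s_p(\partial\Omega)$ is the dual space of $B^{-s}_{p'}(\partial\Omega)$, $\frac1p+\frac1{p'}=1$, and $\langle\cdot,\cdot\rangle$ is the duality pairing, extending $\int_{\partial\Omega}\phi\psi\,dQ$. *)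

theory Defs
  imports "HOL-Analysis.Analysis" "HOL-Library.Multiset"
begin

section \<open>Multi-indices, test functions and tempered distributions\<close>

text \<open>All functions and distributions are real-valued.  Distributions are represented by
  functionals on all functions, of which only the values on Schwartz functions are ever used.\<close>

primrec iter_partial :: "'a::euclidean_space list \<Rightarrow> ('a \<Rightarrow> real) \<Rightarrow> 'a \<Rightarrow> real" where
  "iter_partial [] f = f"
| "iter_partial (b # bs) f = (\<lambda>x. frechet_derivative (iter_partial bs f) (at x) b)"

definition smooth :: "('a::euclidean_space \<Rightarrow> real) \<Rightarrow> bool" where
  "smooth f \<longleftrightarrow> (\<forall>bs. set bs \<subseteq> Basis \<longrightarrow> iter_partial bs f differentiable_on UNIV)"

text \<open>A multi-index is a multiset of coordinate directions: the multiplicity of a basis vector is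
  the corresponding entry, and the size is the order of the multi-index.\<close>

definition multi_indices :: "'a::euclidean_space multiset set" where
  "multi_indices = {\<beta>. set_mset \<beta> \<subseteq> Basis}"

text \<open>Only applied to smooth functions, for which the order of differentiation, that is the
  choice of the list, is irrelevant.\<close>

definition partial :: "'a::euclidean_space multiset \<Rightarrow> ('a \<Rightarrow> real) \<Rightarrow> 'a \<Rightarrow> real" where
  "partial \<beta> f = iter_partial (SOME bs. mset bs = \<beta>) f"

definition test_functions :: "'a::euclidean_space set \<Rightarrow> ('a \<Rightarrow> real) set" where
  "test_functions U =
     {\<eta>. smooth \<eta> \<and> compact (closure {x. \<eta> x \<noteq> 0}) \<and> closure {x. \<eta> x \<noteq> 0} \<subseteq> U}"

definition schwartz :: "('a::euclidean_space \<Rightarrow> real) set" where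
  "schwartz = {\<eta>. smooth \<eta> \<and>
     (\<forall>\<beta>\<in>multi_indices. \<forall>N::nat. bounded (range (\<lambda>x. (1 + norm x) ^ N * partial \<beta> \<eta> x)))}"

definition schwartz_seminorm :: "nat \<Rightarrow> ('a::euclidean_space \<Rightarrow> real) \<Rightarrow> real" where
  "schwartz_seminorm N \<eta> =
     (\<Sum>\<beta> | \<beta> \<in> multi_indices \<and> size \<beta> \<le> N. SUP x. (1 + norm x) ^ N * \<bar>partial \<beta> \<eta> x\<bar>)"

definition tempered_distributions :: "(('a::euclidean_space \<Rightarrow> real) \<Rightarrow> real) set" where
  "tempered_distributions = {T.
     (\<forall>\<eta>\<in>schwartz. \<forall>\<zeta>\<in>schwartz. T (\<lambda>x. \<eta> x + \<zeta> x) = T \<eta> + T \<zeta>) \<and>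
     (\<forall>\<eta>\<in>schwartz. \<forall>a. T (\<lambda>x. a * \<eta> x) = a * T \<eta>) \<and>
     (\<exists>C N. \<forall>\<eta>\<in>schwartz. \<bar>T \<eta>\<bar> \<le> C * schwartz_seminorm N \<eta>)}"

definition dist_deriv ::
  "'a::euclidean_space multiset \<Rightarrow> (('a \<Rightarrow> real) \<Rightarrow> real) \<Rightarrow> ('a \<Rightarrow> real) \<Rightarrow> real" where
  "dist_deriv \<beta> T = (\<lambda>\<eta>. (- 1) ^ size \<beta> * T (partial \<beta> \<eta>))"

text \<open>The restriction of the distribution \<open>T\<close> to the open set \<open>U\<close> is the locally integrable
  function \<open>f\<close>.\<close>

definition represents_on ::
  "'a::euclidean_space set \<Rightarrow> ('a \<Rightarrow> real) \<Rightarrow> (('a \<Rightarrow> real) \<Rightarrow> real) \<Rightarrow> bool" where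
  "represents_on U f T \<longleftrightarrow>
     (\<forall>K. compact K \<and> K \<subseteq> U \<longrightarrow> set_integrable lebesgue K f) \<and>
     (\<forall>\<eta>\<in>test_functions U. T \<eta> = (LINT x|lebesgue. f x * \<eta> x))"

definition has_dist_deriv :: "(('a::euclidean_space \<Rightarrow> real) \<Rightarrow> real) \<Rightarrow> 'a multiset \<Rightarrow> bool" where
  "has_dist_deriv T \<beta> \<longleftrightarrow> (\<exists>g. represents_on UNIV g (dist_deriv \<beta> T))"

definition weak_deriv ::
  "(('a::euclidean_space \<Rightarrow> real) \<Rightarrow> real) \<Rightarrow> 'a multiset \<Rightarrow> 'a \<Rightarrow> real" where
  "weak_deriv T \<beta> = (SOME g. represents_on UNIV g (dist_deriv \<beta> T))"

section \<open>Besov spaces on Euclidean space and on open sets\<close>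

text \<open>The integer \<open>k\<close> with \<open>k < \<sigma> < k + 1\<close>; for integer \<open>\<sigma>\<close> it is \<open>\<sigma> - 1\<close>, and then the
  first difference in the seminorm is replaced by a second difference.\<close>

definition besov_order :: "real \<Rightarrow> nat" where
  "besov_order \<sigma> = nat (\<lceil>\<sigma>\<rceil> - 1)"

definition homog_integral :: "real \<Rightarrow> real \<Rightarrow> ('a::euclidean_space \<Rightarrow> real) \<Rightarrow> ennreal" where
  "homog_integral \<sigma> p g =
     (if \<sigma> \<in> \<int> then
        (\<integral>\<^sup>+ x. (\<integral>\<^sup>+ h. ennreal (\<bar>g (x + h) - 2 * g x + g (x - h)\<bar> powr p
             / norm h powr (real DIM('a) + p)) \<partial>lebesgue) \<partial>lebesgue)
      else
        (\<integral>\<^sup>+ x. (\<integral>\<^sup>+ y. ennreal (\<bar>g x - g y\<bar> powr p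
             / norm (x - y) powr (real DIM('a) + p * (\<sigma> - real (besov_order \<sigma>))))
             \<partial>lebesgue) \<partial>lebesgue))"

definition homog_energy :: "real \<Rightarrow> real \<Rightarrow> (('a::euclidean_space \<Rightarrow> real) \<Rightarrow> real) \<Rightarrow> ennreal" where
  "homog_energy \<sigma> p T =
     (\<Sum>\<beta> | \<beta> \<in> multi_indices \<and> size \<beta> = besov_order \<sigma>. homog_integral \<sigma> p (weak_deriv T \<beta>))"

definition sobolev_energy :: "nat \<Rightarrow> real \<Rightarrow> (('a::euclidean_space \<Rightarrow> real) \<Rightarrow> real) \<Rightarrow> ennreal" where
  "sobolev_energy k p T =
     (\<Sum>\<beta> | \<beta> \<in> multi_indices \<and> size \<beta> \<le> k.
        (\<integral>\<^sup>+ x. ennreal (\<bar>weak_deriv T \<beta> x\<bar> powr p) \<partial>lebesgue))"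

definition homog_besov :: "real \<Rightarrow> real \<Rightarrow> (('a::euclidean_space \<Rightarrow> real) \<Rightarrow> real) set" where
  "homog_besov \<sigma> p = {T \<in> tempered_distributions.
     (\<forall>\<beta>\<in>multi_indices. size \<beta> = besov_order \<sigma> \<longrightarrow> has_dist_deriv T \<beta>) \<and>
     homog_energy \<sigma> p T < \<infinity>}"

definition homog_besov_norm :: "real \<Rightarrow> real \<Rightarrow> (('a::euclidean_space \<Rightarrow> real) \<Rightarrow> real) \<Rightarrow> real" where
  "homog_besov_norm \<sigma> p T = enn2real (homog_energy \<sigma> p T) powr (1 / p)"

definition sobolev :: "nat \<Rightarrow> real \<Rightarrow> (('a::euclidean_space \<Rightarrow> real) \<Rightarrow> real) set" where
  "sobolev k p = {T \<in> tempered_distributions.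
     (\<forall>\<beta>\<in>multi_indices. size \<beta> \<le> k \<longrightarrow> has_dist_deriv T \<beta>) \<and> sobolev_energy k p T < \<infinity>}"

definition sobolev_norm :: "nat \<Rightarrow> real \<Rightarrow> (('a::euclidean_space \<Rightarrow> real) \<Rightarrow> real) \<Rightarrow> real" where
  "sobolev_norm k p T = enn2real (sobolev_energy k p T) powr (1 / p)"

definition besov :: "real \<Rightarrow> real \<Rightarrow> (('a::euclidean_space \<Rightarrow> real) \<Rightarrow> real) set" where
  "besov \<sigma> p = sobolev (besov_order \<sigma>) p \<inter> homog_besov \<sigma> p"

definition besov_norm :: "real \<Rightarrow> real \<Rightarrow> (('a::euclidean_space \<Rightarrow> real) \<Rightarrow> real) \<Rightarrow> real" where
  "besov_norm \<sigma> p T = sobolev_norm (besov_order \<sigma>) p T + homog_besov_norm \<sigma> p T"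

text \<open>For \<open>\<sigma> > 0\<close> the elements of \<open>besov \<sigma> p\<close> are functions in \<open>L\<^sup>p\<close>, so their
  restrictions are taken as functions on \<open>U\<close>.  Values outside \<open>U\<close> or on null sets are
  irrelevant.\<close>

definition besov_on :: "'a::euclidean_space set \<Rightarrow> real \<Rightarrow> real \<Rightarrow> ('a \<Rightarrow> real) set" where
  "besov_on U \<sigma> p = {f. \<exists>T\<in>besov \<sigma> p. represents_on U f T}"

definition besov_on_norm :: "'a::euclidean_space set \<Rightarrow> real \<Rightarrow> real \<Rightarrow> ('a \<Rightarrow> real) \<Rightarrow> real" where
  "besov_on_norm U \<sigma> p f = Inf {besov_norm \<sigma> p T | T. T \<in> besov \<sigma> p \<and> represents_on U f T}"

definition besov_loc :: "real \<Rightarrow> real \<Rightarrow> ('a::euclidean_space \<Rightarrow> real) set" where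
  "besov_loc \<sigma> p = {f. \<forall>R>0. f \<in> besov_on (ball 0 R) \<sigma> p}"

section \<open>Domains with twice continuously differentiable boundary\<close>

definition C2_derivs_on ::
  "'a::euclidean_space set \<Rightarrow> ('a \<Rightarrow> 'b::euclidean_space) \<Rightarrow> ('a \<Rightarrow> 'a \<Rightarrow>\<^sub>L 'b)
     \<Rightarrow> ('a \<Rightarrow> 'a \<Rightarrow>\<^sub>L ('a \<Rightarrow>\<^sub>L 'b)) \<Rightarrow> bool" where
  "C2_derivs_on S f f' f'' \<longleftrightarrow>
     (\<forall>x\<in>S. (f has_derivative blinfun_apply (f' x)) (at x)) \<and>
     (\<forall>x\<in>S. (f' has_derivative blinfun_apply (f'' x)) (at x)) \<and>
     continuous_on S f''"

text \<open>Near each boundary point, \<open>\<Omega>\<close> is the region above the graph of a \<open>C\<^sup>2\<close> function \<open>\<gamma>\<close> over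
  the hyperplane orthogonal to a unit vector \<open>e\<close>; \<open>\<gamma>\<close> is only evaluated on that hyperplane.\<close>

definition C2_domain :: "'a::euclidean_space set \<Rightarrow> bool" where
  "C2_domain \<Omega> \<longleftrightarrow> open \<Omega> \<and> connected \<Omega> \<and> \<Omega> \<noteq> {} \<and>
     (\<forall>P\<in>frontier \<Omega>. \<exists>r>0. \<exists>e. \<exists>\<gamma> \<gamma>' \<gamma>''. norm e = 1 \<and>
        C2_derivs_on UNIV (\<gamma> :: 'a \<Rightarrow> real) \<gamma>' \<gamma>'' \<and>
        \<Omega> \<inter> ball P r = {x \<in> ball P r. x \<bullet> e > \<gamma> (x - (x \<bullet> e) *\<^sub>R e)})"

text \<open>The derivatives of the parametrizations are bounded, and their differentials are
  nondegenerate, uniformly on the open ball.  Otherwise smooth functions on the boundary might fail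
  to have a finite norm, and norms obtained from different atlases need not be equivalent.\<close>

definition C2_parametrization ::
  "'b::euclidean_space set \<Rightarrow> ('b \<Rightarrow> 'a::euclidean_space) \<Rightarrow> bool" where
  "C2_parametrization S \<Psi> \<longleftrightarrow>
     (\<exists>\<Psi>' \<Psi>''. C2_derivs_on S \<Psi> \<Psi>' \<Psi>'' \<and>
        (\<exists>c>0. \<exists>C. \<forall>y\<in>S. norm (\<Psi>' y) \<le> C \<and> norm (\<Psi>'' y) \<le> C \<and>
           (\<forall>v. c * norm v \<le> norm (blinfun_apply (\<Psi>' y) v))))"

definition boundary_atlas ::
  "'a::euclidean_space set \<Rightarrow> real \<Rightarrow> nat \<Rightarrow> (nat \<Rightarrow> 'a) \<Rightarrow> (nat \<Rightarrow> 'b::euclidean_space \<Rightarrow> 'a) \<Rightarrow> bool"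
  where
  "boundary_atlas \<Omega> r\<^sub>0 N P \<Psi> \<longleftrightarrow> r\<^sub>0 > 0 \<and>
     (\<forall>i<N. P i \<in> frontier \<Omega> \<and>
        bij_betw (\<Psi> i) (ball 0 r\<^sub>0) (ball (P i) r\<^sub>0 \<inter> frontier \<Omega>) \<and>
        C2_parametrization (ball 0 r\<^sub>0) (\<Psi> i)) \<and>
     frontier \<Omega> \<subseteq> (\<Union>i<N. \<Psi> i ` ball 0 r\<^sub>0)"

section \<open>Besov spaces on the boundary\<close>

text \<open>For \<open>0 < \<sigma> < 2\<close>.  Functions on the boundary are total functions whose values off the boundary
  are irrelevant; the boundary itself enters only through the parametrizations.\<close>

definition bdry_besov ::
  "real \<Rightarrow> nat \<Rightarrow> (nat \<Rightarrow> 'b::euclidean_space \<Rightarrow> 'a::euclidean_space) \<Rightarrow> real \<Rightarrow> real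
     \<Rightarrow> ('a \<Rightarrow> real) set" where
  "bdry_besov r\<^sub>0 N \<Psi> \<sigma> p = {\<psi>. \<forall>i<N. \<psi> \<circ> \<Psi> i \<in> besov_on (ball 0 r\<^sub>0) \<sigma> p}"

definition bdry_besov_norm ::
  "real \<Rightarrow> nat \<Rightarrow> (nat \<Rightarrow> 'b::euclidean_space \<Rightarrow> 'a::euclidean_space) \<Rightarrow> real \<Rightarrow> real
     \<Rightarrow> ('a \<Rightarrow> real) \<Rightarrow> real" where
  "bdry_besov_norm r\<^sub>0 N \<Psi> \<sigma> p \<psi> = (\<Sum>i<N. besov_on_norm (ball 0 r\<^sub>0) \<sigma> p (\<psi> \<circ> \<Psi> i))"

text \<open>For \<open>-2 < s < 0\<close>, the space \<open>B\<^sup>s\<^sub>p\<close> on the boundary is the dual of \<open>B\<^bsup>-s\<^esup>\<close> with the conjugate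
  exponent \<open>p / (p - 1)\<close>; the pairing with \<open>\<psi>\<close> is the application \<open>\<phi> \<psi>\<close>.\<close>

definition bdry_besov_dual ::
  "real \<Rightarrow> nat \<Rightarrow> (nat \<Rightarrow> 'b::euclidean_space \<Rightarrow> 'a::euclidean_space) \<Rightarrow> real \<Rightarrow> real
     \<Rightarrow> (('a \<Rightarrow> real) \<Rightarrow> real) set" where
  "bdry_besov_dual r\<^sub>0 N \<Psi> s p = (let X = bdry_besov r\<^sub>0 N \<Psi> (- s) (p / (p - 1)) in
     {\<phi>. (\<forall>\<psi>\<in>X. \<forall>\<theta>\<in>X. \<phi> (\<lambda>Q. \<psi> Q + \<theta> Q) = \<phi> \<psi> + \<phi> \<theta>) \<and>
         (\<forall>\<psi>\<in>X. \<forall>a. \<phi> (\<lambda>Q. a * \<psi> Q) = a * \<phi> \<psi>) \<and>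
         (\<exists>C. \<forall>\<psi>\<in>X. \<bar>\<phi> \<psi>\<bar> \<le> C * bdry_besov_norm r\<^sub>0 N \<Psi> (- s) (p / (p - 1)) \<psi>)})"

definition bdry_besov_dual_norm ::
  "real \<Rightarrow> nat \<Rightarrow> (nat \<Rightarrow> 'b::euclidean_space \<Rightarrow> 'a::euclidean_space) \<Rightarrow> real \<Rightarrow> real
     \<Rightarrow> (('a \<Rightarrow> real) \<Rightarrow> real) \<Rightarrow> real" where
  "bdry_besov_dual_norm r\<^sub>0 N \<Psi> s p \<phi> =
     Sup {\<bar>\<phi> \<psi>\<bar> | \<psi>. \<psi> \<in> bdry_besov r\<^sub>0 N \<Psi> (- s) (p / (p - 1)) \<and>
                 bdry_besov_norm r\<^sub>0 N \<Psi> (- s) (p / (p - 1)) \<psi> \<le> 1}"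

section \<open>The layer potential\<close>

definition riesz_kernel :: "real \<Rightarrow> 'a::euclidean_space \<Rightarrow> real" where
  "riesz_kernel \<alpha> x =
     pi powr (2 * \<alpha> - real DIM('a) / 2) * Gamma (real DIM('a) / 2 - \<alpha>) / Gamma \<alpha>
       * norm x powr (- (real DIM('a) - 2 * \<alpha>))"

text \<open>\<open>riesz_kernel \<alpha>\<close> is the kernel of order \<open>2\<alpha>\<close>.  The potential is only defined off the boundary;
  the value \<open>0\<close> on the boundary, a null set, is a dummy.\<close>

definition layer_potential ::
  "real \<Rightarrow> 'a::euclidean_space set \<Rightarrow> (('a \<Rightarrow> real) \<Rightarrow> real) \<Rightarrow> 'a \<Rightarrow> real" where
  "layer_potential \<alpha> \<Omega> \<phi> x =
     (if x \<in> frontier \<Omega> then 0 else \<phi> (\<lambda>Q. riesz_kernel \<alpha> (x - Q)))"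

end

theory Submission
  imports Defs "HOL-Library.Nat_Bijection"
begin

text \<open>The Riesz kernel is a sum over \<open>j\<close> of bumps \<open>2\<^bsup>j(n - 2\<alpha>)\<^esup> \<chi>(2\<^bsup>j\<^esup> x)\<close> with
  one smooth \<open>\<chi>\<close> supported in an annulus, so off the boundary the potential is a locally finite sum of
  smooth pieces \<open>u\<^sub>j\<close>.  A finite sum over \<open>j\<close> and over a lattice of spacing \<open>2\<^bsup>-j\<^esup>\<close> of bumps centred there and restricted to
  the boundary is a sum of atoms, whose norm in \<open>B\<^bsup>-s\<^esup>\<close> is bounded by the weighted
  \<open>\<ell>\<^bsup>p'\<^esup>\<close>-norm of the coefficients.  Duality with \<open>\<phi>\<close> and an average over translates of the lattice
  therefore bound the weighted \<open>\<ell>\<^bsup>p\<^esup>\<close>-sum of the \<open>L\<^bsup>p\<^esup>\<close>-norms of the \<open>u\<^sub>j\<close>, and of the pieces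
  built from any other bounded family of bumps, in particular those giving derivatives and differences of \<open>u\<^sub>j\<close>.
  A Hardy inequality over dyadic scales turns such bounds into an estimate of the Besov seminorm of
  \<open>u\<close>.  The same inequality on \<open>\<real>\<^bsup>n-1\<^esup>\<close>, applied in charts that are extended to the whole space by a
  reflection of higher order, gives the bound for atoms.  The scales \<open>j < 0\<close> are finitely many for the
  local estimate; for the global one their bounds form a convergent geometric series when \<open>p > (n - 1) / (n + s - 1)\<close>.\<close>

section \<open>Smooth functions and bumps\<close>

text \<open>The functional \<phi> is known only through its pairings, so all information on the
  potential is read off from pairings with bumps. Both -s and \<sigma> = s + 2\<alpha> - 1 + 1/p lie
  in (0,2). Hence atoms of class C^{1,1} suffice and need no vanishing moments, and this is just the
  regularity that charts of class C^2 with bounded derivatives preserve. With q conjugate to p, an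
  atom of B^{-s}_q on an (n-1)-dimensional surface carries the factor 2^{je}, e = (n-1)/q + s.
  Replacing a sum over a lattice of spacing 2^{-j} by an integral over R^n adds n to the exponent,
  and ep + n = (\<sigma> + n - 2\<alpha>)p. This identity produces the order \<sigma>; its summand
  1/p reflects codimension one. The condition on p in the global estimate says e > 0, because ep =
  p(n-1+s) - (n-1). At low frequencies there is no duality gain: the pairing is merely bounded
  there, on a ball of radius about 2^{-j}, and this gives the terms 2^{jep}. The admissible bumps at
  different scales are independent of each other, so the coefficient at scale j can be a supremum
  over all of them, and one summable sequence serves the pieces, their derivatives and their
  differences.\<close>

fun ck :: "nat \<Rightarrow> ('a::euclidean_space \<Rightarrow> real) \<Rightarrow> bool" where
  "ck 0 f \<longleftrightarrow> continuous_on UNIV f"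
| "ck (Suc k) f \<longleftrightarrow>
     (\<exists>D. (\<forall>x. (f has_derivative D x) (at x)) \<and> (\<forall>v. ck k (\<lambda>x. D x v)))"

lemma ck_SucE:
  assumes "ck (Suc k) f"
  obtains D where "\<forall>x. (f has_derivative D x) (at x)" "\<forall>v. ck k (\<lambda>x. D x v)"
  using assms unfolding ck.simps(2) by blast

lemma ck_SucI:
  assumes "\<And>x. (f has_derivative D x) (at x)" "\<And>v. ck k (\<lambda>x. D x v)"
  shows "ck (Suc k) f"
  using assms unfolding ck.simps(2) by blast

lemma ck_const [simp]: "ck k (\<lambda>x. c)"
proof (induction k arbitrary: c)
  case 0
  show ?case by (simp only: ck.simps(1) continuous_on_const)
next
  case (Suc k)
  show ?case
  proof (rule ck_SucI)
    show "((\<lambda>x. c) has_derivative (\<lambda>v. 0)) (at x)" for x :: 'a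
      by (rule has_derivative_const)
    show "ck k (\<lambda>x::'a. 0)"
      by (rule Suc)
  qed
qed

lemma ck_imp_continuous: "ck k f \<Longrightarrow> continuous_on UNIV f"
  by (cases k) (auto intro: has_derivative_continuous_on)

lemma ck_SucD: "ck (Suc k) f \<Longrightarrow> ck k f"
proof (induction k arbitrary: f)
  case 0
  then show ?case using ck_imp_continuous by fastforce
next
  case (Suc k)
  obtain D where D: "\<forall>x. (f has_derivative D x) (at x)" "\<forall>v. ck (Suc k) (\<lambda>x. D x v)"
    using ck_SucE[OF Suc.prems] .
  show ?case
  proof (rule ck_SucI[of f D])
    show "ck k (\<lambda>x. D x v)" for v
      by (rule Suc.IH) (rule D(2)[rule_format])
  qed (rule D(1)[rule_format])
qed

lemma ck_add: "ck k f \<Longrightarrow> ck k g \<Longrightarrow> ck k (\<lambda>x. f x + g x)"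
proof (induction k arbitrary: f g)
  case 0
  then show ?case by (simp add: continuous_on_add)
next
  case (Suc k)
  obtain D where D: "\<forall>x. (f has_derivative D x) (at x)" "\<forall>v. ck k (\<lambda>x. D x v)"
    using ck_SucE[of k f] Suc.prems by metis
  obtain E where E: "\<forall>x. (g has_derivative E x) (at x)" "\<forall>v. ck k (\<lambda>x. E x v)"
    using ck_SucE[of k g] Suc.prems by metis
  show ?case
    by (rule ck_SucI[of _ "\<lambda>x v. D x v + E x v"])
      (use D E in \<open>simp_all only: Suc.IH has_derivative_add simp_thms\<close>)
qed

lemma ck_mult: "ck k f \<Longrightarrow> ck k g \<Longrightarrow> ck k (\<lambda>x. f x * g x)"
proof (induction k arbitrary: f g)
  case 0
  then show ?case by (simp add: continuous_on_mult)
next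
  case (Suc k)
  obtain D where D: "\<forall>x. (f has_derivative D x) (at x)" "\<forall>v. ck k (\<lambda>x. D x v)"
    using ck_SucE[of k f] Suc.prems by metis
  obtain E where E: "\<forall>x. (g has_derivative E x) (at x)" "\<forall>v. ck k (\<lambda>x. E x v)"
    using ck_SucE[of k g] Suc.prems by metis
  have "ck k f" "ck k g" by (rule ck_SucD, rule Suc.prems)+
  then show ?case
    by (intro ck_SucI[of _ "\<lambda>x v. f x * E x v + D x v * g x"])
      (use D E in \<open>simp_all only: Suc.IH ck_add has_derivative_mult simp_thms\<close>)
qed

lemma ck_cmult: "ck k f \<Longrightarrow> ck k (\<lambda>x. c * f x)"
  by (rule ck_mult) auto

lemma ck_diff: "ck k f \<Longrightarrow> ck k g \<Longrightarrow> ck k (\<lambda>x. f x - g x)"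
  using ck_add[of k f "\<lambda>x. (-1) * g x"] ck_cmult[of k g "-1"] by simp

lemma ck_sum: "(\<And>i. i \<in> I \<Longrightarrow> ck k (f i)) \<Longrightarrow> ck k (\<lambda>x. \<Sum>i\<in>I. f i x)"
  by (induction I rule: infinite_finite_induct) (auto intro: ck_add)

lemma ck_prod: "(\<And>i. i \<in> I \<Longrightarrow> ck k (f i)) \<Longrightarrow> ck k (\<lambda>x. \<Prod>i\<in>I. f i x)"
  by (induction I rule: infinite_finite_induct) (auto intro: ck_mult)

lemma ck_inner: "ck k (\<lambda>x. x \<bullet> a)"
proof (cases k)
  case (Suc l)
  then show ?thesis
    by (auto intro!: ck_SucI[of _ "\<lambda>x v. v \<bullet> a"] derivative_eq_intros simp del: ck.simps)
qed (auto intro: continuous_intros)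

lemma ck_norm2: "ck k (\<lambda>x::'a::euclidean_space. x \<bullet> x)"
proof -
  have "(\<lambda>x::'a. x \<bullet> x) = (\<lambda>x. \<Sum>b\<in>Basis. (x \<bullet> b) * (x \<bullet> b))"
    using euclidean_inner by blast
  then show ?thesis by (simp add: ck_sum ck_mult ck_inner)
qed

lemma ck_compose: "ck k (g :: real \<Rightarrow> real) \<Longrightarrow> ck k f \<Longrightarrow> ck k (\<lambda>x. g (f x))"
proof (induction k arbitrary: f g)
  case 0
  then show ?case using continuous_on_compose2 by force
next
  case (Suc k)
  obtain D where D: "\<forall>x. (f has_derivative D x) (at x)" "\<forall>v. ck k (\<lambda>x. D x v)"
    using ck_SucE[of k f] Suc.prems by metis
  obtain E where E: "\<forall>x. (g has_derivative E x) (at x)" "\<forall>v. ck k (\<lambda>x. E x v)"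
    using ck_SucE[of k g] Suc.prems by metis
  have fk: "ck k f" by (rule ck_SucD, rule Suc.prems)
  \<comment> \<open>The direction \<open>D x v\<close> varies with x, while regularity of E is known
    along fixed directions only. Linearity on the real line turns the chain rule into a product of
    two functions of class C^k.\<close>
  have lin: "E t v = v * E t 1" for t v
    using linear_scale[OF has_derivative_linear[OF E(1)[rule_format, of t]], of v 1] by simp
  show ?case
  proof (rule ck_SucI[of _ "\<lambda>x v. E (f x) (D x v)"])
    show "((\<lambda>x. g (f x)) has_derivative (\<lambda>v. E (f x) (D x v))) (at x)" for x
      using has_derivative_compose[of f "D x" x UNIV g "E (f x)"] D E by simp
    have "ck k (\<lambda>x. E (f x) 1)" by (rule Suc.IH[OF _ fk]) (use E in auto)
    then have "ck k (\<lambda>x. D x v * E (f x) 1)" for v by (intro ck_mult) (use D in auto)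
    moreover have "(\<lambda>x. E (f x) (D x v)) = (\<lambda>x. D x v * E (f x) 1)" for v
      using lin by (intro ext) blast
    ultimately show "ck k (\<lambda>x. E (f x) (D x v))" for v by simp
  qed
qed

lemma ck_powr: "ck k f \<Longrightarrow> (\<And>x. f x > 0) \<Longrightarrow> ck k (\<lambda>x. f x powr c)"
proof (induction k arbitrary: c)
  case 0
  have "f x \<noteq> 0" for x using 0(2)[of x] by linarith
  then show ?case using 0(1) by (simp add: continuous_on_powr)
next
  case (Suc k)
  obtain D where D: "\<forall>x. (f has_derivative D x) (at x)" "\<forall>v. ck k (\<lambda>x. D x v)"
    using ck_SucE[of k f] Suc.prems by metis
  have fk: "ck k f" by (rule ck_SucD, rule Suc.prems)
  show ?case
  proof (rule ck_SucI[of _ "\<lambda>x v. (c * f x powr (c - 1)) * D x v"])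
    show "((\<lambda>x. f x powr c) has_derivative (\<lambda>v. (c * f x powr (c - 1)) * D x v)) (at x)" for x
    proof -
      have "((\<lambda>y. y powr c) has_real_derivative c * f x powr (c - 1)) (at (f x))"
        using Suc.prems(2) by (intro has_real_derivative_powr) auto
      then show ?thesis
        using has_derivative_compose[of f "D x" x UNIV "\<lambda>y. y powr c" "(*) (c * f x powr (c - 1))"] D(1)
        by (simp add: has_field_derivative_def)
    qed
    show "ck k (\<lambda>x. (c * f x powr (c - 1)) * D x v)" for v
      using Suc.IH[OF fk, of "c - 1"] Suc.prems(2) D(2) by (intro ck_mult ck_cmult) auto
  qed
qed

lemma ck_iter_partial:
  assumes "\<And>k. ck k f"
  shows "ck k (iter_partial bs f)"
proof (induction bs arbitrary: k)
  case Nil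
  then show ?case using assms by simp
next
  case (Cons b bs)
  obtain D where D: "\<forall>x. (iter_partial bs f has_derivative D x) (at x)" "\<forall>v. ck k (\<lambda>x. D x v)"
    using ck_SucE[OF Cons[of "Suc k"]] .
  have "frechet_derivative (iter_partial bs f) (at x) = D x" for x
    using frechet_derivative_at[OF D(1)[rule_format]] by simp
  then show ?case using D(2) by simp
qed

lemma ck_imp_smooth:
  assumes "\<And>k. ck k f"
  shows "smooth f"
  unfolding smooth_def
proof (intro allI impI)
  fix bs :: "'a list"
  have "ck (Suc 0) (iter_partial bs f)" using ck_iter_partial[OF assms] .
  then show "iter_partial bs f differentiable_on UNIV"
    unfolding differentiable_on_def differentiable_def by auto
qed

text \<open>The derivative of exp(-c/t) t^{-n} is a combination of two functions of the same shape,
  so smoothness of the whole class follows by a single induction. The parameter c is kept because c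
  tending to 0 turns these functions into indicators of half-lines.\<close>

definition flat :: "real \<Rightarrow> nat \<Rightarrow> real \<Rightarrow> real" where
  "flat c n t = (if t > 0 then exp (- c / t) * inverse t ^ n else 0)"

text \<open>From (1 + x/N)^N \<le> exp x with N = n + 2. The exponential beats t^{-n} with t^2 to
  spare, which makes the derivative at the origin vanish.\<close>

lemma flat_le:
  assumes "c > 0"
  shows "\<bar>flat c n t\<bar> \<le> (real (n + 2) / c) ^ (n + 2) * t\<^sup>2"
proof (cases "t > 0")
  case True
  define N where "N = n + 2"
  define a where "a = c / t / real N"
  have a: "a > 0" using assms True by (simp add: a_def N_def)
  have "a ^ N \<le> (1 + a) ^ N"
    using a by (intro power_mono) auto
  also have "\<dots> \<le> exp (c / t)"
    unfolding a_def using assms True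
    by (intro exp_ge_one_plus_x_over_n_power_n) (auto intro: order_trans[of _ 0] simp: N_def)
  finally have "exp (- c / t) \<le> inverse (a ^ N)"
    using a by (simp add: exp_minus le_imp_inverse_le)
  also have "inverse (a ^ N) = (real N / c) ^ N * t ^ N"
    unfolding power_inverse[symmetric] power_mult_distrib[symmetric] using True assms
    by (intro arg_cong[where f="\<lambda>x. x ^ N"]) (simp add: a_def)
  finally have "exp (- c / t) * inverse t ^ n \<le> (real N / c) ^ N * t ^ N * inverse t ^ n"
    using True by (intro mult_right_mono) auto
  also have "\<dots> = (real N / c) ^ N * t\<^sup>2"
    using True by (simp add: N_def power_add power_inverse power2_eq_square)
  finally show ?thesis using True by (simp add: flat_def N_def)
qed (use assms in \<open>simp add: flat_def\<close>)

lemma flat_has_real_derivative: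
  assumes "c > 0"
  shows "(flat c n has_real_derivative (c * flat c (n + 2) t - real n * flat c (n + 1) t)) (at t)"
proof -
  consider "t > 0" | "t < 0" | "t = 0" by linarith
  then show ?thesis
  proof cases
    case 1
    have e: "((\<lambda>t. exp (- c / t)) has_real_derivative c * exp (- c / t) * inverse t ^ 2) (at t)"
      using 1 by (auto intro!: derivative_eq_intros simp: power2_eq_square field_simps)
    have p: "((\<lambda>t. inverse t ^ n) has_real_derivative - real n * inverse t ^ (n + 1)) (at t)"
    proof (cases n)
      case (Suc l)
      have "((\<lambda>t. inverse t ^ n) has_real_derivative real n * inverse t ^ (n - 1) * (- (inverse t ^ 2))) (at t)"
        using 1 by (auto intro!: derivative_eq_intros simp: power2_eq_square)
      moreover have "real n * inverse t ^ (n - 1) * (- (inverse t ^ 2)) = - real n * inverse t ^ (n + 1)"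
        using Suc by (simp add: power2_eq_square algebra_simps)
      ultimately show ?thesis by metis
    qed simp
    have "((\<lambda>t. exp (- c / t) * inverse t ^ n) has_real_derivative
        (c * flat c (n + 2) t - real n * flat c (n + 1) t)) (at t)"
      using DERIV_mult[OF e p] 1
      by (simp add: flat_def power_add power2_eq_square algebra_simps)
    then show ?thesis
      by (rule has_field_derivative_transform_within_open[of _ _ _ "{0<..}"])
        (use 1 in \<open>auto simp: flat_def\<close>)
  next
    case 2
    have "((\<lambda>t. 0) has_real_derivative 0) (at t)" by simp
    then have "(flat c n has_real_derivative 0) (at t)"
      by (rule has_field_derivative_transform_within_open[of _ _ _ "{..<0}"])
        (use 2 in \<open>auto simp: flat_def\<close>)
    then show ?thesis using 2 by (simp add: flat_def)
  next
    case 3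
    let ?K = "(real (n + 2) / c) ^ (n + 2)"
    have "((\<lambda>h. flat c n h / h) \<longlongrightarrow> 0) (at 0)"
    proof (rule Lim_null_comparison)
      show "\<forall>\<^sub>F h in at 0. norm (flat c n h / h) \<le> ?K * \<bar>h\<bar>"
      proof (rule eventually_mono[OF eventually_neq_at_within])
        fix h :: real assume "h \<noteq> 0"
        then show "norm (flat c n h / h) \<le> ?K * \<bar>h\<bar>"
          using flat_le[OF assms, of n h]
          by (simp add: abs_divide divide_le_eq power2_eq_square mult.assoc)
      qed
      show "((\<lambda>h. ?K * \<bar>h\<bar>) \<longlongrightarrow> 0) (at 0)"
        by (rule tendsto_eq_intros | simp)+
    qed
    then show ?thesis using 3 by (simp add: DERIV_def flat_def)
  qed
qed

lemma ck_flat: "c > 0 \<Longrightarrow> ck k (flat c n)"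
proof (induction k arbitrary: n)
  case 0
  then show ?case
    using flat_has_real_derivative[OF 0]
    by (simp, meson DERIV_isCont continuous_at_imp_continuous_on)
next
  case (Suc k)
  let ?d = "\<lambda>t. c * flat c (n + 2) t - real n * flat c (n + 1) t"
  show ?case
  proof (rule ck_SucI[of _ "\<lambda>t v. ?d t * v"])
    show "(flat c n has_derivative (*) (?d t)) (at t)" for t
      using flat_has_real_derivative[OF Suc.prems] by (simp add: has_field_derivative_def)
    show "ck k (\<lambda>t. ?d t * v)" for v
      by (intro ck_mult ck_diff ck_cmult Suc.IH Suc.prems ck_const)
  qed
qed

lemma flat_nonneg: "flat c n t \<ge> 0"
  by (simp add: flat_def)

lemma flat_pos: "t > 0 \<Longrightarrow> flat c n t > 0"
  by (simp add: flat_def)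

text \<open>The thresholds 1 and 4 are meant for squared norms: applied to w \<bullet> w the
  function is 1 for |w| \<le> 1 and 0 for |w| \<ge> 2. The two flat functions in the denominator
  never vanish together, since t < 4 or t > 1.\<close>

definition step_fun :: "real \<Rightarrow> real" where
  "step_fun t = flat 1 0 (4 - t) * (flat 1 0 (4 - t) + flat 1 0 (t - 1)) powr (- 1)"

lemma ck_affine_real: "ck k (\<lambda>t::real. a * t + b)"
  using ck_add[OF ck_cmult[OF ck_inner[of k "1::real"], of a] ck_const[of k b]] by simp

lemma ck_step_fun: "ck k step_fun"
proof -
  have 1: "ck k (\<lambda>t. flat 1 0 (4 - t))"
    using ck_compose[OF ck_flat ck_affine_real[of k "-1" 4], of 1 0] by simp
  have 2: "ck k (\<lambda>t. flat 1 0 (t - 1))"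
    using ck_compose[OF ck_flat ck_affine_real[of k "1" "-1"], of 1 0] by simp
  have "flat 1 0 (4 - t) + flat 1 0 (t - 1) > 0" for t
    using flat_nonneg[of 1 0 "4 - t"] flat_pos[of "4 - t" 1 0] flat_nonneg[of 1 0 "t - 1"] flat_pos[of "t - 1" 1 0]
    by (cases "t < 4") auto
  then show ?thesis unfolding step_fun_def using 1 2 by (intro ck_mult ck_powr ck_add) auto
qed

lemma step_fun_1: "t \<le> 1 \<Longrightarrow> step_fun t = 1"
  by (simp add: step_fun_def flat_def powr_minus)

lemma step_fun_0: "t \<ge> 4 \<Longrightarrow> step_fun t = 0"
  by (simp add: step_fun_def flat_def)

lemma step_fun_nonneg: "step_fun t \<ge> 0"
  by (simp add: step_fun_def flat_nonneg)

section \<open>Functions with uniformly bounded derivatives\<close>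

text \<open>The class C^{k,1} with one constant for the function, its directional derivatives and
  the Lipschitz bound of the last ones. Base level 0 already contains a Lipschitz bound, so
  \<open>creg 1\<close> is C^{1,1}: enough for Besov smoothness below 2, and stable under
  composition with C^{1,1} charts.\<close>

fun creg :: "nat \<Rightarrow> real \<Rightarrow> ('a::euclidean_space \<Rightarrow> real) \<Rightarrow> bool" where
  "creg 0 M f \<longleftrightarrow> (\<forall>x. \<bar>f x\<bar> \<le> M) \<and> (\<forall>x y. \<bar>f x - f y\<bar> \<le> M * norm (x - y))"
| "creg (Suc k) M f \<longleftrightarrow> (\<forall>x. \<bar>f x\<bar> \<le> M) \<and>
     (\<exists>D. (\<forall>x. (f has_derivative D x) (at x)) \<and> (\<forall>v. norm v \<le> 1 \<longrightarrow> creg k M (\<lambda>x. D x v)))"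

declare creg.simps [simp del]

lemma creg_SucE:
  assumes "creg (Suc k) M f"
  obtains D where "\<And>x. (f has_derivative D x) (at x)" "\<And>v. norm v \<le> 1 \<Longrightarrow> creg k M (\<lambda>x. D x v)"
  using assms unfolding creg.simps by blast

lemma creg_SucI:
  assumes "\<And>x. \<bar>f x\<bar> \<le> M" "\<And>x. (f has_derivative D x) (at x)"
    "\<And>v. norm v \<le> 1 \<Longrightarrow> creg k M (\<lambda>x. D x v)"
  shows "creg (Suc k) M f"
  using assms unfolding creg.simps by blast

lemma creg_bound: "creg k M f \<Longrightarrow> \<bar>f x\<bar> \<le> M"
  by (cases k) (auto simp: creg.simps)

lemma creg_nonneg: "creg k M f \<Longrightarrow> M \<ge> 0"
  using creg_bound[of k M f 0] by linarith

lemma has_derivative_bound_scale: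
  assumes "(f has_derivative D) (at (x :: 'a::real_normed_vector))" "\<And>v. norm v \<le> 1 \<Longrightarrow> \<bar>D v\<bar> \<le> M"
  shows "\<bar>D v\<bar> \<le> M * norm v"
proof (cases "v = 0")
  case True
  then show ?thesis using linear_0[OF has_derivative_linear[OF assms(1)]] by simp
next
  case False
  have "D v = norm v * D (v /\<^sub>R norm v)"
    using linear_scale[OF has_derivative_linear[OF assms(1)], of "norm v" "v /\<^sub>R norm v"] False by simp
  then show ?thesis using assms(2)[of "v /\<^sub>R norm v"] False by (simp add: abs_mult mult.commute)
qed

lemma lipschitz_from_derivative:
  fixes f :: "'a::real_normed_vector \<Rightarrow> real"
  assumes "\<And>x. (f has_derivative D x) (at x)" "\<And>x v. norm v \<le> 1 \<Longrightarrow> \<bar>D x v\<bar> \<le> M"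
  shows "\<bar>f x - f y\<bar> \<le> M * norm (x - y)"
proof -
  have "norm (f x - f y) \<le> M * norm (x - y)"
  proof (rule differentiable_bound[of UNIV])
    show "onorm (D x) \<le> M" for x
    proof (rule onorm_bound)
      show "0 \<le> M" using assms(2)[of 0 x] by simp
      show "norm (D x v) \<le> M * norm v" for v
        using has_derivative_bound_scale[OF assms(1) assms(2)] by simp
    qed
    show "(f has_derivative D x) (at x within UNIV)" for x using assms(1) by simp
  qed auto
  then show ?thesis by simp
qed

lemma creg_lipschitz: "creg k M f \<Longrightarrow> \<bar>f x - f y\<bar> \<le> M * norm (x - y)"
proof (cases k)
  case 0
  then show "creg k M f \<Longrightarrow> ?thesis" by (simp add: creg.simps)
next
  case (Suc l)
  assume "creg k M f"
  then obtain D where D: "\<And>x. (f has_derivative D x) (at x)" "\<And>v. norm v \<le> 1 \<Longrightarrow> creg l M (\<lambda>x. D x v)"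
    using creg_SucE[of l M f] Suc by metis
  show ?thesis
    by (rule lipschitz_from_derivative[OF D(1)]) (use creg_bound[OF D(2)] in auto)
qed

lemma creg_0I: "(\<And>x. \<bar>f x\<bar> \<le> M) \<Longrightarrow> (\<And>x y. \<bar>f x - f y\<bar> \<le> M * norm (x - y)) \<Longrightarrow> creg 0 M f"
  by (simp add: creg.simps)

lemma creg_continuous: "creg k M f \<Longrightarrow> continuous_on UNIV f"
proof -
  assume c: "creg k M f"
  have "M-lipschitz_on UNIV f"
    using creg_lipschitz[OF c] creg_nonneg[OF c] by (auto intro!: lipschitz_onI simp: dist_norm)
  then show ?thesis by (rule lipschitz_on_continuous_on)
qed

lemma creg_SucD: "creg (Suc k) M f \<Longrightarrow> creg k M f"
proof (induction k arbitrary: f)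
  case 0
  show ?case by (rule creg_0I) (rule creg_bound[OF 0], rule creg_lipschitz[OF 0])
next
  case (Suc k)
  obtain D where D: "\<And>x. (f has_derivative D x) (at x)" "\<And>v. norm v \<le> 1 \<Longrightarrow> creg (Suc k) M (\<lambda>x. D x v)"
    using creg_SucE[OF Suc.prems] by metis
  show ?case
    by (rule creg_SucI[OF creg_bound[OF Suc.prems] D(1)], rule Suc.IH, rule D(2))
qed

lemma creg_le: "creg k M f \<Longrightarrow> l \<le> k \<Longrightarrow> creg l M f"
proof (induction k)
  case (Suc k)
  show ?case
  proof (cases "l = Suc k")
    case False
    then show ?thesis using Suc.IH[OF creg_SucD[OF Suc.prems(1)]] Suc.prems(2) by linarith
  qed (use Suc.prems in simp)
qed simp

lemma creg_mono: "creg k M f \<Longrightarrow> M \<le> M' \<Longrightarrow> creg k M' f"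
proof (induction k arbitrary: f)
  case 0
  show ?case
  proof (rule creg_0I)
    show "\<bar>f x\<bar> \<le> M'" for x using creg_bound[OF 0(1), of x] 0(2) by linarith
    show "\<bar>f x - f y\<bar> \<le> M' * norm (x - y)" for x y
      using creg_lipschitz[OF 0(1), of x y] mult_right_mono[OF 0(2), of "norm (x - y)"] by auto
  qed
next
  case (Suc k)
  obtain D where D: "\<And>x. (f has_derivative D x) (at x)" "\<And>v. norm v \<le> 1 \<Longrightarrow> creg k M (\<lambda>x. D x v)"
    using creg_SucE[OF Suc.prems(1)] by metis
  show ?case
  proof (rule creg_SucI[OF _ D(1)])
    show "\<bar>f x\<bar> \<le> M'" for x using creg_bound[OF Suc.prems(1), of x] Suc.prems(2) by linarith
    show "creg k M' (\<lambda>x. D x v)" if "norm v \<le> 1" for v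
      by (rule Suc.IH[OF D(2)[OF that] Suc.prems(2)])
  qed
qed

lemma creg_add: "creg k M f \<Longrightarrow> creg k M' g \<Longrightarrow> creg k (M + M') (\<lambda>x. f x + g x)"
proof (induction k arbitrary: f g)
  case 0
  show ?case
  proof (rule creg_0I)
    show "\<bar>f x + g x\<bar> \<le> M + M'" for x using creg_bound[OF 0(1), of x] creg_bound[OF 0(2), of x] by linarith
    show "\<bar>f x + g x - (f y + g y)\<bar> \<le> (M + M') * norm (x - y)" for x y
      using creg_lipschitz[OF 0(1), of x y] creg_lipschitz[OF 0(2), of x y] by (simp add: distrib_right)
  qed
next
  case (Suc k)
  obtain D where D: "\<And>x. (f has_derivative D x) (at x)" "\<And>v. norm v \<le> 1 \<Longrightarrow> creg k M (\<lambda>x. D x v)"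
    using creg_SucE[OF Suc.prems(1)] by metis
  obtain E where E: "\<And>x. (g has_derivative E x) (at x)" "\<And>v. norm v \<le> 1 \<Longrightarrow> creg k M' (\<lambda>x. E x v)"
    using creg_SucE[OF Suc.prems(2)] by metis
  show ?case
  proof (rule creg_SucI[OF _ has_derivative_add[OF D(1) E(1)]])
    show "\<bar>f x + g x\<bar> \<le> M + M'" for x
      using creg_bound[OF Suc.prems(1), of x] creg_bound[OF Suc.prems(2), of x] by linarith
    show "creg k (M + M') (\<lambda>x. D x v + E x v)" if "norm v \<le> 1" for v
      by (rule Suc.IH[OF D(2)[OF that] E(2)[OF that]])
  qed
qed

lemma creg_cmult: "creg k M f \<Longrightarrow> creg k (\<bar>c\<bar> * M) (\<lambda>x. c * f x)"
proof (induction k arbitrary: f)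
  case 0
  show ?case
  proof (rule creg_0I)
    show "\<bar>c * f x\<bar> \<le> \<bar>c\<bar> * M" for x using creg_bound[OF 0, of x] by (simp add: abs_mult mult_left_mono)
    show "\<bar>c * f x - c * f y\<bar> \<le> \<bar>c\<bar> * M * norm (x - y)" for x y
      using creg_lipschitz[OF 0(1), of x y]
      by (simp add: mult.assoc abs_mult mult_left_mono flip: right_diff_distrib)
  qed
next
  case (Suc k)
  obtain D where D: "\<And>x. (f has_derivative D x) (at x)" "\<And>v. norm v \<le> 1 \<Longrightarrow> creg k M (\<lambda>x. D x v)"
    using creg_SucE[OF Suc.prems(1)] by metis
  show ?case
  proof (rule creg_SucI[OF _ has_derivative_mult_right[OF D(1)]])
    show "\<bar>c * f x\<bar> \<le> \<bar>c\<bar> * M" for x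
      using creg_bound[OF Suc.prems, of x] by (simp add: abs_mult mult_left_mono)
    show "creg k (\<bar>c\<bar> * M) (\<lambda>x. c * D x v)" if "norm v \<le> 1" for v
      by (rule Suc.IH[OF D(2)[OF that]])
  qed
qed

lemma creg_zero: "M \<ge> 0 \<Longrightarrow> creg k M (\<lambda>x. 0)"
proof (induction k)
  case 0
  then show ?case by (intro creg_0I) auto
next
  case (Suc k)
  show ?case
  proof (rule creg_SucI)
    show "((\<lambda>x::'a. 0) has_derivative (\<lambda>v. 0)) (at x)" for x :: 'a by simp
    show "creg k M (\<lambda>x::'a. 0)" by (rule Suc.IH[OF Suc.prems])
  qed (use Suc.prems in auto)
qed

lemma creg_sum: "finite I \<Longrightarrow> (\<And>i. i \<in> I \<Longrightarrow> creg k (M i) (f i)) \<Longrightarrow> creg k (\<Sum>i\<in>I. M i) (\<lambda>x. \<Sum>i\<in>I. f i x)"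
  by (induction I rule: finite_induct) (auto intro: creg_add creg_zero)

lemma creg_diff: "creg k M f \<Longrightarrow> creg k M' g \<Longrightarrow> creg k (M + M') (\<lambda>x. f x - g x)"
  using creg_add[of k M f M' "\<lambda>x. (-1) * g x"] creg_cmult[of k M' g "-1"] by simp

text \<open>Each differentiation of a product yields two terms, and so does the Lipschitz estimate
  at level 0; hence one factor 2 for each.\<close>

lemma creg_mult: "creg k M f \<Longrightarrow> creg k M' g \<Longrightarrow> creg k (2 ^ Suc k * (M * M')) (\<lambda>x. f x * g x)"
proof (induction k arbitrary: f g)
  case 0
  have nn: "M \<ge> 0" "M' \<ge> 0" using creg_nonneg 0 by blast+
  have b: "\<bar>f x * g y\<bar> \<le> M * M'" for x y
    using creg_bound[OF 0(1), of x] creg_bound[OF 0(2), of y] nn by (simp add: abs_mult mult_mono)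
  show ?case
  proof (rule creg_0I)
    show "\<bar>f x * g x\<bar> \<le> 2 ^ Suc 0 * (M * M')" for x using b[of x x] mult_nonneg_nonneg[OF nn] by simp
    show "\<bar>f x * g x - f y * g y\<bar> \<le> 2 ^ Suc 0 * (M * M') * norm (x - y)" for x y
    proof -
      have "f x * g x - f y * g y = (f x - f y) * g x + f y * (g x - g y)" by (simp add: algebra_simps)
      then have "\<bar>f x * g x - f y * g y\<bar> \<le> \<bar>f x - f y\<bar> * \<bar>g x\<bar> + \<bar>f y\<bar> * \<bar>g x - g y\<bar>"
        by (metis abs_mult abs_triangle_ineq)
      also have "\<dots> \<le> M * norm (x - y) * M' + M * (M' * norm (x - y))"
        using creg_bound[OF 0(1), of y] creg_bound[OF 0(2), of x] nn
          creg_lipschitz[OF 0(1), of x y] creg_lipschitz[OF 0(2), of x y]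
        by (intro add_mono mult_mono) auto
      finally show ?thesis by (simp add: algebra_simps)
    qed
  qed
next
  case (Suc k)
  have nn: "M \<ge> 0" "M' \<ge> 0" using creg_nonneg Suc.prems by blast+
  obtain D where D: "\<And>x. (f has_derivative D x) (at x)" "\<And>v. norm v \<le> 1 \<Longrightarrow> creg k M (\<lambda>x. D x v)"
    using creg_SucE[OF Suc.prems(1)] by metis
  obtain E where E: "\<And>x. (g has_derivative E x) (at x)" "\<And>v. norm v \<le> 1 \<Longrightarrow> creg k M' (\<lambda>x. E x v)"
    using creg_SucE[OF Suc.prems(2)] by metis
  show ?case
  proof (rule creg_SucI[OF _ has_derivative_mult[OF D(1) E(1)]])
    show "\<bar>f x * g x\<bar> \<le> 2 ^ Suc (Suc k) * (M * M')" for x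
    proof -
      have "\<bar>f x * g x\<bar> \<le> M * M'"
        using creg_bound[OF Suc.prems(1), of x] creg_bound[OF Suc.prems(2), of x] nn by (simp add: abs_mult mult_mono)
      also have "\<dots> \<le> 2 ^ Suc (Suc k) * (M * M')"
        using mult_right_mono[OF one_le_power[of "2::real" "Suc (Suc k)"] mult_nonneg_nonneg[OF nn]] by simp
      finally show ?thesis .
    qed
    show "creg k (2 ^ Suc (Suc k) * (M * M')) (\<lambda>x. f x * E x v + D x v * g x)" if "norm v \<le> 1" for v
      using creg_add[OF Suc.IH[OF creg_SucD[OF Suc.prems(1)] E(2)[OF that]]
          Suc.IH[OF D(2)[OF that] creg_SucD[OF Suc.prems(2)]]] by (simp add: mult_ac)
  qed
qed

text \<open>Every derivative, and the final Lipschitz bound, costs one factor |c|. As all orders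
  share one constant, \<open>B\<close> must be at least 1 so that the highest power dominates the
  lower ones.\<close>

lemma creg_affine:
  "creg k M f \<Longrightarrow> \<bar>c\<bar> \<le> B \<Longrightarrow> 1 \<le> B \<Longrightarrow> creg k (M * B ^ Suc k) (\<lambda>x. f (a + c *\<^sub>R x))"
proof (induction k arbitrary: f)
  case 0
  have nn: "M \<ge> 0" using creg_nonneg 0 by blast
  show ?case
  proof (rule creg_0I)
    show "\<bar>f (a + c *\<^sub>R x)\<bar> \<le> M * B ^ Suc 0" for x
      using creg_bound[OF 0(1), of "a + c *\<^sub>R x"] mult_left_mono[OF 0(3) nn] by simp
    show "\<bar>f (a + c *\<^sub>R x) - f (a + c *\<^sub>R y)\<bar> \<le> M * B ^ Suc 0 * norm (x - y)" for x y
    proof -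
      have "\<bar>f (a + c *\<^sub>R x) - f (a + c *\<^sub>R y)\<bar> \<le> M * norm (c *\<^sub>R (x - y))"
        using creg_lipschitz[OF 0(1), of "a + c *\<^sub>R x" "a + c *\<^sub>R y"] by (simp add: scaleR_diff_right)
      also have "\<dots> \<le> M * (B * norm (x - y))"
        using 0(2) nn by (simp add: mult_left_mono mult_right_mono)
      finally show ?thesis by (simp add: mult.assoc)
    qed
  qed
next
  case (Suc k)
  have nn: "M \<ge> 0" using creg_nonneg Suc.prems by blast
  obtain D where D: "\<And>x. (f has_derivative D x) (at x)" "\<And>v. norm v \<le> 1 \<Longrightarrow> creg k M (\<lambda>x. D x v)"
    using creg_SucE[OF Suc.prems(1)] by metis
  show ?case
  proof (rule creg_SucI)
    show "\<bar>f (a + c *\<^sub>R x)\<bar> \<le> M * B ^ Suc (Suc k)" for x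
      using creg_bound[OF Suc.prems(1), of "a + c *\<^sub>R x"]
        mult_left_mono[OF one_le_power[OF Suc.prems(3), of "Suc (Suc k)"] nn] by simp
    show "((\<lambda>x. f (a + c *\<^sub>R x)) has_derivative (\<lambda>v. c * D (a + c *\<^sub>R x) v)) (at x)" for x
    proof -
      have "((\<lambda>x. f (a + c *\<^sub>R x)) has_derivative (\<lambda>v. D (a + c *\<^sub>R x) (c *\<^sub>R v))) (at x)"
        by (rule has_derivative_compose[of "\<lambda>x. a + c *\<^sub>R x" "\<lambda>v. c *\<^sub>R v" x UNIV f])
          (auto intro!: derivative_eq_intros D(1))
      then show ?thesis
        using linear_scale[OF has_derivative_linear[OF D(1)]] by simp
    qed
    show "creg k (M * B ^ Suc (Suc k)) (\<lambda>x. c * D (a + c *\<^sub>R x) v)" if "norm v \<le> 1" for v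
    proof (rule creg_mono)
      show "creg k (\<bar>c\<bar> * (M * B ^ Suc k)) (\<lambda>x. c * D (a + c *\<^sub>R x) v)"
        by (rule creg_cmult, rule Suc.IH[OF D(2)[OF that] Suc.prems(2,3)])
      have "\<bar>c\<bar> * (M * B ^ Suc k) \<le> B * (M * B ^ Suc k)"
        using Suc.prems nn by (intro mult_right_mono) auto
      then show "\<bar>c\<bar> * (M * B ^ Suc k) \<le> M * B ^ Suc (Suc k)" by (simp add: mult_ac)
    qed
  qed
qed

lemma creg_translate: "creg k M f \<Longrightarrow> creg k M (\<lambda>x. f (x + a))"
  using creg_affine[of k M f 1 1 a] by (simp add: add.commute)

lemma has_derivative_shift:
  fixes f :: "'a::real_normed_vector \<Rightarrow> 'b::real_normed_vector"
  shows "(f has_derivative D) (at (x + a)) \<Longrightarrow> ((\<lambda>x. f (x + a)) has_derivative D) (at x)"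
  by (rule has_derivative_compose[of "\<lambda>x. x + a" "\<lambda>v. v" x UNIV f D])
    (auto intro!: derivative_eq_intros)

text \<open>No constant is lost here because the bounds in \<^term>\<open>creg k M\<close> are imposed on
  directional derivatives along vectors of norm at most one.\<close>

lemma creg_diffquot:
  "creg (Suc k) M f \<Longrightarrow> h \<noteq> 0 \<Longrightarrow> creg k M (\<lambda>x. (f (x + h) - f x) / norm h)"
proof (induction k arbitrary: f)
  case 0
  obtain D where D: "\<And>x. (f has_derivative D x) (at x)" "\<And>v. norm v \<le> 1 \<Longrightarrow> creg 0 M (\<lambda>x. D x v)"
    using creg_SucE[OF 0(1)] by metis
  have der: "((\<lambda>x. (f (x + h) - f x) / norm h) has_derivative (\<lambda>v. (D (x + h) v - D x v) / norm h)) (at x)" for x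
    using has_derivative_shift[OF D(1)]
    by (auto intro!: derivative_eq_intros D(1) simp: divide_inverse)
  show ?case
  proof (rule creg_0I)
    show "\<bar>(f (x + h) - f x) / norm h\<bar> \<le> M" for x
      using creg_lipschitz[OF 0(1), of "x + h" x] 0(2) by (simp add: field_simps)
    show "\<bar>(f (x + h) - f x) / norm h - (f (y + h) - f y) / norm h\<bar> \<le> M * norm (x - y)" for x y
    proof (rule lipschitz_from_derivative[OF der])
      fix x v :: 'a assume "norm v \<le> 1"
      then show "\<bar>(D (x + h) v - D x v) / norm h\<bar> \<le> M"
        using creg_lipschitz[OF D(2), of v "x + h" x] 0(2) by (simp add: field_simps)
    qed
  qed
next
  case (Suc k)
  obtain D where D: "\<And>x. (f has_derivative D x) (at x)" "\<And>v. norm v \<le> 1 \<Longrightarrow> creg (Suc k) M (\<lambda>x. D x v)"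
    using creg_SucE[OF Suc.prems(1)] by metis
  show ?case
  proof (rule creg_SucI)
    show "\<bar>(f (x + h) - f x) / norm h\<bar> \<le> M" for x
      using creg_lipschitz[OF Suc.prems(1), of "x + h" x] Suc.prems(2) by (simp add: field_simps)
    show "((\<lambda>x. (f (x + h) - f x) / norm h) has_derivative (\<lambda>v. (D (x + h) v - D x v) / norm h)) (at x)" for x
      using has_derivative_shift[OF D(1)]
      by (auto intro!: derivative_eq_intros D(1) simp: divide_inverse)
    show "creg k M (\<lambda>x. (D (x + h) v - D x v) / norm h)" if "norm v \<le> 1" for v
      by (rule Suc.IH[OF D(2)[OF that] Suc.prems(2)])
  qed
qed

section \<open>Difference quotients and symmetry of second derivatives\<close>

lemma directional_mvt:
  assumes "\<And>x. (f has_derivative D x) (at (x :: 'a::real_normed_vector))" "t > 0"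
  obtains s where "0 < s" "s < t" "f (x + t *\<^sub>R v) - f x = t * D (x + s *\<^sub>R v) v"
proof -
  have "((\<lambda>s. f (x + s *\<^sub>R v)) has_real_derivative D (x + s *\<^sub>R v) v) (at s)" for s
  proof -
    have "((\<lambda>s. f (x + s *\<^sub>R v)) has_derivative (\<lambda>r. D (x + s *\<^sub>R v) (r *\<^sub>R v))) (at s)"
      by (rule has_derivative_compose[of "\<lambda>s. x + s *\<^sub>R v" "\<lambda>r. r *\<^sub>R v" s UNIV f])
        (auto intro!: derivative_eq_intros assms(1))
    moreover have "(\<lambda>r. D (x + s *\<^sub>R v) (r *\<^sub>R v)) = (*) (D (x + s *\<^sub>R v) v)"
      using linear_scale[OF has_derivative_linear[OF assms(1)]] by (auto simp: mult.commute)
    ultimately show ?thesis by (simp add: has_field_derivative_def)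
  qed
  then obtain s where "0 < s" "s < t" "f (x + t *\<^sub>R v) - f (x + 0 *\<^sub>R v) = (t - 0) * D (x + s *\<^sub>R v) v"
    using MVT2[of 0 t "\<lambda>s. f (x + s *\<^sub>R v)" "\<lambda>s. D (x + s *\<^sub>R v) v"] assms(2) by metis
  then show ?thesis using that by simp
qed

text \<open>Schwarz's theorem in a form that fits derivatives given direction by direction. The
  mixed second difference over the parallelogram with sides tv and tw is evaluated twice by the mean
  value theorem, in either order; for small t the two values are close to the two mixed derivatives
  at x.\<close>

lemma second_derivative_symmetric:
  fixes f :: "'a::real_normed_vector \<Rightarrow> real"
  assumes D: "\<And>x. (f has_derivative D x) (at x)"
    and V: "\<And>x. ((\<lambda>x. D x v) has_derivative V x) (at x)"
    and W: "\<And>x. ((\<lambda>x. D x w) has_derivative W x) (at x)"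
    and cV: "isCont (\<lambda>x. V x w) x" and cW: "isCont (\<lambda>x. W x v) x"
  shows "V x w = W x v"
proof (rule ccontr)
  assume "V x w \<noteq> W x v"
  define e where "e = \<bar>V x w - W x v\<bar> / 2"
  have e: "e > 0" using \<open>V x w \<noteq> W x v\<close> by (simp add: e_def)
  obtain d1 where d1: "d1 > 0" "\<And>y. norm (y - x) < d1 \<Longrightarrow> \<bar>V y w - V x w\<bar> < e"
    using cV[unfolded continuous_at_eps_delta] e by (metis dist_norm real_norm_def)
  obtain d2 where d2: "d2 > 0" "\<And>y. norm (y - x) < d2 \<Longrightarrow> \<bar>W y v - W x v\<bar> < e"
    using cW[unfolded continuous_at_eps_delta] e by (metis dist_norm real_norm_def)
  \<comment> \<open>All intermediate points lie in the parallelogram spanned by tv and tw; this t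
    keeps it inside both neighbourhoods of continuity. The summand 1 covers v = w = 0.\<close>
  define t where "t = min d1 d2 / (norm v + norm w + 1)"
  have t: "t > 0" using d1 d2 by (simp add: t_def add_nonneg_pos)
  have small: "norm (r *\<^sub>R v + s *\<^sub>R w) < min d1 d2" if "0 < r" "r < t" "0 < s" "s < t" for r s
  proof -
    have "norm (r *\<^sub>R v + s *\<^sub>R w) \<le> r * norm v + s * norm w"
      using norm_triangle_ineq[of "r *\<^sub>R v" "s *\<^sub>R w"] that by simp
    also have "\<dots> \<le> t * norm v + t * norm w"
      using that by (intro add_mono mult_right_mono) auto
    also have "\<dots> < t * (norm v + norm w + 1)"
      using t by (simp add: algebra_simps)
    also have "\<dots> = min d1 d2" by (simp add: t_def add_nonneg_eq_0_iff)
    finally show ?thesis .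
  qed
  have sh: "((\<lambda>y. f (y + a)) has_derivative D (y + a)) (at y)" for y a
    by (rule has_derivative_shift[OF D])
  obtain r where r: "0 < r" "r < t"
    "(f (x + t *\<^sub>R v + t *\<^sub>R w) - f (x + t *\<^sub>R v)) - (f (x + t *\<^sub>R w) - f x)
      = t * (D (x + r *\<^sub>R v + t *\<^sub>R w) v - D (x + r *\<^sub>R v) v)"
    using directional_mvt[OF has_derivative_diff[OF sh[of "t *\<^sub>R w"] D] t, of x v] by metis
  obtain s where s: "0 < s" "s < t"
    "D (x + r *\<^sub>R v + t *\<^sub>R w) v - D (x + r *\<^sub>R v) v = t * V (x + r *\<^sub>R v + s *\<^sub>R w) w"
    using directional_mvt[OF V t, of "x + r *\<^sub>R v" w] by metis
  obtain r' where r': "0 < r'" "r' < t"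
    "(f (x + t *\<^sub>R w + t *\<^sub>R v) - f (x + t *\<^sub>R w)) - (f (x + t *\<^sub>R v) - f x)
      = t * (D (x + r' *\<^sub>R w + t *\<^sub>R v) w - D (x + r' *\<^sub>R w) w)"
    using directional_mvt[OF has_derivative_diff[OF sh[of "t *\<^sub>R v"] D] t, of x w] by metis
  obtain s' where s': "0 < s'" "s' < t"
    "D (x + r' *\<^sub>R w + t *\<^sub>R v) w - D (x + r' *\<^sub>R w) w = t * W (x + r' *\<^sub>R w + s' *\<^sub>R v) v"
    using directional_mvt[OF W t, of "x + r' *\<^sub>R w" v] by metis
  have "f (x + t *\<^sub>R w + t *\<^sub>R v) = f (x + t *\<^sub>R v + t *\<^sub>R w)" by (simp add: add_ac)
  then have "t * (t * V (x + r *\<^sub>R v + s *\<^sub>R w) w) = t * (t * W (x + r' *\<^sub>R w + s' *\<^sub>R v) v)"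
    using r(3) r'(3) unfolding s(3) s'(3) by linarith
  then have "V (x + (r *\<^sub>R v + s *\<^sub>R w)) w = W (x + (s' *\<^sub>R v + r' *\<^sub>R w)) v"
    using t by (simp add: add_ac)
  moreover have "\<bar>V (x + (r *\<^sub>R v + s *\<^sub>R w)) w - V x w\<bar> < e"
    using d1(2)[of "x + (r *\<^sub>R v + s *\<^sub>R w)"] small[of r s] r s by simp
  moreover have "\<bar>W (x + (s' *\<^sub>R v + r' *\<^sub>R w)) v - W x v\<bar> < e"
    using d2(2)[of "x + (s' *\<^sub>R v + r' *\<^sub>R w)"] small[of s' r'] r' s' by simp
  moreover have "\<bar>V x w - W x v\<bar> = 2 * e" by (simp add: e_def)
  ultimately show False by argo
qed

lemma diffquot_remainder_le:
  assumes "creg (Suc k) M f" "\<And>x. (f has_derivative D x) (at x)" "norm b \<le> 1" "t \<noteq> 0"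
  shows "\<bar>(f (x + t *\<^sub>R b) - f x) / t - D x b\<bar> \<le> M * \<bar>t\<bar>"
proof -
  obtain E where E: "\<And>x. (f has_derivative E x) (at x)" "\<And>v. norm v \<le> 1 \<Longrightarrow> creg k M (\<lambda>x. E x v)"
    using creg_SucE[OF assms(1)] by metis
  have DE: "D = E" using has_derivative_unique[OF assms(2) E(1)] by blast
  have pos: "\<bar>(f (x + t *\<^sub>R b) - f x) / t - D x b\<bar> \<le> M * \<bar>t\<bar>" if that: "norm b \<le> 1" and tpos: "t > 0" for b t
  proof -
    obtain s where s: "0 < s" "s < t" "f (x + t *\<^sub>R b) - f x = t * D (x + s *\<^sub>R b) b"
      using directional_mvt[OF assms(2) tpos] by metis
    have "\<bar>D (x + s *\<^sub>R b) b - D x b\<bar> \<le> M * norm (s *\<^sub>R b)"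
      using creg_lipschitz[OF E(2)[OF that], of "x + s *\<^sub>R b" x] DE by simp
    also have "\<dots> \<le> M * (t * 1)"
      using s that creg_nonneg[OF assms(1)] unfolding norm_scaleR by (intro mult_left_mono mult_mono) auto
    finally show ?thesis using s tpos by simp
  qed
  show ?thesis
  proof (cases "t > 0")
    case False
    \<comment> \<open>A negative step along b is a positive step along -b.\<close>
    have "D x (- b) = - D x b" using linear_neg[OF has_derivative_linear[OF assms(2)]] .
    then show ?thesis using pos[of "- b" "- t"] False assms by simp
  qed (use pos assms in auto)
qed

text \<open>One order is spent on the derivative and one on the rate |t|. In the induction the
  derivative along v of the remainder of f must be the remainder of the derivative of f along v;
  this is the symmetry of second derivatives. The statement makes it possible to differentiate under
  the pairing with \<phi>.\<close>

lemma creg_diffquot_remainder: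
  "creg (Suc (Suc k)) M f \<Longrightarrow> (\<And>x. (f has_derivative D x) (at x)) \<Longrightarrow> norm b \<le> 1 \<Longrightarrow> t \<noteq> 0 \<Longrightarrow>
    creg k (M * \<bar>t\<bar>) (\<lambda>x. (f (x + t *\<^sub>R b) - f x) / t - D x b)"
proof (induction k arbitrary: f D)
  case (0 f D)
  obtain E where E: "\<And>x. (f has_derivative E x) (at x)" "\<And>v. norm v \<le> 1 \<Longrightarrow> creg (Suc 0) M (\<lambda>x. E x v)"
    using creg_SucE[OF 0(1)] by metis
  have DE: "D = E" using has_derivative_unique[OF 0(2) E(1)] by blast
  then have "\<And>v. norm v \<le> 1 \<Longrightarrow> \<exists>F. (\<forall>x. ((\<lambda>x. D x v) has_derivative F x) (at x)) \<and> (\<forall>w. norm w \<le> 1 \<longrightarrow> creg 0 M (\<lambda>x. F x w))"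
    using creg_SucE[OF E(2)] by metis
  then obtain F where F: "\<And>v x. norm v \<le> 1 \<Longrightarrow> ((\<lambda>x. D x v) has_derivative F v x) (at x)"
      "\<And>v w. norm v \<le> 1 \<Longrightarrow> norm w \<le> 1 \<Longrightarrow> creg 0 M (\<lambda>x. F v x w)"
    by metis
  have sym: "F v x w = F w x v" if "norm v \<le> 1" "norm w \<le> 1" for v w x
    using second_derivative_symmetric[OF 0(2) F(1) F(1), OF that]
      creg_continuous[OF F(2)] that by (simp add: continuous_on_eq_continuous_at)
  have der: "((\<lambda>x. (f (x + t *\<^sub>R b) - f x) / t - D x b) has_derivative
      (\<lambda>v. (D (x + t *\<^sub>R b) v - D x v) / t - F b x v)) (at x)" for x
    using has_derivative_shift[OF 0(2)]
    by (auto intro!: derivative_eq_intros 0(2) F(1) 0(3) simp: divide_inverse)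
  show ?case
  proof (rule creg_0I)
    show "\<bar>(f (x + t *\<^sub>R b) - f x) / t - D x b\<bar> \<le> M * \<bar>t\<bar>" for x
      by (rule diffquot_remainder_le[OF 0(1-4)])
    show "\<bar>((f (x + t *\<^sub>R b) - f x) / t - D x b) - ((f (y + t *\<^sub>R b) - f y) / t - D y b)\<bar> \<le> M * \<bar>t\<bar> * norm (x - y)" for x y
    proof (rule lipschitz_from_derivative[OF der])
      fix x v :: 'a assume v: "norm v \<le> 1"
      show "\<bar>(D (x + t *\<^sub>R b) v - D x v) / t - F b x v\<bar> \<le> M * \<bar>t\<bar>"
        using diffquot_remainder_le[OF E(2)[OF v, folded DE] F(1)[OF v] 0(3,4)] sym[OF v 0(3)] by simp
    qed
  qed
next
  case (Suc k f D)
  obtain E where E: "\<And>x. (f has_derivative E x) (at x)" "\<And>v. norm v \<le> 1 \<Longrightarrow> creg (Suc (Suc k)) M (\<lambda>x. E x v)"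
    using creg_SucE[OF Suc.prems(1)] by metis
  have DE: "D = E" using has_derivative_unique[OF Suc.prems(2) E(1)] by blast
  then have "\<And>v. norm v \<le> 1 \<Longrightarrow> \<exists>F. (\<forall>x. ((\<lambda>x. D x v) has_derivative F x) (at x)) \<and> (\<forall>w. norm w \<le> 1 \<longrightarrow> creg (Suc k) M (\<lambda>x. F x w))"
    using creg_SucE[OF E(2)] by metis
  then obtain F where F: "\<And>v x. norm v \<le> 1 \<Longrightarrow> ((\<lambda>x. D x v) has_derivative F v x) (at x)"
      "\<And>v w. norm v \<le> 1 \<Longrightarrow> norm w \<le> 1 \<Longrightarrow> creg (Suc k) M (\<lambda>x. F v x w)"
    by metis
  have sym: "F v x w = F w x v" if "norm v \<le> 1" "norm w \<le> 1" for v w x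
    using second_derivative_symmetric[OF Suc.prems(2) F(1) F(1), OF that]
      creg_continuous[OF F(2)] that by (simp add: continuous_on_eq_continuous_at)
  have der: "((\<lambda>x. (f (x + t *\<^sub>R b) - f x) / t - D x b) has_derivative
      (\<lambda>v. (D (x + t *\<^sub>R b) v - D x v) / t - F b x v)) (at x)" for x
    using has_derivative_shift[OF Suc.prems(2)]
    by (auto intro!: derivative_eq_intros Suc.prems(2) F(1) Suc.prems(3) simp: divide_inverse)
  show ?case
  proof (rule creg_SucI[OF _ der])
    show "\<bar>(f (x + t *\<^sub>R b) - f x) / t - D x b\<bar> \<le> M * \<bar>t\<bar>" for x
      by (rule diffquot_remainder_le[OF Suc.prems(1-4)])
    fix v :: 'a assume v: "norm v \<le> 1"
    show "creg k (M * \<bar>t\<bar>) (\<lambda>x. (D (x + t *\<^sub>R b) v - D x v) / t - F b x v)"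
      using Suc.IH[OF E(2)[OF v, folded DE] F(1)[OF v] Suc.prems(3,4)] sym[OF v Suc.prems(3)] by simp
  qed
qed

text \<open>Bounded support gives a bound for each of the finitely many derivatives along basis
  vectors; a derivative along v with |v| \<le> 1 is a combination of them with coefficients at most
  1, so the sum of the bounds serves all directions at once.\<close>

lemma ck_imp_creg:
  "ck (Suc k) f \<Longrightarrow> (\<And>x. norm x > r \<Longrightarrow> f x = 0) \<Longrightarrow> \<exists>M. creg k M f"
proof (induction k arbitrary: f)
  case (0 f)
  obtain D where D: "\<And>x. (f has_derivative D x) (at x)" "\<And>v. ck 0 (\<lambda>x. D x v)"
    using ck_SucE[OF 0(1)] by metis
  have D0: "D x = (\<lambda>v. 0)" if "norm x > r" for x
  proof (rule has_derivative_unique[OF D(1)])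
    have "((\<lambda>x. 0) has_derivative (\<lambda>v. 0)) (at x)" by simp
    then show "(f has_derivative (\<lambda>v. 0)) (at x)"
      by (rule has_derivative_transform_within_open[of _ _ _ _ "- cball 0 r"])
        (use 0(2) that in \<open>auto simp: dist_norm\<close>)
  qed
  have bd: "\<exists>K. \<forall>x. \<bar>g x\<bar> \<le> K" if "continuous_on UNIV g" "\<And>x. norm x > r \<Longrightarrow> g x = 0" for g :: "'a \<Rightarrow> real"
  proof -
    have "bounded (g ` cball 0 r)"
      using that(1) by (intro compact_imp_bounded compact_continuous_image) (auto intro: continuous_on_subset)
    then obtain K where K: "\<And>x. norm x \<le> r \<Longrightarrow> \<bar>g x\<bar> \<le> K"
      unfolding bounded_iff by (metis imageI mem_cball_0 real_norm_def)
    have "\<bar>g x\<bar> \<le> max K 0" for x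
      using K[of x] that(2)[of x] by (cases "norm x \<le> r") auto
    then show ?thesis by blast
  qed
  obtain K where K: "\<And>x. \<bar>f x\<bar> \<le> K"
    using bd[OF ck_imp_continuous[OF 0(1)] 0(2)] by auto
  have "\<exists>L. \<forall>x. \<bar>D x b\<bar> \<le> L" for b
    by (rule bd) (use D(2) D0 in \<open>auto simp: ck.simps\<close>)
  then obtain L where L: "\<And>x b. \<bar>D x b\<bar> \<le> L b" by metis
  define S where "S = max K (\<Sum>b\<in>Basis. L b)"
  have DS: "\<bar>D x v\<bar> \<le> S" if "norm v \<le> 1" for x v
  proof -
    have "D x v = D x (\<Sum>b\<in>Basis. (v \<bullet> b) *\<^sub>R b)" by (simp add: euclidean_representation)
    also have "\<dots> = (\<Sum>b\<in>Basis. (v \<bullet> b) * D x b)"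
      using has_derivative_linear[OF D(1)[of x]] by (simp add: linear_sum linear_scale)
    also have "\<bar>\<dots>\<bar> \<le> (\<Sum>b\<in>Basis. \<bar>(v \<bullet> b) * D x b\<bar>)" by (rule sum_abs)
    also have "\<dots> \<le> (\<Sum>b\<in>Basis. 1 * L b)"
      unfolding abs_mult
      using L that by (intro sum_mono mult_mono) (auto intro: order_trans[OF Basis_le_norm])
    finally show ?thesis by (simp add: S_def)
  qed
  have "creg 0 S f"
  proof (rule creg_0I)
    show "\<bar>f x\<bar> \<le> S" for x using K[of x] by (simp add: S_def)
    show "\<bar>f x - f y\<bar> \<le> S * norm (x - y)" for x y
      by (rule lipschitz_from_derivative[OF D(1) DS])
  qed
  then show ?case by blast
next
  case (Suc k f)
  obtain D where D: "\<And>x. (f has_derivative D x) (at x)" "\<And>v. ck (Suc k) (\<lambda>x. D x v)"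
    using ck_SucE[OF Suc.prems(1)] by metis
  have D0: "D x = (\<lambda>v. 0)" if "norm x > r" for x
  proof (rule has_derivative_unique[OF D(1)])
    have "((\<lambda>x. 0) has_derivative (\<lambda>v. 0)) (at x)" by simp
    then show "(f has_derivative (\<lambda>v. 0)) (at x)"
      by (rule has_derivative_transform_within_open[of _ _ _ _ "- cball 0 r"])
        (use Suc.prems(2) that in \<open>auto simp: dist_norm\<close>)
  qed
  have "\<exists>L. creg k L (\<lambda>x. D x b)" for b
    by (rule Suc.IH[OF D(2)]) (simp add: D0)
  then obtain L where L: "\<And>b. creg k (L b) (\<lambda>x. D x b)" by metis
  obtain K where K: "creg k K f"
    using Suc.IH[OF ck_SucD[OF Suc.prems(1)] Suc.prems(2)] by blast
  define S where "S = max K (\<Sum>b\<in>Basis. L b)"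
  have "creg (Suc k) S f"
  proof (rule creg_SucI[OF _ D(1)])
    show "\<bar>f x\<bar> \<le> S" for x using creg_bound[OF K, of x] by (simp add: S_def)
    fix v :: 'a assume v: "norm v \<le> 1"
    have "(\<lambda>x. D x v) = (\<lambda>x. \<Sum>b\<in>Basis. (v \<bullet> b) * D x b)"
    proof
      fix x
      have "D x v = D x (\<Sum>b\<in>Basis. (v \<bullet> b) *\<^sub>R b)" by (simp add: euclidean_representation)
      also have "\<dots> = (\<Sum>b\<in>Basis. (v \<bullet> b) * D x b)"
        using has_derivative_linear[OF D(1)[of x]] by (simp add: linear_sum linear_scale)
      finally show "D x v = (\<Sum>b\<in>Basis. (v \<bullet> b) * D x b)" .
    qed
    moreover have "creg k (\<Sum>b\<in>Basis. L b) (\<lambda>x. \<Sum>b\<in>Basis. (v \<bullet> b) * D x b)"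
    proof (rule creg_sum)
      fix b :: 'a assume "b \<in> Basis"
      then have "\<bar>v \<bullet> b\<bar> \<le> 1" using v Basis_le_norm order_trans by blast
      then have "\<bar>v \<bullet> b\<bar> * L b \<le> L b"
        using creg_nonneg[OF L[of b]] by (simp add: mult_left_le_one_le)
      then show "creg k (L b) (\<lambda>x. (v \<bullet> b) * D x b)"
        using creg_mono[OF creg_cmult[OF L]] by blast
    qed simp
    ultimately show "creg k S (\<lambda>x. D x v)"
      using creg_mono by (metis S_def max.cobounded2)
  qed
  then show ?case by blast
qed

section \<open>Distributions represented by functions\<close>

definition dist_of :: "('a::euclidean_space \<Rightarrow> real) \<Rightarrow> ('a \<Rightarrow> real) \<Rightarrow> real" where
  "dist_of f = (\<lambda>\<eta>. LINT x|lebesgue. f x * \<eta> x)"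

text \<open>As c tends to 0 these test functions converge pointwise to the indicator of the open
  box. This replaces mollification in the proof that a function orthogonal to all test functions is
  null.\<close>

definition box_bump :: "'a::euclidean_space \<Rightarrow> 'a \<Rightarrow> real \<Rightarrow> 'a \<Rightarrow> real" where
  "box_bump l u c x = (\<Prod>b\<in>Basis. flat c 0 (x \<bullet> b - l \<bullet> b) * flat c 0 (u \<bullet> b - x \<bullet> b))"

lemma flat_0_le_1: "c \<ge> 0 \<Longrightarrow> flat c 0 t \<le> 1"
  by (simp add: flat_def)

lemma box_bump_nonneg: "0 \<le> box_bump l u c x"
  unfolding box_bump_def by (intro prod_nonneg) (simp add: flat_nonneg)

lemma box_bump_le_1: "c \<ge> 0 \<Longrightarrow> box_bump l u c x \<le> 1"
  unfolding box_bump_def by (intro prod_le_1) (simp add: flat_nonneg flat_0_le_1 mult_le_one)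

lemma box_bump_eq_0: "x \<notin> box l u \<Longrightarrow> box_bump l u c x = 0"
  by (fastforce simp: box_bump_def mem_box flat_def)

lemma ck_box_bump:
  assumes "c > 0"
  shows "ck k (box_bump l u c)"
proof -
  have "ck k (\<lambda>x. flat c 0 (x \<bullet> b - l \<bullet> b))" for b
    by (rule ck_compose[OF ck_flat[OF assms] ck_diff[OF ck_inner ck_const]])
  moreover have "ck k (\<lambda>x. flat c 0 (u \<bullet> b - x \<bullet> b))" for b
    by (rule ck_compose[OF ck_flat[OF assms] ck_diff[OF ck_const ck_inner]])
  ultimately show ?thesis
    unfolding box_bump_def by (intro ck_prod ck_mult)
qed

lemma box_bump_test:
  assumes "c > 0"
  shows "box_bump l u c \<in> test_functions UNIV"
proof -
  have "closure {x. box_bump l u c x \<noteq> 0} \<subseteq> cbox l u"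
    by (rule closure_minimal) (use box_bump_eq_0 box_subset_cbox in blast)+
  then have "compact (closure {x. box_bump l u c x \<noteq> 0})"
    using compact_cbox compact_closure bounded_subset[OF bounded_cbox[of l u]] closure_subset by blast
  then show ?thesis
    unfolding test_functions_def using ck_imp_smooth[OF ck_box_bump[OF assms]] by simp
qed

lemma box_bump_tendsto:
  "(\<lambda>N. box_bump l u (1 / real (Suc N)) x) \<longlonglongrightarrow> indicator (box l u) x"
proof (cases "x \<in> box l u")
  case True
  have "(\<lambda>N. flat (1 / real (Suc N)) 0 t) \<longlonglongrightarrow> 1" if "t > 0" for t
  proof -
    have "(\<lambda>N. exp (- (1 / real (Suc N)) / t)) \<longlonglongrightarrow> exp (- 0 / t)"
      using that by (intro tendsto_intros LIMSEQ_Suc lim_1_over_n) auto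
    then show ?thesis using that by (simp add: flat_def)
  qed
  then have "(\<lambda>N. box_bump l u (1 / real (Suc N)) x) \<longlonglongrightarrow> (\<Prod>b\<in>(Basis :: 'a set). 1 * 1)"
    unfolding box_bump_def using True by (intro tendsto_prod tendsto_mult) (auto simp: mem_box)
  then show ?thesis using True by simp
next
  case False
  then show ?thesis using box_bump_eq_0[OF False] by (simp only: tendsto_const indicator_simps(2) False not_False_eq_True)
qed

lemma integrable_mult_bounded:
  fixes g h :: "'a::euclidean_space \<Rightarrow> real"
  assumes "set_integrable lebesgue K g" "h \<in> borel_measurable lebesgue"
    "\<And>x. \<bar>h x\<bar> \<le> B" "\<And>x. x \<notin> K \<Longrightarrow> h x = 0"
  shows "integrable lebesgue (\<lambda>x. g x * h x)"
proof -
  have "(\<lambda>x. g x * h x) = (\<lambda>x. (indicator K x *\<^sub>R g x) * h x)"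
    using assms(4) by (force simp: indicator_def)
  moreover have "integrable lebesgue (\<lambda>x. (indicator K x *\<^sub>R g x) * h x)"
  proof (rule Bochner_Integration.integrable_bound)
    show "integrable lebesgue (\<lambda>x. B * (indicator K x *\<^sub>R g x))"
      using assms(1) unfolding set_integrable_def by (rule integrable_mult_right)
    show "(\<lambda>x. (indicator K x *\<^sub>R g x) * h x) \<in> borel_measurable lebesgue"
      using assms(1,2) unfolding set_integrable_def by (intro borel_measurable_times) auto
    show "AE x in lebesgue. norm (indicator K x *\<^sub>R g x * h x) \<le> norm (B * indicator K x *\<^sub>R g x)"
    proof (rule AE_I2)
      fix x
      have "\<bar>h x\<bar> * \<bar>g x\<bar> \<le> \<bar>B\<bar> * \<bar>g x\<bar>"
        using assms(3)[of x] by (intro mult_right_mono) auto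
      then show "norm (indicator K x *\<^sub>R g x * h x) \<le> norm (B * indicator K x *\<^sub>R g x)"
        by (simp add: abs_mult indicator_def mult.commute)
    qed
  qed
  ultimately show ?thesis by simp
qed

lemma locally_integrable_measurable:
  fixes g :: "'a::euclidean_space \<Rightarrow> real"
  assumes "\<And>K. compact K \<Longrightarrow> set_integrable lebesgue K g"
  shows "g \<in> borel_measurable lebesgue"
proof (rule borel_measurable_LIMSEQ_real)
  show "(\<lambda>n. indicator (cball 0 (real n)) x *\<^sub>R g x) \<longlonglongrightarrow> g x" for x
  proof (rule tendsto_eventually)
    show "\<forall>\<^sub>F n in sequentially. indicator (cball 0 (real n)) x *\<^sub>R g x = g x"
      using eventually_ge_at_top[of "nat \<lceil>norm x\<rceil>"]
      by eventually_elim (auto simp: indicator_def dist_norm nat_le_iff ceiling_le_iff)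
  qed
  show "(\<lambda>x. indicator (cball 0 (real n)) x *\<^sub>R g x) \<in> borel_measurable lebesgue" for n
    using assms[of "cball 0 (real n)"] unfolding set_integrable_def by auto
qed

text \<open>The densities \<open>ennreal (g x)\<close> and \<open>ennreal (- g x)\<close> are the
  positive and the negative part of g. The two measures agree on the boxes, which form a generator
  stable under intersection, hence agree. So the two parts are equal almost everywhere, and as one
  of them is always 0, both vanish.\<close>

lemma AE_zero_from_boxes:
  fixes g :: "'a::euclidean_space \<Rightarrow> real"
  assumes [measurable]: "g \<in> borel_measurable borel"
    and int: "\<And>l u. integrable lborel (\<lambda>x. indicator (box l u) x * g x)"
    and z: "\<And>l u. (LINT x|lborel. indicator (box l u) x * g x) = 0"
  shows "AE x in lborel. g x = 0"
proof -
  define M where "M = density lborel (\<lambda>x. ennreal (g x))"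
  define N where "N = density lborel (\<lambda>x. ennreal (- g x))"
  let ?E = "range (\<lambda>(a, b). box a b :: 'a set)"
  have em: "emeasure M (box l u) = (\<integral>\<^sup>+x. ennreal (indicator (box l u) x * g x) \<partial>lborel)"
    "emeasure N (box l u) = (\<integral>\<^sup>+x. ennreal (- (indicator (box l u) x * g x)) \<partial>lborel)" for l u
    by (auto simp: M_def N_def emeasure_density intro!: nn_integral_cong split: split_indicator)
  have fin: "(\<integral>\<^sup>+x. ennreal (indicator (box l u) x * g x) \<partial>lborel) < \<infinity>"
    "(\<integral>\<^sup>+x. ennreal (- (indicator (box l u) x * g x)) \<partial>lborel) < \<infinity>" for l u
    using int[of l u] unfolding real_integrable_def by (auto simp: less_top)
  have eq: "emeasure M (box l u) = emeasure N (box l u)" for l u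
    using z[of l u] unfolding real_lebesgue_integral_def[OF int] em using fin[of l u]
    by (metis eq_iff_diff_eq_0 ennreal_enn2real infinity_ennreal_def)
  have "M = N"
  proof (rule measure_eqI_generator_eq)
    show "Int_stable ?E"
      by (auto simp: Int_stable_def box_Int_box)
    show "?E \<subseteq> Pow UNIV" by simp
    show "emeasure M X = emeasure N X" if "X \<in> ?E" for X using that eq by auto
    show "sets M = sigma_sets UNIV ?E" "sets N = sigma_sets UNIV ?E"
      by (simp_all add: M_def N_def borel_eq_box)
    show "range (\<lambda>n::nat. box (- (real n *\<^sub>R One)) (real n *\<^sub>R One) :: 'a set) \<subseteq> ?E" by auto
    show "(\<Union>n::nat. box (- (real n *\<^sub>R One)) (real n *\<^sub>R One) :: 'a set) = UNIV"
      by (rule UN_box_eq_UNIV)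
    show "emeasure M (box (- (real n *\<^sub>R One)) (real n *\<^sub>R One)) \<noteq> \<infinity>" for n
      using fin(1) unfolding em by (metis less_irrefl)
  qed
  then have "AE x in lborel. ennreal (g x) = ennreal (- g x)"
    unfolding M_def N_def by (intro sigma_finite_measure.density_unique[OF sigma_finite_lborel]) auto
  then show ?thesis
    by eventually_elim (metis add.inverse_neutral enn2real_ennreal ennreal_neg linorder_not_le neg_le_0_iff_le nle_le order_less_imp_le)
qed

text \<open>Dominated convergence along \<open>box_bump\<close> shows that g integrates to 0 over
  every box. Boxes control Borel functions only, so the argument passes to a Borel representative of
  g.\<close>

lemma fundamental_lemma:
  fixes g :: "'a::euclidean_space \<Rightarrow> real"
  assumes loc: "\<And>K. compact K \<Longrightarrow> set_integrable lebesgue K g"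
    and z: "\<And>\<eta>. \<eta> \<in> test_functions UNIV \<Longrightarrow> (LINT x|lebesgue. g x * \<eta> x) = 0"
  shows "AE x in lebesgue. g x = 0"
proof -
  have gm: "g \<in> borel_measurable lebesgue"
    by (rule locally_integrable_measurable[OF loc])
  obtain g' where g': "g' \<in> borel_measurable lborel" "AE x in lborel. g x = g' x"
    using completion_ex_borel_measurable_real[OF gm] by auto
  note [measurable] = g'(1)
  have ae: "AE x in lebesgue. g x = g' x" using g'(2) by (rule AE_completion)
  have int: "integrable lebesgue (\<lambda>x. indicator (box l u) x * g x)" for l u
  proof (rule Bochner_Integration.integrable_bound)
    show "integrable lebesgue (\<lambda>x. indicator (cbox l u) x *\<^sub>R g x)"
      using loc[OF compact_cbox] unfolding set_integrable_def .
    show "(\<lambda>x. indicator (box l u) x * g x) \<in> borel_measurable lebesgue"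
      using gm by (intro borel_measurable_times borel_measurable_indicator) auto
    show "AE x in lebesgue. norm (indicator (box l u) x * g x) \<le> norm (indicator (cbox l u) x *\<^sub>R g x)"
      using box_subset_cbox[of l u] by (auto simp: indicator_def)
  qed
  have zero: "(LINT x|lebesgue. indicator (box l u) x * g x) = 0" for l u
  proof (rule LIMSEQ_unique)
    show "(\<lambda>N. LINT x|lebesgue. g x * box_bump l u (1 / real (Suc N)) x) \<longlonglongrightarrow> (LINT x|lebesgue. indicator (box l u) x * g x)"
    proof (rule integral_dominated_convergence)
      show "integrable lebesgue (\<lambda>x. norm (indicator (cbox l u) x *\<^sub>R g x))"
        using loc[OF compact_cbox] unfolding set_integrable_def by (rule integrable_norm)
      show "(\<lambda>x. indicator (box l u) x * g x) \<in> borel_measurable lebesgue"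
        using int by auto
      show "(\<lambda>x. g x * box_bump l u (1 / real (Suc N)) x) \<in> borel_measurable lebesgue" for N
        using gm ck_imp_continuous[OF ck_box_bump, of "1 / real (Suc N)" l u]
        by (intro borel_measurable_times) (auto intro!: borel_measurable_continuous_onI measurable_completion)
      show "AE x in lebesgue. (\<lambda>N. g x * box_bump l u (1 / real (Suc N)) x) \<longlonglongrightarrow> indicator (box l u) x * g x"
        using box_bump_tendsto by (auto intro!: AE_I2 tendsto_mult simp: mult.commute[of "indicator _ _"])
      show "AE x in lebesgue. norm (g x * box_bump l u (1 / real (Suc N)) x) \<le> norm (indicator (cbox l u) x *\<^sub>R g x)" for N
      proof (rule AE_I2)
        fix x
        show "norm (g x * box_bump l u (1 / real (Suc N)) x) \<le> norm (indicator (cbox l u) x *\<^sub>R g x)"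
          using box_bump_eq_0[of x l u] box_subset_cbox[of l u] box_bump_nonneg[of l u "1 / real (Suc N)" x]
            box_bump_le_1[of "1 / real (Suc N)" l u x]
          by (cases "x \<in> box l u") (auto simp: abs_mult mult_left_le subset_eq)
      qed
    qed
    show "(\<lambda>N. LINT x|lebesgue. g x * box_bump l u (1 / real (Suc N)) x) \<longlonglongrightarrow> 0"
      using z[OF box_bump_test] by simp
  qed
  have ind: "AE x in lebesgue. indicator (box l u) x * g x = indicator (box l u) x * g' x"
    "AE x in lebesgue. indicator (box l u) x * g' x = indicator (box l u) x * g x" for l u
    using ae by auto
  have int': "integrable lborel (\<lambda>x. indicator (box l u) x * g' x)" for l u
  proof -
    have "integrable lebesgue (\<lambda>x. indicator (box l u) x * g' x)"
      by (rule integrable_cong_AE_imp[OF int _ ind(1)])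
       (intro measurable_completion, measurable)
    then show ?thesis by (subst (asm) integrable_completion) auto
  qed
  have "AE x in lborel. g' x = 0"
  proof (rule AE_zero_from_boxes[OF _ int'])
    show "(LINT x|lborel. indicator (box l u) x * g' x) = 0" for l u
    proof -
      have "(LINT x|lborel. indicator (box l u) x * g' x) = (LINT x|lebesgue. indicator (box l u) x * g' x)"
        by (rule integral_completion[symmetric]) measurable
      also have "\<dots> = (LINT x|lebesgue. indicator (box l u) x * g x)"
      proof (rule integral_cong_AE)
        show "(\<lambda>x. indicat_real (box l u) x * g' x) \<in> borel_measurable lebesgue"
          by (intro measurable_completion) measurable
      qed (use int ind in auto)
      finally show ?thesis using zero by simp
    qed
  qed auto
  then have "AE x in lebesgue. g' x = 0" by (rule AE_completion)
  then show ?thesis using ae by eventually_elim simp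
qed

section \<open>Test functions and uniqueness of representing functions\<close>

lemma smooth_imp_continuous:
  assumes "smooth \<eta>"
  shows "continuous_on UNIV \<eta>"
  using assms[unfolded smooth_def, rule_format, of "[]"] differentiable_imp_continuous_on by auto

lemma smooth_has_derivative:
  assumes "smooth \<eta>"
  shows "(\<eta> has_derivative frechet_derivative \<eta> (at x)) (at x)"
  using assms[unfolded smooth_def, rule_format, of "[]"]
  by (simp add: differentiable_on_def flip: frechet_derivative_works)

lemma partial_empty: "partial {#} \<eta> = \<eta>"
  by (simp add: partial_def)

lemma partial_single: "partial {#b#} \<eta> = (\<lambda>x. frechet_derivative \<eta> (at x) b)"
proof -
  have "(SOME bs. mset bs = {#b#}) = [b]"
    by (rule some_equality) auto
  then show ?thesis by (simp add: partial_def)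
qed

lemma smooth_partial_continuous:
  assumes "smooth \<eta>" "b \<in> Basis"
  shows "continuous_on UNIV (partial {#b#} \<eta>)"
  using assms(1)[unfolded smooth_def, rule_format, of "[b]"] assms(2) differentiable_imp_continuous_on
  by (auto simp: partial_single)

lemma test_functions_bounded_support:
  assumes "\<eta> \<in> test_functions U"
  obtains r where "r > 0" "\<And>x. norm x > r \<Longrightarrow> \<eta> x = 0"
proof -
  have "bounded (closure {x. \<eta> x \<noteq> 0})"
    using assms compact_imp_bounded by (auto simp: test_functions_def)
  then obtain r where "r > 0" "\<And>x. x \<in> closure {x. \<eta> x \<noteq> 0} \<Longrightarrow> norm x \<le> r"
    unfolding bounded_pos by blast
  then show ?thesis using that[of r] closure_subset by (metis (mono_tags, lifting) mem_Collect_eq not_less subsetD)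
qed

lemma continuous_bounded_support_bounded:
  fixes g :: "'a::euclidean_space \<Rightarrow> real"
  assumes "continuous_on UNIV g" "\<And>x. norm x > r \<Longrightarrow> g x = 0"
  obtains K where "K > 0" "\<And>x. \<bar>g x\<bar> \<le> K"
proof -
  have "bounded (g ` cball 0 r)"
    using assms(1) by (intro compact_imp_bounded compact_continuous_image) (auto intro: continuous_on_subset)
  then obtain K where K: "K > 0" "\<And>x. norm x \<le> r \<Longrightarrow> \<bar>g x\<bar> \<le> K"
    unfolding bounded_pos by (metis imageI mem_cball_0 real_norm_def)
  have "\<bar>g x\<bar> \<le> K" for x
    using K(1) K(2)[of x] assms(2)[of x] by (cases "norm x \<le> r") auto
  then show ?thesis using that K(1) by blast
qed

lemma test_function_bounded:
  assumes "\<eta> \<in> test_functions U"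
  obtains K where "K > 0" "\<And>x. \<bar>\<eta> x\<bar> \<le> K"
proof -
  have s: "smooth \<eta>" using assms by (simp add: test_functions_def)
  obtain r where "r > 0" "\<And>x. norm x > r \<Longrightarrow> \<eta> x = 0" using test_functions_bounded_support[OF assms] by metis
  then show ?thesis using continuous_bounded_support_bounded[OF smooth_imp_continuous[OF s], of r] that by metis
qed

lemma represents_on_unique:
  assumes "represents_on UNIV g T" "represents_on UNIV h T"
  shows "AE x in lebesgue. g x = h x"
proof -
  have g: "\<And>K. compact K \<Longrightarrow> set_integrable lebesgue K g" and h: "\<And>K. compact K \<Longrightarrow> set_integrable lebesgue K h"
    using assms by (auto simp: represents_on_def)
  have "AE x in lebesgue. g x - h x = 0"
  proof (rule fundamental_lemma)
    show "set_integrable lebesgue K (\<lambda>x. g x - h x)" if "compact K" for K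
      using g[OF that] h[OF that] by (rule set_integral_diff(1))
    fix \<eta> :: "'a \<Rightarrow> real" assume eta: "\<eta> \<in> test_functions UNIV"
    obtain r where r: "r > 0" "\<And>x. norm x > r \<Longrightarrow> \<eta> x = 0"
      using test_functions_bounded_support[OF eta] by metis
    obtain K where K: "\<And>x. \<bar>\<eta> x\<bar> \<le> K" using test_function_bounded[OF eta] by metis
    have m: "\<eta> \<in> borel_measurable lebesgue"
      using eta smooth_imp_continuous by (auto simp: test_functions_def intro!: measurable_completion borel_measurable_continuous_onI)
    have "integrable lebesgue (\<lambda>x. g x * \<eta> x)" "integrable lebesgue (\<lambda>x. h x * \<eta> x)"
      using integrable_mult_bounded[OF g[of "cball 0 r"] m K] integrable_mult_bounded[OF h[of "cball 0 r"] m K] r(2)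
      by auto
    then show "(LINT x|lebesgue. (g x - h x) * \<eta> x) = 0"
      using assms eta by (simp add: left_diff_distrib represents_on_def)
  qed
  then show ?thesis by eventually_elim simp
qed

text \<open>\<open>weak_deriv\<close> is an arbitrary choice among representing functions; this
  lemma allows norms to be computed with any explicit representative.\<close>

lemma weak_deriv_AE:
  assumes "represents_on UNIV g (dist_deriv \<beta> T)"
  shows "AE x in lebesgue. weak_deriv T \<beta> x = g x"
proof -
  have "represents_on UNIV (weak_deriv T \<beta>) (dist_deriv \<beta> T)"
    unfolding weak_deriv_def by (rule someI[of "\<lambda>g. represents_on UNIV g (dist_deriv \<beta> T)", OF assms])
  then show ?thesis using assms by (rule represents_on_unique)
qed

lemma AE_lebesgue_affine:
  fixes x :: "'a::euclidean_space"
  assumes "AE y in lebesgue. P y" "c \<noteq> 0"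
  shows "AE h in lebesgue. P (x + c *\<^sub>R h)"
proof -
  obtain N where N: "N \<in> null_sets lebesgue" "\<And>y. y \<notin> N \<Longrightarrow> P y"
    using AE_E3[OF assms(1)] by auto
  have "negligible ((\<lambda>y. (1 / c) *\<^sub>R y) ` ((\<lambda>y. (- x) + y) ` N))"
    using N(1) by (intro negligible_differentiable_image_negligible negligible_translation)
      (auto simp: negligible_iff_null_sets intro!: derivative_intros differentiable_on_scaleR)
  moreover have "h \<in> (\<lambda>y. (1 / c) *\<^sub>R y) ` ((\<lambda>y. (- x) + y) ` N)" if "\<not> P (x + c *\<^sub>R h)" for h
    using N(2)[of "x + c *\<^sub>R h"] that assms(2)
    by (auto simp: image_image intro!: image_eqI[of _ _ "x + c *\<^sub>R h"])
  ultimately show ?thesis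
    by (intro AE_I'[of "(\<lambda>y. (1 / c) *\<^sub>R y) ` ((\<lambda>y. (- x) + y) ` N)"])
      (auto simp: negligible_iff_null_sets)
qed

text \<open>For almost every fixed x, the exceptional set in h is an affine image of the null set
  where g and g' differ, hence null.\<close>

lemma homog_integral_cong_AE:
  fixes g g' :: "'a::euclidean_space \<Rightarrow> real"
  assumes "AE x in lebesgue. g x = g' x"
  shows "homog_integral \<sigma> p g = homog_integral \<sigma> p g'"
proof -
  have 1: "(\<integral>\<^sup>+ x. (\<integral>\<^sup>+ h. ennreal (\<bar>g (x + h) - 2 * g x + g (x - h)\<bar> powr p / w h) \<partial>lebesgue) \<partial>lebesgue) =
    (\<integral>\<^sup>+ x. (\<integral>\<^sup>+ h. ennreal (\<bar>g' (x + h) - 2 * g' x + g' (x - h)\<bar> powr p / w h) \<partial>lebesgue) \<partial>lebesgue)"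
    for w :: "'a \<Rightarrow> real"
  proof (rule nn_integral_cong_AE)
    show "AE x in lebesgue. (\<integral>\<^sup>+ h. ennreal (\<bar>g (x + h) - 2 * g x + g (x - h)\<bar> powr p / w h) \<partial>lebesgue) =
      (\<integral>\<^sup>+ h. ennreal (\<bar>g' (x + h) - 2 * g' x + g' (x - h)\<bar> powr p / w h) \<partial>lebesgue)"
      using assms
    proof eventually_elim
      case (elim x)
      have "AE h in lebesgue. g (x + h) = g' (x + h)" "AE h in lebesgue. g (x - h) = g' (x - h)"
        using AE_lebesgue_affine[OF assms, of 1 x] AE_lebesgue_affine[OF assms, of "-1" x] by simp_all
      then have "AE h in lebesgue. ennreal (\<bar>g (x + h) - 2 * g x + g (x - h)\<bar> powr p / w h) =
          ennreal (\<bar>g' (x + h) - 2 * g' x + g' (x - h)\<bar> powr p / w h)"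
        by eventually_elim (simp add: elim)
      then show ?case by (rule nn_integral_cong_AE)
    qed
  qed
  have 2: "(\<integral>\<^sup>+ x. (\<integral>\<^sup>+ y. ennreal (\<bar>g x - g y\<bar> powr p / w x y) \<partial>lebesgue) \<partial>lebesgue) =
    (\<integral>\<^sup>+ x. (\<integral>\<^sup>+ y. ennreal (\<bar>g' x - g' y\<bar> powr p / w x y) \<partial>lebesgue) \<partial>lebesgue)"
    for w :: "'a \<Rightarrow> 'a \<Rightarrow> real"
  proof (rule nn_integral_cong_AE)
    show "AE x in lebesgue. (\<integral>\<^sup>+ y. ennreal (\<bar>g x - g y\<bar> powr p / w x y) \<partial>lebesgue) =
      (\<integral>\<^sup>+ y. ennreal (\<bar>g' x - g' y\<bar> powr p / w x y) \<partial>lebesgue)"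
      using assms
    proof eventually_elim
      case (elim x)
      show ?case
        by (intro nn_integral_cong_AE) (use assms in \<open>eventually_elim, use elim in simp\<close>)
    qed
  qed
  show ?thesis unfolding homog_integral_def 1 2 ..
qed

section \<open>Integration by parts and weak derivatives of limits\<close>

lemma nn_integral_lborel_shift:
  fixes f :: "'a::euclidean_space \<Rightarrow> ennreal"
  assumes [measurable]: "f \<in> borel_measurable borel"
  shows "(\<integral>\<^sup>+ x. f (x + a) \<partial>lborel) = (\<integral>\<^sup>+ x. f x \<partial>lborel)"
proof -
  have "(\<integral>\<^sup>+ x. f x \<partial>lborel) = (\<integral>\<^sup>+ x. f x \<partial>(distr lborel borel ((+) a)))"
    by (simp add: lborel_distr_plus)
  also have "\<dots> = (\<integral>\<^sup>+ x. f (a + x) \<partial>lborel)"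
    by (rule nn_integral_distr) auto
  finally show ?thesis by (simp add: add.commute)
qed

lemma integral_lborel_shift:
  fixes f :: "'a::euclidean_space \<Rightarrow> real"
  assumes [measurable]: "f \<in> borel_measurable borel"
  shows "(LINT x|lborel. f (x + a)) = (LINT x|lborel. f x)"
proof -
  have "(LINT x|lborel. f x) = (LINT x|distr lborel borel ((+) a). f x)"
    by (simp add: lborel_distr_plus)
  also have "\<dots> = (LINT x|lborel. f (a + x))"
    by (rule integral_distr) auto
  finally show ?thesis by (simp add: add.commute)
qed

lemma continuous_integrable_bounded_support:
  fixes f :: "'a::euclidean_space \<Rightarrow> real"
  assumes "continuous_on UNIV f" "\<And>x. norm x > r \<Longrightarrow> f x = 0"
  shows "integrable lborel f"
proof -
  obtain K where K: "K > 0" "\<And>x. \<bar>f x\<bar> \<le> K"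
    using continuous_bounded_support_bounded[OF assms] by metis
  show ?thesis
  proof (rule Bochner_Integration.integrable_bound)
    show "integrable lborel (\<lambda>x. K * indicator (cball 0 r) x)"
      using emeasure_lborel_cball_finite by (intro integrable_mult_right integrable_real_indicator) (auto simp: less_top)
    show "f \<in> borel_measurable lborel" using assms(1) by (simp add: borel_measurable_continuous_onI)
    show "AE x in lborel. norm (f x) \<le> norm (K * indicator (cball 0 r) x)"
      using K assms(2) by (auto simp: indicator_def not_le)
  qed
qed

lemma directional_derivative_lipschitz:
  fixes F :: "'a::real_normed_vector \<Rightarrow> real"
  assumes "\<And>x. ((\<lambda>t. F (x + t *\<^sub>R b)) has_real_derivative G x) (at 0)"
    "\<And>s. 0 \<le> s \<Longrightarrow> s \<le> t \<Longrightarrow> \<bar>G (x + s *\<^sub>R b)\<bar> \<le> K" "t \<ge> 0"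
  shows "\<bar>F (x + t *\<^sub>R b) - F x\<bar> \<le> K * t"
proof (cases "t = 0")
  case False
  have "((\<lambda>t. F (x + t *\<^sub>R b)) has_real_derivative G (x + s *\<^sub>R b)) (at s)" for s
  proof -
    have "((\<lambda>t. F (x + s *\<^sub>R b + (t - s) *\<^sub>R b)) has_real_derivative G (x + s *\<^sub>R b)) (at s)"
      using assms(1)[of "x + s *\<^sub>R b"] DERIV_shift[of "\<lambda>t. F (x + s *\<^sub>R b + t *\<^sub>R b)" "G (x + s *\<^sub>R b)" s "- s"]
      by simp
    moreover have "x + s *\<^sub>R b + (t - s) *\<^sub>R b = x + t *\<^sub>R b" for t
      by (simp add: scaleR_diff_left)
    ultimately show ?thesis by simp
  qed
  then obtain s where "0 < s" "s < t" "F (x + t *\<^sub>R b) - F (x + 0 *\<^sub>R b) = (t - 0) * G (x + s *\<^sub>R b)"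
    using MVT2[of 0 t "\<lambda>t. F (x + t *\<^sub>R b)" "\<lambda>s. G (x + s *\<^sub>R b)"] False assms(3) by auto
  then show ?thesis using assms(2)[of s] assms(3) by (simp add: abs_mult mult.commute mult_left_mono)
qed auto

text \<open>By translation invariance every difference quotient of H has integral 0. The mean value
  theorem bounds the quotients by the maximum of |K|, and for steps at most 1 they live in a ball of
  radius r + 1, so dominated convergence applies.\<close>

lemma integral_directional_derivative:
  fixes H K :: "'a::euclidean_space \<Rightarrow> real"
  assumes H: "continuous_on UNIV H" and K: "continuous_on UNIV K"
    and der: "\<And>x. ((\<lambda>t. H (x + t *\<^sub>R b)) has_real_derivative K x) (at 0)" and b: "norm b = 1"
    and z: "\<And>x. norm x > r \<Longrightarrow> H x = 0" "\<And>x. norm x > r \<Longrightarrow> K x = 0"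
  shows "(LINT x|lborel. K x) = 0"
proof -
  obtain L where L: "\<And>x. \<bar>K x\<bar> \<le> L" using continuous_bounded_support_bounded[OF K z(2)] by metis
  define h where "h n = 1 / real (Suc n)" for n
  have h: "0 < h n" "h n \<le> 1" for n by (auto simp: h_def)
  have hlim: "filterlim h (at 0) sequentially"
    unfolding filterlim_at
  proof
    show "\<forall>\<^sub>F n in sequentially. h n \<in> UNIV \<and> h n \<noteq> 0" using h(1) by (auto intro!: always_eventually) (metis less_irrefl)
    show "h \<longlonglongrightarrow> 0" unfolding h_def[abs_def] by (rule LIMSEQ_Suc[OF lim_1_over_n])
  qed
  have Hm: "H \<in> borel_measurable borel" and Km: "K \<in> borel_measurable borel"
    using H K by (auto intro: borel_measurable_continuous_onI)
  note [measurable] = Hm Km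
  have i: "integrable lborel H" "integrable lborel (\<lambda>x. H (x + a))" for a
  proof -
    show "integrable lborel H" by (rule continuous_integrable_bounded_support[OF H z(1)])
    show "integrable lborel (\<lambda>x. H (x + a))"
    proof (rule continuous_integrable_bounded_support[of _ "r + norm a"])
      show "continuous_on UNIV (\<lambda>x. H (x + a))"
        by (rule continuous_on_compose2[OF H]) (auto intro!: continuous_intros)
      show "H (x + a) = 0" if "norm x > r + norm a" for x
        using z(1)[of "x + a"] that norm_triangle_ineq2[of x "- a"] by simp
    qed
  qed
  have 0: "(LINT x|lborel. (H (x + h n *\<^sub>R b) - H x) / h n) = 0" for n
    using i integral_lborel_shift[OF Hm] by simp
  have "(\<lambda>n. LINT x|lborel. (H (x + h n *\<^sub>R b) - H x) / h n) \<longlonglongrightarrow> (LINT x|lborel. K x)"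
  proof (rule integral_dominated_convergence[where w="\<lambda>x. L * indicator (cball 0 (r + 1)) x"])
    show "integrable lborel (\<lambda>x. L * indicat_real (cball (0::'a) (r + 1)) x)"
      using emeasure_lborel_cball_finite by (intro integrable_mult_right integrable_real_indicator) (auto simp: less_top)
    show "AE x in lborel. (\<lambda>n. (H (x + h n *\<^sub>R b) - H x) / h n) \<longlonglongrightarrow> K x"
    proof (rule AE_I2)
      fix x
      have "((\<lambda>t. (H (x + t *\<^sub>R b) - H x) / t) \<longlongrightarrow> K x) (at 0)" using der[of x] by (simp add: DERIV_def)
      then show "(\<lambda>n. (H (x + h n *\<^sub>R b) - H x) / h n) \<longlonglongrightarrow> K x" by (rule filterlim_compose[OF _ hlim])
    qed
    show "AE x in lborel. norm ((H (x + h n *\<^sub>R b) - H x) / h n) \<le> L * indicat_real (cball 0 (r + 1)) x" for n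
    proof (rule AE_I2)
      fix x
      have le: "\<bar>H (x + h n *\<^sub>R b) - H x\<bar> \<le> L * h n"
        by (rule directional_derivative_lipschitz[OF der L]) (use h in \<open>auto intro: less_imp_le\<close>)
      show "norm ((H (x + h n *\<^sub>R b) - H x) / h n) \<le> L * indicat_real (cball 0 (r + 1)) x"
      proof (cases "norm x \<le> r + 1")
        case True
        then show ?thesis using le h(1)[of n] by (simp add: field_simps)
      next
        case False
        then have "norm x > r" "norm (x + h n *\<^sub>R b) > r"
          using norm_triangle_ineq2[of x "- (h n *\<^sub>R b)"] h[of n] b by auto
        then show ?thesis using z(1) False by simp
      qed
    qed
  qed measurable
  then show ?thesis using LIMSEQ_unique[OF _ tendsto_const] unfolding 0 by blast
qed

lemma partial_test_bounded:
  assumes "\<eta> \<in> test_functions UNIV" "b \<in> Basis"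
  obtains r K where "r > 0" "\<And>x. norm x > r \<Longrightarrow> partial {#b#} \<eta> x = 0" "\<And>x. \<bar>partial {#b#} \<eta> x\<bar> \<le> K"
proof -
  have sm: "smooth \<eta>" using assms by (simp add: test_functions_def)
  obtain r where r: "r > 0" "\<And>x. norm x > r \<Longrightarrow> \<eta> x = 0"
    using test_functions_bounded_support[OF assms(1)] by metis
  have 0: "partial {#b#} \<eta> x = 0" if "norm x > r" for x
  proof -
    have "((\<lambda>x. 0) has_derivative (\<lambda>v. 0)) (at x)" by simp
    then have "(\<eta> has_derivative (\<lambda>v. 0)) (at x)"
      by (rule has_derivative_transform_within_open[of _ _ _ _ "- cball 0 r"])
        (use r(2) that in \<open>auto simp: dist_norm\<close>)
    then show ?thesis
      using frechet_derivative_at by (metis partial_single)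
  qed
  then show ?thesis
    using continuous_bounded_support_bounded[OF smooth_partial_continuous[OF sm assms(2)] 0] r(1) that by metis
qed

lemma integration_by_parts_test:
  fixes F G :: "'a::euclidean_space \<Rightarrow> real"
  assumes F: "continuous_on UNIV F" and G: "continuous_on UNIV G" and b: "b \<in> Basis"
    and der: "\<And>x. ((\<lambda>t. F (x + t *\<^sub>R b)) has_real_derivative G x) (at 0)"
    and eta: "\<eta> \<in> test_functions UNIV"
  shows "(LINT x|lebesgue. F x * partial {#b#} \<eta> x) = - (LINT x|lebesgue. G x * \<eta> x)"
proof -
  define \<eta>' where "\<eta>' = partial {#b#} \<eta>"
  have sm: "smooth \<eta>" using eta by (simp add: test_functions_def)
  have c: "continuous_on UNIV (\<lambda>x. G x * \<eta> x)" "continuous_on UNIV (\<lambda>x. F x * \<eta>' x)" "continuous_on UNIV (\<lambda>x. F x * \<eta> x)"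
    unfolding \<eta>'_def by (intro continuous_on_mult F G smooth_imp_continuous[OF sm] smooth_partial_continuous[OF sm b])+
  have der\<eta>: "((\<lambda>t. \<eta> (x + t *\<^sub>R b)) has_real_derivative \<eta>' x) (at 0)" for x
  proof -
    have "((\<lambda>t. \<eta> (x + t *\<^sub>R b)) has_derivative (\<lambda>t. frechet_derivative \<eta> (at (x + 0 *\<^sub>R b)) (t *\<^sub>R b))) (at 0)"
      by (rule has_derivative_compose[of "\<lambda>t. x + t *\<^sub>R b" "\<lambda>t. t *\<^sub>R b" 0 UNIV \<eta>])
       (auto intro!: derivative_eq_intros smooth_has_derivative[OF sm])
    moreover have "linear (frechet_derivative \<eta> (at x))"
      using smooth_has_derivative[OF sm] has_derivative_linear by blast
    ultimately show ?thesis
      by (simp add: has_field_derivative_def \<eta>'_def partial_single linear_scale mult.commute[of _ "frechet_derivative \<eta> (at x) b"])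
  qed
  obtain r where r: "r > 0" "\<And>x. norm x > r \<Longrightarrow> \<eta> x = 0"
    using test_functions_bounded_support[OF eta] by metis
  obtain r' where r': "\<And>x. norm x > r' \<Longrightarrow> \<eta>' x = 0"
    unfolding \<eta>'_def using partial_test_bounded[OF eta b] by metis
  have i: "integrable lborel (\<lambda>x. G x * \<eta> x)" "integrable lborel (\<lambda>x. F x * \<eta>' x)"
    by (rule continuous_integrable_bounded_support[OF c(1), of r], use r in simp)
      (rule continuous_integrable_bounded_support[OF c(2), of r'], use r' in simp)
  have "(LINT x|lborel. G x * \<eta> x + F x * \<eta>' x) = 0"
  proof (rule integral_directional_derivative[OF c(3), where b=b and r="max r r'"])
    show "((\<lambda>t. F (x + t *\<^sub>R b) * \<eta> (x + t *\<^sub>R b)) has_real_derivative G x * \<eta> x + F x * \<eta>' x) (at 0)" for x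
      using DERIV_mult[OF der[of x] der\<eta>[of x]] by (simp add: mult.commute)
  qed (use b c r r' in \<open>auto intro: continuous_on_add\<close>)
  then have "(LINT x|lborel. F x * \<eta>' x) = - (LINT x|lborel. G x * \<eta> x)" using i by simp
  moreover have "(\<lambda>x. F x * \<eta>' x) \<in> borel_measurable lborel" "(\<lambda>x. G x * \<eta> x) \<in> borel_measurable lborel"
    using c by (auto intro: borel_measurable_continuous_onI)
  ultimately show ?thesis by (simp add: \<eta>'_def integral_completion)
qed

text \<open>The potential is a limit of smooth partial sums but need not be differentiable on the
  boundary, so its derivative exists only in the weak sense. Integration by parts holds for each
  partial sum and survives the limit because one locally integrable H dominates functions and
  derivatives alike.\<close>

lemma weak_derivative_limit:
  fixes F G H :: "'a::euclidean_space \<Rightarrow> real" and Fn Gn :: "nat \<Rightarrow> 'a \<Rightarrow> real"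
  assumes b: "b \<in> Basis"
    and ibp: "\<And>n \<eta>. \<eta> \<in> test_functions UNIV \<Longrightarrow>
      (LINT x|lebesgue. Fn n x * partial {#b#} \<eta> x) = - (LINT x|lebesgue. Gn n x * \<eta> x)"
    and m: "\<And>n. Fn n \<in> borel_measurable borel" "\<And>n. Gn n \<in> borel_measurable borel"
      "F \<in> borel_measurable borel" "G \<in> borel_measurable borel"
    and lim: "AE x in lebesgue. (\<lambda>n. Fn n x) \<longlonglongrightarrow> F x" "AE x in lebesgue. (\<lambda>n. Gn n x) \<longlonglongrightarrow> G x"
    and dom: "\<And>n. AE x in lebesgue. \<bar>Fn n x\<bar> \<le> H x" "\<And>n. AE x in lebesgue. \<bar>Gn n x\<bar> \<le> H x"
    and H: "\<And>K. compact K \<Longrightarrow> set_integrable lebesgue K H"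
  shows "represents_on UNIV G (dist_deriv {#b#} (dist_of F))"
proof -
  have conv: "(\<lambda>n. LINT x|lebesgue. fn n x * \<zeta> x) \<longlonglongrightarrow> (LINT x|lebesgue. f x * \<zeta> x)"
    if "\<And>n. fn n \<in> borel_measurable borel" "f \<in> borel_measurable borel" "AE x in lebesgue. (\<lambda>n. fn n x) \<longlonglongrightarrow> f x"
      "\<And>n. AE x in lebesgue. \<bar>fn n x\<bar> \<le> H x" "\<zeta> \<in> borel_measurable borel" "\<And>x. \<bar>\<zeta> x\<bar> \<le> K" "\<And>x. norm x > r \<Longrightarrow> \<zeta> x = 0"
    for fn f \<zeta> K r
  proof (rule integral_dominated_convergence[where w="\<lambda>x. H x * \<bar>\<zeta> x\<bar>"])
    show "integrable lebesgue (\<lambda>x. H x * \<bar>\<zeta> x\<bar>)"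
      by (rule integrable_mult_bounded[OF H[of "cball 0 r"]])
        (use that in \<open>auto intro!: measurable_completion borel_measurable_abs\<close>)
    show "(\<lambda>x. fn n x * \<zeta> x) \<in> borel_measurable lebesgue" for n
      using that by (intro measurable_completion) auto
    show "(\<lambda>x. f x * \<zeta> x) \<in> borel_measurable lebesgue"
      using that by (intro measurable_completion) auto
    show "AE x in lebesgue. (\<lambda>n. fn n x * \<zeta> x) \<longlonglongrightarrow> f x * \<zeta> x"
      using that(3) by eventually_elim (intro tendsto_mult tendsto_const)
    show "AE x in lebesgue. norm (fn n x * \<zeta> x) \<le> H x * \<bar>\<zeta> x\<bar>" for n
      using that(4)[of n] by eventually_elim (auto simp: abs_mult intro: mult_right_mono)
  qed
  have loc: "set_integrable lebesgue K G" if K: "compact K" for K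
    unfolding set_integrable_def
  proof (rule Bochner_Integration.integrable_bound)
    show "integrable lebesgue (\<lambda>x. indicator K x *\<^sub>R H x)" using H[OF K] unfolding set_integrable_def .
    show "(\<lambda>x. indicat_real K x *\<^sub>R G x) \<in> borel_measurable lebesgue"
      using m(4) borel_compact[OF K] by (intro measurable_completion borel_measurable_scaleR borel_measurable_indicator) auto
    have "AE x in lebesgue. \<forall>n. \<bar>Gn n x\<bar> \<le> H x" using dom(2) by (simp add: AE_all_countable)
    then show "AE x in lebesgue. norm (indicat_real K x *\<^sub>R G x) \<le> norm (indicat_real K x *\<^sub>R H x)"
      using lim(2)
    proof eventually_elim
      case (elim x)
      then have "\<bar>G x\<bar> \<le> H x"
        by (intro LIMSEQ_le_const2[of "\<lambda>n. \<bar>Gn n x\<bar>"]) (auto intro: tendsto_rabs)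
      then show ?case by (auto simp: indicator_def)
    qed
  qed
  show "represents_on UNIV G (dist_deriv {#b#} (dist_of F))"
    unfolding represents_on_def
  proof (intro conjI allI ballI impI)
    show "set_integrable lebesgue K G" if "compact K \<and> K \<subseteq> UNIV" for K
      using loc that by blast
    fix \<eta> :: "'a \<Rightarrow> real" assume eta: "\<eta> \<in> test_functions UNIV"
    have sm: "smooth \<eta>" using eta by (simp add: test_functions_def)
    obtain r K where rK: "\<And>x. norm x > r \<Longrightarrow> partial {#b#} \<eta> x = 0" "\<And>x. \<bar>partial {#b#} \<eta> x\<bar> \<le> K"
      using partial_test_bounded[OF eta b] by metis
    obtain r' where r': "\<And>x. norm x > r' \<Longrightarrow> \<eta> x = 0"
      using test_functions_bounded_support[OF eta] by metis
    obtain K' where K': "\<And>x. \<bar>\<eta> x\<bar> \<le> K'"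
      using test_function_bounded[OF eta] by metis
    have 1: "(\<lambda>n. LINT x|lebesgue. Fn n x * partial {#b#} \<eta> x) \<longlonglongrightarrow> (LINT x|lebesgue. F x * partial {#b#} \<eta> x)"
      by (rule conv[OF m(1,3) lim(1) dom(1) _ rK(2,1)])
        (auto intro: borel_measurable_continuous_onI smooth_partial_continuous[OF sm b])
    have 2: "(\<lambda>n. LINT x|lebesgue. Gn n x * \<eta> x) \<longlonglongrightarrow> (LINT x|lebesgue. G x * \<eta> x)"
      by (rule conv[OF m(2,4) lim(2) dom(2) _ K' r'])
        (auto intro: borel_measurable_continuous_onI smooth_imp_continuous[OF sm])
    have "(LINT x|lebesgue. F x * partial {#b#} \<eta> x) = - (LINT x|lebesgue. G x * \<eta> x)"
      using LIMSEQ_unique[OF 1[unfolded ibp[OF eta]] tendsto_minus[OF 2]] .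
    then show "dist_deriv {#b#} (dist_of F) \<eta> = (LINT x|lebesgue. G x * \<eta> x)"
      by (simp add: dist_deriv_def dist_of_def)
  qed
qed

section \<open>Hardy inequality over dyadic scales\<close>

abbreviation pint :: "real \<Rightarrow> ('a::euclidean_space \<Rightarrow> real) \<Rightarrow> ennreal" where
  "pint q f \<equiv> \<integral>\<^sup>+x. ennreal (\<bar>f x\<bar> powr q) \<partial>lborel"

lemma sum_two_sided_geometric:
  assumes "0 \<le> a" "a < 1" "0 \<le> b" "b < 1" "finite F"
  shows "(\<Sum>i\<in>F. if (i::int) \<ge> 0 then a ^ nat i else b ^ nat (- i)) \<le> 1 / (1 - a) + 1 / (1 - (b::real))"
proof -
  have "(\<Sum>i\<in>F. if i \<ge> 0 then a ^ nat i else b ^ nat (- i)) =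
      (\<Sum>i\<in>F \<inter> {0..}. a ^ nat i) + (\<Sum>i\<in>F - {0..}. b ^ nat (- i))"
    unfolding sum.Int_Diff[OF assms(5), of _ "{0..}"] by (intro arg_cong2[where f="(+)"] sum.cong) auto
  also have "(\<Sum>i\<in>F \<inter> {0..}. a ^ nat i) = (\<Sum>n\<in>nat ` (F \<inter> {0..}). a ^ n)"
    by (subst sum.reindex) (auto intro: inj_onI)
  also have "\<dots> \<le> (\<Sum>n. a ^ n)"
    using assms by (intro sum_le_suminf summable_geometric) auto
  also have "(\<Sum>i\<in>F - {0..}. b ^ nat (- i)) = (\<Sum>n\<in>(\<lambda>i. nat (- i)) ` (F - {0..}). b ^ n)"
    by (subst sum.reindex) (auto intro!: inj_onI)
  also have "\<dots> \<le> (\<Sum>n. b ^ n)"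
    using assms by (intro sum_le_suminf summable_geometric) auto
  finally show ?thesis using assms by (simp add: suminf_geometric)
qed

lemma suminf_ennreal_le:
  fixes f :: "nat \<Rightarrow> ennreal"
  assumes "\<And>N. (\<Sum>n<N. f n) \<le> C"
  shows "(\<Sum>n. f n) \<le> C"
  unfolding suminf_eq_SUP using assms by (intro SUP_least)

lemma suminf_int_le:
  fixes f :: "int \<Rightarrow> real"
  assumes "\<And>F. finite F \<Longrightarrow> (\<Sum>i\<in>F. f i) \<le> C" "\<And>i. 0 \<le> f i"
  shows "(\<Sum>n. ennreal (f (int_decode n))) \<le> ennreal C"
proof (rule suminf_ennreal_le)
  fix N
  have "(\<Sum>n<N. ennreal (f (int_decode n))) = ennreal (\<Sum>n<N. f (int_decode n))"
    using assms(2) by simp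
  also have "(\<Sum>n<N. f (int_decode n)) = (\<Sum>i\<in>int_decode ` {..<N}. f i)"
    by (subst sum.reindex) (auto intro: inj_on_subset[OF inj_int_decode])
  finally show "(\<Sum>n<N. ennreal (f (int_decode n))) \<le> ennreal C"
    using assms(1)[of "int_decode ` {..<N}"] by (simp add: ennreal_leI)
qed

lemma sum_le_suminf_int:
  fixes f :: "int \<Rightarrow> ennreal"
  assumes "finite F"
  shows "(\<Sum>i\<in>F. f i) \<le> (\<Sum>n. f (int_decode n))"
proof -
  have "(\<Sum>i\<in>F. f i) = (\<Sum>n\<in>int_encode ` F. f (int_decode n))"
    by (subst sum.reindex) (auto intro: inj_on_subset[OF inj_int_encode])
  also have "\<dots> \<le> (\<Sum>n. f (int_decode n))"
    using assms by (intro sum_le_suminf) auto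
  finally show ?thesis .
qed

text \<open>Jensen's inequality for t^q with probabilities w_i / W applied to the values d_i W /
  w_i. The weights remain free; each application chooses them to be summable over scales.\<close>

lemma weighted_power_sum:
  fixes d w :: "'i \<Rightarrow> real"
  assumes "finite F" "\<And>i. i \<in> F \<Longrightarrow> 0 \<le> d i" "\<And>i. i \<in> F \<Longrightarrow> 0 < w i" "(\<Sum>i\<in>F. w i) \<le> C" "1 \<le> q"
  shows "(\<Sum>i\<in>F. d i) powr q \<le> C powr (q - 1) * (\<Sum>i\<in>F. w i powr (1 - q) * d i powr q)"
proof -
  \<comment> \<open>Vanishing terms are discarded, so that Jensen's inequality is applied to
    positive arguments only.\<close>
  define G where "G = {i \<in> F. d i > 0}"
  have G: "finite G" "G \<subseteq> F" using assms(1) by (auto simp: G_def)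
  have sG: "(\<Sum>i\<in>F. d i) = (\<Sum>i\<in>G. d i)"
    using assms(1,2) by (intro sum.mono_neutral_right) (force simp: G_def less_le)+
  show ?thesis
  proof (cases "G = {}")
    case True
    then show ?thesis using sG by (auto intro!: mult_nonneg_nonneg sum_nonneg)
  next
    case False
    define W where "W = (\<Sum>i\<in>G. w i)"
    have W: "W > 0" unfolding W_def using G False assms(3) by (intro sum_pos) auto
    have WC: "W \<le> C" using assms(4) sum_mono2[OF assms(1) G(2), of w] assms(3) unfolding W_def
      by (force intro: less_imp_le)
    have "(\<Sum>i\<in>G. (w i / W) *\<^sub>R (d i * W / w i)) powr q \<le> (\<Sum>i\<in>G. (w i / W) * (d i * W / w i) powr q)"
    proof (rule convex_on_sum[OF G(1) False powr_convex[OF assms(5)]])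
      show "(\<Sum>i\<in>G. w i / W) = 1" using W by (simp add: W_def flip: sum_divide_distrib)
    qed (use W G assms(3) in \<open>auto simp: G_def intro: less_imp_le\<close>)
    also have "(\<Sum>i\<in>G. (w i / W) *\<^sub>R (d i * W / w i)) = (\<Sum>i\<in>G. d i)"
    proof (rule sum.cong[OF refl])
      fix i assume "i \<in> G"
      then have "w i > 0" using assms(3) G by auto
      then show "(w i / W) *\<^sub>R (d i * W / w i) = d i" using W by simp
    qed
    also have "(\<Sum>i\<in>G. (w i / W) * (d i * W / w i) powr q) = (\<Sum>i\<in>G. W powr (q - 1) * (w i powr (1 - q) * d i powr q))"
    proof (rule sum.cong[OF refl])
      fix i assume i: "i \<in> G"
      then have p: "w i > 0" "d i > 0" using assms(3) G by (auto simp: G_def)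
      have "(d i * W / w i) powr q = d i powr q * W powr q / w i powr q"
        using p W by (simp add: powr_mult powr_divide)
      then show "(w i / W) * (d i * W / w i) powr q = W powr (q - 1) * (w i powr (1 - q) * d i powr q)"
        using p W by (simp add: powr_diff field_simps)
    qed
    also have "\<dots> = W powr (q - 1) * (\<Sum>i\<in>G. w i powr (1 - q) * d i powr q)"
      by (simp add: sum_distrib_left)
    also have "\<dots> \<le> C powr (q - 1) * (\<Sum>i\<in>F. w i powr (1 - q) * d i powr q)"
      using W WC assms G
      by (intro mult_mono powr_mono2 sum_mono2) (auto intro!: sum_nonneg)
    finally show ?thesis unfolding sG .
  qed
qed

text \<open>At t = 2^j |h| this is the gain min(1, t^m) of a difference of order m on a function
  living at scale 2^{-j}, multiplied by the weight t^{-\<sigma>} of the seminorm. For 0 < \<sigma> <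
  m it decays at both ends, which is the source of the Hardy inequality.\<close>

definition om :: "real \<Rightarrow> real \<Rightarrow> real \<Rightarrow> real" where
  "om m \<sigma> t = min 1 (t powr m) * t powr (- \<sigma>)"

text \<open>A majorant of \<open>om\<close> on the dyadic interval from 2^i to 2^{i+1}; the factor
  2^m absorbs the variation of \<open>om\<close> inside the interval for negative i.\<close>

definition Om :: "real \<Rightarrow> real \<Rightarrow> int \<Rightarrow> real" where
  "Om m \<sigma> i = 2 powr m * (if i \<ge> 0 then (2 powr (- \<sigma>)) ^ nat i else (2 powr (- (m - \<sigma>))) ^ nat (- i))"

lemma om_pos: "t > 0 \<Longrightarrow> om m \<sigma> t > 0"
  by (simp add: om_def)

lemma om_nonneg: "om m \<sigma> t \<ge> 0"
  by (simp add: om_def)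

lemma Om_nonneg: "Om m \<sigma> i \<ge> 0"
  by (simp add: Om_def)

lemma om_le_Om:
  assumes "0 < \<sigma>" "\<sigma> < m" "2 powr i \<le> t" "t < 2 powr (i + 1)"
  shows "om m \<sigma> t \<le> Om m \<sigma> i"
proof -
  have t: "t > 0" by (rule less_le_trans[OF _ assms(3)]) simp
  show ?thesis
  proof (cases "i \<ge> 0")
    case True
    have "om m \<sigma> t \<le> 1 * t powr (- \<sigma>)"
      unfolding om_def by (intro mult_right_mono) auto
    also have "\<dots> \<le> (2 powr i) powr (- \<sigma>)"
      unfolding mult_1 using assms t by (intro powr_mono2') auto
    also have "\<dots> = (2 powr (- \<sigma>)) ^ nat i"
      using True by (simp add: powr_powr mult.commute flip: powr_realpow)
    also have "\<dots> \<le> 2 powr m * (2 powr (- \<sigma>)) ^ nat i"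
      using assms ge_one_powr_ge_zero[of 2 m] by (simp add: mult_le_cancel_right1)
    finally show ?thesis using True by (simp add: Om_def)
  next
    case False
    have "om m \<sigma> t \<le> t powr m * t powr (- \<sigma>)"
      unfolding om_def by (intro mult_right_mono) auto
    also have "\<dots> = t powr (m - \<sigma>)" by (simp flip: powr_add)
    also have "\<dots> \<le> (2 powr (i + 1)) powr (m - \<sigma>)"
      using assms t by (intro powr_mono2) auto
    also have "\<dots> = 2 powr (m - \<sigma>) * (2 powr (- (m - \<sigma>))) ^ nat (- i)"
    proof -
      have "(2 powr (- (m - \<sigma>))) ^ nat (- i) = (2::real) powr (- (m - \<sigma>) * real (nat (- i)))"
        by (simp add: powr_powr flip: powr_realpow)
      also have "- (m - \<sigma>) * real (nat (- i)) = (m - \<sigma>) * i" using False by (simp add: algebra_simps)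
      finally show ?thesis by (simp add: powr_powr algebra_simps flip: powr_add)
    qed
    also have "\<dots> \<le> 2 powr m * (2 powr (- (m - \<sigma>))) ^ nat (- i)"
      using assms by (intro mult_right_mono powr_mono) auto
    finally show ?thesis using False by (simp add: Om_def)
  qed
qed

definition Om_const :: "real \<Rightarrow> real \<Rightarrow> real" where
  "Om_const m \<sigma> = 2 powr m * (1 / (1 - 2 powr (- \<sigma>)) + 1 / (1 - 2 powr (- (m - \<sigma>))))"

lemma Om_sum_bound:
  assumes "0 < \<sigma>" "\<sigma> < m" "finite F"
  shows "(\<Sum>i\<in>F. Om m \<sigma> i) \<le> Om_const m \<sigma>"
proof -
  have l: "2 powr (- \<sigma>) < (1::real)" "2 powr (- (m - \<sigma>)) < (1::real)"
    using assms powr_less_one[of 2] by auto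
  show ?thesis
    unfolding Om_def Om_const_def sum_distrib_left[symmetric]
    by (intro mult_left_mono sum_two_sided_geometric) (use l assms in auto)
qed

lemma Om_const_nonneg: "0 < \<sigma> \<Longrightarrow> \<sigma> < m \<Longrightarrow> 0 \<le> Om_const m \<sigma>"
  using Om_sum_bound[of \<sigma> m "{}"] by simp

lemma dyadic_floor:
  assumes "(t::real) > 0"
  shows "2 powr \<lfloor>log 2 t\<rfloor> \<le> t" "t < 2 powr (\<lfloor>log 2 t\<rfloor> + 1)"
proof -
  have "2 powr \<lfloor>log 2 t\<rfloor> \<le> 2 powr (log 2 t)" by (intro powr_mono) auto
  then show "2 powr \<lfloor>log 2 t\<rfloor> \<le> t" using assms by simp
  have "2 powr (log 2 t) < 2 powr (\<lfloor>log 2 t\<rfloor> + 1)" by (intro powr_less_mono) linarith+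
  then show "t < 2 powr (\<lfloor>log 2 t\<rfloor> + 1)" using assms by simp
qed

lemma om_dyadic_sum_bound:
  assumes "0 < \<sigma>" "\<sigma> < m" "finite F" "t > 0"
  shows "(\<Sum>j\<in>F. om m \<sigma> (2 powr (j::int) * t)) \<le> Om_const m \<sigma>"
proof -
  define l where "l = \<lfloor>log 2 t\<rfloor>"
  have "om m \<sigma> (2 powr j * t) \<le> Om m \<sigma> (j + l)" for j :: int
    by (rule om_le_Om[OF assms(1,2)]) (use dyadic_floor[OF assms(4)] in \<open>auto simp: l_def powr_add add.assoc\<close>)
  then have "(\<Sum>j\<in>F. om m \<sigma> (2 powr j * t)) \<le> (\<Sum>j\<in>F. Om m \<sigma> (j + l))"
    by (intro sum_mono)
  also have "\<dots> = (\<Sum>i\<in>(\<lambda>j. j + l) ` F. Om m \<sigma> i)"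
    by (subst sum.reindex) (auto intro: inj_onI)
  also have "\<dots> \<le> Om_const m \<sigma>" using assms by (intro Om_sum_bound) auto
  finally show ?thesis .
qed

lemma om_measurable [measurable]: "(\<lambda>h::'a::euclidean_space. om m \<sigma> (c * norm h)) \<in> borel_measurable borel"
  unfolding om_def by measurable

text \<open>The measure dh / |h|^d is invariant under dilations, so the bound does not depend on j.
  Instead of polar coordinates, the shell where 2^j |h| lies between 2^i and 2^{i+1} is enclosed in
  a ball, and the resulting values are summed by the two-sided geometric series of
  \<open>Om\<close>.\<close>

lemma om_integral_bound:
  fixes j :: int
  assumes "0 < \<sigma>" "\<sigma> < m"
  shows "(\<integral>\<^sup>+h. ennreal (om m \<sigma> (2 powr j * norm h) / norm (h::'a::euclidean_space) powr DIM('a)) \<partial>lborel)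
    \<le> ennreal (unit_ball_vol DIM('a) * 2 powr DIM('a) * Om_const m \<sigma>)"
proof -
  define d where "d = real DIM('a)"
  define V where "V = unit_ball_vol d * 2 powr d"
  have V: "V \<ge> 0" by (simp add: V_def d_def unit_ball_vol_nonneg)
  define g where "g i h = ennreal (Om m \<sigma> i * 2 powr (- ((i - j) * d))) * indicator (ball (0::'a) (2 powr (i + 1 - j))) h" for i :: int and h
  have "(\<integral>\<^sup>+h. ennreal (om m \<sigma> (2 powr j * norm h) / norm (h::'a) powr d) \<partial>lborel)
      \<le> (\<integral>\<^sup>+h. (\<Sum>n. g (int_decode n) h) \<partial>lborel)"
  proof (rule nn_integral_mono)
    fix h :: 'a
    show "ennreal (om m \<sigma> (2 powr j * norm h) / norm h powr d) \<le> (\<Sum>n. g (int_decode n) h)"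
    proof (cases "h = 0")
      case False
      define i where "i = \<lfloor>log 2 (2 powr j * norm h)\<rfloor>"
      have pos: "2 powr j * norm h > 0" using False by simp
      note fl = dyadic_floor[OF pos, folded i_def]
      have a: "om m \<sigma> (2 powr j * norm h) \<le> Om m \<sigma> i"
        by (rule om_le_Om[OF assms fl])
      have lo: "2 powr (i - j) \<le> norm h" using fl(1) by (simp add: powr_diff field_simps)
      have hi: "norm h < 2 powr (i + 1 - j)" using fl(2) by (simp add: powr_diff field_simps)
      have "2 powr ((i - j) * d) \<le> norm h powr d"
        using powr_mono2[OF _ _ lo, of d] by (simp add: powr_powr d_def)
      then have "om m \<sigma> (2 powr j * norm h) / norm h powr d \<le> Om m \<sigma> i / 2 powr ((i - j) * d)"
        using a om_nonneg Om_nonneg by (intro frac_le) auto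
      then have "ennreal (om m \<sigma> (2 powr j * norm h) / norm h powr d) \<le> g i h"
        using hi by (simp add: g_def powr_minus divide_inverse ennreal_leI)
      also have "\<dots> \<le> (\<Sum>n. g (int_decode n) h)"
        using sum_le_suminf_int[of "{i}" "\<lambda>i. g i h"] by simp
      finally show ?thesis .
    qed (simp add: d_def)
  qed
  also have "\<dots> = (\<Sum>n. \<integral>\<^sup>+h. g (int_decode n) h \<partial>lborel)"
  proof (rule nn_integral_suminf)
    show "g (int_decode n) \<in> borel_measurable lborel" for n
      unfolding g_def[abs_def]
      by (intro borel_measurable_times_ennreal borel_measurable_const borel_measurable_indicator)
        (simp only: sets_lborel borel_open open_ball)
  qed
  also have "(\<lambda>n. \<integral>\<^sup>+h. g (int_decode n) h \<partial>lborel) = (\<lambda>n. ennreal (V * Om m \<sigma> (int_decode n)))"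
  proof
    fix n
    define i where "i = int_decode n"
    have "(\<integral>\<^sup>+h. g i h \<partial>lborel) = ennreal (Om m \<sigma> i * 2 powr (- ((i - j) * d))) * ennreal (unit_ball_vol d * (2 powr (i + 1 - j)) ^ DIM('a))"
      unfolding g_def by (subst nn_integral_cmult_indicator) (auto simp: emeasure_ball d_def)
    also have "\<dots> = ennreal (Om m \<sigma> i * 2 powr (- ((i - j) * d)) * (unit_ball_vol d * (2 powr (i + 1 - j)) ^ DIM('a)))"
      by (simp add: ennreal_mult' Om_nonneg)
    also have "(2 powr (i + 1 - j)) ^ DIM('a) = 2 powr ((i - j) * d) * 2 powr d"
    proof -
      have "(2 powr (i + 1 - j)) ^ DIM('a) = (2::real) powr ((i + 1 - j) * d)"
        by (simp add: powr_powr d_def flip: powr_realpow)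
      also have "(i + 1 - j) * d = (i - j) * d + d" by (simp add: algebra_simps)
      finally show ?thesis by (simp add: powr_add)
    qed
    also have "Om m \<sigma> i * 2 powr (- ((i - j) * d)) * (unit_ball_vol d * (2 powr ((i - j) * d) * 2 powr d)) = V * Om m \<sigma> i"
      by (simp add: V_def powr_minus)
    finally show "(\<integral>\<^sup>+h. g (int_decode n) h \<partial>lborel) = ennreal (V * Om m \<sigma> (int_decode n))"
      by (simp add: i_def)
  qed
  also have "(\<Sum>n. ennreal (V * Om m \<sigma> (int_decode n))) \<le> ennreal (V * Om_const m \<sigma>)"
    by (rule suminf_int_le) (use V Om_sum_bound[OF assms] Om_nonneg in \<open>auto simp flip: sum_distrib_left intro: mult_left_mono\<close>)
  finally show ?thesis by (simp add: d_def V_def)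
qed

text \<open>The first factor comes from Jensen's inequality over the scales, the second from the
  integral over h.\<close>

definition hardy_const :: "real \<Rightarrow> real \<Rightarrow> real \<Rightarrow> real \<Rightarrow> real" where
  "hardy_const d m \<sigma> q = Om_const m \<sigma> powr (q - 1) * (unit_ball_vol d * 2 powr d * Om_const m \<sigma>)"

lemma hardy_const_nonneg: "0 < \<sigma> \<Longrightarrow> \<sigma> < m \<Longrightarrow> 0 \<le> d \<Longrightarrow> 0 \<le> hardy_const d m \<sigma> q"
  by (simp add: hardy_const_def Om_const_nonneg unit_ball_vol_nonneg)

text \<open>A Schur test. For fixed h, Jensen's inequality over j with weights \<open>om\<close> at
  2^j |h|, whose sum over j is bounded independently of h; then, for fixed j, integration over x by
  hypothesis and over h by \<open>om_integral_bound\<close>. The finite set of relevant scales may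
  depend on x and h, so finite sums are dominated by the full series before integrating.\<close>

lemma hardy_dyadic:
  fixes \<sigma> m q :: real and D :: "int \<Rightarrow> 'a::euclidean_space \<Rightarrow> 'a \<Rightarrow> real"
  assumes "0 < \<sigma>" "\<sigma> < m" "1 \<le> q"
    and mD: "\<And>j. case_prod (D j) \<in> borel_measurable (lborel \<Otimes>\<^sub>M lborel)"
    and A: "\<And>j. 0 \<le> A j" and B: "\<And>F. finite F \<Longrightarrow> (\<Sum>j\<in>F. A j) \<le> B"
    and bd: "\<And>j h. pint q (\<lambda>x. D j x h) \<le> ennreal (min 1 ((2 powr j * norm h) powr m) powr q * 2 powr (- (j * \<sigma> * q)) * A j)"
    and E: "AE x in lborel. AE h in lborel. \<exists>F. finite F \<and> \<bar>E x h\<bar> \<le> (\<Sum>j\<in>F. \<bar>D j x h\<bar>)"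
  shows "(\<integral>\<^sup>+x. (\<integral>\<^sup>+h. ennreal (\<bar>E x h\<bar> powr q / norm h powr (DIM('a) + q * \<sigma>)) \<partial>lborel) \<partial>lborel)
    \<le> ennreal (hardy_const DIM('a) m \<sigma> q * B)"
proof -
  define d where "d = real DIM('a)"
  define C0 where "C0 = Om_const m \<sigma>"
  define C1 where "C1 = unit_ball_vol DIM('a) * 2 powr DIM('a) * Om_const m \<sigma>"
  have C1: "C1 \<ge> 0" unfolding C1_def using assms(1,2) by (simp add: Om_const_nonneg unit_ball_vol_nonneg)
  define c where "c j h = C0 powr (q - 1) * om m \<sigma> (2 powr j * norm h) powr (1 - q) / norm h powr (d + q * \<sigma>)"
    for j :: int and h :: 'a
  have c0: "c j h \<ge> 0" for j h by (simp add: c_def)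
  define g where "g j x h = ennreal (c j h * \<bar>D j x h\<bar> powr q)" for j x h
  have mg: "case_prod (g j) \<in> borel_measurable (lborel \<Otimes>\<^sub>M lborel)" for j
  proof -
    have [measurable]: "(\<lambda>z. D j (fst z) (snd z)) \<in> borel_measurable (lborel \<Otimes>\<^sub>M lborel)"
      using mD[of j] by (simp add: case_prod_beta')
    have [measurable]: "(\<lambda>z. om m \<sigma> (2 powr j * norm (snd z))) \<in> borel_measurable (lborel \<Otimes>\<^sub>M lborel)"
      by (rule measurable_compose[OF measurable_snd]) simp
    show ?thesis unfolding g_def c_def case_prod_beta' by measurable
  qed
  have "(\<integral>\<^sup>+x. (\<integral>\<^sup>+h. ennreal (\<bar>E x h\<bar> powr q / norm h powr (d + q * \<sigma>)) \<partial>lborel) \<partial>lborel)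
    \<le> (\<integral>\<^sup>+x. (\<integral>\<^sup>+h. (\<Sum>n. g (int_decode n) x h) \<partial>lborel) \<partial>lborel)"
  proof (rule nn_integral_mono_AE)
    show "AE x in lborel. (\<integral>\<^sup>+h. ennreal (\<bar>E x h\<bar> powr q / norm h powr (d + q * \<sigma>)) \<partial>lborel)
      \<le> (\<integral>\<^sup>+h. (\<Sum>n. g (int_decode n) x h) \<partial>lborel)"
      using E
    proof eventually_elim
      case (elim x)
      have "AE h in lborel. ennreal (\<bar>E x h\<bar> powr q / norm h powr (d + q * \<sigma>)) \<le> (\<Sum>n. g (int_decode n) x h)"
        using elim AE_lborel_singleton[of 0]
      proof eventually_elim
        case (elim h)
        then obtain F where F: "finite F" "\<bar>E x h\<bar> \<le> (\<Sum>j\<in>F. \<bar>D j x h\<bar>)" by blast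
        have nh: "norm h > 0" using elim by simp
        have "\<bar>E x h\<bar> powr q \<le> (\<Sum>j\<in>F. \<bar>D j x h\<bar>) powr q"
          using F assms(3) by (intro powr_mono2) auto
        also have "\<dots> \<le> C0 powr (q - 1) * (\<Sum>j\<in>F. om m \<sigma> (2 powr j * norm h) powr (1 - q) * \<bar>D j x h\<bar> powr q)"
          by (rule weighted_power_sum) (use F C0_def om_dyadic_sum_bound[OF assms(1,2) F(1) nh] nh assms(3) om_pos in auto)
        finally have "\<bar>E x h\<bar> powr q / norm h powr (d + q * \<sigma>) \<le>
            C0 powr (q - 1) * (\<Sum>j\<in>F. om m \<sigma> (2 powr j * norm h) powr (1 - q) * \<bar>D j x h\<bar> powr q) / norm h powr (d + q * \<sigma>)"
          by (rule divide_right_mono) simp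
        also have "\<dots> = (\<Sum>j\<in>F. c j h * \<bar>D j x h\<bar> powr q)"
          by (simp add: c_def sum_distrib_left sum_divide_distrib mult.assoc)
        finally have "\<bar>E x h\<bar> powr q / norm h powr (d + q * \<sigma>) \<le> (\<Sum>j\<in>F. c j h * \<bar>D j x h\<bar> powr q)" .
        then have "ennreal (\<bar>E x h\<bar> powr q / norm h powr (d + q * \<sigma>)) \<le> (\<Sum>j\<in>F. g j x h)"
          using c0 by (simp add: g_def ennreal_leI)
        also have "\<dots> \<le> (\<Sum>n. g (int_decode n) x h)" by (rule sum_le_suminf_int[OF F(1)])
        finally show ?case .
      qed
      then show ?case by (rule nn_integral_mono_AE)
    qed
  qed
  also have "\<dots> = (\<integral>\<^sup>+x. (\<Sum>n. \<integral>\<^sup>+h. g (int_decode n) x h \<partial>lborel) \<partial>lborel)"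
  proof -
    have "g j x \<in> borel_measurable lborel" for j x
      using measurable_Pair2[OF mg[of j], of x] by simp
    then show ?thesis by (intro nn_integral_cong nn_integral_suminf)
  qed
  also have "\<dots> = (\<Sum>n. \<integral>\<^sup>+x. (\<integral>\<^sup>+h. g (int_decode n) x h \<partial>lborel) \<partial>lborel)"
    by (rule nn_integral_suminf) (use lborel.borel_measurable_nn_integral[OF mg] in simp)
  also have "\<dots> \<le> (\<Sum>n. ennreal (C0 powr (q - 1) * C1 * A (int_decode n)))"
  proof (intro suminf_le allI)
    fix n
    define j where "j = int_decode n"
    have "(\<integral>\<^sup>+x. (\<integral>\<^sup>+h. g j x h \<partial>lborel) \<partial>lborel) = (\<integral>\<^sup>+h. (\<integral>\<^sup>+x. g j x h \<partial>lborel) \<partial>lborel)"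
      using lborel_pair.Fubini'[OF mg] by simp
    also have "\<dots> \<le> (\<integral>\<^sup>+h. ennreal (C0 powr (q - 1) * A j) * ennreal (om m \<sigma> (2 powr j * norm h) / norm (h::'a) powr d) \<partial>lborel)"
    proof (rule nn_integral_mono_AE)
      show "AE h in lborel. (\<integral>\<^sup>+x. g j x h \<partial>lborel) \<le> ennreal (C0 powr (q - 1) * A j) * ennreal (om m \<sigma> (2 powr j * norm h) / norm h powr d)"
        using AE_lborel_singleton[of 0]
      proof eventually_elim
        case (elim h)
        then have nh: "norm h > 0" by simp
        have mDh: "(\<lambda>x. D j x h) \<in> borel_measurable lborel"
          using measurable_Pair1[OF mD[of j], of h] by simp
        have "(\<integral>\<^sup>+x. g j x h \<partial>lborel) = ennreal (c j h) * (pint q (\<lambda>x. D j x h))"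
          unfolding g_def using c0 mDh by (subst nn_integral_cmult[symmetric]) (auto simp: ennreal_mult)
        also have "\<dots> \<le> ennreal (c j h) * ennreal (min 1 ((2 powr j * norm h) powr m) powr q * 2 powr (- (j * \<sigma> * q)) * A j)"
          by (intro mult_left_mono bd) auto
        also have "\<dots> = ennreal (c j h * (min 1 ((2 powr j * norm h) powr m) powr q * 2 powr (- (j * \<sigma> * q)) * A j))"
          using c0 A by (simp add: ennreal_mult)
        \<comment> \<open>The hypothesis supplies \<open>om\<close> to the power q together with
          |h|^{q \<sigma>}, and Jensen's inequality supplies \<open>om\<close> to the power 1 - q.
          The product is \<open>om\<close> itself, integrable against dh / |h|^d.\<close>
        also have "c j h * (min 1 ((2 powr j * norm h) powr m) powr q * 2 powr (- (j * \<sigma> * q)) * A j) =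
          C0 powr (q - 1) * A j * (om m \<sigma> (2 powr j * norm h) / norm h powr d)"
        proof -
          have op: "om m \<sigma> (2 powr j * norm h) > 0" using nh by (intro om_pos) auto
          have "om m \<sigma> (2 powr j * norm h) powr q =
              min 1 ((2 powr j * norm h) powr m) powr q * (2 powr (- (j * \<sigma> * q)) * norm h powr (- (q * \<sigma>)))"
            unfolding om_def using nh by (simp add: powr_mult powr_powr mult_ac)
          then have "om m \<sigma> (2 powr j * norm h) powr q * norm h powr (q * \<sigma>) =
              min 1 ((2 powr j * norm h) powr m) powr q * 2 powr (- (j * \<sigma> * q))"
            using nh by (simp add: powr_minus field_simps)
          then have "c j h * (min 1 ((2 powr j * norm h) powr m) powr q * 2 powr (- (j * \<sigma> * q)) * A j) =
            c j h * (om m \<sigma> (2 powr j * norm h) powr q * norm h powr (q * \<sigma>) * A j)" by simp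
          also have "\<dots> = C0 powr (q - 1) * A j * ((om m \<sigma> (2 powr j * norm h) powr (1 - q) * om m \<sigma> (2 powr j * norm h) powr q)
             / norm h powr d)"
            using nh by (simp add: c_def powr_add field_simps)
          also have "om m \<sigma> (2 powr j * norm h) powr (1 - q) * om m \<sigma> (2 powr j * norm h) powr q = om m \<sigma> (2 powr j * norm h)"
            using op by (simp flip: powr_add)
          finally show ?thesis .
        qed
        also have "ennreal (C0 powr (q - 1) * A j * (om m \<sigma> (2 powr j * norm h) / norm h powr d)) =
          ennreal (C0 powr (q - 1) * A j) * ennreal (om m \<sigma> (2 powr j * norm h) / norm h powr d)"
          using A om_nonneg by (intro ennreal_mult) auto
        finally show ?case .
      qed
    qed
    also have "\<dots> = ennreal (C0 powr (q - 1) * A j) * (\<integral>\<^sup>+h. ennreal (om m \<sigma> (2 powr j * norm h) / norm (h::'a) powr d) \<partial>lborel)"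
      by (rule nn_integral_cmult) measurable
    also have "\<dots> \<le> ennreal (C0 powr (q - 1) * A j) * ennreal C1"
      unfolding C1_def d_def by (intro mult_left_mono om_integral_bound assms(1,2)) auto
    also have "\<dots> = ennreal (C0 powr (q - 1) * C1 * A j)"
      using A C1 by (simp add: mult_ac flip: ennreal_mult)
    finally show "(\<integral>\<^sup>+x. (\<integral>\<^sup>+h. g (int_decode n) x h \<partial>lborel) \<partial>lborel) \<le> ennreal (C0 powr (q - 1) * C1 * A (int_decode n))"
      by (simp add: j_def)
  qed auto
  also have "\<dots> \<le> ennreal (C0 powr (q - 1) * C1 * B)"
    by (rule suminf_int_le) (use A B C1 in \<open>auto simp flip: sum_distrib_left intro!: mult_left_mono\<close>)
  finally show ?thesis by (simp add: d_def hardy_const_def C0_def C1_def)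
qed

section \<open>Sums of dyadic pieces\<close>

text \<open>A limit over symmetric ranges is defined at every point and measurable without further
  conditions, unlike an indexed sum over a support that depends on x. Where only finitely many terms
  are nonzero it is the finite sum.\<close>

definition dysum :: "(int \<Rightarrow> 'a \<Rightarrow> real) \<Rightarrow> 'a \<Rightarrow> real" where
  "dysum fs x = lim (\<lambda>N. \<Sum>j\<in>{- int N..int N}. fs j x)"

lemma finite_int_subset_symmetric_interval:
  assumes "finite (S :: int set)"
  obtains N where "\<And>n. n \<ge> N \<Longrightarrow> S \<subseteq> {- int n..int n}"
proof
  show "S \<subseteq> {- int n..int n}" if "n \<ge> (\<Sum>j\<in>S. nat \<bar>j\<bar>)" for n
  proof
    fix j assume "j \<in> S"
    then have "nat \<bar>j\<bar> \<le> n" using member_le_sum[of j S "\<lambda>j. nat \<bar>j\<bar>"] assms that by simp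
    then show "j \<in> {- int n..int n}" by auto
  qed
qed

lemma partial_sums_tendsto:
  assumes "finite S" "\<And>j. j \<notin> S \<Longrightarrow> fs j x = (0::real)"
  shows "(\<lambda>N. \<Sum>j\<in>{- int N..int N}. fs j x) \<longlonglongrightarrow> (\<Sum>j\<in>S. fs j x)"
proof (rule tendsto_eventually)
  obtain N where N: "\<And>n. n \<ge> N \<Longrightarrow> S \<subseteq> {- int n..int n}"
    using finite_int_subset_symmetric_interval[OF assms(1)] by metis
  show "\<forall>\<^sub>F n in sequentially. (\<Sum>j\<in>{- int n..int n}. fs j x) = (\<Sum>j\<in>S. fs j x)"
    using eventually_ge_at_top[of N]
  proof eventually_elim
    case (elim n)
    show ?case by (rule sum.mono_neutral_right) (use N[OF elim] assms in auto)
  qed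
qed

lemma dysum_eq:
  assumes "finite S" "\<And>j. j \<notin> S \<Longrightarrow> fs j x = 0"
  shows "dysum fs x = (\<Sum>j\<in>S. fs j x)"
  unfolding dysum_def using partial_sums_tendsto[of S fs x] assms by (intro limI) auto

lemma dysum_measurable:
  assumes "\<And>j. fs j \<in> borel_measurable M"
  shows "dysum fs \<in> borel_measurable M"
  unfolding dysum_def[abs_def] by (intro borel_measurable_lim_metric borel_measurable_sum assms)

lemma AE_lborel_shift:
  fixes x :: "'a::euclidean_space"
  assumes "AE y in lborel. P y"
  shows "AE h in lborel. P (x + h)" "AE h in lborel. P (x - h)"
proof -
  have a: "AE y in lebesgue. P y" using assms by (rule AE_completion)
  show "AE h in lborel. P (x + h)" "AE h in lborel. P (x - h)"
    using AE_lebesgue_affine[OF a, of 1 x] AE_lebesgue_affine[OF a, of "-1" x]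
    by (simp_all add: AE_completion_iff)
qed

lemma powr_three_terms:
  assumes "\<bar>x\<bar> \<le> \<bar>a\<bar> + 2 * \<bar>b\<bar> + \<bar>c\<bar>" "(q::real) \<ge> 0"
  shows "\<bar>x\<bar> powr q \<le> 4 powr q * (\<bar>a\<bar> powr q + \<bar>b\<bar> powr q + \<bar>c\<bar> powr q)"
proof -
  define m where "m = max \<bar>a\<bar> (max \<bar>b\<bar> \<bar>c\<bar>)"
  have "\<bar>x\<bar> \<le> 4 * m" using assms(1) unfolding m_def by linarith
  then have "\<bar>x\<bar> powr q \<le> (4 * m) powr q" using assms by (intro powr_mono2) auto
  also have "\<dots> = 4 powr q * m powr q" by (simp add: powr_mult m_def)
  also have "m powr q \<le> \<bar>a\<bar> powr q + \<bar>b\<bar> powr q + \<bar>c\<bar> powr q"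
    unfolding m_def max_def by (auto intro: add_nonneg_nonneg)
  finally show ?thesis by (simp add: mult_left_mono)
qed

text \<open>Either t \<le> l, or t^{1-q} \<le> l^{1-q}. It converts L^q bounds into L^1 bounds on
  sets of finite measure with a threshold l adapted to the scale.\<close>

lemma le_young:
  assumes "l > 0" "t \<ge> 0" "q > (1::real)"
  shows "t \<le> l + l powr (1 - q) * t powr q"
proof (cases "t \<le> l")
  case False
  have "t = t powr (1 - q) * t powr q" using False assms by (simp flip: powr_add)
  also have "\<dots> \<le> l powr (1 - q) * t powr q"
    using False assms by (intro mult_right_mono powr_mono2') auto
  finally show ?thesis using assms by linarith
next
  case True
  then show ?thesis by (simp add: add_increasing2)
qed

text \<open>\<open>A j\<close> is the q-th power of a normalized L^q norm at scale 2^{-j}.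
  Finiteness of the set of active scales is required only almost everywhere: for the potential,
  infinitely many scales may contribute at a boundary point.\<close>

locale dyadic_pieces =
  fixes \<sigma> q :: real and fs :: "int \<Rightarrow> 'a::euclidean_space \<Rightarrow> real" and A :: "int \<Rightarrow> real" and B :: real
  assumes q: "1 < q" and sigma: "0 < \<sigma>"
    and cont: "\<And>j. continuous_on UNIV (fs j)"
    and A_nonneg: "\<And>j. 0 \<le> A j" and A_sum: "\<And>F. finite F \<Longrightarrow> (\<Sum>j\<in>F. A j) \<le> B"
    and size_bound: "\<And>j. (pint q (fs j)) \<le> ennreal (2 powr (- (j * \<sigma> * q)) * A j)"
    and fin: "AE x in lborel. finite {j. fs j x \<noteq> 0}"
begin

lemma B_nonneg: "0 \<le> B"
  using A_sum[of "{}"] by simp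

lemma meas: "fs j \<in> borel_measurable borel"
  using cont by (rule borel_measurable_continuous_onI)

lemma dysum_meas: "dysum fs \<in> borel_measurable borel"
  by (rule dysum_measurable[OF meas])

lemma sup_scale_sum:
  fixes J :: int and F :: "int set"
  assumes "finite F" "\<And>j. j \<in> F \<Longrightarrow> j \<ge> J"
  shows "(\<Sum>j\<in>F. 2 powr (- (j * \<sigma>))) \<le> 2 powr (- (J * \<sigma>)) * (1 / (1 - 2 powr (- \<sigma>)))"
proof -
  have l: "2 powr (- \<sigma>) < (1::real)" using sigma powr_less_one[of 2] by auto
  have "(\<Sum>j\<in>F. 2 powr (- (j * \<sigma>))) = (\<Sum>j\<in>F. 2 powr (- (J * \<sigma>)) * (2 powr (- \<sigma>)) ^ nat (j - J))"
  proof (rule sum.cong[OF refl])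
    fix j assume "j \<in> F"
    then have "real (nat (j - J)) = real_of_int j - real_of_int J" using assms(2) by simp
    then have "(2 powr (- \<sigma>)) ^ nat (j - J) = (2::real) powr (- \<sigma> * (real_of_int j - real_of_int J))"
      by (simp add: powr_powr flip: powr_realpow)
    then show "2 powr (- (j * \<sigma>)) = 2 powr (- (J * \<sigma>)) * (2 powr (- \<sigma>)) ^ nat (j - J)"
      by (simp add: algebra_simps flip: powr_add)
  qed
  also have "\<dots> = 2 powr (- (J * \<sigma>)) * (\<Sum>n\<in>(\<lambda>j. nat (j - J)) ` F. (2 powr (- \<sigma>)) ^ n)"
    unfolding sum_distrib_left using assms(2) by (subst sum.reindex) (auto intro!: inj_onI simp: eq_nat_nat_iff)
  also have "\<dots> \<le> 2 powr (- (J * \<sigma>)) * (\<Sum>n. (2 powr (- \<sigma>)) ^ n)"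
    using assms l by (intro mult_left_mono sum_le_suminf summable_geometric) auto
  finally show ?thesis using l by (simp add: suminf_geometric)
qed

text \<open>On K the L^1 norm of the piece at scale j is at most 2^{-j \<sigma>} times a constant,
  so positivity of \<sigma> gives convergence at high frequencies, and no scale below J meets
  K.\<close>

lemma sum_abs_local:
  fixes J :: int
  assumes "K \<in> sets borel" "emeasure lborel K < \<infinity>" "\<And>j x. j < J \<Longrightarrow> x \<in> K \<Longrightarrow> fs j x = 0"
  shows "(\<integral>\<^sup>+x. (\<Sum>n. ennreal \<bar>fs (int_decode n) x\<bar>) * indicator K x \<partial>lborel) < \<infinity>"
proof -
  note [measurable] = meas assms(1)
  define k where "k = measure lborel K"
  have k: "emeasure lborel K = ennreal k" "k \<ge> 0"
    using assms(2) by (auto simp: k_def emeasure_eq_ennreal_measure)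
  define t where "t j = (if j < J then 0 else 2 powr (- (j * \<sigma>)) * (k + B))" for j :: int
  have one: "(\<integral>\<^sup>+x. ennreal \<bar>fs j x\<bar> * indicator K x \<partial>lborel) \<le> ennreal (t j)" for j
  proof (cases "j < J")
    case True
    then have "(\<lambda>x. ennreal \<bar>fs j x\<bar> * indicator K x) = (\<lambda>x. 0)"
      using assms(3) by (force simp: indicator_def)
    then show ?thesis by (simp add: t_def)
  next
    case False
    \<comment> \<open>With this threshold both terms of \<open>le_young\<close> have size 2^{-j
      \<sigma>}.\<close>
    define l where "l = (2::real) powr (- (j * \<sigma>))"
    have l: "l > 0" by (simp add: l_def)
    have "(\<integral>\<^sup>+x. ennreal \<bar>fs j x\<bar> * indicator K x \<partial>lborel) \<le>
      (\<integral>\<^sup>+x. ennreal l * indicator K x + ennreal (l powr (1 - q)) * ennreal (\<bar>fs j x\<bar> powr q) \<partial>lborel)"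
    proof (rule nn_integral_mono)
      fix x
      have "ennreal \<bar>fs j x\<bar> \<le> ennreal (l + l powr (1 - q) * \<bar>fs j x\<bar> powr q)"
        by (intro ennreal_leI le_young l q) auto
      also have "\<dots> = ennreal l + ennreal (l powr (1 - q)) * ennreal (\<bar>fs j x\<bar> powr q)"
        using l by (simp add: ennreal_mult)
      finally show "ennreal \<bar>fs j x\<bar> * indicator K x \<le> ennreal l * indicator K x + ennreal (l powr (1 - q)) * ennreal (\<bar>fs j x\<bar> powr q)"
        by (auto simp: indicator_def)
    qed
    also have "\<dots> = ennreal l * emeasure lborel K + ennreal (l powr (1 - q)) * (pint q (fs j))"
      by (subst nn_integral_add) (auto simp: nn_integral_cmult)
    also have "\<dots> \<le> ennreal l * ennreal k + ennreal (l powr (1 - q)) * ennreal (2 powr (- (j * \<sigma> * q)) * A j)"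
      unfolding k by (intro add_left_mono mult_left_mono size_bound) auto
    also have "\<dots> = ennreal (l * k + l powr (1 - q) * (2 powr (- (j * \<sigma> * q)) * A j))"
      using l k A_nonneg by (simp add: ennreal_mult ennreal_plus)
    also have "l powr (1 - q) * (2 powr (- (j * \<sigma> * q)) * A j) = l * A j"
      by (simp add: l_def powr_powr algebra_simps flip: powr_add)
    also have "l * k + l * A j \<le> l * (k + B)"
      using A_sum[of "{j}"] l by (simp add: distrib_left)
    finally show ?thesis using False by (simp add: t_def l_def ennreal_leI)
  qed
  have tn: "t j \<ge> 0" for j using k B_nonneg by (simp add: t_def)
  have "(\<integral>\<^sup>+x. (\<Sum>n. ennreal \<bar>fs (int_decode n) x\<bar>) * indicator K x \<partial>lborel) =
    (\<integral>\<^sup>+x. (\<Sum>n. ennreal \<bar>fs (int_decode n) x\<bar> * indicator K x) \<partial>lborel)"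
    by simp
  also have "\<dots> = (\<Sum>n. \<integral>\<^sup>+x. ennreal \<bar>fs (int_decode n) x\<bar> * indicator K x \<partial>lborel)"
  proof (rule nn_integral_suminf)
    fix n
    have [measurable]: "fs (int_decode n) \<in> borel_measurable borel" by (rule meas)
    show "(\<lambda>x. ennreal \<bar>fs (int_decode n) x\<bar> * indicator K x) \<in> borel_measurable lborel" by measurable
  qed
  also have "\<dots> \<le> (\<Sum>n. ennreal (t (int_decode n)))"
    by (intro suminf_le one) auto
  also have "\<dots> \<le> ennreal (2 powr (- (J * \<sigma>)) * (1 / (1 - 2 powr (- \<sigma>))) * (k + B))"
  proof (rule suminf_int_le[OF _ tn])
    fix F :: "int set" assume F: "finite F"
    have "(\<Sum>j\<in>F. t j) = (\<Sum>j\<in>{j\<in>F. j \<ge> J}. 2 powr (- (j * \<sigma>)) * (k + B))"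
      using F by (intro sum.mono_neutral_cong_right) (auto simp: t_def)
    also have "\<dots> \<le> 2 powr (- (J * \<sigma>)) * (1 / (1 - 2 powr (- \<sigma>))) * (k + B)"
      unfolding sum_distrib_right[symmetric] using F k B_nonneg by (intro mult_right_mono sup_scale_sum) auto
    finally show "(\<Sum>j\<in>F. t j) \<le> 2 powr (- (J * \<sigma>)) * (1 / (1 - 2 powr (- \<sigma>))) * (k + B)" .
  qed
  finally show ?thesis by (simp add: le_less_trans)
qed

text \<open>Jensen's inequality with weights w_j = 2^{-j \<sigma>}, summable over j \<ge> J. The
  remaining factor w_j^{1-q} 2^{-j \<sigma> q} equals w_j, which is at most 2^{-J \<sigma>}.\<close>

lemma Lq_bound:
  fixes J :: int
  assumes "\<And>j x. j < J \<Longrightarrow> fs j x = 0"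
  shows "pint q (dysum fs) \<le>
    ennreal ((2 powr (- (J * \<sigma>)) * (1 / (1 - 2 powr (- \<sigma>)))) powr (q - 1) * 2 powr (- (J * \<sigma>)) * B)"
proof -
  note [measurable] = meas
  define C where "C = (2 powr (- (J * \<sigma>)) * (1 / (1 - 2 powr (- \<sigma>)))) powr (q - 1)"
  have C: "C \<ge> 0" by (simp add: C_def)
  define w where "w j = (2::real) powr (- (j * \<sigma>))" for j :: int
  define g where "g j x = (if j < J then 0 else ennreal (C * w j powr (1 - q)) * ennreal (\<bar>fs j x\<bar> powr q))" for j x
  have gm: "g j \<in> borel_measurable lborel" for j
    unfolding g_def[abs_def] by (cases "j < J") (simp_all only: if_True if_False not_False_eq_True, measurable)
  have "pint q (dysum fs) \<le> (\<integral>\<^sup>+x. (\<Sum>n. g (int_decode n) x) \<partial>lborel)"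
  proof (rule nn_integral_mono_AE)
    show "AE x in lborel. ennreal (\<bar>dysum fs x\<bar> powr q) \<le> (\<Sum>n. g (int_decode n) x)"
      using fin
    proof eventually_elim
      case (elim x)
      define S where "S = {j. fs j x \<noteq> 0}"
      have S: "finite S" using elim by (simp add: S_def)
      have SJ: "j \<ge> J" if "j \<in> S" for j using assms[of j x] that by (cases "j < J") (auto simp: S_def)
      have "dysum fs x = (\<Sum>j\<in>S. fs j x)" by (rule dysum_eq[OF S]) (simp add: S_def)
      then have "\<bar>dysum fs x\<bar> powr q \<le> (\<Sum>j\<in>S. \<bar>fs j x\<bar>) powr q"
        using q by (intro powr_mono2) auto
      also have "\<dots> \<le> C * (\<Sum>j\<in>S. w j powr (1 - q) * \<bar>fs j x\<bar> powr q)"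
        unfolding C_def by (rule weighted_power_sum) (use S q sup_scale_sum[OF S SJ] in \<open>auto simp: w_def\<close>)
      finally have "ennreal (\<bar>dysum fs x\<bar> powr q) \<le> ennreal (\<Sum>j\<in>S. C * w j powr (1 - q) * \<bar>fs j x\<bar> powr q)"
        by (simp add: ennreal_leI sum_distrib_left mult.assoc)
      also have "\<dots> = (\<Sum>j\<in>S. ennreal (C * w j powr (1 - q) * \<bar>fs j x\<bar> powr q))"
        using C by (intro sum_ennreal[symmetric]) simp
      also have "\<dots> = (\<Sum>j\<in>S. g j x)"
      proof (rule sum.cong[OF refl])
        fix j assume "j \<in> S"
        then have "\<not> j < J" using SJ by force
        then show "ennreal (C * w j powr (1 - q) * \<bar>fs j x\<bar> powr q) = g j x"
          using C by (simp add: g_def ennreal_mult)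
      qed
      also have "\<dots> \<le> (\<Sum>n. g (int_decode n) x)" by (rule sum_le_suminf_int[OF S])
      finally show ?case .
    qed
  qed
  also have "\<dots> = (\<Sum>n. \<integral>\<^sup>+x. g (int_decode n) x \<partial>lborel)"
    by (rule nn_integral_suminf[OF gm])
  also have "\<dots> \<le> (\<Sum>n. ennreal (C * 2 powr (- (J * \<sigma>)) * A (int_decode n)))"
  proof (intro suminf_le allI)
    fix n
    define j where "j = int_decode n"
    show "(\<integral>\<^sup>+x. g (int_decode n) x \<partial>lborel) \<le> ennreal (C * 2 powr (- (J * \<sigma>)) * A (int_decode n))"
    proof (cases "j < J")
      case False
      have "(\<integral>\<^sup>+x. g j x \<partial>lborel) = ennreal (C * w j powr (1 - q)) * (pint q (fs j))"
        using False by (simp add: g_def nn_integral_cmult)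
      also have "\<dots> \<le> ennreal (C * w j powr (1 - q)) * ennreal (2 powr (- (j * \<sigma> * q)) * A j)"
        by (intro mult_left_mono size_bound) auto
      also have "\<dots> = ennreal (C * w j powr (1 - q) * (2 powr (- (j * \<sigma> * q)) * A j))"
        using C A_nonneg by (simp add: ennreal_mult)
      also have "C * w j powr (1 - q) * (2 powr (- (j * \<sigma> * q)) * A j) = C * w j * A j"
        by (simp add: w_def powr_powr algebra_simps flip: powr_add)
      also have "\<dots> \<le> C * 2 powr (- (J * \<sigma>)) * A j"
        using C A_nonneg False sigma by (intro mult_right_mono mult_left_mono) (auto simp: w_def)
      finally show ?thesis by (simp add: j_def ennreal_leI)
    qed (simp add: g_def j_def)
  qed auto
  also have "\<dots> \<le> ennreal (C * 2 powr (- (J * \<sigma>)) * B)"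
    by (rule suminf_int_le) (use C A_nonneg A_sum in \<open>auto simp flip: sum_distrib_left intro!: mult_left_mono\<close>)
  finally show ?thesis by (simp add: C_def)
qed

end

section \<open>Differences of dyadic sums\<close>

lemma nn_integral_shift_bound:
  fixes f :: "'a::euclidean_space \<Rightarrow> real"
  assumes "f \<in> borel_measurable borel"
  shows "pint q (\<lambda>x. f (x + h)) = pint q f"
  by (rule nn_integral_lborel_shift[where f="\<lambda>x. ennreal (\<bar>f x\<bar> powr q)"]) (use assms in measurable)

lemma three_term_integral:
  fixes f :: "'a::euclidean_space \<Rightarrow> real"
  assumes "f \<in> borel_measurable borel" "q \<ge> 0"
    "\<And>x. \<bar>g x\<bar> \<le> \<bar>f (x + h)\<bar> + 2 * \<bar>f x\<bar> + \<bar>f (x - h)\<bar>"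
    "pint q f \<le> ennreal c"
  shows "pint q g \<le> ennreal (3 * 4 powr q * c)"
proof -
  note [measurable] = assms(1)
  have "pint q g \<le>
    (\<integral>\<^sup>+x. ennreal (4 powr q) * (ennreal (\<bar>f (x + h)\<bar> powr q) + ennreal (\<bar>f x\<bar> powr q) + ennreal (\<bar>f (x + (- h))\<bar> powr q)) \<partial>lborel)"
  proof (rule nn_integral_mono)
    fix x
    have "ennreal (\<bar>g x\<bar> powr q) \<le> ennreal (4 powr q * (\<bar>f (x + h)\<bar> powr q + \<bar>f x\<bar> powr q + \<bar>f (x - h)\<bar> powr q))"
      by (intro ennreal_leI powr_three_terms assms)
    also have "\<dots> = ennreal (4 powr q) * (ennreal (\<bar>f (x + h)\<bar> powr q) + ennreal (\<bar>f x\<bar> powr q) + ennreal (\<bar>f (x + (- h))\<bar> powr q))"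
      by (simp add: ennreal_mult)
    finally show "ennreal (\<bar>g x\<bar> powr q) \<le> ennreal (4 powr q) * (ennreal (\<bar>f (x + h)\<bar> powr q) + ennreal (\<bar>f x\<bar> powr q) + ennreal (\<bar>f (x + (- h))\<bar> powr q))" .
  qed
  also have "\<dots> = ennreal (4 powr q) * ((pint q (\<lambda>x. f (x + h))) + (pint q f)
      + (pint q (\<lambda>x. f (x + (- h)))))"
    by (simp add: nn_integral_cmult nn_integral_add)
  also have "\<dots> = ennreal (4 powr q) * (pint q f) * 3"
  proof -
    have "x + x + x = x * 3" for x :: ennreal
    proof -
      have "x + x + x = x * (1 + 1 + 1)" by (simp only: distrib_left mult_1_right)
      then show ?thesis by simp
    qed
    then show ?thesis unfolding nn_integral_shift_bound[OF assms(1)] by (simp add: mult.assoc)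
  qed
  also have "\<dots> \<le> ennreal (4 powr q) * ennreal c * 3"
    by (intro mult_right_mono mult_left_mono assms) auto
  also have "\<dots> = ennreal (3 * 4 powr q * c)"
  proof -
    have "ennreal (3 * 4 powr q * c) = ennreal (3 * 4 powr q) * ennreal c" by (rule ennreal_mult') simp
    also have "ennreal (3 * 4 powr q) = 3 * ennreal (4 powr q)" by (subst ennreal_mult') simp_all
    finally show ?thesis by (simp add: mult_ac)
  qed
  finally show ?thesis .
qed

text \<open>For t \<le> 1 the gain from smoothness is assumed; for t > 1 the minimum is 1 and the
  triangle inequality over three translates is enough. That inequality is the origin of the factor 3
  * 4^q.\<close>

lemma all_scale_bound:
  fixes f :: "'a::euclidean_space \<Rightarrow> real"
  assumes "f \<in> borel_measurable borel" "q \<ge> 0" "m \<ge> 0" "t \<ge> 0" "a \<ge> 0"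
    "\<And>x. \<bar>g x\<bar> \<le> \<bar>f (x + h)\<bar> + 2 * \<bar>f x\<bar> + \<bar>f (x - h)\<bar>"
    "pint q f \<le> ennreal a"
    "t \<le> 1 \<Longrightarrow> (pint q g) \<le> ennreal ((t powr m) powr q * a)"
  shows "pint q g \<le> ennreal (min 1 (t powr m) powr q * (3 * 4 powr q * a))"
proof (cases "t \<le> 1")
  case True
  have "t powr m \<le> 1" using True assms by (simp add: powr_le1)
  have "1 \<le> 4 powr q" using assms by (simp add: ge_one_powr_ge_zero)
  then have "1 * a \<le> 3 * 4 powr q * a" using assms by (intro mult_right_mono) auto
  then have "(t powr m) powr q * a \<le> min 1 (t powr m) powr q * (3 * 4 powr q * a)"
    using \<open>t powr m \<le> 1\<close> by (simp add: mult_left_mono min_absorb2)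
  then show ?thesis using assms(8)[OF True] by (meson ennreal_leI order_trans)
next
  case False
  then have "1 \<le> t powr m" using assms by (simp add: ge_one_powr_ge_zero)
  then have "min 1 (t powr m) powr q = 1" by (simp add: min_absorb1)
  then show ?thesis using three_term_integral[OF assms(1,2,6,7)] by simp
qed

text \<open>First differences for \<open>c = 0\<close> and second differences for \<open>c = 1\<close>.\<close>

definition delta :: "real \<Rightarrow> ('a::real_vector \<Rightarrow> real) \<Rightarrow> 'a \<Rightarrow> 'a \<Rightarrow> real" where
  "delta c g h x = g (x + h) - (1 + c) * g x + c * g (x - h)"

text \<open>The hypothesis on \<sigma> is the usual one that the order 1 + c of the difference
  exceeds the smoothness. A difference of the sum is the finite sum of the differences over the
  scales active at one of the points x, x + h, x - h.\<close>

lemma (in dyadic_pieces) dyadic_difference: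
  assumes c: "c \<in> {0, 1}" "\<sigma> < 1 + c"
    and d: "\<And>j h. 2 powr j * norm h \<le> 1 \<Longrightarrow>
      pint q (delta c (fs j) h) \<le> ennreal (((2 powr j * norm h) powr (1 + c)) powr q * (2 powr (- (j * \<sigma> * q)) * A j))"
  shows "(\<integral>\<^sup>+x. (\<integral>\<^sup>+h. ennreal (\<bar>delta c (dysum fs) h x\<bar> powr q / norm h powr (DIM('a) + q * \<sigma>)) \<partial>lborel) \<partial>lborel)
    \<le> ennreal (hardy_const DIM('a) (1 + c) \<sigma> q * (3 * 4 powr q * B))"
proof (rule hardy_dyadic[where D="\<lambda>j x h. delta c (fs j) h x" and A="\<lambda>j. 3 * 4 powr q * A j", OF sigma c(2)])
  note [measurable] = meas
  show "1 \<le> q" using q by simp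
  show "(\<lambda>(x, h). delta c (fs j) h x) \<in> borel_measurable (lborel \<Otimes>\<^sub>M lborel)" for j
    unfolding delta_def by measurable
  show "0 \<le> 3 * 4 powr q * A j" for j using A_nonneg by simp
  show "(\<Sum>j\<in>S. 3 * 4 powr q * A j) \<le> 3 * 4 powr q * B" if "finite S" for S
    unfolding sum_distrib_left[symmetric] using A_sum[OF that] by (intro mult_left_mono) auto
  fix j :: int and h :: 'a
  have "\<bar>delta c (fs j) h x\<bar> \<le> \<bar>fs j (x + h)\<bar> + 2 * \<bar>fs j x\<bar> + \<bar>fs j (x - h)\<bar>" for x
    using c(1) by (auto simp: delta_def)
  then have "pint q (delta c (fs j) h) \<le> ennreal (min 1 ((2 powr j * norm h) powr (1 + c)) powr q * (3 * 4 powr q * (2 powr (- (j * \<sigma> * q)) * A j)))"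
    by (intro all_scale_bound[OF meas[of j], where h=h]) (use c q A_nonneg size_bound d in auto)
  then show "pint q (delta c (fs j) h) \<le> ennreal (min 1 ((2 powr j * norm h) powr (1 + c)) powr q * 2 powr (- (j * \<sigma> * q)) * (3 * 4 powr q * A j))"
    by (simp only: mult_ac)
next
  show "AE x in lborel. AE h in lborel. \<exists>S. finite S \<and> \<bar>delta c (dysum fs) h x\<bar> \<le> (\<Sum>j\<in>S. \<bar>delta c (fs j) h x\<bar>)"
    using fin
  proof eventually_elim
    case (elim x)
    note ex = elim
    show ?case using AE_lborel_shift[OF fin, of x]
    proof eventually_elim
      case (elim h)
      define S where "S = {j. fs j x \<noteq> 0} \<union> {j. fs j (x + h) \<noteq> 0} \<union> {j. fs j (x - h) \<noteq> 0}"
      have S: "finite S" using ex elim by (simp add: S_def)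
      have F: "dysum fs x = (\<Sum>j\<in>S. fs j x)" "dysum fs (x + h) = (\<Sum>j\<in>S. fs j (x + h))" "dysum fs (x - h) = (\<Sum>j\<in>S. fs j (x - h))"
        by (rule dysum_eq[OF S]; simp add: S_def)+
      have "delta c (dysum fs) h x = (\<Sum>j\<in>S. delta c (fs j) h x)"
        unfolding delta_def F by (simp add: sum.distrib sum_subtractf sum_distrib_left)
      then show ?case using S by (intro exI[of _ S]) simp
    qed
  qed
qed

section \<open>Tempered distributions given by functions\<close>

lemma integrable_decay: "integrable lborel (\<lambda>x::'a::euclidean_space. 1 / (1 + norm x) ^ Suc DIM('a))"
proof (rule integrableI_bounded)
  show "(\<lambda>x::'a. 1 / (1 + norm x) ^ Suc DIM('a)) \<in> borel_measurable lborel"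
    by (intro borel_measurable_divide borel_measurable_const borel_measurable_power borel_measurable_add)
      (auto intro: borel_measurable_continuous_onI continuous_on_norm)
  \<comment> \<open>The decay function lies below \<open>om 2 1\<close> at |x| divided by |x|^d:
    this quotient is |x|^{-1-d} for |x| \<ge> 1, and |x|^{1-d} \<ge> 1 for 0 < |x| < 1. So the
    integral of the Hardy inequality with j = 0 is reused.\<close>
  have "(\<integral>\<^sup>+x. ennreal (norm (1 / (1 + norm (x::'a)) ^ Suc DIM('a))) \<partial>lborel) \<le>
    (\<integral>\<^sup>+h. ennreal (om 2 1 (2 powr real_of_int 0 * norm h) / norm (h::'a) powr DIM('a)) \<partial>lborel)"
  proof (rule nn_integral_mono_AE)
    show "AE x in lborel. ennreal (norm (1 / (1 + norm x) ^ Suc DIM('a))) \<le> ennreal (om 2 1 (2 powr real_of_int 0 * norm x) / norm (x::'a) powr DIM('a))"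
      using AE_lborel_singleton[of 0]
    proof eventually_elim
      case (elim x)
      then have x: "norm x > 0" by simp
      have "1 / (1 + norm x) ^ Suc DIM('a) \<le> om 2 1 (norm x) / norm x ^ DIM('a)"
      proof (cases "norm x \<ge> 1")
        case True
        have "norm x ^ Suc DIM('a) \<le> (1 + norm x) ^ Suc DIM('a)" by (intro power_mono) auto
        then have "1 / (1 + norm x) ^ Suc DIM('a) \<le> 1 / norm x ^ Suc DIM('a)"
          using x by (intro divide_left_mono mult_pos_pos zero_less_power) (auto intro: add_pos_nonneg)
        moreover have "1 \<le> norm x powr 2" using True by (simp add: ge_one_powr_ge_zero)
        ultimately show ?thesis using x by (simp add: om_def powr_minus min_absorb1 divide_inverse)
      next
        case False
        have "norm x powr 2 \<le> 1" using False x by (intro powr_le1) auto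
        then have o: "om 2 1 (norm x) = norm x"
          using x by (simp add: om_def min_absorb2 powr_minus power2_eq_square)
        have "norm x ^ DIM('a) \<le> norm x ^ 1" using False x by (intro power_decreasing) (auto simp: DIM_positive Suc_leI)
        then have "1 \<le> norm x / norm x ^ DIM('a)" using x by (simp add: le_divide_eq)
        moreover have "1 / (1 + norm x) ^ Suc DIM('a) \<le> 1"
          using one_le_power[of "1 + norm x" "Suc DIM('a)"] by (simp add: divide_le_eq_1)
        ultimately show ?thesis unfolding o by linarith
      qed
      then show ?case using x by (simp add: powr_realpow ennreal_leI)
    qed
  qed
  also note om_integral_bound[where 'a='a and m=2 and \<sigma>=1 and j=0]
  finally show "(\<integral>\<^sup>+x. ennreal (norm (1 / (1 + norm (x::'a)) ^ Suc DIM('a))) \<partial>lborel) < \<infinity>"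
    by (rule le_less_trans) simp_all
qed

lemma finite_multi_indices: "finite {\<beta> \<in> multi_indices. size (\<beta> :: 'a::euclidean_space multiset) \<le> N}"
proof (rule finite_subset)
  show "{\<beta> \<in> multi_indices. size (\<beta> :: 'a multiset) \<le> N} \<subseteq> mset ` {xs. set xs \<subseteq> Basis \<and> length xs \<le> N}"
  proof
    fix \<beta> :: "'a multiset" assume b: "\<beta> \<in> {\<beta> \<in> multi_indices. size \<beta> \<le> N}"
    obtain xs where "mset xs = \<beta>" using ex_mset by blast
    then show "\<beta> \<in> mset ` {xs. set xs \<subseteq> Basis \<and> length xs \<le> N}"
      using b by (auto simp: multi_indices_def intro!: image_eqI[of _ _ xs] simp flip: set_mset_mset size_mset)
  qed
qed (intro finite_imageI finite_lists_length_le finite_Basis)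

lemma schwartz_seminorm_ge:
  assumes "\<eta> \<in> schwartz"
  shows "(1 + norm x) ^ N * \<bar>\<eta> x\<bar> \<le> schwartz_seminorm N \<eta>"
proof -
  define s where "s \<beta> = (SUP x. (1 + norm x) ^ N * \<bar>partial \<beta> \<eta> x\<bar>)" for \<beta>
  have bdd: "bdd_above (range (\<lambda>x. (1 + norm x) ^ N * \<bar>partial \<beta> \<eta> x\<bar>))" if "\<beta> \<in> multi_indices" for \<beta>
  proof -
    have "bounded (range (\<lambda>x. (1 + norm x) ^ N * partial \<beta> \<eta> x))"
      using assms that by (auto simp: schwartz_def)
    then obtain K where "\<And>x. \<bar>(1 + norm x) ^ N * partial \<beta> \<eta> x\<bar> \<le> K"
      unfolding bounded_iff by auto
    then show ?thesis
      by (intro bdd_aboveI[of _ K]) (auto simp: abs_mult power_abs abs_of_nonneg add_nonneg_nonneg)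
  qed
  have up: "(1 + norm x) ^ N * \<bar>partial \<beta> \<eta> x\<bar> \<le> s \<beta>" if "\<beta> \<in> multi_indices" for \<beta> x
    unfolding s_def by (rule cSUP_upper[OF _ bdd[OF that]]) simp
  have s0: "s \<beta> \<ge> 0" if "\<beta> \<in> multi_indices" for \<beta>
    using up[OF that, of 0] by (rule order_trans[rotated]) simp
  have e: "{#} \<in> {\<beta> \<in> multi_indices. size \<beta> \<le> N}" by (simp add: multi_indices_def)
  have "(1 + norm x) ^ N * \<bar>\<eta> x\<bar> \<le> s {#}"
    using up[of "{#}" x] e by (simp add: partial_empty)
  also have "\<dots> \<le> (\<Sum>\<beta>\<in>{\<beta> \<in> multi_indices. size \<beta> \<le> N}. s \<beta>)"
    by (rule member_le_sum[OF e _ finite_multi_indices]) (use s0 in auto)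
  finally show ?thesis by (simp add: schwartz_seminorm_def s_def)
qed

lemma dist_of_tempered:
  fixes F :: "'a::euclidean_space \<Rightarrow> real"
  assumes m: "F \<in> borel_measurable lebesgue" and i: "set_integrable lebesgue (cball 0 r) F"
    and b: "\<And>x. norm x > r \<Longrightarrow> \<bar>F x\<bar> \<le> B" and B: "B \<ge> 0"
  shows "dist_of F \<in> tempered_distributions"
proof -
  \<comment> \<open>The smallest integer power for which (1 + |x|)^{-N} is integrable; it pays for
    the merely bounded part of F at infinity, while F is integrable on the ball.\<close>
  define N where "N = Suc DIM('a)"
  define W where "W x = \<bar>indicator (cball 0 r) x *\<^sub>R F x\<bar> + B * (1 / (1 + norm x) ^ N)" for x
  have dec: "integrable lebesgue (\<lambda>x::'a. 1 / (1 + norm x) ^ N)"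
    using integrable_decay[where 'a='a] by (simp add: N_def integrable_completion)
  have W: "integrable lebesgue W"
    unfolding W_def[abs_def] using i unfolding set_integrable_def
    by (intro Bochner_Integration.integrable_add integrable_abs integrable_mult_right dec)
  have bd: "\<bar>F x * \<eta> x\<bar> \<le> W x * schwartz_seminorm N \<eta>" if "\<eta> \<in> schwartz" for \<eta> x
  proof -
    have pw: "(1 + norm x) ^ N \<ge> 1" by (rule one_le_power) simp
    have ge: "(1 + norm x) ^ N * \<bar>\<eta> x\<bar> \<le> schwartz_seminorm N \<eta>"
      by (rule schwartz_seminorm_ge[OF that])
    then have e1: "\<bar>\<eta> x\<bar> \<le> 1 / (1 + norm x) ^ N * schwartz_seminorm N \<eta>"
      using less_le_trans[OF zero_less_one pw] pos_le_divide_eq[of "(1 + norm x) ^ N" "\<bar>\<eta> x\<bar>" "schwartz_seminorm N \<eta>"] by (simp add: mult.commute)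
    have e2: "\<bar>\<eta> x\<bar> \<le> schwartz_seminorm N \<eta>"
      using mult_right_mono[OF pw, of "\<bar>\<eta> x\<bar>"] ge by simp
    have S: "schwartz_seminorm N \<eta> \<ge> 0" using e2 by linarith
    show ?thesis
    proof (cases "norm x \<le> r")
      case True
      have "\<bar>F x\<bar> * \<bar>\<eta> x\<bar> \<le> \<bar>F x\<bar> * schwartz_seminorm N \<eta>" using e2 by (intro mult_left_mono) auto
      also have "\<dots> \<le> W x * schwartz_seminorm N \<eta>"
        using True S B by (intro mult_right_mono) (auto simp: W_def)
      finally show ?thesis by (simp add: abs_mult)
    next
      case False
      have "\<bar>F x\<bar> * \<bar>\<eta> x\<bar> \<le> B * (1 / (1 + norm x) ^ N * schwartz_seminorm N \<eta>)"
        using e1 b[of x] False by (intro mult_mono) auto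
      then show ?thesis using False by (simp add: W_def abs_mult)
    qed
  qed
  have me: "\<eta> \<in> borel_measurable lebesgue" if "\<eta> \<in> schwartz" for \<eta> :: "'a \<Rightarrow> real"
    using that smooth_imp_continuous by (auto simp: schwartz_def intro!: measurable_completion borel_measurable_continuous_onI)
  have int: "integrable lebesgue (\<lambda>x. F x * \<eta> x)" if "\<eta> \<in> schwartz" for \<eta>
  proof (rule Bochner_Integration.integrable_bound)
    show "integrable lebesgue (\<lambda>x. W x * schwartz_seminorm N \<eta>)" using W by (rule integrable_mult_left)
    show "(\<lambda>x. F x * \<eta> x) \<in> borel_measurable lebesgue" using m me[OF that] by (rule borel_measurable_times)
    show "AE x in lebesgue. norm (F x * \<eta> x) \<le> norm (W x * schwartz_seminorm N \<eta>)"
      using bd[OF that] by (auto intro!: AE_I2 order_trans[OF _ abs_ge_self])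
  qed
  show ?thesis
    unfolding tempered_distributions_def mem_Collect_eq
  proof (intro conjI ballI allI)
    show "dist_of F (\<lambda>x. \<eta> x + \<zeta> x) = dist_of F \<eta> + dist_of F \<zeta>" if "\<eta> \<in> schwartz" "\<zeta> \<in> schwartz" for \<eta> \<zeta>
      using int[OF that(1)] int[OF that(2)] by (simp add: dist_of_def distrib_left)
    show "dist_of F (\<lambda>x. a * \<eta> x) = a * dist_of F \<eta>" for \<eta> a
      by (simp add: dist_of_def mult.left_commute)
    have "\<bar>dist_of F \<eta>\<bar> \<le> (LINT x|lebesgue. W x) * schwartz_seminorm N \<eta>" if "\<eta> \<in> schwartz" for \<eta>
    proof -
      have "\<bar>dist_of F \<eta>\<bar> \<le> (LINT x|lebesgue. \<bar>F x * \<eta> x\<bar>)" unfolding dist_of_def by (rule integral_abs_bound)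
      also have "\<dots> \<le> (LINT x|lebesgue. W x * schwartz_seminorm N \<eta>)"
        using int[OF that] W bd[OF that] by (intro integral_mono integrable_abs integrable_mult_left) auto
      finally show ?thesis by simp
    qed
    then show "\<exists>C N. \<forall>\<eta>\<in>schwartz. \<bar>dist_of F \<eta>\<bar> \<le> C * schwartz_seminorm N \<eta>" by blast
  qed
qed

lemma dist_of_tempered_bounded_support:
  fixes F :: "'a::euclidean_space \<Rightarrow> real"
  assumes "F \<in> borel_measurable lebesgue" "\<And>K. compact K \<Longrightarrow> set_integrable lebesgue K F"
    "\<And>x. norm x > r \<Longrightarrow> F x = 0"
  shows "dist_of F \<in> tempered_distributions"
  using assms by (intro dist_of_tempered[of F r 0]) auto

context dyadic_pieces
begin

text \<open>The common dominating function of all partial sums. The series is finite almost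
  everywhere; \<open>enn2real\<close> gives the value 0 on the remaining null set.\<close>

definition maj :: "'a \<Rightarrow> real" where
  "maj x = enn2real (\<Sum>n. ennreal \<bar>fs (int_decode n) x\<bar>)"

lemma suminf_finite_support:
  assumes "finite {j. fs j x \<noteq> 0}"
  shows "(\<Sum>n. ennreal \<bar>fs (int_decode n) x\<bar>) < \<infinity>"
proof -
  have "(\<Sum>n. ennreal \<bar>fs (int_decode n) x\<bar>) \<le> ennreal (\<Sum>j\<in>{j. fs j x \<noteq> 0}. \<bar>fs j x\<bar>)"
  proof (rule suminf_int_le)
    show "(\<Sum>j\<in>S. \<bar>fs j x\<bar>) \<le> (\<Sum>j\<in>{j. fs j x \<noteq> 0}. \<bar>fs j x\<bar>)" if "finite S" for S
    proof -
      have "(\<Sum>j\<in>S. \<bar>fs j x\<bar>) = (\<Sum>j\<in>S \<inter> {j. fs j x \<noteq> 0}. \<bar>fs j x\<bar>)"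
        using that by (intro sum.mono_neutral_right) auto
      also have "\<dots> \<le> (\<Sum>j\<in>{j. fs j x \<noteq> 0}. \<bar>fs j x\<bar>)"
        using assms by (intro sum_mono2) auto
      finally show ?thesis .
    qed
  qed simp
  then show ?thesis by (simp add: le_less_trans)
qed

lemma maj_ge:
  assumes "finite {j. fs j x \<noteq> 0}" "finite S"
  shows "\<bar>\<Sum>j\<in>S. fs j x\<bar> \<le> maj x"
proof -
  have "ennreal (\<Sum>j\<in>S. \<bar>fs j x\<bar>) = (\<Sum>j\<in>S. ennreal \<bar>fs j x\<bar>)" by simp
  also have "\<dots> \<le> (\<Sum>n. ennreal \<bar>fs (int_decode n) x\<bar>)" by (rule sum_le_suminf_int[OF assms(2)])
  also have "\<dots> = ennreal (maj x)"
    unfolding maj_def using suminf_finite_support[OF assms(1)] by (simp add: ennreal_enn2real_if less_top)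
  finally have "(\<Sum>j\<in>S. \<bar>fs j x\<bar>) \<le> maj x"
    by (subst (asm) ennreal_le_iff) (simp_all add: maj_def)
  then show ?thesis using sum_abs[of "\<lambda>j. fs j x" S] by linarith
qed

lemma maj_integrable:
  assumes loc: "\<And>r. \<exists>J::int. \<forall>j<J. \<forall>x. norm x \<le> r \<longrightarrow> fs j x = 0" and K: "compact K"
  shows "set_integrable lebesgue K maj"
proof -
  obtain r where r: "\<And>x. x \<in> K \<Longrightarrow> norm x \<le> r"
    using compact_imp_bounded[OF K] unfolding bounded_iff by blast
  obtain J :: int where J: "\<And>j x. j < J \<Longrightarrow> norm x \<le> r \<Longrightarrow> fs j x = 0" using loc[of r] by metis
  have Kb: "K \<in> sets borel" using K by (rule borel_compact)
  have Kf: "emeasure lborel K < \<infinity>" by (rule emeasure_bounded_finite[OF compact_imp_bounded[OF K]])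
  have fin': "(\<integral>\<^sup>+x. (\<Sum>n. ennreal \<bar>fs (int_decode n) x\<bar>) * indicator K x \<partial>lborel) < \<infinity>"
    by (rule sum_abs_local[OF Kb Kf, of J]) (use J r in blast)
  have mm: "(\<lambda>x. \<Sum>n. ennreal \<bar>fs (int_decode n) x\<bar>) \<in> borel_measurable borel"
  proof (rule borel_measurable_suminf_order)
    fix n
    have [measurable]: "fs (int_decode n) \<in> borel_measurable borel" by (rule meas)
    show "(\<lambda>x. ennreal \<bar>fs (int_decode n) x\<bar>) \<in> borel_measurable borel" by measurable
  qed
  have mj: "maj \<in> borel_measurable borel"
    unfolding maj_def[abs_def] by (rule measurable_compose[OF mm]) simp
  have "integrable lborel (\<lambda>x. indicator K x *\<^sub>R maj x)"
  proof (rule integrableI_bounded)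
    show "(\<lambda>x. indicator K x *\<^sub>R maj x) \<in> borel_measurable lborel"
      using mj Kb by (intro borel_measurable_scaleR borel_measurable_indicator) auto
    have "(\<integral>\<^sup>+x. ennreal (norm (indicator K x *\<^sub>R maj x)) \<partial>lborel) \<le> (\<integral>\<^sup>+x. (\<Sum>n. ennreal \<bar>fs (int_decode n) x\<bar>) * indicator K x \<partial>lborel)"
    proof (rule nn_integral_mono)
      fix x
      show "ennreal (norm (indicator K x *\<^sub>R maj x)) \<le> (\<Sum>n. ennreal \<bar>fs (int_decode n) x\<bar>) * indicator K x"
        by (cases "(\<Sum>n. ennreal \<bar>fs (int_decode n) x\<bar>) = top") (auto simp: maj_def indicator_def ennreal_enn2real_if)
    qed
    then show "(\<integral>\<^sup>+x. ennreal (norm (indicator K x *\<^sub>R maj x)) \<partial>lborel) < \<infinity>"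
      using fin' by (rule le_less_trans)
  qed
  then show ?thesis unfolding set_integrable_def by (simp add: integrable_completion)
qed

lemma dysum_locally_integrable:
  assumes loc: "\<And>r. \<exists>J::int. \<forall>j<J. \<forall>x. norm x \<le> r \<longrightarrow> fs j x = 0" and K: "compact K"
  shows "set_integrable lebesgue K (dysum fs)"
  unfolding set_integrable_def
proof (rule Bochner_Integration.integrable_bound)
  show "integrable lebesgue (\<lambda>x. indicator K x *\<^sub>R maj x)"
    using maj_integrable[OF loc K] unfolding set_integrable_def .
  show "(\<lambda>x. indicat_real K x *\<^sub>R dysum fs x) \<in> borel_measurable lebesgue"
    using dysum_meas borel_compact[OF K]
    by (intro measurable_completion borel_measurable_scaleR borel_measurable_indicator) auto
  have "AE x in lebesgue. finite {j. fs j x \<noteq> 0}" using fin by (rule AE_completion)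
  then show "AE x in lebesgue. norm (indicat_real K x *\<^sub>R dysum fs x) \<le> norm (indicat_real K x *\<^sub>R maj x)"
  proof eventually_elim
    case (elim x)
    have "\<bar>dysum fs x\<bar> \<le> maj x"
      using maj_ge[OF elim elim] by (subst dysum_eq[OF elim]) auto
    then show ?case by (auto simp: indicator_def)
  qed
qed

end

text \<open>The estimates say that a derivative costs 2^j and a difference of step h gains 2^j |h|
  per order, which for \<tau> < 2 is wanted up to total order two. \<open>Floc\<close> and
  \<open>Gloc\<close> state that on bounded sets low frequencies are absent; they give local
  integrability even when infinitely many negative scales occur.\<close>

locale dyadic_family =
  fixes \<tau> q :: real and Fs :: "int \<Rightarrow> 'a::euclidean_space \<Rightarrow> real" and Gs :: "int \<Rightarrow> 'a \<Rightarrow> 'a \<Rightarrow> real"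
    and A :: "int \<Rightarrow> real" and B :: real
  assumes q: "1 < q" and tau: "0 < \<tau>" "\<tau> < 2"
    and Fcont: "\<And>j. continuous_on UNIV (Fs j)"
    and Gcont: "\<And>j b. b \<in> Basis \<Longrightarrow> continuous_on UNIV (Gs j b)"
    and der: "\<And>j b x. b \<in> Basis \<Longrightarrow> ((\<lambda>t. Fs j (x + t *\<^sub>R b)) has_real_derivative Gs j b x) (at 0)"
    and A_nonneg: "\<And>j. 0 \<le> A j" and A_sum: "\<And>S. finite S \<Longrightarrow> (\<Sum>j\<in>S. A j) \<le> B"
    and Fsize: "\<And>j. (pint q (Fs j)) \<le> ennreal (2 powr (- (j * \<tau> * q)) * A j)"
    and Gsize: "\<And>j b. b \<in> Basis \<Longrightarrow> (pint q (Gs j b)) \<le> ennreal (2 powr (- (j * (\<tau> - 1) * q)) * A j)"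
    and Fdiff: "\<And>c j h. c \<in> {0, 1} \<Longrightarrow> 2 powr j * norm h \<le> 1 \<Longrightarrow>
      pint q (delta c (Fs j) h) \<le> ennreal (((2 powr j * norm h) powr (1 + c)) powr q * (2 powr (- (j * \<tau> * q)) * A j))"
    and Gdiff: "\<And>j b h. b \<in> Basis \<Longrightarrow> 2 powr j * norm h \<le> 1 \<Longrightarrow>
      pint q (delta 0 (Gs j b) h) \<le> ennreal ((2 powr j * norm h) powr q * (2 powr (- (j * (\<tau> - 1) * q)) * A j))"
    and Ffin: "AE x in lborel. finite {j. Fs j x \<noteq> 0}"
    and Gfin: "\<And>b. b \<in> Basis \<Longrightarrow> AE x in lborel. finite {j. Gs j b x \<noteq> 0}"
    and Floc: "\<And>r. \<exists>J::int. \<forall>j<J. \<forall>x. norm x \<le> r \<longrightarrow> Fs j x = 0"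
    and Gloc: "\<And>b r. b \<in> Basis \<Longrightarrow> \<exists>J::int. \<forall>j<J. \<forall>x. norm x \<le> r \<longrightarrow> Gs j b x = 0"
begin

lemma F_pieces: "dyadic_pieces \<tau> q Fs A B"
  by unfold_locales (use q tau Fcont A_nonneg A_sum Fsize Ffin in auto)

lemma G_pieces: "1 < \<tau> \<Longrightarrow> b \<in> Basis \<Longrightarrow> dyadic_pieces (\<tau> - 1) q (\<lambda>j. Gs j b) A B"
  by unfold_locales (use q Gcont A_nonneg A_sum Gsize Gfin in auto)

sublocale F: dyadic_pieces \<tau> q Fs A B by (rule F_pieces)

lemma F_locally_integrable: "compact K \<Longrightarrow> set_integrable lebesgue K (dysum Fs)"
  by (rule F.dysum_locally_integrable[OF Floc])

lemma represents_order_0: "represents_on UNIV (dysum Fs) (dist_deriv {#} (dist_of (dysum Fs)))"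
  using F_locally_integrable by (simp add: represents_on_def dist_deriv_def partial_empty dist_of_def)

text \<open>The differentiated pieces form a family of smoothness \<tau> - 1 > 0, so their absolute
  values are still summable in L^1 on compact sets. The sum of the two majorants dominates the
  partial sums of functions and derivatives.\<close>

lemma represents_order_1:
  assumes "1 < \<tau>" "b \<in> Basis"
  shows "represents_on UNIV (dysum (\<lambda>j. Gs j b)) (dist_deriv {#b#} (dist_of (dysum Fs)))"
proof -
  interpret G: dyadic_pieces "\<tau> - 1" q "\<lambda>j. Gs j b" A B by (rule G_pieces[OF assms])
  have Fae: "AE x in lebesgue. finite {j. Fs j x \<noteq> 0}" using Ffin by (rule AE_completion)
  have Gae: "AE x in lebesgue. finite {j. Gs j b x \<noteq> 0}" using Gfin[OF assms(2)] by (rule AE_completion)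
  show ?thesis
  proof (rule weak_derivative_limit[where H="\<lambda>x. F.maj x + G.maj x" and Fn="\<lambda>N x. \<Sum>j\<in>{- int N..int N}. Fs j x"
        and Gn="\<lambda>N x. \<Sum>j\<in>{- int N..int N}. Gs j b x"])
    show "b \<in> Basis" by (rule assms)
    fix N and \<eta> :: "'a \<Rightarrow> real" assume eta: "\<eta> \<in> test_functions UNIV"
    show "(LINT x|lebesgue. (\<Sum>j = - int N..int N. Fs j x) * partial {#b#} \<eta> x) = - (LINT x|lebesgue. (\<Sum>j = - int N..int N. Gs j b x) * \<eta> x)"
    proof (rule integration_by_parts_test[OF _ _ assms(2) _ eta])
      show "continuous_on UNIV (\<lambda>x. \<Sum>j = - int N..int N. Fs j x)"
        by (intro continuous_on_sum Fcont)
      show "continuous_on UNIV (\<lambda>x. \<Sum>j = - int N..int N. Gs j b x)"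
        by (intro continuous_on_sum Gcont assms)
      show "((\<lambda>t. \<Sum>j = - int N..int N. Fs j (x + t *\<^sub>R b)) has_real_derivative (\<Sum>j = - int N..int N. Gs j b x)) (at 0)" for x
        by (intro DERIV_sum der assms)
    qed
  next
    show "(\<lambda>x. \<Sum>j = - int N..int N. Fs j x) \<in> borel_measurable borel" for N
      by (intro borel_measurable_sum F.meas)
    show "(\<lambda>x. \<Sum>j = - int N..int N. Gs j b x) \<in> borel_measurable borel" for N
      by (intro borel_measurable_sum G.meas)
    show "dysum Fs \<in> borel_measurable borel" "dysum (\<lambda>j. Gs j b) \<in> borel_measurable borel"
      by (rule F.dysum_meas, rule G.dysum_meas)
    show "AE x in lebesgue. (\<lambda>N. \<Sum>j = - int N..int N. Fs j x) \<longlonglongrightarrow> dysum Fs x"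
      using Fae
    proof eventually_elim
      case (elim x)
      show ?case using partial_sums_tendsto[OF elim, of Fs x] dysum_eq[OF elim, of Fs x] by simp
    qed
    show "AE x in lebesgue. (\<lambda>N. \<Sum>j = - int N..int N. Gs j b x) \<longlonglongrightarrow> dysum (\<lambda>j. Gs j b) x"
      using Gae
    proof eventually_elim
      case (elim x)
      show ?case using partial_sums_tendsto[OF elim, of "\<lambda>j. Gs j b" x] dysum_eq[OF elim, of "\<lambda>j. Gs j b" x] by simp
    qed
    show "AE x in lebesgue. \<bar>\<Sum>j = - int N..int N. Fs j x\<bar> \<le> F.maj x + G.maj x" for N
      using Fae
    proof eventually_elim
      case (elim x)
      have "0 \<le> G.maj x" by (simp add: G.maj_def)
      then show ?case using F.maj_ge[OF elim, of "{- int N..int N}"] by simp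
    qed
    show "AE x in lebesgue. \<bar>\<Sum>j = - int N..int N. Gs j b x\<bar> \<le> F.maj x + G.maj x" for N
      using Gae
    proof eventually_elim
      case (elim x)
      have "0 \<le> F.maj x" by (simp add: F.maj_def)
      then show ?case using G.maj_ge[OF elim, of "{- int N..int N}"] by simp
    qed
    show "set_integrable lebesgue K (\<lambda>x. F.maj x + G.maj x)" if "compact K" for K
      using F.maj_integrable[OF Floc that] G.maj_integrable[OF Gloc[OF assms(2)] that] by (rule set_integral_add(1))
  qed
qed

end

section \<open>Besov norms of dyadic families\<close>

lemma multi_indices_size_0: "{\<beta>. \<beta> \<in> multi_indices \<and> size \<beta> = 0} = {{#}}"
  by (auto simp: multi_indices_def)

lemma multi_indices_size_1: "{\<beta> :: 'a::euclidean_space multiset. \<beta> \<in> multi_indices \<and> size \<beta> = Suc 0} = (\<lambda>b. {#b#}) ` Basis"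
proof
  show "{\<beta> :: 'a multiset. \<beta> \<in> multi_indices \<and> size \<beta> = Suc 0} \<subseteq> (\<lambda>b. {#b#}) ` Basis"
  proof
    fix \<beta> :: "'a multiset" assume b: "\<beta> \<in> {\<beta> \<in> multi_indices. size \<beta> = Suc 0}"
    then obtain c where "\<beta> = {#c#}" using size_1_singleton_mset by auto
    then show "\<beta> \<in> (\<lambda>b. {#b#}) ` Basis" using b by (auto simp: multi_indices_def)
  qed
qed (auto simp: multi_indices_def)

lemma besov_order_0: "0 < \<tau> \<Longrightarrow> \<tau> \<le> 1 \<Longrightarrow> besov_order \<tau> = 0"
proof -
  assume "0 < \<tau>" "\<tau> \<le> 1"
  then have "\<lceil>\<tau>\<rceil> = 1" by (simp add: ceiling_eq_iff)
  then show ?thesis by (simp add: besov_order_def)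
qed

lemma besov_order_1: "1 < \<tau> \<Longrightarrow> \<tau> < 2 \<Longrightarrow> besov_order \<tau> = Suc 0"
proof -
  assume "1 < \<tau>" "\<tau> < 2"
  then have "\<lceil>\<tau>\<rceil> = 2" by (simp add: ceiling_eq_iff)
  then show ?thesis by (simp add: besov_order_def)
qed

lemma Ints_between: "0 < (\<tau>::real) \<Longrightarrow> \<tau> < 2 \<Longrightarrow> \<tau> \<in> \<int> \<longleftrightarrow> \<tau> = 1"
proof
  assume a: "0 < \<tau>" "\<tau> < 2" "\<tau> \<in> \<int>"
  then obtain k where k: "\<tau> = of_int k" by (auto elim: Ints_cases)
  then have "0 < k" "k < 2" using a by simp_all
  then have "k = 1" by linarith
  then show "\<tau> = 1" using k by simp
qed simp

text \<open>Brings both forms of the seminorm to one shape: the substitution y = x + h turns the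
  kernel of the first difference into a weight in h, as already present for the second
  difference.\<close>

lemma homog_integral_delta:
  fixes \<tau> q :: real and g :: "'a::euclidean_space \<Rightarrow> real"
  assumes [measurable]: "g \<in> borel_measurable borel" and t: "0 < \<tau>" "\<tau> < 2"
  shows "homog_integral \<tau> q g = (\<integral>\<^sup>+x. (\<integral>\<^sup>+h. ennreal (\<bar>delta (if \<tau> = 1 then 1 else 0) g h x\<bar> powr q
    / norm h powr (DIM('a) + q * (\<tau> - besov_order \<tau>))) \<partial>lborel) \<partial>lborel)"
proof (cases "\<tau> = 1")
  case True
  then show ?thesis by (simp add: homog_integral_def nn_integral_completion delta_def besov_order_0)
next
  case False
  then have "\<tau> \<notin> \<int>" using Ints_between[OF t] by simp
  let ?w = "\<lambda>h::'a. norm h powr (DIM('a) + q * (\<tau> - besov_order \<tau>))"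
  have "(\<integral>\<^sup>+y. ennreal (\<bar>g x - g y\<bar> powr q / ?w (x - y)) \<partial>lborel) = (\<integral>\<^sup>+h. ennreal (\<bar>g (x + h) - g x\<bar> powr q / ?w h) \<partial>lborel)" for x
  proof -
    have "(\<integral>\<^sup>+y. ennreal (\<bar>g x - g y\<bar> powr q / ?w (x - y)) \<partial>lborel) = (\<integral>\<^sup>+h. ennreal (\<bar>g x - g (h + x)\<bar> powr q / ?w (x - (h + x))) \<partial>lborel)"
      by (rule nn_integral_lborel_shift[symmetric]) measurable
    then show ?thesis by (simp add: add.commute abs_minus_commute)
  qed
  then show ?thesis
    using False \<open>\<tau> \<notin> \<int>\<close> by (simp add: homog_integral_def nn_integral_completion delta_def)
qed

lemma energy_root_le:
  assumes "E \<le> ennreal (C * B)" "C \<ge> 0" "B \<ge> 0" "q > 0"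
  shows "enn2real E powr (1 / q) \<le> C powr (1 / q) * B powr (1 / q)"
proof -
  have "enn2real E \<le> C * B" using assms by (intro enn2real_leI) auto
  then have "enn2real E powr (1 / q) \<le> (C * B) powr (1 / q)" using assms by (intro powr_mono2) auto
  then show ?thesis using assms by (simp add: powr_mult)
qed

text \<open>Second differences are taken only for \<tau> = 1. Above 1 the first difference acts on
  the d first-order derivatives, whose smoothness is \<tau> - 1.\<close>

definition homog_const :: "real \<Rightarrow> real \<Rightarrow> real \<Rightarrow> real" where
  "homog_const d \<tau> q = 3 * 4 powr q *
     (if \<tau> \<le> 1 then hardy_const d (if \<tau> = 1 then 2 else 1) \<tau> q else d * hardy_const d 1 (\<tau> - 1) q)"

definition sobolev_const :: "int \<Rightarrow> real \<Rightarrow> real \<Rightarrow> real" where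
  "sobolev_const J \<sigma> q = (2 powr (- (J * \<sigma>)) * (1 / (1 - 2 powr (- \<sigma>)))) powr (q - 1) * 2 powr (- (J * \<sigma>))"

definition besov_const :: "int \<Rightarrow> real \<Rightarrow> real \<Rightarrow> real \<Rightarrow> real" where
  "besov_const J d \<tau> q = (sobolev_const J \<tau> q + d * sobolev_const J (\<tau> - 1) q) powr (1 / q) + homog_const d \<tau> q powr (1 / q)"

lemma sobolev_const_nonneg: "0 \<le> sobolev_const J \<sigma> q"
  by (simp add: sobolev_const_def)

lemma besov_const_nonneg: "0 \<le> besov_const J d \<tau> q"
  by (simp add: besov_const_def)

context dyadic_family
begin

abbreviation T where "T \<equiv> dist_of (dysum Fs)"

text \<open>A junk value for multi-indices of size above one, which do not occur since \<open>\<tau> < 2\<close>.\<close>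

definition deriv_sum :: "'a multiset \<Rightarrow> 'a \<Rightarrow> real" where
  "deriv_sum \<beta> = (if \<beta> = {#} then dysum Fs else dysum (\<lambda>j. Gs j (THE b. \<beta> = {#b#})))"

lemma deriv_sum_simps: "deriv_sum {#} = dysum Fs" "deriv_sum {#b#} = dysum (\<lambda>j. Gs j b)"
  by (simp_all add: deriv_sum_def)

lemma small_multi_index:
  assumes "\<beta> \<in> multi_indices" "size \<beta> \<le> besov_order \<tau>"
  obtains "\<beta> = {#}" | b where "1 < \<tau>" "b \<in> Basis" "\<beta> = {#b#}"
proof (cases "\<tau> \<le> 1")
  case True
  then show ?thesis using assms tau that(1) by (simp add: besov_order_0)
next
  case False
  then have "size \<beta> = 0 \<or> size \<beta> = Suc 0" using assms(2) tau by (auto simp: besov_order_1 le_Suc_eq)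
  then show ?thesis
  proof
    assume "size \<beta> = Suc 0"
    then obtain b where "\<beta> = {#b#}" using size_1_singleton_mset by auto
    then show ?thesis using assms(1) False that(2)[of b] by (simp add: multi_indices_def)
  qed (use that(1) in simp)
qed

lemma represents_deriv_sum:
  assumes "\<beta> \<in> multi_indices" "size \<beta> \<le> besov_order \<tau>"
  shows "represents_on UNIV (deriv_sum \<beta>) (dist_deriv \<beta> T)"
  using assms by (cases rule: small_multi_index) (auto simp: deriv_sum_simps represents_order_0 represents_order_1)

lemma has_dist_deriv_low: "\<beta> \<in> multi_indices \<Longrightarrow> size \<beta> \<le> besov_order \<tau> \<Longrightarrow> has_dist_deriv T \<beta>"
  unfolding has_dist_deriv_def by (rule exI, rule represents_deriv_sum)

lemma homog_sum_bound:
  "(\<Sum>\<beta> | \<beta> \<in> multi_indices \<and> size \<beta> = besov_order \<tau>. homog_integral \<tau> q (deriv_sum \<beta>)) \<le> ennreal (homog_const DIM('a) \<tau> q * B)"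
proof (cases "\<tau> \<le> 1")
  case True
  define c :: real where "c = (if \<tau> = 1 then 1 else 0)"
  have o: "besov_order \<tau> = 0" by (rule besov_order_0[OF tau(1) True])
  have "homog_integral \<tau> q (dysum Fs) \<le> ennreal (hardy_const DIM('a) (1 + c) \<tau> q * (3 * 4 powr q * B))"
    unfolding homog_integral_delta[OF F.dysum_meas tau] o c_def[symmetric]
    using F.dyadic_difference[of c] True tau Fdiff[of c] by (simp add: c_def split: if_splits)
  then show ?thesis
    unfolding o multi_indices_size_0 using True by (simp add: deriv_sum_simps homog_const_def c_def mult_ac split: if_splits)
next
  case False
  then have t1: "1 < \<tau>" by simp
  have o: "besov_order \<tau> = Suc 0" by (rule besov_order_1[OF t1 tau(2)])
  define H where "H = hardy_const DIM('a) 1 (\<tau> - 1) q * (3 * 4 powr q * B)"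
  have "homog_integral \<tau> q (deriv_sum {#b#}) \<le> ennreal H" if b: "b \<in> Basis" for b
  proof -
    interpret G: dyadic_pieces "\<tau> - 1" q "\<lambda>j. Gs j b" A B by (rule G_pieces[OF t1 b])
    have "(\<integral>\<^sup>+x. (\<integral>\<^sup>+h. ennreal (\<bar>delta 0 (dysum (\<lambda>j. Gs j b)) h x\<bar> powr q / norm h powr (DIM('a) + q * (\<tau> - 1))) \<partial>lborel) \<partial>lborel)
      \<le> ennreal (hardy_const DIM('a) (1 + 0) (\<tau> - 1) q * (3 * 4 powr q * B))"
      by (rule G.dyadic_difference) (use tau Gdiff[OF b] in auto)
    then show ?thesis
      unfolding deriv_sum_simps homog_integral_delta[OF G.dysum_meas tau] o H_def using t1 by simp
  qed
  then have "(\<Sum>b\<in>Basis. homog_integral \<tau> q (deriv_sum {#b#})) \<le> (\<Sum>b\<in>(Basis::'a set). ennreal H)"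
    by (rule sum_mono)
  also have "\<dots> = ennreal (homog_const DIM('a) \<tau> q * B)"
  proof -
    have "0 \<le> H" using t1 tau F.B_nonneg by (simp add: H_def hardy_const_nonneg)
    then show ?thesis using False by (simp add: ennreal_of_nat_eq_real_of_nat H_def homog_const_def mult_ac flip: ennreal_mult')
  qed
  finally show ?thesis
    unfolding o multi_indices_size_1 by (subst sum.reindex) (auto intro: inj_onI)
qed

lemma homog_estimate:
  assumes "T \<in> tempered_distributions"
  shows "T \<in> homog_besov \<tau> q" "homog_besov_norm \<tau> q T \<le> homog_const DIM('a) \<tau> q powr (1 / q) * B powr (1 / q)"
proof -
  have "homog_energy \<tau> q T = (\<Sum>\<beta> | \<beta> \<in> multi_indices \<and> size \<beta> = besov_order \<tau>. homog_integral \<tau> q (deriv_sum \<beta>))"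
    unfolding homog_energy_def
    by (intro sum.cong homog_integral_cong_AE weak_deriv_AE represents_deriv_sum) auto
  with homog_sum_bound have e: "homog_energy \<tau> q T \<le> ennreal (homog_const DIM('a) \<tau> q * B)" by simp
  then have "homog_energy \<tau> q T < \<infinity>" by (simp add: le_less_trans)
  then show "T \<in> homog_besov \<tau> q"
    using assms by (simp add: homog_besov_def has_dist_deriv_low)
  have "0 \<le> homog_const DIM('a) \<tau> q"
    unfolding homog_const_def using tau by (auto intro!: mult_nonneg_nonneg hardy_const_nonneg)
  then show "homog_besov_norm \<tau> q T \<le> homog_const DIM('a) \<tau> q powr (1 / q) * B powr (1 / q)"
    unfolding homog_besov_norm_def using e F.B_nonneg q by (intro energy_root_le) auto
qed

text \<open>The L^q norm, unlike the seminorm, has no decay at low frequencies, so a first scale J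
  is imposed and enters the constant.\<close>

lemma besov_estimate:
  assumes tm: "T \<in> tempered_distributions"
    and Fz: "\<And>j x. j < J \<Longrightarrow> Fs j x = 0" and Gz: "\<And>j b x. j < J \<Longrightarrow> Gs j b x = 0"
  shows "T \<in> besov \<tau> q" "besov_norm \<tau> q T \<le> besov_const J DIM('a) \<tau> q * B powr (1 / q)"
proof -
  let ?K = "\<lambda>\<sigma>. sobolev_const J \<sigma> q"
  note B = F.B_nonneg and K = sobolev_const_nonneg[of J _ q]
  define C where "C = ?K \<tau> + real DIM('a) * ?K (\<tau> - 1)"
  define e where "e \<beta> = (\<integral>\<^sup>+ x. ennreal (\<bar>weak_deriv T \<beta> x\<bar> powr q) \<partial>lebesgue)" for \<beta>
  have ee: "e \<beta> = pint q g" if "represents_on UNIV g (dist_deriv \<beta> T)" for \<beta> g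
  proof -
    have "e \<beta> = (\<integral>\<^sup>+x. ennreal (\<bar>g x\<bar> powr q) \<partial>lebesgue)"
      unfolding e_def
    proof (rule nn_integral_cong_AE)
      show "AE x in lebesgue. ennreal (\<bar>weak_deriv T \<beta> x\<bar> powr q) = ennreal (\<bar>g x\<bar> powr q)"
        using weak_deriv_AE[OF that] by eventually_elim simp
    qed
    then show ?thesis by (simp add: nn_integral_completion)
  qed
  have e0: "e {#} \<le> ennreal (?K \<tau> * B)"
    unfolding ee[OF represents_order_0] sobolev_const_def by (rule F.Lq_bound) (rule Fz)
  have e1: "e {#b#} \<le> ennreal (?K (\<tau> - 1) * B)" if "1 < \<tau>" "b \<in> Basis" for b
  proof -
    interpret G: dyadic_pieces "\<tau> - 1" q "\<lambda>j. Gs j b" A B by (rule G_pieces[OF that])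
    show ?thesis
      unfolding ee[OF represents_order_1[OF that]] sobolev_const_def by (rule G.Lq_bound) (rule Gz)
  qed
  have "(\<Sum>\<beta> | \<beta> \<in> multi_indices \<and> size \<beta> \<le> besov_order \<tau>. e \<beta>) \<le> ennreal (C * B)"
  proof (cases "\<tau> \<le> 1")
    case True
    have "ennreal (?K \<tau> * B) \<le> ennreal (C * B)"
      using K B by (intro ennreal_leI mult_right_mono) (auto simp: C_def)
    then show ?thesis
      using e0 unfolding besov_order_0[OF tau(1) True] le_zero_eq multi_indices_size_0 by simp
  next
    case False
    then have t1: "1 < \<tau>" by simp
    have ms: "{\<beta> :: 'a multiset. \<beta> \<in> multi_indices \<and> size \<beta> \<le> Suc 0} = insert {#} ((\<lambda>b. {#b#}) ` Basis)"
      unfolding multi_indices_size_1[symmetric] by (auto simp: multi_indices_def le_Suc_eq)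
    have "(\<Sum>\<beta> | \<beta> \<in> multi_indices \<and> size \<beta> \<le> besov_order \<tau>. e \<beta>) = e {#} + (\<Sum>b\<in>Basis. e {#b#})"
      unfolding besov_order_1[OF t1 tau(2)] ms by (subst sum.insert) (auto simp: sum.reindex inj_on_def)
    also have "\<dots> \<le> ennreal (?K \<tau> * B) + (\<Sum>b\<in>(Basis::'a set). ennreal (?K (\<tau> - 1) * B))"
      by (intro add_mono e0 sum_mono e1 t1)
    also have "\<dots> = ennreal (?K \<tau> * B) + ennreal (real DIM('a) * (?K (\<tau> - 1) * B))"
      by (simp add: ennreal_mult' ennreal_of_nat_eq_real_of_nat)
    also have "\<dots> = ennreal (C * B)"
    proof -
      have "C * B = ?K \<tau> * B + real DIM('a) * (?K (\<tau> - 1) * B)" by (simp add: C_def distrib_right)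
      then show ?thesis using K[of \<tau>] K[of "\<tau> - 1"] B by (simp add: ennreal_plus)
    qed
    finally show ?thesis .
  qed
  then have se: "sobolev_energy (besov_order \<tau>) q T \<le> ennreal (C * B)" by (simp add: sobolev_energy_def e_def)
  have "sobolev_energy (besov_order \<tau>) q T < \<infinity>" using se by (simp add: le_less_trans)
  then have "T \<in> sobolev (besov_order \<tau>) q"
    using tm by (simp add: sobolev_def has_dist_deriv_low)
  then show "T \<in> besov \<tau> q" using homog_estimate(1)[OF tm] by (simp add: besov_def)
  have "sobolev_norm (besov_order \<tau>) q T \<le> C powr (1 / q) * B powr (1 / q)"
    unfolding sobolev_norm_def using se K B q by (intro energy_root_le) (auto simp: C_def)
  then show "besov_norm \<tau> q T \<le> besov_const J DIM('a) \<tau> q * B powr (1 / q)"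
    using homog_estimate(2)[OF tm] by (simp add: besov_norm_def besov_const_def C_def distrib_right)
qed

end

text \<open>Restricting to a set I of scales lets one set of estimates serve finite sums of atoms,
  the scales from J on of the local estimate, and all scales of the global one; only the summability
  of the coefficients depends on I.\<close>

lemma dyadic_family_on:
  fixes F :: "int \<Rightarrow> 'a::euclidean_space \<Rightarrow> real"
  assumes "1 < q" "0 < \<tau>" "\<tau> < 2"
    and Fc: "\<And>j. j \<in> I \<Longrightarrow> continuous_on UNIV (F j)"
    and Gc: "\<And>j b. j \<in> I \<Longrightarrow> b \<in> Basis \<Longrightarrow> continuous_on UNIV (G j b)"
    and der: "\<And>j b x. j \<in> I \<Longrightarrow> b \<in> Basis \<Longrightarrow> ((\<lambda>t. F j (x + t *\<^sub>R b)) has_real_derivative G j b x) (at 0)"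
    and A: "\<And>j. 0 \<le> A j" and B: "\<And>S. finite S \<Longrightarrow> S \<subseteq> I \<Longrightarrow> (\<Sum>j\<in>S. A j) \<le> B"
    and Fs: "\<And>j. j \<in> I \<Longrightarrow> pint q (F j) \<le> ennreal (2 powr (- (j * \<tau> * q)) * A j)"
    and Gs: "\<And>j b. j \<in> I \<Longrightarrow> b \<in> Basis \<Longrightarrow> pint q (G j b) \<le> ennreal (2 powr (- (j * (\<tau> - 1) * q)) * A j)"
    and Fd: "\<And>c j h. j \<in> I \<Longrightarrow> c \<in> {0, 1} \<Longrightarrow> 2 powr j * norm h \<le> 1 \<Longrightarrow>
      pint q (delta c (F j) h) \<le> ennreal (((2 powr j * norm h) powr (1 + c)) powr q * (2 powr (- (j * \<tau> * q)) * A j))"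
    and Gd: "\<And>j b h. j \<in> I \<Longrightarrow> b \<in> Basis \<Longrightarrow> 2 powr j * norm h \<le> 1 \<Longrightarrow>
      pint q (delta 0 (G j b) h) \<le> ennreal ((2 powr j * norm h) powr q * (2 powr (- (j * (\<tau> - 1) * q)) * A j))"
    and Ff: "AE x in lborel. finite {j \<in> I. F j x \<noteq> 0}" and Gf: "\<And>b. b \<in> Basis \<Longrightarrow> AE x in lborel. finite {j \<in> I. G j b x \<noteq> 0}"
    and Fl: "\<And>r. \<exists>J. \<forall>j<J. \<forall>x. j \<in> I \<longrightarrow> norm x \<le> r \<longrightarrow> F j x = 0"
    and Gl: "\<And>b r. b \<in> Basis \<Longrightarrow> \<exists>J. \<forall>j<J. \<forall>x. j \<in> I \<longrightarrow> norm x \<le> r \<longrightarrow> G j b x = 0"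
  shows "dyadic_family \<tau> q (\<lambda>j x. if j \<in> I then F j x else 0) (\<lambda>j b x. if j \<in> I then G j b x else 0) (\<lambda>j. if j \<in> I then A j else 0) B"
proof
  show "1 < q" "0 < \<tau>" "\<tau> < 2" by fact+
next
  fix j :: int
  have d0: "delta c (\<lambda>x. 0) h = (\<lambda>x. 0)" for c and h :: 'a by (simp add: delta_def fun_eq_iff)
  note [simp] = d0
  show "continuous_on UNIV (\<lambda>x. if j \<in> I then F j x else 0)" using Fc by (cases "j \<in> I") auto
  show "0 \<le> (if j \<in> I then A j else 0)" using A by simp
  show "pint q (\<lambda>x. if j \<in> I then F j x else 0) \<le> ennreal (2 powr (- (j * \<tau> * q)) * (if j \<in> I then A j else 0))"
    using Fs[of j] by (cases "j \<in> I") auto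
  show "pint q (delta c (\<lambda>x. if j \<in> I then F j x else 0) h)
    \<le> ennreal (((2 powr j * norm h) powr (1 + c)) powr q * (2 powr (- (j * \<tau> * q)) * (if j \<in> I then A j else 0)))"
    if "c \<in> {0, 1}" "2 powr j * norm h \<le> 1" for c h
    using Fd[OF _ that] by (cases "j \<in> I") simp_all
  fix b :: 'a assume b: "b \<in> Basis"
  show "continuous_on UNIV (\<lambda>x. if j \<in> I then G j b x else 0)" using Gc b by (cases "j \<in> I") auto
  show "((\<lambda>t. if j \<in> I then F j (x + t *\<^sub>R b) else 0) has_real_derivative (if j \<in> I then G j b x else 0)) (at 0)" for x
    using der b by (cases "j \<in> I") auto
  show "pint q (\<lambda>x. if j \<in> I then G j b x else 0) \<le> ennreal (2 powr (- (j * (\<tau> - 1) * q)) * (if j \<in> I then A j else 0))"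
    using Gs[of j b] b by (cases "j \<in> I") auto
  show "pint q (delta 0 (\<lambda>x. if j \<in> I then G j b x else 0) h)
    \<le> ennreal ((2 powr j * norm h) powr q * (2 powr (- (j * (\<tau> - 1) * q)) * (if j \<in> I then A j else 0)))"
    if "2 powr j * norm h \<le> 1" for h
    using Gd[OF _ b that] by (cases "j \<in> I") simp_all
next
  fix S :: "int set" assume S: "finite S"
  have "(\<Sum>j\<in>S. if j \<in> I then A j else 0) = (\<Sum>j\<in>S \<inter> I. A j)"
    using S by (intro sum.mono_neutral_cong_right) auto
  also have "\<dots> \<le> B" using S by (intro B) auto
  finally show "(\<Sum>j\<in>S. if j \<in> I then A j else 0) \<le> B" .
next
  fix r
  show "\<exists>J. \<forall>j<J. \<forall>x. norm x \<le> r \<longrightarrow> (if j \<in> I then F j x else 0) = 0" using Fl[of r] by auto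
  show "\<exists>J. \<forall>j<J. \<forall>x. norm x \<le> r \<longrightarrow> (if j \<in> I then G j b x else 0) = 0" if "b \<in> Basis" for b using Gl[OF that, of r] by auto
next
  have e: "{j. (if j \<in> I then u j else 0) \<noteq> 0} = {j \<in> I. u j \<noteq> (0::real)}" for u by auto
  show "AE x in lborel. finite {j. (if j \<in> I then F j x else 0) \<noteq> 0}" unfolding e by (rule Ff)
  show "AE x in lborel. finite {j. (if j \<in> I then G j b x else 0) \<noteq> 0}" if "b \<in> Basis" for b unfolding e by (rule Gf[OF that])
qed

section \<open>Extension of charts by reflection\<close>

text \<open>Closed under sums, bilinear products and composition, so that the Lipschitz bound for
  the differential of the reflected map can be assembled from its factors.\<close>

definition bdd_lip :: "'a::real_normed_vector set \<Rightarrow> ('a \<Rightarrow> 'b::real_normed_vector) \<Rightarrow> bool" where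
  "bdd_lip S g \<longleftrightarrow> (\<exists>K. (\<forall>y\<in>S. norm (g y) \<le> K) \<and> (\<forall>y\<in>S. \<forall>z\<in>S. norm (g y - g z) \<le> K * norm (y - z)))"

lemma bdd_lipI:
  assumes "\<And>y. y \<in> S \<Longrightarrow> norm (g y) \<le> K" "\<And>y z. y \<in> S \<Longrightarrow> z \<in> S \<Longrightarrow> norm (g y - g z) \<le> L * norm (y - z)"
  shows "bdd_lip S g"
  unfolding bdd_lip_def
proof (intro exI[of _ "max K L"] conjI ballI)
  show "norm (g y) \<le> max K L" if "y \<in> S" for y using assms(1)[OF that] by simp
  show "norm (g y - g z) \<le> max K L * norm (y - z)" if "y \<in> S" "z \<in> S" for y z
    using assms(2)[OF that] mult_right_mono[of L "max K L" "norm (y - z)"] by simp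
qed

lemma bdd_lipE:
  assumes "bdd_lip S g"
  obtains K where "K \<ge> 0" "\<And>y. y \<in> S \<Longrightarrow> norm (g y) \<le> K" "\<And>y z. y \<in> S \<Longrightarrow> z \<in> S \<Longrightarrow> norm (g y - g z) \<le> K * norm (y - z)"
proof -
  obtain K where K: "\<forall>y\<in>S. norm (g y) \<le> K" "\<forall>y\<in>S. \<forall>z\<in>S. norm (g y - g z) \<le> K * norm (y - z)"
    using assms by (auto simp: bdd_lip_def)
  have "norm (g y - g z) \<le> max K 0 * norm (y - z)" if "y \<in> S" "z \<in> S" for y z
    using K(2) that mult_right_mono[of K "max K 0" "norm (y - z)"] by (meson max.cobounded1 norm_ge_zero order_trans)
  then show ?thesis using K by (intro that[of "max K 0"]) (auto simp: le_max_iff_disj)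
qed

lemma bdd_lip_const: "bdd_lip S (\<lambda>y. c)"
  by (rule bdd_lipI[of _ _ "norm c" 0]) auto

lemma bdd_lip_add: "bdd_lip S f \<Longrightarrow> bdd_lip S g \<Longrightarrow> bdd_lip S (\<lambda>y. f y + g y)"
proof -
  assume f: "bdd_lip S f" and g: "bdd_lip S g"
  obtain K where K: "\<And>y. y \<in> S \<Longrightarrow> norm (f y) \<le> K" "\<And>y z. y \<in> S \<Longrightarrow> z \<in> S \<Longrightarrow> norm (f y - f z) \<le> K * norm (y - z)"
    using bdd_lipE[OF f] by metis
  obtain L where L: "\<And>y. y \<in> S \<Longrightarrow> norm (g y) \<le> L" "\<And>y z. y \<in> S \<Longrightarrow> z \<in> S \<Longrightarrow> norm (g y - g z) \<le> L * norm (y - z)"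
    using bdd_lipE[OF g] by metis
  show ?thesis
  proof (rule bdd_lipI[of _ _ "K + L" "K + L"])
    show "norm (f y + g y) \<le> K + L" if "y \<in> S" for y
      using norm_triangle_ineq[of "f y" "g y"] K(1)[OF that] L(1)[OF that] by linarith
    show "norm (f y + g y - (f z + g z)) \<le> (K + L) * norm (y - z)" if "y \<in> S" "z \<in> S" for y z
      using norm_triangle_ineq[of "f y - f z" "g y - g z"] K(2)[OF that] L(2)[OF that]
      by (simp add: add_diff_add distrib_right)
  qed
qed

lemma bdd_lip_linear:
  assumes "bounded_linear T" "bdd_lip S f"
  shows "bdd_lip S (\<lambda>y. T (f y))"
proof -
  interpret bounded_linear T by (rule assms)
  obtain K where K: "\<And>y. y \<in> S \<Longrightarrow> norm (f y) \<le> K" "\<And>y z. y \<in> S \<Longrightarrow> z \<in> S \<Longrightarrow> norm (f y - f z) \<le> K * norm (y - z)"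
    using bdd_lipE[OF assms(2)] by metis
  obtain B where B: "B \<ge> 0" "\<And>x. norm (T x) \<le> norm x * B" using nonneg_bounded by blast
  show ?thesis
  proof (rule bdd_lipI)
    show "norm (T (f y)) \<le> K * B" if "y \<in> S" for y
      using B(2)[of "f y"] mult_right_mono[OF K(1)[OF that] B(1)] by linarith
    show "norm (T (f y) - T (f z)) \<le> (K * B) * norm (y - z)" if "y \<in> S" "z \<in> S" for y z
      using B(2)[of "f y - f z"] mult_right_mono[OF K(2)[OF that] B(1)] by (simp add: diff mult_ac)
  qed
qed

lemma bdd_lip_bilinear:
  assumes "bounded_bilinear mul" "bdd_lip S f" "bdd_lip S g"
  shows "bdd_lip S (\<lambda>y. mul (f y) (g y))"
proof -
  interpret bounded_bilinear mul by (rule assms)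
  obtain K where K: "K \<ge> 0" "\<And>y. y \<in> S \<Longrightarrow> norm (f y) \<le> K" "\<And>y z. y \<in> S \<Longrightarrow> z \<in> S \<Longrightarrow> norm (f y - f z) \<le> K * norm (y - z)"
    using bdd_lipE[OF assms(2)] by metis
  obtain L where L: "L \<ge> 0" "\<And>y. y \<in> S \<Longrightarrow> norm (g y) \<le> L" "\<And>y z. y \<in> S \<Longrightarrow> z \<in> S \<Longrightarrow> norm (g y - g z) \<le> L * norm (y - z)"
    using bdd_lipE[OF assms(3)] by metis
  obtain B where B: "B \<ge> 0" "\<And>a b. norm (mul a b) \<le> norm a * norm b * B" using nonneg_bounded by blast
  show ?thesis
  proof (rule bdd_lipI)
    show "norm (mul (f y) (g y)) \<le> K * L * B" if "y \<in> S" for y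
      by (rule order_trans[OF B(2)]) (intro mult_right_mono mult_mono K(2) L(2) that; use K L B in auto)
    show "norm (mul (f y) (g y) - mul (f z) (g z)) \<le> (2 * (K * L) * B) * norm (y - z)" if "y \<in> S" "z \<in> S" for y z
    proof -
      have "mul (f y) (g y) - mul (f z) (g z) = mul (f y - f z) (g y) + mul (f z) (g y - g z)"
        by (simp add: diff_left diff_right)
      then have "norm (mul (f y) (g y) - mul (f z) (g z)) \<le> norm (mul (f y - f z) (g y)) + norm (mul (f z) (g y - g z))"
        by (simp add: norm_triangle_ineq)
      also have "\<dots> \<le> (K * norm (y - z)) * L * B + K * (L * norm (y - z)) * B"
        by (intro add_mono order_trans[OF B(2)] mult_right_mono mult_mono K L that; use K L B in auto)
      finally show ?thesis by (simp add: algebra_simps)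
    qed
  qed
qed

lemma bdd_lip_mult:
  fixes f g :: "'a::real_normed_vector \<Rightarrow> real"
  shows "bdd_lip S f \<Longrightarrow> bdd_lip S g \<Longrightarrow> bdd_lip S (\<lambda>y. f y * g y)"
  by (rule bdd_lip_bilinear[OF bounded_bilinear_mult])

lemma bdd_lip_power:
  fixes f :: "'a::real_normed_vector \<Rightarrow> real"
  shows "bdd_lip S f \<Longrightarrow> bdd_lip S (\<lambda>y. f y ^ n)"
  by (induction n) (auto intro: bdd_lip_const bdd_lip_mult)

lemma bdd_lip_scaleR:
  "bdd_lip S f \<Longrightarrow> bdd_lip S g \<Longrightarrow> bdd_lip S (\<lambda>y. f y *\<^sub>R g y)"
  by (rule bdd_lip_bilinear[OF bounded_bilinear_scaleR])

lemma bdd_lip_diff: "bdd_lip S f \<Longrightarrow> bdd_lip S g \<Longrightarrow> bdd_lip S (\<lambda>y. f y - g y)"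
  using bdd_lip_add[of S f "\<lambda>y. - g y"] bdd_lip_linear[OF bounded_linear_minus[OF bounded_linear_ident], of S g] by simp

lemma bdd_lip_compose:
  assumes "bdd_lip T g" "bdd_lip S f" "\<And>y. y \<in> S \<Longrightarrow> f y \<in> T"
  shows "bdd_lip S (\<lambda>y. g (f y))"
proof -
  obtain K where K: "K \<ge> 0" "\<And>y. y \<in> T \<Longrightarrow> norm (g y) \<le> K" "\<And>y z. y \<in> T \<Longrightarrow> z \<in> T \<Longrightarrow> norm (g y - g z) \<le> K * norm (y - z)"
    using bdd_lipE[OF assms(1)] by metis
  obtain L where L: "\<And>y. y \<in> S \<Longrightarrow> norm (f y) \<le> L" "\<And>y z. y \<in> S \<Longrightarrow> z \<in> S \<Longrightarrow> norm (f y - f z) \<le> L * norm (y - z)"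
    using bdd_lipE[OF assms(2)] by metis
  show ?thesis
  proof (rule bdd_lipI)
    show "norm (g (f y)) \<le> K" if "y \<in> S" for y using K(2) assms(3) that by blast
    show "norm (g (f y) - g (f z)) \<le> (K * L) * norm (y - z)" if "y \<in> S" "z \<in> S" for y z
      using K(3)[OF assms(3)[OF that(1)] assms(3)[OF that(2)]] mult_left_mono[OF L(2)[OF that] K(1)] by (simp add: mult.assoc)
  qed
qed

text \<open>The map \<open>y \<mapsto> (r / |y|)\<^bsup>2n\<^esup> y\<close> fixes the sphere of radius \<open>r\<close>, sends its exterior into the ball,
  and has normal derivative \<open>1 - 2n\<close> on the sphere.  Hence the combination with coefficients \<open>2\<close>
  (for \<open>n = 1\<close>) and \<open>-1\<close> (for \<open>n = 2\<close>) reproduces values and gradients on the sphere.\<close>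

definition refl_map :: "real \<Rightarrow> nat \<Rightarrow> 'a::euclidean_space \<Rightarrow> 'a" where
  "refl_map r n y = (r / norm y) ^ (2 * n) *\<^sub>R y"

definition refl_deriv :: "real \<Rightarrow> nat \<Rightarrow> 'a::euclidean_space \<Rightarrow> 'a \<Rightarrow>\<^sub>L 'a" where
  "refl_deriv r n y = (r / norm y) ^ (2 * n) *\<^sub>R
     (id_blinfun - (2 * real n) *\<^sub>R (blinfun_scaleR_left (sgn y) o\<^sub>L blinfun_inner_left (sgn y)))"

lemma refl_map_sphere: "norm y = r \<Longrightarrow> r > 0 \<Longrightarrow> refl_map r n y = y"
  by (simp add: refl_map_def)

lemma refl_map_norm:
  assumes "r > 0" "norm y \<ge> r" "n > 0"
  shows "norm (refl_map r n y) \<le> r"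
proof -
  obtain l where n: "n = Suc l" using assms(3) gr0_implies_Suc by blast
  have y: "norm y > 0" using assms by linarith
  have "norm (refl_map r n y) = (r / norm y) ^ (2 * n) * norm y"
    using assms by (simp add: refl_map_def)
  also have "\<dots> = (r / norm y) ^ (2 * l + 1) * r"
    using y by (simp add: n field_simps)
  also have "\<dots> \<le> 1 * r"
    using assms y by (intro mult_right_mono power_le_one) auto
  finally show ?thesis by simp
qed

lemma refl_map_has_derivative:
  fixes y :: "'a::euclidean_space"
  assumes "y \<noteq> 0"
  shows "(refl_map r n has_derivative blinfun_apply (refl_deriv r n y)) (at y)"
proof -
  have eq: "refl_map r n z = ((r\<^sup>2 / (z \<bullet> z)) ^ n) *\<^sub>R z" for z :: 'a
    by (simp add: refl_map_def power_mult power_divide power2_norm_eq_inner)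
  have ny: "y \<bullet> y \<noteq> 0" using assms by simp
  have s: "((\<lambda>z. r\<^sup>2 / (z \<bullet> z)) has_derivative (\<lambda>v. - (r\<^sup>2 / (y \<bullet> y)) * (2 * (y \<bullet> v) / (y \<bullet> y)))) (at y)"
    using ny by (auto intro!: derivative_eq_intros simp: inner_commute field_simps)
  have p: "((\<lambda>z. (r\<^sup>2 / (z \<bullet> z)) ^ n) has_derivative (\<lambda>v. - ((r\<^sup>2 / (y \<bullet> y)) ^ n) * (2 * real n * (y \<bullet> v) / (y \<bullet> y)))) (at y)"
  proof (cases n)
    case (Suc l)
    show ?thesis
      by (rule has_derivative_eq_rhs[OF has_derivative_power[OF s]]) (auto simp: Suc fun_eq_iff)
  qed simp
  have "(refl_map r n has_derivative (\<lambda>v. ((r\<^sup>2 / (y \<bullet> y)) ^ n) *\<^sub>R v + (- ((r\<^sup>2 / (y \<bullet> y)) ^ n) * (2 * real n * (y \<bullet> v) / (y \<bullet> y))) *\<^sub>R y)) (at y)"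
    unfolding eq[abs_def] by (rule has_derivative_scaleR[OF p has_derivative_ident])
  moreover have "(\<lambda>v. ((r\<^sup>2 / (y \<bullet> y)) ^ n) *\<^sub>R v + (- ((r\<^sup>2 / (y \<bullet> y)) ^ n) * (2 * real n * (y \<bullet> v) / (y \<bullet> y))) *\<^sub>R y) = blinfun_apply (refl_deriv r n y)"
  proof
    fix v
    have e: "(r / norm y) ^ (2 * n) = (r\<^sup>2 / (y \<bullet> y)) ^ n"
      by (simp add: power_mult power_divide power2_norm_eq_inner)
    have f: "(v \<bullet> sgn y) *\<^sub>R sgn y = ((y \<bullet> v) / (y \<bullet> y)) *\<^sub>R y"
      by (simp add: sgn_div_norm inner_commute power2_norm_eq_inner[symmetric] power2_eq_square divide_inverse)
    have "blinfun_apply (refl_deriv r n y) v = (r\<^sup>2 / (y \<bullet> y)) ^ n *\<^sub>R (v - (2 * real n) *\<^sub>R ((v \<bullet> sgn y) *\<^sub>R sgn y))"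
      unfolding refl_deriv_def e
      by (simp add: blinfun.bilinear_simps blinfun_inner_left.rep_eq)
    also have "\<dots> = ((r\<^sup>2 / (y \<bullet> y)) ^ n) *\<^sub>R v + (- ((r\<^sup>2 / (y \<bullet> y)) ^ n) * (2 * real n * (y \<bullet> v) / (y \<bullet> y))) *\<^sub>R y"
      unfolding f by (simp add: scaleR_diff_right mult_ac)
    finally show "((r\<^sup>2 / (y \<bullet> y)) ^ n) *\<^sub>R v + (- ((r\<^sup>2 / (y \<bullet> y)) ^ n) * (2 * real n * (y \<bullet> v) / (y \<bullet> y))) *\<^sub>R y = blinfun_apply (refl_deriv r n y) v" ..
  qed
  ultimately show ?thesis by simp
qed

lemma bdd_lip_sgn:
  assumes "r > 0"
  shows "bdd_lip {y::'a::euclidean_space. norm y \<ge> r} sgn"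
proof (rule bdd_lipI)
  show "norm (sgn y) \<le> 1" for y :: 'a by (simp add: norm_sgn)
  show "norm (sgn y - sgn z) \<le> (2 / r) * norm (y - z)" if "y \<in> {y. norm y \<ge> r}" "z \<in> {y. norm y \<ge> r}" for y z :: 'a
  proof -
    have p: "norm y > 0" "norm z > 0" "norm y \<ge> r" using that assms by auto
    have "sgn y - sgn z = (y - z) /\<^sub>R norm y + ((norm z - norm y) / (norm y * norm z)) *\<^sub>R z"
    proof -
      have "(norm z - norm y) / (norm y * norm z) = inverse (norm y) - inverse (norm z)"
        using p by (simp add: field_simps)
      then show ?thesis by (simp only: sgn_div_norm scaleR_diff_right scaleR_diff_left) simp
    qed
    then have "norm (sgn y - sgn z) \<le> norm ((y - z) /\<^sub>R norm y) + norm (((norm z - norm y) / (norm y * norm z)) *\<^sub>R z)"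
      by (metis norm_triangle_ineq)
    also have "\<dots> = norm (y - z) / norm y + \<bar>norm z - norm y\<bar> / norm y"
      using p by (simp add: divide_inverse abs_mult)
    also have "\<dots> \<le> norm (y - z) / r + norm (y - z) / r"
      using p assms norm_triangle_ineq3[of z y] by (intro add_mono frac_le) (auto simp: norm_minus_commute)
    finally show ?thesis by simp
  qed
qed

lemma bdd_lip_inverse_norm:
  assumes "r > 0"
  shows "bdd_lip {y::'a::euclidean_space. norm y \<ge> r} (\<lambda>y. r / norm y)"
proof (rule bdd_lipI)
  show "norm (r / norm y) \<le> 1" if "y \<in> {y. norm y \<ge> r}" for y :: 'a using that assms by (auto simp: divide_le_eq_1)
  show "norm (r / norm y - r / norm z) \<le> (1 / r) * norm (y - z)" if "y \<in> {y. norm y \<ge> r}" "z \<in> {y. norm y \<ge> r}" for y z :: 'a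
  proof -
    have p: "norm y > 0" "norm z > 0" "norm y \<ge> r" "norm z \<ge> r" using that assms by auto
    have "\<bar>r / norm y - r / norm z\<bar> = r * \<bar>norm z - norm y\<bar> / (norm y * norm z)"
      using p assms by (simp add: diff_frac_eq abs_mult abs_divide flip: right_diff_distrib)
    also have "\<dots> \<le> r * norm (y - z) / (r * r)"
      using p assms norm_triangle_ineq3[of z y]
      by (intro frac_le mult_left_mono mult_mono) (auto simp: norm_minus_commute)
    finally show ?thesis using assms by simp
  qed
qed

lemma bdd_lip_refl_map:
  assumes "r > 0" "n > 0"
  shows "bdd_lip {y::'a::euclidean_space. norm y \<ge> r} (refl_map r n)"
proof -
  obtain l where n: "n = Suc l" using assms(2) gr0_implies_Suc by blast
  \<comment> \<open>Rewritten with \<open>sgn y\<close>, because the factor y is unbounded on the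
    exterior; one power of r / |y| compensates its length.\<close>
  have "bdd_lip {y::'a. norm y \<ge> r} (\<lambda>y. (r * (r / norm y) ^ (2 * l + 1)) *\<^sub>R sgn y)"
    by (intro bdd_lip_scaleR bdd_lip_mult bdd_lip_const bdd_lip_power bdd_lip_inverse_norm bdd_lip_sgn assms)
  moreover have "(r * (r / norm y) ^ (2 * l + 1)) *\<^sub>R sgn y = refl_map r n y" for y :: 'a
    by (cases "y = 0") (simp_all add: refl_map_def n sgn_div_norm divide_inverse mult_ac)
  ultimately show ?thesis by simp
qed

lemma bdd_lip_refl_deriv:
  assumes "r > 0"
  shows "bdd_lip {y::'a::euclidean_space. norm y \<ge> r} (refl_deriv r n)"
  unfolding refl_deriv_def[abs_def]
  by (intro bdd_lip_scaleR bdd_lip_diff bdd_lip_const bdd_lip_power bdd_lip_inverse_norm assms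
      bdd_lip_bilinear[OF bounded_bilinear_blinfun_compose] bdd_lip_linear[OF bounded_linear_blinfun_scaleR_left]
      bdd_lip_linear[OF bounded_linear_blinfun_inner_left] bdd_lip_sgn)

text \<open>Tangentially the combination gives 2 - 1 = 1, normally 2(1 - 2) - (1 - 4) = 1.\<close>

lemma refl_combination_sphere:
  "norm y = r \<Longrightarrow> r > 0 \<Longrightarrow> 2 *\<^sub>R refl_deriv r 1 y - refl_deriv r 2 y = id_blinfun"
proof (rule blinfun_eqI)
  fix v assume y: "norm y = r" "r > 0"
  define w where "w = (v \<bullet> sgn y) *\<^sub>R sgn y"
  have "blinfun_apply (2 *\<^sub>R refl_deriv r 1 y - refl_deriv r 2 y) v = 2 *\<^sub>R (v - 2 *\<^sub>R w) - (v - 4 *\<^sub>R w)"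
    using y by (simp add: refl_deriv_def blinfun.bilinear_simps blinfun_inner_left.rep_eq w_def)
  also have "\<dots> = v" by (simp add: scaleR_diff_right) (simp add: scaleR_2)
  finally show "blinfun_apply (2 *\<^sub>R refl_deriv r 1 y - refl_deriv r 2 y) v = blinfun_apply id_blinfun v" by simp
qed

text \<open>Map and differential are Lipschitz, hence extend to the closed ball. That the extended
  differential is still the derivative at boundary points follows from the quadratic Taylor
  estimate, which holds in the open ball and passes to the closed one along the dilations t y with t
  tending to 1 from below.\<close>

lemma continuous_extension_C1_ball:
  fixes f :: "'b::euclidean_space \<Rightarrow> 'a::euclidean_space" and f' :: "'b \<Rightarrow> 'b \<Rightarrow>\<^sub>L 'a"
  assumes r: "r > 0" and C: "C \<ge> 0" and der: "\<And>y. y \<in> ball 0 r \<Longrightarrow> (f has_derivative blinfun_apply (f' y)) (at y)"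
    and bd: "\<And>y. y \<in> ball 0 r \<Longrightarrow> norm (f' y) \<le> C"
    and lip: "\<And>y z. y \<in> ball 0 r \<Longrightarrow> z \<in> ball 0 r \<Longrightarrow> norm (f' y - f' z) \<le> C * norm (y - z)"
  obtains g g' where "\<And>y. y \<in> ball 0 r \<Longrightarrow> g y = f y" "\<And>y. y \<in> ball 0 r \<Longrightarrow> g' y = f' y"
    "\<And>y. y \<in> cball 0 r \<Longrightarrow> (g has_derivative blinfun_apply (g' y)) (at y within cball 0 r)"
    "bdd_lip (cball 0 r) g'"
proof -
  let ?B = "ball (0::'b) r"
  have cl: "closure ?B = cball 0 r" using r by simp
  have "C-lipschitz_on ?B f"
  proof (rule lipschitz_onI[OF _ C])
    fix y z assume "y \<in> ?B" "z \<in> ?B"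
    then show "dist (f y) (f z) \<le> C * dist y z"
      unfolding dist_norm
    proof (intro differentiable_bound[of ?B f "\<lambda>y. blinfun_apply (f' y)" C])
      show "(f has_derivative blinfun_apply (f' x)) (at x within ?B)" if "x \<in> ?B" for x
        by (rule has_derivative_at_withinI[OF der[OF that]])
      show "onorm (blinfun_apply (f' x)) \<le> C" if "x \<in> ?B" for x
        using bd[OF that] by (simp add: norm_blinfun.rep_eq)
    qed auto
  qed
  then obtain g where g: "C-lipschitz_on (cball 0 r) g" "\<And>y. y \<in> ?B \<Longrightarrow> g y = f y"
    using lipschitz_extend_closure[of C ?B f] cl by auto
  have "C-lipschitz_on ?B f'"
    by (rule lipschitz_onI[OF _ C]) (use lip in \<open>auto simp: dist_norm\<close>)
  then obtain g' where g': "C-lipschitz_on (cball 0 r) g'" "\<And>y. y \<in> ?B \<Longrightarrow> g' y = f' y"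
    using lipschitz_extend_closure[of C ?B f'] cl by auto
  have shrink: "((\<lambda>t. t *\<^sub>R y) \<longlongrightarrow> y) (at_left 1)" for y :: 'b
    by (rule tendsto_eq_intros | simp)+
  have evt: "eventually (\<lambda>t. t *\<^sub>R y \<in> ?B) (at_left (1::real))" if "y \<in> cball 0 r" for y :: 'b
  proof -
    have "eventually (\<lambda>t::real. t \<in> {0<..<1}) (at_left 1)"
      by (rule eventually_at_left_real) simp
    then show ?thesis
    proof eventually_elim
      case (elim t)
      have "t * norm y \<le> t * r" using that elim by (intro mult_left_mono) auto
      also have "\<dots> < r" using elim r by simp
      finally show ?case using elim by simp
    qed
  qed
  have lim: "((\<lambda>t. h (t *\<^sub>R y)) \<longlongrightarrow> h y) (at_left 1)" if "C-lipschitz_on (cball 0 r) h" "y \<in> cball 0 r" for y and h :: "'b \<Rightarrow> 'c::real_normed_vector"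
  proof -
    have "continuous_on (cball 0 r) h" using that(1) by (rule lipschitz_on_continuous_on)
    then show ?thesis
      by (rule continuous_on_tendsto_compose[OF _ shrink that(2)])
        (rule eventually_mono[OF evt[OF that(2)]], auto simp: less_imp_le)
  qed
  have taylor: "norm (g z - g y - g' y (z - y)) \<le> C * norm (z - y) ^ 2" if y: "y \<in> cball 0 r" and z: "z \<in> cball 0 r" for y z
  proof (rule tendsto_le[OF _ _ _ ])
    show "((\<lambda>t. C * norm (t *\<^sub>R z - t *\<^sub>R y) ^ 2) \<longlongrightarrow> C * norm (z - y) ^ 2) (at_left 1)"
      by (intro tendsto_intros shrink)
    show "((\<lambda>t. norm (g (t *\<^sub>R z) - g (t *\<^sub>R y) - g' (t *\<^sub>R y) (t *\<^sub>R z - t *\<^sub>R y))) \<longlongrightarrow> norm (g z - g y - g' y (z - y))) (at_left 1)"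
      by (intro tendsto_intros lim[OF g(1)] lim[OF g'(1)] shrink y z)
    show "\<forall>\<^sub>F t in at_left 1. norm (g (t *\<^sub>R z) - g (t *\<^sub>R y) - g' (t *\<^sub>R y) (t *\<^sub>R z - t *\<^sub>R y)) \<le> C * norm (t *\<^sub>R z - t *\<^sub>R y) ^ 2"
      using evt[OF y] evt[OF z]
    proof eventually_elim
      case (elim t)
      define a b where "a = t *\<^sub>R y" and "b = t *\<^sub>R z"
      have ab: "a \<in> ?B" "b \<in> ?B" using elim by (auto simp: a_def b_def)
      have seg: "a + u *\<^sub>R (b - a) \<in> closed_segment a b" if "u \<in> {0..1}" for u
        using that unfolding closed_segment_def mem_Collect_eq
        by (intro exI[of _ u]) (auto simp: algebra_simps)
      have sub: "closed_segment a b \<subseteq> ?B" using ab by (intro closed_segment_subset convex_ball) auto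
      have "norm (f b - f a - f' a (b - a)) \<le> norm (b - a) * (C * norm (b - a))"
      proof (rule differentiable_bound_linearization[OF seg])
        show "(f has_derivative blinfun_apply (f' x)) (at x within closed_segment a b)" if "x \<in> closed_segment a b" for x
          using der that sub by (blast intro: has_derivative_at_withinI)
        show "onorm (blinfun_apply (f' x) - blinfun_apply (f' a)) \<le> C * norm (b - a)" if x: "x \<in> closed_segment a b" for x
        proof -
          have "onorm (blinfun_apply (f' x) - blinfun_apply (f' a)) = norm (f' x - f' a)"
            by (simp add: norm_blinfun.rep_eq minus_blinfun.rep_eq fun_diff_def)
          also have "\<dots> \<le> C * norm (x - a)" using lip x sub ab by blast
          also have "\<dots> \<le> C * norm (b - a)"
            using segment_bound(1)[OF x] C by (intro mult_left_mono) (auto simp: norm_minus_commute)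
          finally show ?thesis .
        qed
      qed auto
      then show ?case
        using ab g(2) g'(2) by (simp add: a_def[symmetric] b_def[symmetric] power2_eq_square mult_ac)
    qed
  qed simp
  have der: "(g has_derivative blinfun_apply (g' y)) (at y within cball 0 r)" if y: "y \<in> cball 0 r" for y
    unfolding has_derivative_within_alt
  proof (intro conjI allI impI)
    show "bounded_linear (blinfun_apply (g' y))" by (rule blinfun.bounded_linear_right)
    fix e :: real assume e: "e > 0"
    show "\<exists>d>0. \<forall>z\<in>cball 0 r. norm (z - y) < d \<longrightarrow> norm (g z - g y - g' y (z - y)) \<le> e * norm (z - y)"
    proof (intro exI[of _ "e / (C + 1)"] conjI ballI impI)
      show "0 < e / (C + 1)" using e C by simp
      fix z :: 'b assume z: "z \<in> cball 0 r" "norm (z - y) < e / (C + 1)"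
      have "C * norm (z - y) \<le> (C + 1) * norm (z - y)" by (simp add: distrib_right)
      also have "\<dots> \<le> e" using z(2) C by (simp add: field_simps)
      finally have "C * norm (z - y) * norm (z - y) \<le> e * norm (z - y)" by (rule mult_right_mono) simp
      then show "norm (g z - g y - g' y (z - y)) \<le> e * norm (z - y)"
        using taylor[OF y z(1)] by (simp add: power2_eq_square mult.assoc)
    qed
  qed
  have "bdd_lip (cball 0 r) g'"
  proof (rule bdd_lipI)
    show l: "norm (g' y - g' z) \<le> C * norm (y - z)" if "y \<in> cball 0 r" "z \<in> cball 0 r" for y z
      using lipschitz_onD[OF g'(1) that] by (simp add: dist_norm)
    show "norm (g' y) \<le> norm (g' 0) + C * r" if "y \<in> cball 0 r" for y
    proof -
      have "norm (g' y - g' 0) \<le> C * norm (y - 0)" using that r by (intro l) auto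
      also have "\<dots> \<le> C * r" using that C by (intro mult_left_mono) auto
      finally show ?thesis using norm_triangle_ineq2[of "g' y" "g' 0"] by linarith
    qed
  qed
  then show ?thesis using that[of g g'] g(2) g'(2) der by blast
qed

text \<open>The ball keeps the given map, and the exterior receives the combination of its two
  reflections. On the sphere both definitions agree together with their differentials, so the
  derivatives within the two closed pieces fit together to one derivative.\<close>

lemma C11_extension:
  fixes f :: "'b::euclidean_space \<Rightarrow> 'a::euclidean_space" and f' :: "'b \<Rightarrow> 'b \<Rightarrow>\<^sub>L 'a"
  assumes r: "r > 0" and C: "C \<ge> 0" and der: "\<And>y. y \<in> ball 0 r \<Longrightarrow> (f has_derivative blinfun_apply (f' y)) (at y)"
    and bd: "\<And>y. y \<in> ball 0 r \<Longrightarrow> norm (f' y) \<le> C"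
    and lip: "\<And>y z. y \<in> ball 0 r \<Longrightarrow> z \<in> ball 0 r \<Longrightarrow> norm (f' y - f' z) \<le> C * norm (y - z)"
  obtains F D where "\<And>y. y \<in> ball 0 r \<Longrightarrow> F y = f y" "\<And>y. y \<in> ball 0 r \<Longrightarrow> D y = f' y"
    "\<And>y. (F has_derivative blinfun_apply (D y)) (at y)" "bdd_lip UNIV D"
proof -
  obtain g g' where g: "\<And>y. y \<in> ball 0 r \<Longrightarrow> g y = f y" "\<And>y. y \<in> ball 0 r \<Longrightarrow> g' y = f' y"
    "\<And>y. y \<in> cball 0 r \<Longrightarrow> (g has_derivative blinfun_apply (g' y)) (at y within cball 0 r)"
    "bdd_lip (cball 0 r) g'"
    using continuous_extension_C1_ball[OF r C der bd lip] by metis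
  let ?S = "{y::'b. norm y \<ge> r}"
  define F where "F y = (if norm y \<le> r then g y else 2 *\<^sub>R g (refl_map r 1 y) - g (refl_map r 2 y))" for y
  define D where "D y = (if norm y \<le> r then g' y else
      2 *\<^sub>R (g' (refl_map r 1 y) o\<^sub>L refl_deriv r 1 y) - (g' (refl_map r 2 y) o\<^sub>L refl_deriv r 2 y))" for y
  have FS: "F y = 2 *\<^sub>R g (refl_map r 1 y) - g (refl_map r 2 y)" if "norm y \<ge> r" for y
  proof (cases "norm y = r")
    case True
    then show ?thesis using r by (simp add: F_def refl_map_sphere scaleR_2)
  next
    case False
    then show ?thesis using that by (simp add: F_def)
  qed
  have DS: "D y = 2 *\<^sub>R (g' (refl_map r 1 y) o\<^sub>L refl_deriv r 1 y) - (g' (refl_map r 2 y) o\<^sub>L refl_deriv r 2 y)" if "norm y \<ge> r" for y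
  proof (cases "norm y = r")
    case True
    have "2 *\<^sub>R (g' y o\<^sub>L refl_deriv r 1 y) - (g' y o\<^sub>L refl_deriv r 2 y) = g' y o\<^sub>L (2 *\<^sub>R refl_deriv r 1 y - refl_deriv r 2 y)"
      by (rule blinfun_eqI) (simp add: blinfun.bilinear_simps)
    also have "\<dots> = g' y" unfolding refl_combination_sphere[OF True r] by (rule blinfun_eqI) simp
    finally show ?thesis using True r by (simp add: D_def refl_map_sphere)
  next
    case False
    then show ?thesis using that by (simp add: D_def)
  qed
  have dc: "(F has_derivative blinfun_apply (D y)) (at y within cball 0 r)" if "norm y \<le> r" for y
    by (rule has_derivative_transform[of y "cball 0 r" F g]) (use that g(3) in \<open>auto simp: F_def D_def\<close>)
  have chain: "((\<lambda>y. g (refl_map r n y)) has_derivative (\<lambda>v. g' (refl_map r n y) (refl_deriv r n y v))) (at y within ?S)"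
    if "norm y \<ge> r" "n > 0" for y n
  proof (rule has_derivative_in_compose2[OF g(3)])
    show "refl_map r n ` ?S \<subseteq> cball 0 r" using refl_map_norm[OF r _ that(2)] by auto
    show "y \<in> ?S" using that by simp
    show "(refl_map r n has_derivative blinfun_apply (refl_deriv r n y)) (at y within ?S)"
      by (rule has_derivative_at_withinI[OF refl_map_has_derivative]) (use that r in auto)
  qed
  have ds: "(F has_derivative blinfun_apply (D y)) (at y within ?S)" if "norm y \<ge> r" for y
  proof (rule has_derivative_transform[of y ?S F "\<lambda>y. 2 *\<^sub>R g (refl_map r 1 y) - g (refl_map r 2 y)"])
    have "((\<lambda>y. 2 *\<^sub>R g (refl_map r 1 y) - g (refl_map r 2 y)) has_derivative
      (\<lambda>v. 2 *\<^sub>R g' (refl_map r 1 y) (refl_deriv r 1 y v) - g' (refl_map r 2 y) (refl_deriv r 2 y v))) (at y within ?S)"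
      by (intro has_derivative_diff has_derivative_scaleR_right chain that) auto
    moreover have "blinfun_apply (D y) = (\<lambda>v. 2 *\<^sub>R g' (refl_map r 1 y) (refl_deriv r 1 y v) - g' (refl_map r 2 y) (refl_deriv r 2 y v))"
      unfolding DS[OF that] by (simp add: fun_eq_iff blinfun.bilinear_simps)
    ultimately show "((\<lambda>y. 2 *\<^sub>R g (refl_map r 1 y) - g (refl_map r 2 y)) has_derivative blinfun_apply (D y)) (at y within ?S)" by simp
  qed (use that FS in auto)
  \<comment> \<open>A point outside a closed piece has a neighbourhood missing it, so the estimate
    there is vacuous; hence both pieces can be treated alike at every point.\<close>
  have piece: "\<exists>d>0. \<forall>z\<in>T. norm (z - y) < d \<longrightarrow> norm (F z - F y - D y (z - y)) \<le> e * norm (z - y)"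
    if "closed T" "y \<in> T \<Longrightarrow> (F has_derivative blinfun_apply (D y)) (at y within T)" "e > 0" for T y e
  proof (cases "y \<in> T")
    case True
    then show ?thesis using that(2,3) unfolding has_derivative_within_alt by blast
  next
    case False
    have "open (- T)" using that(1) by (rule open_Compl)
    then obtain d where "d > 0" "ball y d \<subseteq> - T" using False unfolding open_contains_ball by blast
    then show ?thesis by (intro exI[of _ d]) (auto simp: subset_eq dist_norm norm_minus_commute)
  qed
  have der': "(F has_derivative blinfun_apply (D y)) (at y)" for y
    unfolding has_derivative_at_alt
  proof (intro conjI allI impI)
    show "bounded_linear (blinfun_apply (D y))" by (rule blinfun.bounded_linear_right)
    fix e :: real assume e: "e > 0"
    obtain d1 where d1: "d1 > 0" "\<forall>z\<in>cball 0 r. norm (z - y) < d1 \<longrightarrow> norm (F z - F y - D y (z - y)) \<le> e * norm (z - y)"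
      using piece[of "cball 0 r" y e] dc[of y] e by auto
    have "closed ?S" by (intro closed_Collect_le continuous_intros)
    then obtain d2 where d2: "d2 > 0" "\<forall>z\<in>?S. norm (z - y) < d2 \<longrightarrow> norm (F z - F y - D y (z - y)) \<le> e * norm (z - y)"
      using piece[of ?S y e] ds[of y] e by auto
    show "\<exists>d>0. \<forall>z. norm (z - y) < d \<longrightarrow> norm (F z - F y - D y (z - y)) \<le> e * norm (z - y)"
    proof (intro exI[of _ "min d1 d2"] conjI allI impI)
      fix z assume "norm (z - y) < min d1 d2"
      then show "norm (F z - F y - D y (z - y)) \<le> e * norm (z - y)"
        using d1(2) d2(2) by (cases "norm z \<le> r") auto
    qed (use d1 d2 in auto)
  qed
  have lc: "bdd_lip (cball 0 r) D"
    using g(4) unfolding bdd_lip_def D_def by simp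
  have "bdd_lip ?S (\<lambda>y. 2 *\<^sub>R (g' (refl_map r 1 y) o\<^sub>L refl_deriv r 1 y) - (g' (refl_map r 2 y) o\<^sub>L refl_deriv r 2 y))"
  proof -
    have c: "bdd_lip ?S (\<lambda>y. g' (refl_map r n y))" if "n > 0" for n
      by (rule bdd_lip_compose[OF g(4) bdd_lip_refl_map[OF r that]]) (use refl_map_norm[OF r _ that] in auto)
    show ?thesis
      by (intro bdd_lip_diff bdd_lip_scaleR bdd_lip_const bdd_lip_bilinear[OF bounded_bilinear_blinfun_compose] c bdd_lip_refl_deriv r) auto
  qed
  then have ls: "bdd_lip ?S D"
    unfolding bdd_lip_def by (auto simp: DS)
  obtain K where K: "K \<ge> 0" "\<And>y. y \<in> cball 0 r \<Longrightarrow> norm (D y) \<le> K" "\<And>y z. y \<in> cball 0 r \<Longrightarrow> z \<in> cball 0 r \<Longrightarrow> norm (D y - D z) \<le> K * norm (y - z)"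
    using bdd_lipE[OF lc] by metis
  obtain L where L: "L \<ge> 0" "\<And>y. y \<in> ?S \<Longrightarrow> norm (D y) \<le> L" "\<And>y z. y \<in> ?S \<Longrightarrow> z \<in> ?S \<Longrightarrow> norm (D y - D z) \<le> L * norm (y - z)"
    using bdd_lipE[OF ls] by metis
  \<comment> \<open>The segment from y to z crosses the sphere at some w, where both Lipschitz
    bounds are available; the parts of the segment are no longer than the whole.\<close>
  have mixed: "norm (D y - D z) \<le> (K + L) * norm (y - z)" if "norm y \<le> r" "norm z \<ge> r" for y z
  proof -
    have "\<exists>t\<ge>0. t \<le> 1 \<and> norm (y + t *\<^sub>R (z - y)) = r"
      using that by (intro IVT') (auto intro!: continuous_intros)
    then obtain t where t: "t \<ge> 0" "t \<le> 1" "norm (y + t *\<^sub>R (z - y)) = r" by blast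
    moreover have "y + t *\<^sub>R (z - y) \<in> closed_segment y z"
      unfolding closed_segment_def mem_Collect_eq using t by (intro exI[of _ t]) (auto simp: algebra_simps)
    ultimately obtain w where w: "w \<in> closed_segment y z" "norm w = r" by blast
    have "norm (D y - D z) \<le> norm (D y - D w) + norm (D w - D z)"
      using norm_triangle_ineq[of "D y - D w" "D w - D z"] by simp
    also have "\<dots> \<le> K * norm (y - w) + L * norm (w - z)"
      using that w by (intro add_mono K(3) L(3)) auto
    also have "\<dots> \<le> K * norm (y - z) + L * norm (y - z)"
      using segment_bound[OF w(1)] K L by (intro add_mono mult_left_mono) (auto simp: norm_minus_commute)
    finally show ?thesis by (simp add: distrib_right)
  qed
  have "bdd_lip UNIV D"
  proof (rule bdd_lipI)
    show "norm (D y) \<le> K + L" for y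
    proof (cases "norm y \<le> r")
      case True
      then show ?thesis using K(2)[of y] L(1) by auto
    next
      case False
      then show ?thesis using L(2)[of y] K(1) by auto
    qed
    show "norm (D y - D z) \<le> (K + L) * norm (y - z)" for y z
    proof -
      consider "norm y \<le> r" "norm z \<le> r" | "norm y \<ge> r" "norm z \<ge> r" | "norm y \<le> r" "norm z \<ge> r" | "norm y \<ge> r" "norm z \<le> r" by linarith
      then show ?thesis
      proof cases
        case 1
        then show ?thesis using K(3)[of y z] mult_nonneg_nonneg[OF L(1) norm_ge_zero[of "y - z"]] by (simp add: distrib_right)
      next
        case 2
        then show ?thesis using L(3)[of y z] mult_nonneg_nonneg[OF K(1) norm_ge_zero[of "y - z"]] by (simp add: distrib_right)
      next
        case 3
        then show ?thesis by (rule mixed)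
      next
        case 4
        then show ?thesis using mixed[of z y] by (simp add: norm_minus_commute)
      qed
    qed
  qed
  show ?thesis
    by (rule that[OF _ _ der' \<open>bdd_lip UNIV D\<close>]) (use g(1,2) in \<open>auto simp: F_def D_def\<close>)
qed

text \<open>Nondegeneracy makes F expand distances below \<delta> by at least c/2. Within a ball of
  radius \<delta>/2, two points mapped \<rho>-close to x are thus at distance at most 4\<rho>/c.
  Finitely many such balls cover the large ball, so F need not be injective. The exponent is the
  dimension of the boundary, not that of the surrounding space.\<close>

lemma expanding_preimage_measure:
  fixes F :: "'b::euclidean_space \<Rightarrow> 'a::euclidean_space"
  assumes r: "0 < r" "r < r1" and der: "\<And>y. (F has_derivative blinfun_apply (D y)) (at y)"
    and L: "L > 0" "\<And>y z. norm (D y - D z) \<le> L * norm (y - z)"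
    and c: "c > 0" "\<And>y v. norm y \<le> r1 \<Longrightarrow> c * norm v \<le> norm (D y v)"
  obtains V where "V \<ge> 0" "\<And>x \<rho>. \<rho> > 0 \<Longrightarrow> emeasure lborel {y \<in> cball 0 r1. norm (F y - x) \<le> \<rho>} \<le> ennreal (V * \<rho> ^ DIM('b))"
proof -
  \<comment> \<open>At distance \<delta> the linearization error L |z - y|^2 uses up at most half of
    the lower bound c |z - y|.\<close>
  define \<delta> where "\<delta> = c / (2 * L)"
  have \<delta>: "\<delta> > 0" using c L by (simp add: \<delta>_def)
  have cont: "continuous_on S F" for S
    by (intro continuous_at_imp_continuous_on ballI has_derivative_continuous[OF der])
  have expand: "c / 2 * norm (z - y) \<le> norm (F z - F y)" if "norm y \<le> r1" "norm (z - y) \<le> \<delta>" for y z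
  proof -
    have "norm (F z - F y - D y (z - y)) \<le> norm (z - y) * (L * norm (z - y))"
    proof (rule differentiable_bound_linearization[where S="closed_segment y z" and f'="\<lambda>y. blinfun_apply (D y)"])
      show "y + t *\<^sub>R (z - y) \<in> closed_segment y z" if "t \<in> {0..1}" for t
        using that unfolding closed_segment_def mem_Collect_eq by (intro exI[of _ t]) (auto simp: algebra_simps)
      show "(F has_derivative blinfun_apply (D w)) (at w within closed_segment y z)" for w
        by (rule has_derivative_at_withinI[OF der])
      show "onorm (blinfun_apply (D w) - blinfun_apply (D y)) \<le> L * norm (z - y)" if w: "w \<in> closed_segment y z" for w
      proof -
        have "onorm (blinfun_apply (D w) - blinfun_apply (D y)) = norm (D w - D y)"
          by (simp add: norm_blinfun.rep_eq minus_blinfun.rep_eq fun_diff_def)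
        also have "\<dots> \<le> L * norm (w - y)" by (rule L)
        also have "\<dots> \<le> L * norm (z - y)"
          using segment_bound(1)[OF w] L by (intro mult_left_mono) (auto simp: norm_minus_commute)
        finally show ?thesis .
      qed
    qed auto
    moreover have "norm (z - y) * (L * norm (z - y)) \<le> norm (z - y) * (c / 2)"
    proof (rule mult_left_mono)
      have "L * norm (z - y) \<le> L * \<delta>" using that L by (intro mult_left_mono) auto
      then show "L * norm (z - y) \<le> c / 2" using L by (simp add: \<delta>_def)
    qed simp
    moreover have "c * norm (z - y) \<le> norm (D y (z - y))" by (rule c(2)[OF that(1)])
    moreover have "norm (D y (z - y)) \<le> norm (F z - F y) + norm (F z - F y - D y (z - y))"
      using norm_triangle_ineq4[of "F z - F y" "F z - F y - D y (z - y)"] by simp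
    ultimately show ?thesis by (simp add: algebra_simps)
  qed
  obtain T where T: "finite T" "cball (0::'b) r1 \<subseteq> (\<Union>t\<in>T. ball t (\<delta> / 2))"
  proof -
    have "\<forall>e>0. \<exists>T. finite T \<and> cball (0::'b) r1 \<subseteq> (\<Union>t\<in>T. ball t e)"
      using compact_cball[of "0::'b" r1] unfolding compact_eq_totally_bounded by (rule conjunct2)
    then show ?thesis using \<delta> that by (metis half_gt_zero)
  qed
  define V where "V = real (card T) * (unit_ball_vol (DIM('b)) * (4 / c) ^ DIM('b))"
  show ?thesis
  proof (rule that[of V])
    show "V \<ge> 0" using c by (simp add: V_def)
    fix x :: 'a and \<rho> :: real assume \<rho>: "\<rho> > 0"
    define S where "S t = {y \<in> cball 0 r1. norm (F y - x) \<le> \<rho>} \<inter> cball t (\<delta> / 2)" for t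
    have cl: "closed {y \<in> cball 0 r1. norm (F y - x) \<le> \<rho>}"
    proof -
      have "{y \<in> cball 0 r1. norm (F y - x) \<le> \<rho>} = cball 0 r1 \<inter> {y. norm (F y - x) \<le> \<rho>}" by auto
      moreover have "closed {y. norm (F y - x) \<le> \<rho>}" by (intro closed_Collect_le continuous_intros cont)
      ultimately show ?thesis by auto
    qed
    have S: "emeasure lborel (S t) \<le> ennreal (unit_ball_vol (DIM('b)) * (4 / c) ^ DIM('b) * \<rho> ^ DIM('b))" for t
    proof (cases "S t = {}")
      case False
      then obtain y where y: "y \<in> S t" by blast
      have "S t \<subseteq> cball y (4 / c * \<rho>)"
      proof
        fix z assume z: "z \<in> S t"
        have "dist z y \<le> \<delta>" using dist_triangle_half_r[of t z \<delta> y] y z dist_triangle3[of z y t] by (auto simp: S_def)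
        then have "c / 2 * norm (z - y) \<le> norm (F z - F y)"
          using y by (intro expand) (auto simp: S_def dist_norm)
        also have "\<dots> \<le> norm (F z - x) + norm (F y - x)"
          using norm_triangle_ineq4[of "F z - x" "F y - x"] by simp
        also have "\<dots> \<le> 2 * \<rho>" using y z by (auto simp: S_def)
        finally show "z \<in> cball y (4 / c * \<rho>)"
          using c by (simp add: dist_norm norm_minus_commute field_simps)
      qed
      then have "emeasure lborel (S t) \<le> emeasure lborel (cball y (4 / c * \<rho>))"
        by (intro emeasure_mono) auto
      also have "\<dots> = ennreal (unit_ball_vol (DIM('b)) * (4 / c * \<rho>) ^ DIM('b))"
        using c \<rho> by (intro emeasure_cball) auto
      finally show ?thesis by (simp only: power_mult_distrib mult.assoc)
    qed simp
    have "{y \<in> cball 0 r1. norm (F y - x) \<le> \<rho>} \<subseteq> (\<Union>t\<in>T. S t)"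
    proof
      fix y assume y: "y \<in> {y \<in> cball 0 r1. norm (F y - x) \<le> \<rho>}"
      then have "y \<in> cball 0 r1" by simp
      then obtain t where t: "t \<in> T" "y \<in> ball t (\<delta> / 2)" using T(2) by blast
      then have "y \<in> cball t (\<delta> / 2)" by simp
      then have "y \<in> S t" using y unfolding S_def by (rule IntI[rotated])
      then show "y \<in> (\<Union>t\<in>T. S t)" using t(1) by (rule UN_I[rotated])
    qed
    then have "emeasure lborel {y \<in> cball 0 r1. norm (F y - x) \<le> \<rho>} \<le> emeasure lborel (\<Union>t\<in>T. S t)"
      using cl T(1) by (intro emeasure_mono sets.finite_UN) (auto simp: S_def)
    also have "\<dots> \<le> (\<Sum>t\<in>T. emeasure lborel (S t))"
      using cl T(1) by (intro emeasure_subadditive_finite) (auto simp: S_def)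
    also have "\<dots> \<le> (\<Sum>t\<in>T. ennreal (unit_ball_vol (DIM('b)) * (4 / c) ^ DIM('b) * \<rho> ^ DIM('b)))"
      by (rule sum_mono[OF S])
    also have "\<dots> = ennreal (V * \<rho> ^ DIM('b))"
      using c \<rho> by (simp add: V_def ennreal_mult' ennreal_of_nat_eq_real_of_nat mult.assoc)
    finally show "emeasure lborel {y \<in> cball 0 r1. norm (F y - x) \<le> \<rho>} \<le> ennreal (V * \<rho> ^ DIM('b))" .
  qed
qed

text \<open>Atoms meeting the edge of a chart must be cut off outside it, so the chart has to be
  extended a little beyond its ball with its nondegeneracy, and with it the measure bound,
  preserved.\<close>

lemma chart_extension:
  fixes \<Psi> :: "'b::euclidean_space \<Rightarrow> 'a::euclidean_space"
  assumes r: "r > 0" and par: "C2_parametrization (ball 0 r) \<Psi>"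
  obtains F D r1 V L where "r < r1" "\<And>y. y \<in> ball 0 r \<Longrightarrow> F y = \<Psi> y"
    "\<And>y. (F has_derivative blinfun_apply (D y)) (at y)"
    "L \<ge> 1" "\<And>y. norm (D y) \<le> L" "\<And>y z. norm (D y - D z) \<le> L * norm (y - z)"
    "V \<ge> 0" "\<And>x \<rho>. \<rho> > 0 \<Longrightarrow> emeasure lborel {y \<in> cball 0 r1. norm (F y - x) \<le> \<rho>} \<le> ennreal (V * \<rho> ^ DIM('b))"
proof -
  obtain \<Psi>' where "\<exists>\<Psi>''. C2_derivs_on (ball 0 r) \<Psi> \<Psi>' \<Psi>'' \<and> (\<exists>c>0. \<exists>C. \<forall>y\<in>ball 0 r.
      norm (\<Psi>' y) \<le> C \<and> norm (\<Psi>'' y) \<le> C \<and> (\<forall>v. c * norm v \<le> norm (\<Psi>' y v)))"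
    using par unfolding C2_parametrization_def by (rule exE) (rule that)
  then obtain \<Psi>'' where 12: "C2_derivs_on (ball 0 r) \<Psi> \<Psi>' \<Psi>'' \<and> (\<exists>c>0. \<exists>C. \<forall>y\<in>ball 0 r.
      norm (\<Psi>' y) \<le> C \<and> norm (\<Psi>'' y) \<le> C \<and> (\<forall>v. c * norm v \<le> norm (\<Psi>' y v)))"
    by (rule exE) (rule that)
  note 1 = conjunct1[OF 12] and 2 = conjunct2[OF 12]
  obtain c C where 3: "c > 0" "\<forall>y\<in>ball 0 r.
      norm (\<Psi>' y) \<le> C \<and> norm (\<Psi>'' y) \<le> C \<and> (\<forall>v. c * norm v \<le> norm (\<Psi>' y v))"
    using 2 by (elim exE conjE) (rule that)
  have P: "C2_derivs_on (ball 0 r) \<Psi> \<Psi>' \<Psi>''" "c > 0"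
    "\<And>y. y \<in> ball 0 r \<Longrightarrow> norm (\<Psi>' y) \<le> C" "\<And>y. y \<in> ball 0 r \<Longrightarrow> norm (\<Psi>'' y) \<le> C"
    "\<And>y v. y \<in> ball 0 r \<Longrightarrow> c * norm v \<le> norm (\<Psi>' y v)"
    using 1 3 by auto
  have C: "C \<ge> 0" using P(3)[of 0] r norm_ge_zero[of "\<Psi>' 0"] by (simp, linarith)
  have der: "(\<Psi> has_derivative blinfun_apply (\<Psi>' y)) (at y)" if "y \<in> ball 0 r" for y
    using P(1) that by (auto simp: C2_derivs_on_def)
  have lip: "norm (\<Psi>' y - \<Psi>' z) \<le> C * norm (y - z)" if "y \<in> ball 0 r" "z \<in> ball 0 r" for y z
  proof (rule differentiable_bound[of "ball 0 r" \<Psi>' "\<lambda>y. blinfun_apply (\<Psi>'' y)" C])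
    show "(\<Psi>' has_derivative blinfun_apply (\<Psi>'' x)) (at x within ball 0 r)" if "x \<in> ball 0 r" for x
      by (rule has_derivative_at_withinI) (use P(1) that in \<open>auto simp: C2_derivs_on_def\<close>)
    show "onorm (blinfun_apply (\<Psi>'' x)) \<le> C" if "x \<in> ball 0 r" for x
      using P(4)[OF that] by (simp add: norm_blinfun.rep_eq)
  qed (use that in auto)
  obtain F D where F: "\<And>y. y \<in> ball 0 r \<Longrightarrow> F y = \<Psi> y" "\<And>y. y \<in> ball 0 r \<Longrightarrow> D y = \<Psi>' y"
    "\<And>y. (F has_derivative blinfun_apply (D y)) (at y)" "bdd_lip UNIV D"
    by (rule C11_extension[OF r C der P(3) lip]) (assumption | rule that)+
  obtain K where K: "\<And>y. norm (D y) \<le> K" "\<And>y z. norm (D y - D z) \<le> K * norm (y - z)"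
    by (rule bdd_lipE[OF F(4)]) (rule that, auto)
  define L where "L = max K 1"
  have L: "L \<ge> 1" "\<And>y. norm (D y) \<le> L" "\<And>y z. norm (D y - D z) \<le> L * norm (y - z)"
  proof -
    show "L \<ge> 1" by (simp add: L_def)
    show "norm (D y) \<le> L" for y using K(1)[of y] by (simp add: L_def)
    show "norm (D y - D z) \<le> L * norm (y - z)" for y z
      using K(2)[of y z] mult_right_mono[of K L "norm (y - z)"] by (simp add: L_def)
  qed
  \<comment> \<open>Every point of the enlarged ball is within 2e of a point of the open ball; there
    the differential changes by at most 2eL \<le> c/2, which leaves the lower bound c/2.\<close>
  define e where "e = min (c / (4 * L)) 1"
  have e: "e > 0" "e \<le> c / (4 * L)" using P(2) L by (auto simp: e_def)
  define r1 where "r1 = r + e"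
  have low: "(c / 2) * norm v \<le> norm (D y v)" if y: "norm y \<le> r1" for y v
  proof -
    obtain y0 where y0: "y0 \<in> ball 0 r" "norm (y - y0) \<le> 2 * e"
    proof (cases "norm y < r")
      case True
      then show ?thesis using that[of y] e by simp
    next
      case False
      \<comment> \<open>Moves y towards the origin by 2e, or to the origin itself; as |y| \<le> r +
        e the new point lies strictly inside the ball.\<close>
      define t where "t = max 0 (1 - 2 * e / norm y)"
      have ny: "norm y > 0" using False r by linarith
      have t: "t \<ge> 0" "1 - t \<ge> 0" "(1 - t) * norm y \<le> 2 * e" "t * norm y < r"
      proof -
        show "t \<ge> 0" "1 - t \<ge> 0" using e ny by (auto simp: t_def)
        have "1 - t \<le> 2 * e / norm y" by (simp add: t_def)
        then show "(1 - t) * norm y \<le> 2 * e" using ny by (simp add: pos_le_divide_eq)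
        have "t * norm y = max 0 (norm y - 2 * e)"
          using ny by (simp add: t_def max_mult_distrib_right left_diff_distrib)
        then show "t * norm y < r" using y e r by (simp add: r1_def)
      qed
      have "norm (y - t *\<^sub>R y) = (1 - t) * norm y"
        using t by (metis abs_of_nonneg norm_scaleR scaleR_diff_left scaleR_one)
      then show ?thesis using that[of "t *\<^sub>R y"] t by simp
    qed
    have "c * norm v \<le> norm (D y0 v)" using P(5)[OF y0(1)] F(2)[OF y0(1)] by simp
    also have "\<dots> \<le> norm (D y v) + norm (D y0 v - D y v)"
      using norm_triangle_ineq[of "D y v" "D y0 v - D y v"] by simp
    also have "norm (D y0 v - D y v) \<le> norm (D y0 - D y) * norm v"
      by (metis blinfun.diff_left norm_blinfun)
    also have "\<dots> \<le> (L * (2 * e)) * norm v"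
    proof (rule mult_right_mono)
      have "norm (D y0 - D y) \<le> L * norm (y0 - y)" by (rule L)
      also have "\<dots> \<le> L * (2 * e)" using y0 L by (intro mult_left_mono) (auto simp: norm_minus_commute)
      finally show "norm (D y0 - D y) \<le> L * (2 * e)" .
    qed simp
    also have "\<dots> \<le> (c / 2) * norm v"
      using e L by (intro mult_right_mono) (auto simp: field_simps)
    finally show ?thesis by (simp add: algebra_simps)
  qed
  obtain V where V: "V \<ge> 0" "\<And>x \<rho>. \<rho> > 0 \<Longrightarrow> emeasure lborel {y \<in> cball 0 r1. norm (F y - x) \<le> \<rho>} \<le> ennreal (V * \<rho> ^ DIM('b))"
  proof (rule expanding_preimage_measure[OF r _ F(3) _ L(3) _ low])
    show "r < r1" using e by (simp add: r1_def)
    show "L > 0" "c / 2 > 0" using L P by auto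
  qed (assumption | rule that)+
  show ?thesis
    by (rule that[OF _ F(1) F(3) L V]) (use e in \<open>auto simp: r1_def\<close>)
qed

lemma ball_cutoff:
  assumes "0 < r" "r < r1"
  obtains \<kappa> K where "creg 1 K (\<kappa> :: 'b::euclidean_space \<Rightarrow> real)" "\<And>y. norm y \<le> r \<Longrightarrow> \<kappa> y = 1" "\<And>y. norm y > r1 \<Longrightarrow> \<kappa> y = 0"
proof -
  \<comment> \<open>The affine function of |y|^2 that sends r^2 to 1 and r1^2 to 4, the thresholds
    of \<open>step_fun\<close>.\<close>
  define \<kappa> :: "'b \<Rightarrow> real" where "\<kappa> y = step_fun ((3 / (r1\<^sup>2 - r\<^sup>2)) * (y \<bullet> y) + (1 - 3 * r\<^sup>2 / (r1\<^sup>2 - r\<^sup>2)))" for y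
  have "r\<^sup>2 < r1\<^sup>2" by (rule power_strict_mono) (use assms in auto)
  then have p: "r1\<^sup>2 - r\<^sup>2 > 0" by simp
  have e: "(3 / (r1\<^sup>2 - r\<^sup>2)) * (y \<bullet> y) + (1 - 3 * r\<^sup>2 / (r1\<^sup>2 - r\<^sup>2)) = 1 + 3 * ((norm y)\<^sup>2 - r\<^sup>2) / (r1\<^sup>2 - r\<^sup>2)" for y :: 'b
    by (simp add: power2_norm_eq_inner right_diff_distrib diff_divide_distrib)
  have "ck 2 \<kappa>"
    unfolding \<kappa>_def[abs_def] by (intro ck_compose[OF ck_step_fun] ck_add ck_cmult ck_norm2 ck_const)
  moreover have z: "\<kappa> y = 0" if "norm y > r1" for y
  proof -
    have "r1\<^sup>2 < (norm y)\<^sup>2" using that assms by (intro power_strict_mono) auto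
    then have "3 \<le> 3 * ((norm y)\<^sup>2 - r\<^sup>2) / (r1\<^sup>2 - r\<^sup>2)" using p by (simp add: le_divide_eq)
    then show ?thesis unfolding \<kappa>_def e by (intro step_fun_0) simp
  qed
  ultimately obtain K where K: "creg 1 K \<kappa>"
    using ck_imp_creg[of 1 \<kappa> r1] by (auto simp: numeral_2_eq_2)
  have "\<kappa> y = 1" if "norm y \<le> r" for y
  proof -
    have "(norm y)\<^sup>2 \<le> r\<^sup>2" using that by (intro power_mono) auto
    then have "3 * ((norm y)\<^sup>2 - r\<^sup>2) / (r1\<^sup>2 - r\<^sup>2) \<le> 0" using p by (simp add: divide_nonpos_pos)
    then show ?thesis unfolding \<kappa>_def e by (intro step_fun_1) simp
  qed
  then show ?thesis using that K z by blast
qed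

section \<open>Atoms on the boundary\<close>

text \<open>The mean value theorem on the two halves gives intermediate points between y - h and y +
  h, whose distance is at most 2|h|.\<close>

lemma second_difference_bound:
  fixes f :: "'a::real_normed_vector \<Rightarrow> real"
  assumes der: "\<And>y. (f has_derivative B y) (at y)" and lip: "\<And>y z v. \<bar>B y v - B z v\<bar> \<le> A * norm (y - z) * norm v" and A: "A \<ge> 0"
  shows "\<bar>f (y + h) - 2 * f y + f (y - h)\<bar> \<le> 2 * A * (norm h)\<^sup>2"
proof -
  obtain s where s: "0 < s" "s < 1" "f (y + 1 *\<^sub>R h) - f y = 1 * B (y + s *\<^sub>R h) h"
    using directional_mvt[OF der zero_less_one] by metis
  obtain s' where s': "0 < s'" "s' < 1" "f ((y - h) + 1 *\<^sub>R h) - f (y - h) = 1 * B ((y - h) + s' *\<^sub>R h) h"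
    using directional_mvt[OF der zero_less_one] by metis
  have "f (y + h) - 2 * f y + f (y - h) = B (y + s *\<^sub>R h) h - B ((y - h) + s' *\<^sub>R h) h"
    using s(3) s'(3) by simp
  then have "\<bar>f (y + h) - 2 * f y + f (y - h)\<bar> \<le> A * norm ((y + s *\<^sub>R h) - ((y - h) + s' *\<^sub>R h)) * norm h"
    using lip[of "y + s *\<^sub>R h" h "(y - h) + s' *\<^sub>R h"] by (simp only:)
  also have "(y + s *\<^sub>R h) - ((y - h) + s' *\<^sub>R h) = (1 + s - s') *\<^sub>R h"
    by (simp add: algebra_simps)
  also have "A * norm ((1 + s - s') *\<^sub>R h) * norm h = A * (1 + s - s') * (norm h)\<^sup>2"
    using s s' by (simp add: power2_eq_square)
  also have "\<dots> \<le> A * 2 * (norm h)\<^sup>2"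
    using s s' A by (intro mult_right_mono mult_left_mono) auto
  finally show ?thesis by (simp add: mult_ac)
qed

lemma creg1E:
  assumes "creg 1 M f"
  obtains D where "\<And>x. (f has_derivative D x) (at x)" "\<And>x v. \<bar>D x v\<bar> \<le> M * norm v"
    "\<And>x y v. \<bar>D x v - D y v\<bar> \<le> M * norm (x - y) * norm v"
proof -
  obtain D where D: "\<And>x. (f has_derivative D x) (at x)" "\<And>v. norm v \<le> 1 \<Longrightarrow> creg 0 M (\<lambda>x. D x v)"
    using creg_SucE[of 0 M f] assms by auto
  have b: "\<bar>D x v\<bar> \<le> M * norm v" for x v
    by (rule has_derivative_bound_scale[OF D(1)]) (use creg_bound[OF D(2)] in auto)
  have l: "\<bar>D x v - D y v\<bar> \<le> M * norm (x - y) * norm v" for x y v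
  proof (cases "v = 0")
    case True
    then show ?thesis using has_derivative_linear[OF D(1)] by (simp add: linear_0)
  next
    case False
    have sc: "D z v = norm v * D z (v /\<^sub>R norm v)" for z
      using linear_scale[OF has_derivative_linear[OF D(1)[of z]], of "norm v" "v /\<^sub>R norm v"] False by simp
    have "\<bar>D x (v /\<^sub>R norm v) - D y (v /\<^sub>R norm v)\<bar> \<le> M * norm (x - y)"
      by (rule creg_lipschitz[OF D(2)]) (use False in simp)
    then have "norm v * \<bar>D x (v /\<^sub>R norm v) - D y (v /\<^sub>R norm v)\<bar> \<le> norm v * (M * norm (x - y))"
      by (rule mult_left_mono) simp
    then show ?thesis unfolding sc[of x] sc[of y] by (simp add: abs_mult mult_ac flip: right_diff_distrib)
  qed
  show ?thesis using that[OF D(1) b l] .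
qed

text \<open>An atom at scale \<open>1 / t\<close>: each derivative costs a factor \<open>t\<close>.\<close>

lemma atom_bounds:
  fixes \<Phi> :: "'b::euclidean_space \<Rightarrow> 'a::euclidean_space" and x :: 'a
  assumes der: "\<And>y. (\<Phi> has_derivative blinfun_apply (D y)) (at y)"
    and L: "L \<ge> 1" "\<And>y. norm (D y) \<le> L" "\<And>y z. norm (D y - D z) \<le> L * norm (y - z)"
    and \<kappa>: "creg 1 K \<kappa>" "\<And>y. norm y > r1 \<Longrightarrow> \<kappa> y = 0"
    and \<xi>: "creg 1 M \<xi>" "\<And>w. norm w > \<rho> \<Longrightarrow> \<xi> w = 0"
    and t: "t > 0" "1 \<le> c0 * t" "c0 \<ge> 1"
  defines "b \<equiv> \<lambda>y. \<kappa> y * \<xi> (t *\<^sub>R (x - \<Phi> y))" and "S \<equiv> {y \<in> cball 0 r1. norm (\<Phi> y - x) \<le> \<rho> / t}"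
    and "M' \<equiv> 3 * K * M * (c0 + L)\<^sup>2"
  obtains B where "\<And>y. (b has_derivative B y) (at y)" "\<And>y. \<bar>b y\<bar> \<le> M' * indicator S y"
    "\<And>y v. \<bar>B y v\<bar> \<le> M' * t * indicator S y * norm v" "\<And>y z v. \<bar>B y v - B z v\<bar> \<le> M' * t\<^sup>2 * norm (y - z) * norm v"
proof -
  have K: "K \<ge> 0" and M: "M \<ge> 0" using creg_nonneg \<kappa> \<xi> by blast+
  have t0: "t \<ge> 0" using t by simp
  obtain k where k: "\<And>y. (\<kappa> has_derivative k y) (at y)" "\<And>y v. \<bar>k y v\<bar> \<le> K * norm v"
    "\<And>y z v. \<bar>k y v - k z v\<bar> \<le> K * norm (y - z) * norm v" using creg1E[OF \<kappa>(1)] by metis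
  obtain X where X: "\<And>y. (\<xi> has_derivative X y) (at y)" "\<And>y v. \<bar>X y v\<bar> \<le> M * norm v"
    "\<And>y z v. \<bar>X y v - X z v\<bar> \<le> M * norm (y - z) * norm v" using creg1E[OF \<xi>(1)] by metis
  have Xl: "X w v - X w v' = X w (v - v')" for w v v'
    using linear_diff[OF has_derivative_linear[OF X(1)]] by metis
  define G where "G y = t *\<^sub>R (x - \<Phi> y)" for y
  define E where "E y v = - (t *\<^sub>R blinfun_apply (D y) v)" for y v
  have Gd: "(G has_derivative E y) (at y)" for y
    unfolding G_def[abs_def] E_def[abs_def] by (auto intro!: derivative_eq_intros der)
  have Db: "norm (blinfun_apply (D y) v) \<le> L * norm v" for y v
    using norm_blinfun[of "D y" v] mult_right_mono[OF L(2)[of y], of "norm v"] by simp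
  have Eb: "norm (E y v) \<le> t * L * norm v" for y v
    unfolding E_def using mult_left_mono[OF Db[of y v] t0] t0 by (simp add: mult.assoc)
  have El: "norm (E y v - E z v) \<le> t * L * norm (y - z) * norm v" for y z v
  proof -
    have "norm (E y v - E z v) = t * norm (blinfun_apply (D z - D y) v)"
      using t0 by (simp add: E_def blinfun.diff_left flip: scaleR_diff_right)
    also have "\<dots> \<le> t * (norm (D z - D y) * norm v)" using t0 by (intro mult_left_mono norm_blinfun)
    also have "\<dots> \<le> t * (L * norm (z - y) * norm v)" using t0 L(3) by (intro mult_left_mono mult_right_mono) auto
    finally show ?thesis by (simp add: mult_ac norm_minus_commute)
  qed
  have Gl: "norm (G y - G z) \<le> t * L * norm (y - z)" for y z
  proof (rule differentiable_bound[of UNIV G E])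
    show "(G has_derivative E x) (at x within UNIV)" for x using Gd by simp
    show "onorm (E x) \<le> t * L" for x using Eb t0 L by (intro onorm_bound) auto
  qed auto
  define f where "f y = \<xi> (G y)" for y
  define f' where "f' y v = X (G y) (E y v)" for y v
  have fd: "(f has_derivative f' y) (at y)" for y
    unfolding f_def[abs_def] f'_def[abs_def] by (rule has_derivative_compose[OF Gd X(1)])
  have fb: "\<bar>f y\<bar> \<le> M" for y unfolding f_def by (rule creg_bound[OF \<xi>(1)])
  have f'b: "\<bar>f' y v\<bar> \<le> M * (t * L) * norm v" for y v
  proof -
    have "\<bar>f' y v\<bar> \<le> M * norm (E y v)" unfolding f'_def by (rule X)
    also have "\<dots> \<le> M * (t * L * norm v)" using M Eb by (intro mult_left_mono)
    finally show ?thesis by (simp add: mult_ac)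
  qed
  have fl: "\<bar>f y - f z\<bar> \<le> M * (t * L) * norm (y - z)" for y z
  proof -
    have "\<bar>f y - f z\<bar> \<le> M * norm (G y - G z)" unfolding f_def by (rule creg_lipschitz[OF \<xi>(1)])
    also have "\<dots> \<le> M * (t * L * norm (y - z))" using M Gl by (intro mult_left_mono)
    finally show ?thesis by (simp add: mult_ac)
  qed
  have f'l: "\<bar>f' y v - f' z v\<bar> \<le> (M * (t * L) * (t * L) + M * (t * L)) * norm (y - z) * norm v" for y z v
  proof -
    have "f' y v - f' z v = (X (G y) (E y v) - X (G z) (E y v)) + X (G z) (E y v - E z v)"
      by (simp add: f'_def flip: Xl)
    then have "\<bar>f' y v - f' z v\<bar> \<le> \<bar>X (G y) (E y v) - X (G z) (E y v)\<bar> + \<bar>X (G z) (E y v - E z v)\<bar>" by linarith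
    also have "\<dots> \<le> M * norm (G y - G z) * norm (E y v) + M * norm (E y v - E z v)"
      by (intro add_mono X)
    also have "\<dots> \<le> M * (t * L * norm (y - z)) * (t * L * norm v) + M * (t * L * norm (y - z) * norm v)"
      using M t0 L(1) Gl Eb El by (intro add_mono mult_left_mono mult_mono) auto
    finally show ?thesis by (simp add: algebra_simps)
  qed
  define B where "B y v = \<kappa> y * f' y v + k y v * f y" for y v
  have bf: "b y = \<kappa> y * f y" for y by (simp add: b_def f_def G_def)
  have bd: "(b has_derivative B y) (at y)" for y
    unfolding bf[abs_def] B_def[abs_def] by (rule has_derivative_mult[OF k(1) fd])
  \<comment> \<open>Derivatives that fall on the cut-off bring no factor t. Because c0 t \<ge> 1
    they can be charged with powers of c0 t instead, and everything is homogeneous in t.\<close>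
  have c0: "K * M \<le> M'" "K * M * (c0 + L) \<le> M'" "K * M * (c0\<^sup>2 + 3 * (c0 * L) + L\<^sup>2) \<le> M'"
  proof -
    have c: "c0 + L \<ge> 1" using t L by simp
    have KM: "K * M \<ge> 0" using K M by simp
    have 1: "c0 + L \<le> (c0 + L)\<^sup>2" using c by (simp add: power2_eq_square mult_le_cancel_left1)
    have 2: "(c0 + L)\<^sup>2 \<le> 3 * (c0 + L)\<^sup>2" by simp
    have 3: "c0\<^sup>2 + 3 * (c0 * L) + L\<^sup>2 \<le> 3 * (c0 + L)\<^sup>2"
      using t L by (simp add: power2_eq_square algebra_simps)
    have e: "M' = K * M * (3 * (c0 + L)\<^sup>2)" by (simp add: M'_def)
    show "K * M \<le> M'" unfolding e using mult_left_mono[of 1 "3 * (c0 + L)\<^sup>2" "K * M"] KM 1 2 c by simp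
    show "K * M * (c0 + L) \<le> M'" unfolding e using KM order_trans[OF 1 2] by (intro mult_left_mono)
    show "K * M * (c0\<^sup>2 + 3 * (c0 * L) + L\<^sup>2) \<le> M'" unfolding e using KM 3 by (intro mult_left_mono) auto
  qed
  have M'0: "M' \<ge> 0" using K M c0(1) mult_nonneg_nonneg[of K M] by linarith
  have off: "b y = 0" if "y \<notin> S" for y
  proof (cases "norm y > r1")
    case True
    then show ?thesis using \<kappa>(2) by (simp add: b_def)
  next
    case False
    then have "norm (\<Phi> y - x) > \<rho> / t" using that by (auto simp: S_def)
    then have "norm (t *\<^sub>R (x - \<Phi> y)) > \<rho>"
      using t by (simp add: norm_minus_commute pos_divide_less_eq mult.commute)
    then show ?thesis using \<xi>(2) by (simp add: b_def)
  qed
  have cont: "continuous_on UNIV \<Phi>"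
    by (intro continuous_at_imp_continuous_on ballI has_derivative_continuous[OF der])
  have clS: "closed S"
  proof -
    have "S = cball 0 r1 \<inter> {y. norm (\<Phi> y - x) \<le> \<rho> / t}" by (auto simp: S_def)
    moreover have "closed {y. norm (\<Phi> y - x) \<le> \<rho> / t}" by (intro closed_Collect_le continuous_intros cont)
    ultimately show ?thesis by auto
  qed
  have Boff: "B y = (\<lambda>v. 0)" if "y \<notin> S" for y
  proof (rule has_derivative_unique[OF bd])
    have "((\<lambda>x. 0) has_derivative (\<lambda>v. 0)) (at y)" by simp
    then show "(b has_derivative (\<lambda>v. 0)) (at y)"
      by (rule has_derivative_transform_within_open[of _ _ _ _ "- S"]) (use clS off that in auto)
  qed
  show ?thesis
  proof (rule that[OF bd])
    show "\<bar>b y\<bar> \<le> M' * indicator S y" for y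
    proof (cases "y \<in> S")
      case True
      have "\<bar>b y\<bar> \<le> K * M" unfolding bf abs_mult using creg_bound[OF \<kappa>(1), of y] fb[of y] K by (intro mult_mono) auto
      then show ?thesis using True c0(1) by simp
    qed (simp add: off)
    show "\<bar>B y v\<bar> \<le> M' * t * indicator S y * norm v" for y v
    proof (cases "y \<in> S")
      case True
      have "\<bar>B y v\<bar> \<le> \<bar>\<kappa> y\<bar> * \<bar>f' y v\<bar> + \<bar>k y v\<bar> * \<bar>f y\<bar>"
        unfolding B_def abs_mult[symmetric] by (rule abs_triangle_ineq)
      also have "\<dots> \<le> K * (M * (t * L) * norm v) + (K * norm v) * M"
        using creg_bound[OF \<kappa>(1), of y] fb[of y] K f'b k(2) by (intro add_mono mult_mono) auto
      also have "\<dots> = K * M * norm v * (1 + L * t)" by (simp add: algebra_simps)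
      also have "\<dots> \<le> K * M * norm v * ((c0 + L) * t)"
        using K M t by (intro mult_left_mono) (auto simp: distrib_right)
      also have "\<dots> = (K * M * (c0 + L)) * (t * norm v)" by (simp add: mult_ac)
      also have "\<dots> \<le> M' * (t * norm v)" using c0(2) t0 by (intro mult_right_mono) auto
      finally show ?thesis using True by (simp add: mult_ac)
    qed (simp add: Boff)
    show "\<bar>B y v - B z v\<bar> \<le> M' * t\<^sup>2 * norm (y - z) * norm v" for y z v
    proof -
      have kl: "\<bar>\<kappa> y - \<kappa> z\<bar> \<le> K * norm (y - z)" by (rule creg_lipschitz[OF \<kappa>(1)])
      have "B y v - B z v = (\<kappa> y - \<kappa> z) * f' y v + \<kappa> z * (f' y v - f' z v) + (k y v - k z v) * f y + k z v * (f y - f z)"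
        by (simp add: B_def algebra_simps)
      then have "\<bar>B y v - B z v\<bar> \<le> \<bar>\<kappa> y - \<kappa> z\<bar> * \<bar>f' y v\<bar> + \<bar>\<kappa> z\<bar> * \<bar>f' y v - f' z v\<bar> + \<bar>k y v - k z v\<bar> * \<bar>f y\<bar> + \<bar>k z v\<bar> * \<bar>f y - f z\<bar>"
        unfolding abs_mult[symmetric] by linarith
      also have "\<dots> \<le> (K * norm (y - z)) * (M * (t * L) * norm v) + K * ((M * (t * L) * (t * L) + M * (t * L)) * norm (y - z) * norm v)
          + (K * norm (y - z) * norm v) * M + (K * norm v) * (M * (t * L) * norm (y - z))"
        using kl creg_bound[OF \<kappa>(1), of z] fb[of y] K f'b f'l k(2,3) fl by (intro add_mono mult_mono) auto
      also have "\<dots> = K * M * (norm (y - z) * norm v) * (1 * 1 + 3 * (1 * L) * t + L\<^sup>2 * t\<^sup>2)"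
        by (simp add: power2_eq_square algebra_simps)
      also have "\<dots> \<le> K * M * (norm (y - z) * norm v) * ((c0 * t) * (c0 * t) + 3 * ((c0 * t) * L) * t + L\<^sup>2 * t\<^sup>2)"
        using K M t L t0 by (intro mult_left_mono add_mono mult_mono mult_right_mono) auto
      also have "\<dots> = (K * M * (c0\<^sup>2 + 3 * (c0 * L) + L\<^sup>2)) * (t\<^sup>2 * norm (y - z) * norm v)"
        by (simp add: power2_eq_square algebra_simps)
      also have "\<dots> \<le> M' * (t\<^sup>2 * norm (y - z) * norm v)"
        using c0(3) by (intro mult_right_mono) auto
      finally show ?thesis by (simp add: mult_ac)
    qed
  qed
qed

text \<open>At each point at most N terms are active; Jensen's inequality with unit weights costs
  N^{q-1}, and the remaining sum integrates to v times the sum of the powers.\<close>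

lemma overlap_integral:
  fixes S :: "'x \<Rightarrow> 'b::euclidean_space set"
  assumes K: "finite K" and N: "\<And>y. card {x \<in> K. y \<in> S x} \<le> N" and S: "\<And>x. x \<in> K \<Longrightarrow> S x \<in> sets borel"
    and v: "\<And>x. x \<in> K \<Longrightarrow> emeasure lborel (S x) \<le> ennreal v" "v \<ge> 0" and q: "q \<ge> 1"
  shows "(\<integral>\<^sup>+y. ennreal ((\<Sum>x\<in>K. \<bar>a x\<bar> * indicator (S x) y) powr q) \<partial>lborel)
    \<le> ennreal (real N powr (q - 1) * v * (\<Sum>x\<in>K. \<bar>a x\<bar> powr q))"
proof -
  have pw: "(\<Sum>x\<in>K. \<bar>a x\<bar> * indicator (S x) y) powr q \<le> (\<Sum>x\<in>K. (real N powr (q - 1) * \<bar>a x\<bar> powr q) * indicator (S x) y)" for y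
  proof -
    let ?K = "{x \<in> K. y \<in> S x}"
    have fin: "finite ?K" using K by simp
    have "(\<Sum>x\<in>K. \<bar>a x\<bar> * indicator (S x) y) = (\<Sum>x\<in>?K. \<bar>a x\<bar>)"
      using K by (intro sum.mono_neutral_cong_right) (auto simp: indicator_def)
    moreover have "(\<Sum>x\<in>?K. \<bar>a x\<bar>) powr q \<le> real N powr (q - 1) * (\<Sum>x\<in>?K. 1 powr (1 - q) * \<bar>a x\<bar> powr q)"
      by (rule weighted_power_sum) (use fin N[of y] q in auto)
    moreover have "real N powr (q - 1) * (\<Sum>x\<in>?K. 1 powr (1 - q) * \<bar>a x\<bar> powr q) =
        (\<Sum>x\<in>?K. (real N powr (q - 1) * \<bar>a x\<bar> powr q) * indicator (S x) y)"
      unfolding sum_distrib_left by (intro sum.cong) auto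
    moreover have "\<dots> = (\<Sum>x\<in>K. (real N powr (q - 1) * \<bar>a x\<bar> powr q) * indicator (S x) y)"
      using K by (intro sum.mono_neutral_left) (auto simp: indicator_def)
    ultimately show ?thesis by simp
  qed
  have "(\<integral>\<^sup>+y. ennreal ((\<Sum>x\<in>K. \<bar>a x\<bar> * indicator (S x) y) powr q) \<partial>lborel)
    \<le> (\<integral>\<^sup>+y. (\<Sum>x\<in>K. ennreal (real N powr (q - 1) * \<bar>a x\<bar> powr q) * indicator (S x) y) \<partial>lborel)"
  proof (rule nn_integral_mono)
    fix y
    have "ennreal ((\<Sum>x\<in>K. \<bar>a x\<bar> * indicator (S x) y) powr q) \<le> ennreal (\<Sum>x\<in>K. (real N powr (q - 1) * \<bar>a x\<bar> powr q) * indicator (S x) y)"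
      by (rule ennreal_leI[OF pw])
    also have "\<dots> = (\<Sum>x\<in>K. ennreal ((real N powr (q - 1) * \<bar>a x\<bar> powr q) * indicator (S x) y))"
      by (rule sum_ennreal[symmetric]) simp
    also have "\<dots> = (\<Sum>x\<in>K. ennreal (real N powr (q - 1) * \<bar>a x\<bar> powr q) * indicator (S x) y)"
      by (intro sum.cong) (auto simp: indicator_def)
    finally show "ennreal ((\<Sum>x\<in>K. \<bar>a x\<bar> * indicator (S x) y) powr q) \<le> (\<Sum>x\<in>K. ennreal (real N powr (q - 1) * \<bar>a x\<bar> powr q) * indicator (S x) y)" .
  qed
  also have "\<dots> = (\<Sum>x\<in>K. \<integral>\<^sup>+y. ennreal (real N powr (q - 1) * \<bar>a x\<bar> powr q) * indicator (S x) y \<partial>lborel)"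
    by (rule nn_integral_sum) (use S in auto)
  also have "\<dots> = (\<Sum>x\<in>K. ennreal (real N powr (q - 1) * \<bar>a x\<bar> powr q) * emeasure lborel (S x))"
    by (intro sum.cong nn_integral_cmult_indicator) (use S in auto)
  also have "\<dots> \<le> (\<Sum>x\<in>K. ennreal (real N powr (q - 1) * \<bar>a x\<bar> powr q) * ennreal v)"
    by (intro sum_mono mult_left_mono v) auto
  also have "\<dots> = ennreal (\<Sum>x\<in>K. (real N powr (q - 1) * \<bar>a x\<bar> powr q) * v)"
    using v(2) by (simp add: ennreal_mult flip: sum_ennreal)
  also have "(\<Sum>x\<in>K. (real N powr (q - 1) * \<bar>a x\<bar> powr q) * v) = real N powr (q - 1) * v * (\<Sum>x\<in>K. \<bar>a x\<bar> powr q)"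
    by (simp add: sum_distrib_left sum_distrib_right mult_ac)
  finally show ?thesis .
qed

lemma majorized_integral:
  fixes W :: "'b::euclidean_space \<Rightarrow> real"
  assumes W: "W \<in> borel_measurable borel" "\<And>y. W y \<ge> 0" and q: "q \<ge> 0" and c: "c \<ge> 0"
    and g: "\<And>y. \<bar>g y\<bar> \<le> c * (W (y + h) + 2 * W y + W (y - h))"
    and w: "(\<integral>\<^sup>+y. ennreal (W y powr q) \<partial>lborel) \<le> ennreal w"
  shows "pint q g \<le> ennreal (3 * 4 powr q * (c powr q * w))"
proof (rule three_term_integral[where f="\<lambda>y. c * W y" and h=h])
  show "(\<lambda>y. c * W y) \<in> borel_measurable borel" using W by simp
  show "\<bar>g y\<bar> \<le> \<bar>c * W (y + h)\<bar> + 2 * \<bar>c * W y\<bar> + \<bar>c * W (y - h)\<bar>" for y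
    using g[of y] c W(2) by (simp add: abs_mult distrib_left mult_ac)
  have "pint q (\<lambda>y. c * W y) = (\<integral>\<^sup>+y. ennreal (c powr q) * ennreal (W y powr q) \<partial>lborel)"
    using c W(2) by (intro nn_integral_cong) (simp add: abs_mult powr_mult ennreal_mult)
  also have "\<dots> = ennreal (c powr q) * (\<integral>\<^sup>+y. ennreal (W y powr q) \<partial>lborel)"
    using W(1) by (intro nn_integral_cmult) simp
  also have "\<dots> \<le> ennreal (c powr q) * ennreal w" by (intro mult_left_mono w) auto
  also have "\<dots> = ennreal (c powr q * w)" by (simp add: ennreal_mult')
  finally show "pint q (\<lambda>y. c * W y) \<le> ennreal (c powr q * w)" .
qed (use q in auto)

text \<open>One profile per scale, translated to all centres of that scale, with at most N centres
  close to any point. The lower bound J for the scales keeps atoms from being much wider than the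
  charts.\<close>

definition atomic_data ::
  "int \<Rightarrow> real \<Rightarrow> real \<Rightarrow> nat \<Rightarrow> int set \<Rightarrow> (int \<Rightarrow> 'a::euclidean_space set) \<Rightarrow> (int \<Rightarrow> 'a \<Rightarrow> real) \<Rightarrow> bool" where
  "atomic_data J M \<rho> N Js Ks \<xi> \<longleftrightarrow> finite Js \<and> (\<forall>j\<in>Js. J \<le> j \<and> finite (Ks j) \<and>
     (\<forall>w. card {x \<in> Ks j. norm (w - x) \<le> \<rho> / 2 powr j} \<le> N) \<and> creg 1 M (\<xi> j) \<and> (\<forall>w. norm w > \<rho> \<longrightarrow> \<xi> j w = 0))"

text \<open>For e = m/q - \<tau> in dimension m the factor 2^{je} is the normalization in
  B^\<tau>_q: the L^q norm of an atom is of size 2^{je} 2^{-jm/q} = 2^{-j\<tau>}.\<close>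

definition atomic_sum ::
  "real \<Rightarrow> int set \<Rightarrow> (int \<Rightarrow> 'a::euclidean_space set) \<Rightarrow> (int \<Rightarrow> 'a \<Rightarrow> real) \<Rightarrow> (int \<Rightarrow> 'a \<Rightarrow> real) \<Rightarrow> 'a \<Rightarrow> real" where
  "atomic_sum e Js Ks \<xi> a Q = (\<Sum>j\<in>Js. \<Sum>x\<in>Ks j. a j x * 2 powr (real_of_int j * e) * \<xi> j (2 powr real_of_int j *\<^sub>R (x - Q)))"

text \<open>In the chart a scale consists of bumps on sets of measure at most V (\<rho> / 2^j)^m
  with bounded overlap, so the q-th power of its L^q norm is of order 2^{jeq - jm} = 2^{-j\<tau>q}
  times the sum of the |a|^q. The C^{1,1} bounds for single atoms give derivatives and differences
  in the same way.\<close>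

lemma chart_family:
  fixes \<Phi> :: "'b::euclidean_space \<Rightarrow> 'a::euclidean_space" and \<xi> a :: "int \<Rightarrow> 'a \<Rightarrow> real"
  assumes q: "1 < q" and \<tau>: "0 < \<tau>" "\<tau> < 2" and \<rho>: "\<rho> > 0" and M: "M \<ge> 0"
    and der: "\<And>y. (\<Phi> has_derivative blinfun_apply (D y)) (at y)"
    and L: "L \<ge> 1" "\<And>y. norm (D y) \<le> L" "\<And>y z. norm (D y - D z) \<le> L * norm (y - z)"
    and V: "V \<ge> 0" "\<And>x \<rho>. \<rho> > 0 \<Longrightarrow> emeasure lborel {y \<in> cball 0 r1. norm (\<Phi> y - x) \<le> \<rho>} \<le> ennreal (V * \<rho> ^ DIM('b))"
    and \<kappa>: "creg 1 K \<kappa>" "\<And>y. norm y > r1 \<Longrightarrow> \<kappa> y = 0"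
    and ad: "atomic_data J M \<rho> N Js Ks \<xi>"
  defines "C \<equiv> 3 * 4 powr q * ((2 * (3 * K * M * (max 1 (2 powr (- real_of_int J)) + L)\<^sup>2)) powr q * (real N powr (q - 1) * (V * \<rho> ^ DIM('b))))"
  shows "\<exists>Gs A. dyadic_family \<tau> q (\<lambda>j y. if j \<in> Js then \<kappa> y * (\<Sum>x\<in>Ks j. a j x * 2 powr (j * (DIM('b) / q - \<tau>)) * \<xi> j (2 powr j *\<^sub>R (x - \<Phi> y))) else 0)
      Gs A (C * (\<Sum>j\<in>Js. \<Sum>x\<in>Ks j. \<bar>a j x\<bar> powr q)) \<and> (\<forall>j b y. j \<notin> Js \<longrightarrow> Gs j b y = 0)"
proof -
  define m where "m = real DIM('b)"
  define e where "e = m / q - \<tau>"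
  define c0 where "c0 = max 1 (2 powr (- real_of_int J))"
  define M' where "M' = 3 * K * M * (c0 + L)\<^sup>2"
  have K0: "K \<ge> 0" using creg_nonneg \<kappa>(1) by blast
  have M'0: "M' \<ge> 0" using K0 M by (simp add: M'_def)
  have C0: "C \<ge> 0" using V \<rho> by (simp add: C_def)
  have Js: "finite Js" using ad by (simp add: atomic_data_def)
  have Ks: "finite (Ks j)" and Jj: "J \<le> j" and ov: "card {x \<in> Ks j. norm (w - x) \<le> \<rho> / 2 powr j} \<le> N"
    and xi: "creg 1 M (\<xi> j)" "norm w > \<rho> \<Longrightarrow> \<xi> j w = 0" if "j \<in> Js" for j w
    using ad that by (auto simp: atomic_data_def)
  define t where "t j = (2::real) powr j" for j :: int
  have t: "t j > 0" for j by (simp add: t_def)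
  have tc: "1 \<le> c0 * t j" if "j \<in> Js" for j
  proof -
    have "1 = 2 powr (- real_of_int J) * 2 powr J" by (simp flip: powr_add)
    also have "\<dots> \<le> c0 * t j" unfolding t_def c0_def using Jj[OF that] by (intro mult_mono) auto
    finally show ?thesis .
  qed
  define S where "S j x = {y \<in> cball 0 r1. norm (\<Phi> y - x) \<le> \<rho> / t j}" for j x
  define b where "b j x y = \<kappa> y * \<xi> j (t j *\<^sub>R (x - \<Phi> y))" for j x y
  have "\<exists>B. (\<forall>y. (b j x has_derivative B y) (at y)) \<and> (\<forall>y. \<bar>b j x y\<bar> \<le> M' * indicator (S j x) y) \<and>
    (\<forall>y v. \<bar>B y v\<bar> \<le> M' * t j * indicator (S j x) y * norm v) \<and> (\<forall>y z v. \<bar>B y v - B z v\<bar> \<le> M' * (t j)\<^sup>2 * norm (y - z) * norm v)"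
    if "j \<in> Js" for j x
  proof (rule atom_bounds[OF der L \<kappa> xi[OF that] t[of j] tc[OF that], folded M'_def b_def])
    show "1 \<le> c0" by (simp add: c0_def)
    fix B
    assume "\<And>y. (b j x has_derivative B y) (at y)"
      "\<And>y. \<bar>b j x y\<bar> \<le> M' * indicator {y \<in> cball 0 r1. norm (\<Phi> y - x) \<le> \<rho> / t j} y"
      "\<And>y v. \<bar>B y v\<bar> \<le> M' * t j * indicator {y \<in> cball 0 r1. norm (\<Phi> y - x) \<le> \<rho> / t j} y * norm v"
      "\<And>y z v. \<bar>B y v - B z v\<bar> \<le> M' * (t j)\<^sup>2 * norm (y - z) * norm v"
    then show ?thesis unfolding S_def by (intro exI[of _ B]) simp
  qed
  then obtain B where B: "\<And>j x y. j \<in> Js \<Longrightarrow> (b j x has_derivative B j x y) (at y)"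
    "\<And>j x y. j \<in> Js \<Longrightarrow> \<bar>b j x y\<bar> \<le> M' * indicator (S j x) y"
    "\<And>j x y v. j \<in> Js \<Longrightarrow> \<bar>B j x y v\<bar> \<le> M' * t j * indicator (S j x) y * norm v"
    "\<And>j x y z v. j \<in> Js \<Longrightarrow> \<bar>B j x y v - B j x z v\<bar> \<le> M' * (t j)\<^sup>2 * norm (y - z) * norm v"
    by metis
  define c where "c j x = a j x * 2 powr (j * e)" for j x
  define f where "f j y = (\<Sum>x\<in>Ks j. c j x * b j x y)" for j y
  define f' where "f' j v y = (\<Sum>x\<in>Ks j. c j x * B j x y v)" for j y v
  have fd: "(f j has_derivative (\<lambda>v. f' j v y)) (at y)" if "j \<in> Js" for j y
    unfolding f_def[abs_def] f'_def[abs_def]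
    by (intro has_derivative_sum has_derivative_mult_right B(1)[OF that])
  have feq: "\<kappa> y * (\<Sum>x\<in>Ks j. a j x * 2 powr (j * (DIM('b) / q - \<tau>)) * \<xi> j (2 powr j *\<^sub>R (x - \<Phi> y))) = f j y" for j y
    unfolding f_def sum_distrib_left by (intro sum.cong) (simp_all add: c_def b_def t_def e_def m_def mult_ac)
  define W where "W j y = (\<Sum>x\<in>Ks j. \<bar>a j x\<bar> * indicator (S j x) y)" for j and y :: 'b
  have W0: "W j y \<ge> 0" for j y unfolding W_def by (intro sum_nonneg) auto
  have cont: "continuous_on UNIV \<Phi>"
    by (intro continuous_at_imp_continuous_on ballI has_derivative_continuous[OF der])
  have clS: "closed (S j x)" for j x
  proof -
    have "S j x = cball 0 r1 \<inter> {y. norm (\<Phi> y - x) \<le> \<rho> / t j}" by (auto simp: S_def)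
    moreover have "closed {y. norm (\<Phi> y - x) \<le> \<rho> / t j}" by (intro closed_Collect_le continuous_intros cont)
    ultimately show ?thesis by auto
  qed
  have Wm: "W j \<in> borel_measurable borel" for j
    unfolding W_def[abs_def]
    by (intro borel_measurable_sum borel_measurable_times borel_measurable_const borel_measurable_indicator borel_closed clS)
  define s where "s j = (\<Sum>x\<in>Ks j. \<bar>a j x\<bar> powr q)" for j
  have s0: "s j \<ge> 0" for j unfolding s_def by (intro sum_nonneg) auto
  define w where "w j = real N powr (q - 1) * (V * (\<rho> / t j) ^ DIM('b)) * s j" for j
  have Wi: "(\<integral>\<^sup>+y. ennreal (W j y powr q) \<partial>lborel) \<le> ennreal (w j)" if j: "j \<in> Js" for j
    unfolding W_def w_def s_def
  proof (rule overlap_integral[OF Ks[OF j]])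
    show "card {x \<in> Ks j. y \<in> S j x} \<le> N" for y
    proof -
      have "{x \<in> Ks j. y \<in> S j x} \<subseteq> {x \<in> Ks j. norm (\<Phi> y - x) \<le> \<rho> / 2 powr j}" by (auto simp: S_def t_def)
      then have "card {x \<in> Ks j. y \<in> S j x} \<le> card {x \<in> Ks j. norm (\<Phi> y - x) \<le> \<rho> / 2 powr j}"
        using Ks[OF j] by (intro card_mono) auto
      then show ?thesis using ov[OF j, of "\<Phi> y"] by linarith
    qed
    show "emeasure lborel (S j x) \<le> ennreal (V * (\<rho> / t j) ^ DIM('b))" for x
      unfolding S_def using \<rho> t[of j] by (intro V(2)) simp
    show "0 \<le> V * (\<rho> / t j) ^ DIM('b)" using V \<rho> t[of j] by simp
  qed (use q clS borel_closed in auto)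
  \<comment> \<open>One estimate for all sums derived from the atoms: \<theta> is 1 for the sum
    itself, 2^j for a derivative, and contains powers of 2^j |h| for differences. A difference sees
    an atom at y and at y + h, y - h, hence the three translates of W.\<close>
  have en: "pint q g \<le> ennreal (\<theta> powr q * (2 powr (- (j * \<tau> * q)) * (C * s j)))"
    if j: "j \<in> Js" and th: "\<theta> \<ge> 0" and g: "\<And>y. g y = (\<Sum>x\<in>Ks j. c j x * u x y)" and u: "\<And>x y. \<bar>u x y\<bar> \<le> 2 * M' * \<theta>"
      and u0: "\<And>x y. y + h \<notin> S j x \<Longrightarrow> y \<notin> S j x \<Longrightarrow> y - h \<notin> S j x \<Longrightarrow> u x y = 0" for j \<theta> g u h
  proof -
    have le: "\<bar>g y\<bar> \<le> 2 * M' * 2 powr (j * e) * \<theta> * (W j (y + h) + 2 * W j y + W j (y - h))" for y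
    proof -
      define X where "X x = indicator (S j x) (y + h) + 2 * indicator (S j x) y + (indicator (S j x) (y - h) :: real)" for x
      have "\<bar>u x y\<bar> \<le> 2 * M' * \<theta> * X x" for x
      proof (cases "u x y = 0")
        case True
        then show ?thesis using M'0 th by (simp add: X_def)
      next
        case False
        then have "1 \<le> X x" using u0[of y x] by (auto simp: X_def indicator_def)
        then have "2 * M' * \<theta> * 1 \<le> 2 * M' * \<theta> * X x" using M'0 th by (intro mult_left_mono) auto
        then show ?thesis using u[of x y] by simp
      qed
      then have "\<bar>g y\<bar> \<le> (\<Sum>x\<in>Ks j. \<bar>c j x\<bar> * (2 * M' * \<theta> * X x))"
        unfolding g by (intro order_trans[OF sum_abs] sum_mono) (simp add: abs_mult mult_left_mono)
      also have "\<dots> = 2 * M' * 2 powr (j * e) * \<theta> * (W j (y + h) + 2 * W j y + W j (y - h))"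
        by (simp add: W_def X_def c_def abs_mult sum_distrib_left distrib_left sum.distrib mult_ac)
      finally show ?thesis .
    qed
    have "pint q g \<le> ennreal (3 * 4 powr q * ((2 * M' * 2 powr (j * e) * \<theta>) powr q * w j))"
      using q M'0 th by (intro majorized_integral[OF Wm W0 _ _ le Wi[OF j]]) auto
    also have "3 * 4 powr q * ((2 * M' * 2 powr (j * e) * \<theta>) powr q * w j) = \<theta> powr q * (2 powr (- (j * \<tau> * q)) * (C * s j))"
    proof -
      have tm: "(\<rho> / t j) ^ DIM('b) = \<rho> ^ DIM('b) * 2 powr (- (j * m))"
      proof -
        have "(2 powr j) ^ DIM('b) = 2 powr (j * m)"
          by (simp add: powr_powr m_def flip: powr_realpow)
        then have "(\<rho> / t j) ^ DIM('b) = \<rho> ^ DIM('b) / 2 powr (j * m)" by (simp only: t_def power_divide)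
        then show ?thesis by (simp add: powr_minus divide_inverse)
      qed
      have e1: "(2 powr (j * e)) powr q * 2 powr (- (j * m)) = 2 powr (- (j * \<tau> * q))"
        using q by (simp add: powr_powr e_def left_diff_distrib right_diff_distrib flip: powr_add)
      have e2: "(2 * M' * 2 powr (j * e) * \<theta>) powr q = (2 * M') powr q * (2 powr (j * e)) powr q * \<theta> powr q"
        using M'0 th by (simp add: powr_mult)
      show ?thesis
        unfolding w_def tm C_def c0_def[symmetric] M'_def[symmetric] e2 e1[symmetric] by (simp only: mult_ac)
    qed
    finally show ?thesis .
  qed
  have bz: "b j x y = 0" if "j \<in> Js" "y \<notin> S j x" for j x y using B(2)[OF that(1), of x y] that(2) by simp
  have Bz: "B j x y v = 0" if "j \<in> Js" "y \<notin> S j x" for j x y v using B(3)[OF that(1), of x y v] that(2) by simp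
  have bb: "\<bar>b j x y\<bar> \<le> M'" if "j \<in> Js" for j x y
    using B(2)[OF that, of x y] M'0 by (cases "y \<in> S j x") auto
  have Bb: "\<bar>B j x y v\<bar> \<le> M' * t j * norm v" if "j \<in> Js" for j x y v
    using B(3)[OF that, of x y v] M'0 t[of j] mult_nonneg_nonneg[of "M' * t j" "norm v"]
    by (cases "y \<in> S j x") auto
  have th1: "t j powr q * (2 powr (- (j * \<tau> * q)) * X) = 2 powr (- (j * (\<tau> - 1) * q)) * X" for j X
  proof -
    have "t j powr q * 2 powr (- (j * \<tau> * q)) = 2 powr (- (j * (\<tau> - 1) * q))"
      by (simp add: t_def powr_powr algebra_simps flip: powr_add)
    then show ?thesis by (simp only: mult.assoc[symmetric])
  qed
  have "dyadic_family \<tau> q (\<lambda>j y. if j \<in> Js then f j y else 0) (\<lambda>j v y. if j \<in> Js then f' j v y else 0)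
    (\<lambda>j. if j \<in> Js then C * s j else 0) (C * (\<Sum>j\<in>Js. s j))"
  proof (rule dyadic_family_on[OF q \<tau>])
    fix j assume j: "j \<in> Js"
    have t0: "t j \<ge> 0" using t[of j] by simp
    show "continuous_on UNIV (f j)"
      by (intro continuous_at_imp_continuous_on ballI has_derivative_continuous[OF fd[OF j]])
    show "pint q (f j) \<le> ennreal (2 powr (- (j * \<tau> * q)) * (C * s j))"
      using en[of j 1 "f j" "b j" 0] j bb[OF j] M'0 bz[OF j] unfolding f_def
      by (simp add: order_trans[OF bb[OF j], of "2 * M'"])
    have bd1: "\<bar>b j x (y + h) - b j x y\<bar> \<le> M' * t j * norm h" for x y h
    proof -
      have "\<bar>b j x (y + h) - b j x y\<bar> \<le> M' * t j * norm ((y + h) - y)"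
      proof (rule lipschitz_from_derivative[OF B(1)[OF j]])
        show "\<bar>B j x y v\<bar> \<le> M' * t j" if "norm v \<le> 1" for y v
          using Bb[OF j, of x y v] mult_left_mono[OF that, of "M' * t j"] M'0 t0 by simp
      qed
      then show ?thesis by simp
    qed
    have bd2: "\<bar>b j x (y + h) - 2 * b j x y + b j x (y - h)\<bar> \<le> 2 * (M' * (t j)\<^sup>2) * (norm h)\<^sup>2" for x y h
      by (rule second_difference_bound[OF B(1)[OF j] B(4)[OF j]]) (use M'0 in simp)
    show "pint q (delta k (f j) h) \<le> ennreal (((2 powr j * norm h) powr (1 + k)) powr q * (2 powr (- (j * \<tau> * q)) * (C * s j)))"
      if k: "k \<in> {0, 1}" for k h
    proof (rule en[where u="\<lambda>x. delta k (b j x) h" and h=h, OF j])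
      show "delta k (f j) h y = (\<Sum>x\<in>Ks j. c j x * delta k (b j x) h y)" for y
        by (simp add: delta_def f_def distrib_left right_diff_distrib sum.distrib sum_subtractf sum_distrib_left mult_ac)
      show "\<bar>delta k (b j x) h y\<bar> \<le> 2 * M' * (2 powr j * norm h) powr (1 + k)" for x y
        using k bd1[of x y h] bd2[of x y h] M'0 t0
        by (auto simp: delta_def t_def powr_mult power_mult_distrib mult_ac intro: order_trans)
      show "delta k (b j x) h y = 0" if "y + h \<notin> S j x" "y \<notin> S j x" "y - h \<notin> S j x" for x y
        using that bz[OF j] by (simp add: delta_def)
    qed simp
    fix v :: 'b assume "v \<in> Basis"
    then have v: "norm v = 1" by simp
    have "continuous_on UNIV (\<lambda>y. B j x y v)" for x
    proof -
      have "(M' * (t j)\<^sup>2 * norm v)-lipschitz_on UNIV (\<lambda>y. B j x y v)"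
        by (rule lipschitz_onI) (use B(4)[OF j] M'0 in \<open>auto simp: dist_norm mult_ac\<close>)
      then show ?thesis by (rule lipschitz_on_continuous_on)
    qed
    then show "continuous_on UNIV (f' j v)" unfolding f'_def by (intro continuous_intros)
    show "pint q (f' j v) \<le> ennreal (2 powr (- (j * (\<tau> - 1) * q)) * (C * s j))"
      unfolding th1[symmetric]
    proof (rule en[where u="\<lambda>x y. B j x y v" and h=0, OF j t0])
      show "\<bar>B j x y v\<bar> \<le> 2 * M' * t j" for x y
        using Bb[OF j, of x y v] mult_nonneg_nonneg[OF M'0 t0] v by simp
    qed (use Bz[OF j] in \<open>auto simp: f'_def\<close>)
    show "pint q (delta 0 (f' j v) h) \<le> ennreal ((2 powr j * norm h) powr q * (2 powr (- (j * (\<tau> - 1) * q)) * (C * s j)))" for h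
    proof -
      have "pint q (delta 0 (f' j v) h) \<le> ennreal ((t j * (t j * norm h)) powr q * (2 powr (- (j * \<tau> * q)) * (C * s j)))"
      proof (rule en[where u="\<lambda>x. delta 0 (\<lambda>y. B j x y v) h" and h=h, OF j])
        show "delta 0 (f' j v) h y = (\<Sum>x\<in>Ks j. c j x * delta 0 (\<lambda>y. B j x y v) h y)" for y
          by (simp add: delta_def f'_def right_diff_distrib sum_subtractf)
        show "\<bar>delta 0 (\<lambda>y. B j x y v) h y\<bar> \<le> 2 * M' * (t j * (t j * norm h))" for x y
          using B(4)[OF j, of x "y + h" v y] mult_nonneg_nonneg[OF M'0 mult_nonneg_nonneg[OF t0 mult_nonneg_nonneg[OF t0 norm_ge_zero[of h]]]] v
          by (simp add: delta_def power2_eq_square mult_ac)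
      qed (use Bz[OF j] t0 in \<open>auto simp: delta_def\<close>)
      also have "(t j * (t j * norm h)) powr q * (2 powr (- (j * \<tau> * q)) * (C * s j)) = (2 powr j * norm h) powr q * (2 powr (- (j * (\<tau> - 1) * q)) * (C * s j))"
        unfolding th1[symmetric] using t0 by (simp add: powr_mult t_def mult_ac)
      finally show ?thesis .
    qed
    show "((\<lambda>u. f j (y + u *\<^sub>R v)) has_real_derivative f' j v y) (at 0)" for y
    proof -
      have "((\<lambda>u. f j (y + u *\<^sub>R v)) has_derivative (\<lambda>u. f' j (u *\<^sub>R v) (y + 0 *\<^sub>R v))) (at 0)"
        by (rule has_derivative_compose[of "\<lambda>u. y + u *\<^sub>R v" "\<lambda>u. u *\<^sub>R v" 0 UNIV "f j"])
          (auto intro!: derivative_eq_intros fd[OF j])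
      then show ?thesis
        using linear_scale[OF has_derivative_linear[OF fd[OF j, of y]]]
        by (simp add: has_field_derivative_def mult.commute[of _ "f' j v y"])
    qed
  next
    show "0 \<le> C * s j" for j using C0 s0 by simp
    show "(\<Sum>j\<in>F. C * s j) \<le> C * (\<Sum>j\<in>Js. s j)" if "F \<subseteq> Js" for F
      unfolding sum_distrib_left[symmetric] using Js C0 s0 that by (intro mult_left_mono sum_mono2) auto
    have "j \<notin> Js" if "j < J" for j using Jj[of j] that by auto
    then show "\<exists>J. \<forall>j<J. \<forall>x. j \<in> Js \<longrightarrow> norm x \<le> r \<longrightarrow> f j x = 0"
      "\<exists>J. \<forall>j<J. \<forall>x. j \<in> Js \<longrightarrow> norm x \<le> r \<longrightarrow> f' j v x = 0" for r v
      by (auto intro!: exI[of _ J])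
  qed (use Js in auto)
  then show ?thesis
    unfolding feq s_def by (intro exI conjI) auto
qed

section \<open>From one chart to norms on the boundary\<close>

lemma represents_on_dist_of:
  fixes f F :: "'a::euclidean_space \<Rightarrow> real"
  assumes F: "\<And>K. compact K \<Longrightarrow> set_integrable lebesgue K F" and f: "AE x in lebesgue. x \<in> U \<longrightarrow> f x = F x"
  shows "represents_on U f (dist_of F)"
  unfolding represents_on_def
proof (intro conjI allI impI ballI)
  fix K assume K: "compact K \<and> K \<subseteq> U"
  have i: "integrable lebesgue (\<lambda>x. indicator K x *\<^sub>R F x)" using F K by (simp add: set_integrable_def)
  have e: "AE x in lebesgue. indicator K x *\<^sub>R F x = indicator K x *\<^sub>R f x"
    using f by eventually_elim (use K in \<open>auto simp: indicator_def\<close>)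
  show "set_integrable lebesgue K f"
    unfolding set_integrable_def
    by (rule integrable_cong_AE_imp[OF i borel_measurable_AE[OF borel_measurable_integrable[OF i] e] e])
next
  fix \<eta> assume \<eta>: "\<eta> \<in> test_functions U"
  have z: "\<eta> x = 0" if "x \<notin> U" for x
    using \<eta> closure_subset[of "{x. \<eta> x \<noteq> 0}"] that by (auto simp: test_functions_def)
  have "smooth \<eta>" using \<eta> by (simp add: test_functions_def)
  then have \<eta>m: "\<eta> \<in> borel_measurable lebesgue"
    by (intro measurable_completion) (simp add: borel_measurable_continuous_onI smooth_imp_continuous)
  have Fm: "F \<in> borel_measurable lebesgue" by (rule locally_integrable_measurable[OF F])
  have e: "AE x in lebesgue. F x * \<eta> x = f x * \<eta> x"
    using f by eventually_elim (use z in auto)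
  have m: "(\<lambda>x. F x * \<eta> x) \<in> borel_measurable lebesgue" using \<eta>m Fm by simp
  show "dist_of F \<eta> = (LINT x|lebesgue. f x * \<eta> x)"
    unfolding dist_of_def by (rule integral_cong_AE[OF m borel_measurable_AE[OF m e] e])
qed

lemma besov_on_norm_le:
  assumes "T \<in> besov \<sigma> p" "represents_on U f T" "besov_norm \<sigma> p T \<le> B"
  shows "besov_on_norm U \<sigma> p f \<le> B"
proof -
  have "bdd_below {besov_norm \<sigma> p T | T. T \<in> besov \<sigma> p \<and> represents_on U f T}"
    by (rule bdd_belowI[of _ 0]) (auto simp: besov_norm_def sobolev_norm_def homog_besov_norm_def)
  then have "besov_on_norm U \<sigma> p f \<le> besov_norm \<sigma> p T"
    unfolding besov_on_norm_def by (rule cInf_lower[rotated]) (use assms in auto)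
  then show ?thesis using assms(3) by simp
qed

lemma besov_on_norm_nonneg:
  assumes "f \<in> besov_on U \<sigma> p"
  shows "besov_on_norm U \<sigma> p f \<ge> 0"
  unfolding besov_on_norm_def
  by (rule cInf_greatest) (use assms in \<open>auto simp: besov_on_def besov_norm_def sobolev_norm_def homog_besov_norm_def\<close>)

text \<open>The dyadic family built from the extended chart and a cut-off is defined on the whole
  space and agrees with the pulled back atoms on the ball, so it is admissible in the quotient norm.
  The constant is chosen before scales, centres, profiles and coefficients; duality relies on this
  uniformity.\<close>

lemma chart_atoms:
  fixes \<Psi> :: "'b::euclidean_space \<Rightarrow> 'a::euclidean_space"
  assumes r: "r > 0" and par: "C2_parametrization (ball 0 r) \<Psi>"
    and q: "1 < q" and \<tau>: "0 < \<tau>" "\<tau> < 2" and \<rho>: "\<rho> > 0" and M: "M \<ge> 0"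
  shows "\<exists>C\<ge>0. \<forall>Js Ks \<xi> a \<psi>. atomic_data J M \<rho> N Js Ks \<xi> \<longrightarrow>
    (\<forall>y\<in>ball 0 r. \<psi> (\<Psi> y) = atomic_sum (DIM('b) / q - \<tau>) Js Ks \<xi> a (\<Psi> y)) \<longrightarrow>
    \<psi> \<circ> \<Psi> \<in> besov_on (ball 0 r) \<tau> q \<and>
    besov_on_norm (ball 0 r) \<tau> q (\<psi> \<circ> \<Psi>) \<le> C * (\<Sum>j\<in>Js. \<Sum>x\<in>Ks j. \<bar>a j x\<bar> powr q) powr (1 / q)"
proof -
  obtain \<Phi> D r1 V L where r1: "r < r1" and \<Phi>: "\<And>y. y \<in> ball 0 r \<Longrightarrow> \<Phi> y = \<Psi> y"
    and der: "\<And>y. (\<Phi> has_derivative blinfun_apply (D y)) (at y)"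
    and L: "L \<ge> 1" "\<And>y. norm (D y) \<le> L" "\<And>y z. norm (D y - D z) \<le> L * norm (y - z)"
    and V: "V \<ge> 0" "\<And>x \<rho>. \<rho> > 0 \<Longrightarrow> emeasure lborel {y \<in> cball 0 r1. norm (\<Phi> y - x) \<le> \<rho>} \<le> ennreal (V * \<rho> ^ DIM('b))"
    by (rule chart_extension[OF r par]) (rule that)
  obtain \<kappa> :: "'b \<Rightarrow> real" and K where \<kappa>: "creg 1 K \<kappa>" "\<And>y. norm y \<le> r \<Longrightarrow> \<kappa> y = 1" "\<And>y. norm y > r1 \<Longrightarrow> \<kappa> y = 0"
    using ball_cutoff[OF r r1] by metis
  define Fs where "Fs Js Ks \<xi> a = (\<lambda>(j::int) y. if j \<in> Js then \<kappa> y * (\<Sum>x\<in>Ks j. a j x * 2 powr (j * (DIM('b) / q - \<tau>)) * \<xi> j (2 powr j *\<^sub>R (x - \<Phi> y))) else 0)"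
    for Js Ks and \<xi> a :: "int \<Rightarrow> 'a \<Rightarrow> real"
  define C1 where "C1 = 3 * 4 powr q * ((2 * (3 * K * M * (max 1 (2 powr (- real_of_int J)) + L)\<^sup>2)) powr q * (real N powr (q - 1) * (V * \<rho> ^ DIM('b))))"
  have C1: "C1 \<ge> 0" using V(1) \<rho> by (simp add: C1_def)
  let ?C2 = "besov_const J DIM('b) \<tau> q"
  show ?thesis
  proof (intro exI[of _ "?C2 * C1 powr (1 / q)"] conjI allI impI)
    show "0 \<le> ?C2 * C1 powr (1 / q)" by (simp add: besov_const_nonneg)
    fix Js Ks and \<xi> a :: "int \<Rightarrow> 'a \<Rightarrow> real" and \<psi> :: "'a \<Rightarrow> real"
    assume ad: "atomic_data J M \<rho> N Js Ks \<xi>"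
      and \<psi>: "\<forall>y\<in>ball 0 r. \<psi> (\<Psi> y) = atomic_sum (DIM('b) / q - \<tau>) Js Ks \<xi> a (\<Psi> y)"
    have Js: "finite Js" and Jj: "j \<in> Js \<Longrightarrow> J \<le> j" for j using ad by (auto simp: atomic_data_def)
    let ?s = "\<Sum>j\<in>Js. \<Sum>x\<in>Ks j. \<bar>a j x\<bar> powr q"
    define F where "F = dysum (Fs Js Ks \<xi> a)"
    have "\<exists>Gs A. dyadic_family \<tau> q (Fs Js Ks \<xi> a) Gs A (C1 * ?s) \<and> (\<forall>j b y. j \<notin> Js \<longrightarrow> Gs j b y = 0)"
      unfolding Fs_def C1_def
      by (rule chart_family[OF q \<tau> \<rho> M der L V(1) _ \<kappa>(1) _ ad]) (use V(2) \<kappa>(3) in auto)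
    then obtain Gs A where GA: "dyadic_family \<tau> q (Fs Js Ks \<xi> a) Gs A (C1 * ?s) \<and> (\<forall>j b y. j \<notin> Js \<longrightarrow> Gs j b y = 0)"
      by (elim exE)
    have Gs: "j \<notin> Js \<Longrightarrow> Gs j b y = 0" for j b y using conjunct2[OF GA] by simp
    interpret dyadic_family \<tau> q "Fs Js Ks \<xi> a" Gs A "C1 * ?s" by (rule conjunct1[OF GA])
    have Feq: "F y = (\<Sum>j\<in>Js. Fs Js Ks \<xi> a j y)" for y
      unfolding F_def by (rule dysum_eq[OF Js]) (simp add: Fs_def)
    have Fi: "set_integrable lebesgue K F" if "compact K" for K
      unfolding F_def by (rule F_locally_integrable[OF that])
    have Fm: "F \<in> borel_measurable lebesgue" by (rule locally_integrable_measurable[OF Fi])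
    have F0: "F y = 0" if "norm y > r1" for y
      unfolding Feq by (rule sum.neutral) (use \<kappa>(3)[OF that] in \<open>simp add: Fs_def\<close>)
    have tm: "dist_of F \<in> tempered_distributions"
      by (rule dist_of_tempered_bounded_support[OF Fm Fi F0])
    have "j \<notin> Js" if "j < J" for j using Jj[of j] that by auto
    then have bes: "dist_of F \<in> besov \<tau> q" "besov_norm \<tau> q (dist_of F) \<le> ?C2 * (C1 * ?s) powr (1 / q)"
      unfolding F_def using besov_estimate[OF tm[unfolded F_def], of J] Gs by (auto simp: Fs_def)
    have "F y = (\<psi> \<circ> \<Psi>) y" if "y \<in> ball 0 r" for y
    proof -
      have "(\<psi> \<circ> \<Psi>) y = atomic_sum (DIM('b) / q - \<tau>) Js Ks \<xi> a (\<Psi> y)" using \<psi> that by simp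
      also have "\<dots> = (\<Sum>j\<in>Js. Fs Js Ks \<xi> a j y)"
        unfolding atomic_sum_def Fs_def using \<kappa>(2)[of y] \<Phi>[OF that] that by simp
      finally show ?thesis by (simp add: Feq)
    qed
    then have rep: "represents_on (ball 0 r) (\<psi> \<circ> \<Psi>) (dist_of F)"
      using Fi by (intro represents_on_dist_of) auto
    show "\<psi> \<circ> \<Psi> \<in> besov_on (ball 0 r) \<tau> q" using bes rep by (auto simp: besov_on_def)
    have "(C1 * ?s) powr (1 / q) = C1 powr (1 / q) * ?s powr (1 / q)"
      by (rule powr_mult)
    with bes rep show "besov_on_norm (ball 0 r) \<tau> q (\<psi> \<circ> \<Psi>) \<le> ?C2 * C1 powr (1 / q) * ?s powr (1 / q)"
      by (intro besov_on_norm_le) (auto simp: mult.assoc)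
  qed
qed

lemma boundary_atoms:
  fixes \<Psi> :: "nat \<Rightarrow> 'b::euclidean_space \<Rightarrow> 'a::euclidean_space"
  assumes atlas: "boundary_atlas \<Omega> r\<^sub>0 N P \<Psi>"
    and q: "1 < q" and \<tau>: "0 < \<tau>" "\<tau> < 2" and \<rho>: "\<rho> > 0" and M: "M \<ge> 0"
  shows "\<exists>C\<ge>0. \<forall>Js Ks \<xi> a \<psi>. atomic_data J M \<rho> N' Js Ks \<xi> \<longrightarrow>
    (\<forall>Q\<in>frontier \<Omega>. \<psi> Q = atomic_sum (DIM('b) / q - \<tau>) Js Ks \<xi> a Q) \<longrightarrow>
    \<psi> \<in> bdry_besov r\<^sub>0 N \<Psi> \<tau> q \<and>
    bdry_besov_norm r\<^sub>0 N \<Psi> \<tau> q \<psi> \<le> C * (\<Sum>j\<in>Js. \<Sum>x\<in>Ks j. \<bar>a j x\<bar> powr q) powr (1 / q)"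
proof -
  have r: "r\<^sub>0 > 0" and par: "C2_parametrization (ball 0 r\<^sub>0) (\<Psi> i)" and im: "\<Psi> i ` ball 0 r\<^sub>0 \<subseteq> frontier \<Omega>" if "i < N" for i
    using atlas that by (auto simp: boundary_atlas_def bij_betw_def)
  \<comment> \<open>Named so that the constants of the finitely many charts can be chosen
    simultaneously and added.\<close>
  define good where "good i C \<longleftrightarrow> 0 \<le> C \<and> (\<forall>Js Ks \<xi> a \<psi>. atomic_data J M \<rho> N' Js Ks \<xi> \<longrightarrow>
    (\<forall>y\<in>ball 0 r\<^sub>0. \<psi> (\<Psi> i y) = atomic_sum (DIM('b) / q - \<tau>) Js Ks \<xi> a (\<Psi> i y)) \<longrightarrow>
    \<psi> \<circ> \<Psi> i \<in> besov_on (ball 0 r\<^sub>0) \<tau> q \<and>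
    besov_on_norm (ball 0 r\<^sub>0) \<tau> q (\<psi> \<circ> \<Psi> i) \<le> C * (\<Sum>j\<in>Js. \<Sum>x\<in>Ks j. \<bar>a j x\<bar> powr q) powr (1 / q))" for i C
  have "\<exists>C. good i C" if "i < N" for i
    unfolding good_def by (rule chart_atoms[OF r[OF that] par[OF that] q \<tau> \<rho> M])
  then obtain C where gC: "\<And>i. i < N \<Longrightarrow> good i (C i)" by metis
  show ?thesis
  proof (intro exI[of _ "\<Sum>i<N. C i"] conjI allI impI)
    show "0 \<le> (\<Sum>i<N. C i)" using gC by (intro sum_nonneg) (auto simp: good_def)
    fix Js Ks and \<xi> a :: "int \<Rightarrow> 'a \<Rightarrow> real" and \<psi> :: "'a \<Rightarrow> real"
    assume ad: "atomic_data J M \<rho> N' Js Ks \<xi>" and \<psi>: "\<forall>Q\<in>frontier \<Omega>. \<psi> Q = atomic_sum (DIM('b) / q - \<tau>) Js Ks \<xi> a Q"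
    have c: "\<psi> \<circ> \<Psi> i \<in> besov_on (ball 0 r\<^sub>0) \<tau> q \<and>
      besov_on_norm (ball 0 r\<^sub>0) \<tau> q (\<psi> \<circ> \<Psi> i) \<le> C i * (\<Sum>j\<in>Js. \<Sum>x\<in>Ks j. \<bar>a j x\<bar> powr q) powr (1 / q)" if "i < N" for i
      by (rule conjunct2[OF gC[OF that, unfolded good_def], rule_format, OF ad]) (use \<psi> im[OF that] in \<open>auto simp: subset_iff\<close>)
    show "\<psi> \<in> bdry_besov r\<^sub>0 N \<Psi> \<tau> q" using c by (simp add: bdry_besov_def)
    show "bdry_besov_norm r\<^sub>0 N \<Psi> \<tau> q \<psi> \<le> (\<Sum>i<N. C i) * (\<Sum>j\<in>Js. \<Sum>x\<in>Ks j. \<bar>a j x\<bar> powr q) powr (1 / q)"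
      unfolding bdry_besov_norm_def sum_distrib_right using c by (intro sum_mono) auto
  qed
qed


lemma creg_cutoff_mult:
  assumes "0 < r" "r < r1"
  obtains K and \<kappa> :: "'a::euclidean_space \<Rightarrow> real" where "K \<ge> 0" "\<And>y. norm y \<le> r \<Longrightarrow> \<kappa> y = 1" "\<And>y. norm y > r1 \<Longrightarrow> \<kappa> y = 0"
    "\<And>M \<theta>. creg 1 M \<theta> \<Longrightarrow> creg 1 (K * M) (\<lambda>y. \<kappa> y * \<theta> y)"
proof -
  obtain \<kappa> :: "'a \<Rightarrow> real" and K where \<kappa>: "creg 1 K \<kappa>" "\<And>y. norm y \<le> r \<Longrightarrow> \<kappa> y = 1" "\<And>y. norm y > r1 \<Longrightarrow> \<kappa> y = 0"
    using ball_cutoff[OF assms] by metis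
  have "creg 1 (2 ^ 2 * K * M) (\<lambda>y. \<kappa> y * \<theta> y)" if "creg 1 M \<theta>" for M \<theta>
    using creg_mult[OF \<kappa>(1) that] by (simp add: mult.assoc numeral_2_eq_2)
  then show ?thesis using that[of "2 ^ 2 * K" \<kappa>] \<kappa>(2,3) creg_nonneg[OF \<kappa>(1)] by simp
qed

section \<open>The dual space on the boundary and its action on atoms\<close>

locale boundary_dual =
  fixes \<Omega> :: "'a::euclidean_space set" and r\<^sub>0 :: real and N :: nat and P :: "nat \<Rightarrow> 'a"
    and \<Psi> :: "nat \<Rightarrow> 'b::euclidean_space \<Rightarrow> 'a" and p s :: real
  assumes atlas: "boundary_atlas \<Omega> r\<^sub>0 N P \<Psi>" and bounded: "bounded \<Omega>"
    and p: "1 < p" and s: "-2 < s" "s < 0"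
begin

definition q where "q = p / (p - 1)"

text \<open>The normalizing exponent of atoms for smoothness -s and integrability q on a surface of
  dimension \<open>DIM('b)\<close>.\<close>

definition e where "e = real DIM('b) / q + s"

abbreviation X where "X \<equiv> bdry_besov r\<^sub>0 N \<Psi> (- s) (p / (p - 1))"

abbreviation nX where "nX \<equiv> bdry_besov_norm r\<^sub>0 N \<Psi> (- s) (p / (p - 1))"

abbreviation D where "D \<equiv> bdry_besov_dual r\<^sub>0 N \<Psi> s p"

abbreviation nD where "nD \<equiv> bdry_besov_dual_norm r\<^sub>0 N \<Psi> s p"

lemma q1: "1 < q" and pq: "1 / q = 1 - 1 / p" "q * (p - 1) = p"
  using p by (auto simp: q_def field_simps)

lemma compact_frontier: "compact (frontier \<Omega>)"
  using bounded by (simp add: compact_frontier_bounded)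

lemma D_add: "\<phi> \<in> D \<Longrightarrow> \<psi> \<in> X \<Longrightarrow> \<theta> \<in> X \<Longrightarrow> \<phi> (\<lambda>Q. \<psi> Q + \<theta> Q) = \<phi> \<psi> + \<phi> \<theta>"
  and D_mult: "\<phi> \<in> D \<Longrightarrow> \<psi> \<in> X \<Longrightarrow> \<phi> (\<lambda>Q. a * \<psi> Q) = a * \<phi> \<psi>"
  by (auto simp: bdry_besov_dual_def Let_def)

lemma nX_nonneg: "\<psi> \<in> X \<Longrightarrow> 0 \<le> nX \<psi>"
  unfolding bdry_besov_norm_def by (intro sum_nonneg besov_on_norm_nonneg) (auto simp: bdry_besov_def)

lemma D_bound:
  assumes "\<phi> \<in> D"
  obtains C where "C \<ge> 0" "\<And>\<psi>. \<psi> \<in> X \<Longrightarrow> \<bar>\<phi> \<psi>\<bar> \<le> C * nX \<psi>"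
proof -
  have "\<exists>C. \<forall>\<psi>\<in>X. \<bar>\<phi> \<psi>\<bar> \<le> C * nX \<psi>"
    using assms by (simp add: bdry_besov_dual_def Let_def)
  then obtain C where C: "\<forall>\<psi>\<in>X. \<bar>\<phi> \<psi>\<bar> \<le> C * nX \<psi>" by (rule exE) (rule that)
  show ?thesis
  proof (rule that[of "max 0 C"])
    show "\<bar>\<phi> \<psi>\<bar> \<le> max 0 C * nX \<psi>" if "\<psi> \<in> X" for \<psi>
      using C[rule_format, OF that] mult_right_mono[OF max.cobounded2[of C 0] nX_nonneg[OF that]] by linarith
  qed simp
qed

lemma nD_upper:
  assumes "\<phi> \<in> D" "\<psi> \<in> X" "nX \<psi> \<le> 1"
  shows "\<bar>\<phi> \<psi>\<bar> \<le> nD \<phi>"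
proof -
  obtain C where C: "C \<ge> 0" "\<And>\<psi>. \<psi> \<in> X \<Longrightarrow> \<bar>\<phi> \<psi>\<bar> \<le> C * nX \<psi>" using D_bound[OF assms(1)] by metis
  have "\<bar>\<phi> \<psi>\<bar> \<le> C" if "\<psi> \<in> X" "nX \<psi> \<le> 1" for \<psi>
    using C(2)[OF that(1)] mult_left_mono[OF that(2) C(1)] by simp
  then have "bdd_above {\<bar>\<phi> \<psi>\<bar> | \<psi>. \<psi> \<in> X \<and> nX \<psi> \<le> 1}" by (intro bdd_aboveI[of _ C]) auto
  then show ?thesis
    unfolding bdry_besov_dual_norm_def by (rule cSup_upper[rotated]) (use assms in auto)
qed

text \<open>The dual norm is a supremum over the unit ball, so the atomic sum is scaled into it by t
  = 1 / ((C + 1) A). Using C + 1 avoids division by zero. If A = 0 the function has norm 0, and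
  \<phi> annihilates it by the bound contained in membership in the dual.\<close>

lemma dual_atoms:
  assumes \<rho>: "\<rho> > 0" and M: "M \<ge> 0"
  shows "\<exists>C\<ge>0. \<forall>\<phi>\<in>D. \<forall>Js Ks \<xi> a \<psi>. atomic_data J M \<rho> N' Js Ks \<xi> \<longrightarrow>
    (\<forall>Q\<in>frontier \<Omega>. \<psi> Q = atomic_sum e Js Ks \<xi> a Q) \<longrightarrow>
    \<psi> \<in> X \<and> \<bar>\<phi> \<psi>\<bar> \<le> C * nD \<phi> * (\<Sum>j\<in>Js. \<Sum>x\<in>Ks j. \<bar>a j x\<bar> powr q) powr (1 / q)"
proof -
  have ex: "\<exists>C\<ge>0. \<forall>Js Ks \<xi> a \<psi>. atomic_data J M \<rho> N' Js Ks \<xi> \<longrightarrow>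
    (\<forall>Q\<in>frontier \<Omega>. \<psi> Q = atomic_sum e Js Ks \<xi> a Q) \<longrightarrow>
    \<psi> \<in> X \<and> nX \<psi> \<le> C * (\<Sum>j\<in>Js. \<Sum>x\<in>Ks j. \<bar>a j x\<bar> powr q) powr (1 / q)"
    using boundary_atoms[OF atlas q1 _ _ \<rho> M, of "- s" J N'] s by (simp add: e_def q_def)
  obtain C where C: "C \<ge> 0" "\<forall>Js Ks \<xi> a \<psi>. atomic_data J M \<rho> N' Js Ks \<xi> \<longrightarrow>
    (\<forall>Q\<in>frontier \<Omega>. \<psi> Q = atomic_sum e Js Ks \<xi> a Q) \<longrightarrow>
    \<psi> \<in> X \<and> nX \<psi> \<le> C * (\<Sum>j\<in>Js. \<Sum>x\<in>Ks j. \<bar>a j x\<bar> powr q) powr (1 / q)"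
    using ex by (elim exE conjE) (rule that)
  note C2 = C(2)[rule_format]
  show ?thesis
  proof (intro exI[of _ "C + 1"] conjI ballI allI impI)
    show "0 \<le> C + 1" using C by simp
    fix \<phi> Js Ks and \<xi> a :: "int \<Rightarrow> 'a \<Rightarrow> real" and \<psi>
    assume \<phi>: "\<phi> \<in> D" and ad: "atomic_data J M \<rho> N' Js Ks \<xi>" and \<psi>: "\<forall>Q\<in>frontier \<Omega>. \<psi> Q = atomic_sum e Js Ks \<xi> a Q"
    have 1: "\<psi> \<in> X \<and> nX \<psi> \<le> C * (\<Sum>j\<in>Js. \<Sum>x\<in>Ks j. \<bar>a j x\<bar> powr q) powr (1 / q)"
      by (rule C2[OF ad]) (use \<psi> in simp)
    then show X: "\<psi> \<in> X" by simp
    define A where "A = (\<Sum>j\<in>Js. \<Sum>x\<in>Ks j. \<bar>a j x\<bar> powr q) powr (1 / q)"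
    have A0: "A \<ge> 0" by (simp add: A_def)
    show "\<bar>\<phi> \<psi>\<bar> \<le> (C + 1) * nD \<phi> * (\<Sum>j\<in>Js. \<Sum>x\<in>Ks j. \<bar>a j x\<bar> powr q) powr (1 / q)"
    proof (cases "A = 0")
      case True
      obtain K where K: "K \<ge> 0" "\<And>\<psi>. \<psi> \<in> X \<Longrightarrow> \<bar>\<phi> \<psi>\<bar> \<le> K * nX \<psi>" using D_bound[OF \<phi>] by metis
      have "nX \<psi> \<le> 0" using 1 True by (simp add: A_def)
      then have "nX \<psi> = 0" using nX_nonneg[OF X] by simp
      then show ?thesis using K(2)[OF X] True by (simp add: A_def)
    next
      case False
      then have Ap: "A > 0" using A0 by simp
      define t where "t = 1 / ((C + 1) * A)"
      have t: "t > 0" using Ap C(1) by (simp add: t_def)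
      have 2: "(\<lambda>Q. t * \<psi> Q) \<in> X \<and> nX (\<lambda>Q. t * \<psi> Q) \<le> C * (\<Sum>j\<in>Js. \<Sum>x\<in>Ks j. \<bar>t * a j x\<bar> powr q) powr (1 / q)"
        by (rule C2[OF ad]) (use \<psi> in \<open>simp add: atomic_sum_def sum_distrib_left mult.assoc\<close>)
      have "(\<Sum>j\<in>Js. \<Sum>x\<in>Ks j. \<bar>t * a j x\<bar> powr q) = t powr q * (\<Sum>j\<in>Js. \<Sum>x\<in>Ks j. \<bar>a j x\<bar> powr q)"
        using t by (simp add: abs_mult powr_mult sum_distrib_left)
      then have "(\<Sum>j\<in>Js. \<Sum>x\<in>Ks j. \<bar>t * a j x\<bar> powr q) powr (1 / q) = t * A"
        using t q1 by (simp add: powr_mult A_def powr_powr)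
      moreover have "t * A = 1 / (C + 1)" using Ap by (simp add: t_def)
      then have "C * (t * A) \<le> 1" using C(1) by simp
      ultimately have "\<bar>\<phi> (\<lambda>Q. t * \<psi> Q)\<bar> \<le> nD \<phi>" using 2 by (intro nD_upper[OF \<phi>]) auto
      then have "t * \<bar>\<phi> \<psi>\<bar> \<le> nD \<phi>" using t by (simp add: D_mult[OF \<phi> X] abs_mult)
      then have "((C + 1) * A) * (t * \<bar>\<phi> \<psi>\<bar>) \<le> ((C + 1) * A) * nD \<phi>" using Ap C(1) by (intro mult_left_mono) auto
      moreover have "((C + 1) * A) * (t * \<bar>\<phi> \<psi>\<bar>) = \<bar>\<phi> \<psi>\<bar>" using Ap C(1) by (simp add: t_def)
      ultimately have "\<bar>\<phi> \<psi>\<bar> \<le> ((C + 1) * A) * nD \<phi>" by (simp only:)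
      then show ?thesis unfolding A_def[symmetric] by (simp add: mult_ac)
    qed
  qed
qed

text \<open>A supremum of absolute values is known to be nonnegative only once the set has an
  element and is bounded. The element comes from the zero function, which lies in the space as an
  empty sum of atoms.\<close>

lemma nD_nonneg:
  assumes "\<phi> \<in> D"
  shows "0 \<le> nD \<phi>"
proof -
  have ex: "\<exists>C\<ge>0. \<forall>Js Ks \<xi> a \<psi>. atomic_data 0 1 1 0 Js Ks \<xi> \<longrightarrow>
    (\<forall>Q\<in>frontier \<Omega>. \<psi> Q = atomic_sum e Js Ks \<xi> a Q) \<longrightarrow>
    \<psi> \<in> X \<and> nX \<psi> \<le> C * (\<Sum>j\<in>Js. \<Sum>x\<in>Ks j. \<bar>a j x\<bar> powr q) powr (1 / q)"
    using boundary_atoms[OF atlas q1 _ _ zero_less_one zero_le_one, of "- s" 0 0] s by (simp add: e_def q_def)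
  obtain C where C: "C \<ge> 0" "\<forall>Js Ks \<xi> a \<psi>. atomic_data 0 1 1 0 Js Ks \<xi> \<longrightarrow>
    (\<forall>Q\<in>frontier \<Omega>. \<psi> Q = atomic_sum e Js Ks \<xi> a Q) \<longrightarrow>
    \<psi> \<in> X \<and> nX \<psi> \<le> C * (\<Sum>j\<in>Js. \<Sum>x\<in>Ks j. \<bar>a j x\<bar> powr q) powr (1 / q)"
    using ex by (elim exE conjE) (rule that)
  have "(\<lambda>Q. 0) \<in> X \<and> nX (\<lambda>Q. 0) \<le> C * (\<Sum>j\<in>({}::int set). \<Sum>x\<in>({}::'a set). \<bar>0\<bar> powr q) powr (1 / q)"
    by (rule C(2)[rule_format, of "{}" "\<lambda>_. {}" "\<lambda>_ _. 0" _ "\<lambda>_ _. 0"]) (auto simp: atomic_data_def atomic_sum_def)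
  then have "\<bar>\<phi> (\<lambda>Q. 0)\<bar> \<le> nD \<phi>" by (intro nD_upper[OF assms]) auto
  then show ?thesis by linarith
qed

text \<open>Restrictions to the boundary of C^{1,1} functions with constant M. Linearity of \<phi>
  is granted on its domain only; this explicit subspace contains every function to which linearity
  is applied.\<close>

definition Y where "Y M = {\<psi>. \<exists>\<theta>. creg 1 M \<theta> \<and> (\<forall>Q\<in>frontier \<Omega>. \<psi> Q = \<theta> Q)}"

lemma frontier_radius:
  obtains R where "R > 0" "\<And>Q. Q \<in> frontier \<Omega> \<Longrightarrow> norm Q \<le> R"
  using compact_imp_bounded[OF compact_frontier] by (auto simp: bounded_pos)

text \<open>After a cut-off around the boundary, which changes nothing on it, a C^{1,1} function is
  a single atom at scale 0 centred at the origin. The constant is independent of M.\<close>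

lemma dual_Y: "\<exists>C\<ge>0. \<forall>\<phi>\<in>D. \<forall>M. \<forall>\<psi>\<in>Y M. \<psi> \<in> X \<and> \<bar>\<phi> \<psi>\<bar> \<le> C * nD \<phi> * M"
proof -
  obtain R where R: "R > 0" "\<And>Q. Q \<in> frontier \<Omega> \<Longrightarrow> norm Q \<le> R" by (rule frontier_radius) (rule that)
  have R1: "R + 1 > 0" using R by simp
  obtain K and \<kappa> :: "'a \<Rightarrow> real" where K: "K \<ge> 0" and \<kappa>: "\<And>y. norm y \<le> R \<Longrightarrow> \<kappa> y = 1" "\<And>y. norm y > R + 1 \<Longrightarrow> \<kappa> y = 0"
    and \<kappa>c: "\<And>M \<theta>. creg 1 M \<theta> \<Longrightarrow> creg 1 (K * M) (\<lambda>y. \<kappa> y * \<theta> y)"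
    by (rule creg_cutoff_mult[of R "R + 1"]) (use R in \<open>auto intro: that\<close>)
  obtain C where C: "C \<ge> 0" "\<forall>\<phi>\<in>D. \<forall>Js Ks \<xi> a \<psi>. atomic_data 0 K (R + 1) 1 Js Ks \<xi> \<longrightarrow>
    (\<forall>Q\<in>frontier \<Omega>. \<psi> Q = atomic_sum e Js Ks \<xi> a Q) \<longrightarrow>
    \<psi> \<in> X \<and> \<bar>\<phi> \<psi>\<bar> \<le> C * nD \<phi> * (\<Sum>j\<in>Js. \<Sum>x\<in>Ks j. \<bar>a j x\<bar> powr q) powr (1 / q)"
    using dual_atoms[OF R1 K, of 0 1] by (elim exE conjE) (rule that)
  show ?thesis
  proof (intro exI[of _ C] conjI[OF C(1)] ballI allI)
    fix \<phi> M \<psi> assume \<phi>: "\<phi> \<in> D" and "\<psi> \<in> Y M"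
    then obtain \<theta> where \<theta>: "creg 1 M \<theta>" "\<And>Q. Q \<in> frontier \<Omega> \<Longrightarrow> \<psi> Q = \<theta> Q" by (auto simp: Y_def)
    have M: "M \<ge> 0" by (rule creg_nonneg[OF \<theta>(1)])
    \<comment> \<open>An atom centred at 0 is evaluated at -Q, hence the reflection. Division by M
      normalizes the profile and the coefficient M undoes it; for M = 0 both sides vanish, since
      then \<theta> = 0.\<close>
    define \<xi> where "\<xi> w = \<kappa> (- w) * ((1 / M) * \<theta> (- w))" for w
    have "creg 1 1 (\<lambda>y. (1 / M) * \<theta> y)"
      by (rule creg_mono[OF creg_cmult[OF \<theta>(1)]]) (use M in auto)
    from creg_affine[OF \<kappa>c[OF this], of "-1" 1 0] have xi: "creg 1 K \<xi>" by (simp add: \<xi>_def[abs_def])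
    have "\<psi> \<in> X \<and> \<bar>\<phi> \<psi>\<bar> \<le> C * nD \<phi> * (\<Sum>j\<in>{0::int}. \<Sum>x\<in>{0::'a}. \<bar>M\<bar> powr q) powr (1 / q)"
    proof (rule C(2)[rule_format, OF \<phi>, of "{0}" "\<lambda>_. {0}" "\<lambda>_. \<xi>" _ "\<lambda>_ _. M"])
      show "atomic_data 0 K (R + 1) 1 {0} (\<lambda>_. {0}) (\<lambda>_. \<xi>)"
        using xi \<kappa>(2) by (auto simp: atomic_data_def \<xi>_def intro!: card_mono[of "{0}", simplified])
      show "\<psi> Q = atomic_sum e {0} (\<lambda>_. {0}) (\<lambda>_. \<xi>) (\<lambda>_ _. M) Q" if "Q \<in> frontier \<Omega>" for Q
        using \<theta>(2)[OF that] \<kappa>(1)[OF R(2)[OF that]] creg_bound[OF \<theta>(1), of Q] by (auto simp: atomic_sum_def \<xi>_def)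
    qed
    moreover have "(\<bar>M\<bar> powr q) powr (1 / q) = M" using M q1 by (simp add: powr_powr)
    ultimately show "\<psi> \<in> X \<and> \<bar>\<phi> \<psi>\<bar> \<le> C * nD \<phi> * M" by simp
  qed
qed

end

section \<open>Duality with atoms on lattices\<close>

definition lattice_point :: "('a::euclidean_space \<Rightarrow> int) \<Rightarrow> 'a" where
  "lattice_point f = (\<Sum>b\<in>Basis. of_int (f b) *\<^sub>R b)"

definition lattice_box :: "int \<Rightarrow> 'a::euclidean_space set" where
  "lattice_box m = lattice_point ` (Basis \<rightarrow>\<^sub>E {- m..m})"

lemma lattice_point_inner: "b \<in> Basis \<Longrightarrow> lattice_point f \<bullet> b = of_int (f b)"
  by (simp add: lattice_point_def)

lemma finite_lattice_box: "finite (lattice_box m)"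
  unfolding lattice_box_def by (intro finite_imageI finite_PiE) auto

lemma lattice_box_cover:
  assumes "norm y \<le> real_of_int m - 1"
  shows "\<exists>k\<in>lattice_box m. y - k \<in> cbox 0 One"
proof -
  define f where "f = restrict (\<lambda>b. \<lfloor>y \<bullet> b\<rfloor>) Basis"
  have "f \<in> Basis \<rightarrow>\<^sub>E {- m..m}"
  proof (rule PiE_I)
    fix b :: 'a assume b: "b \<in> Basis"
    have "\<bar>y \<bullet> b\<bar> \<le> real_of_int m - 1" using Basis_le_norm[OF b, of y] assms by linarith
    then show "f b \<in> {- m..m}" using b by (simp add: f_def) linarith
  qed (simp add: f_def)
  moreover have "y - lattice_point f \<in> cbox 0 One"
    unfolding mem_box by (auto simp: inner_diff_left lattice_point_inner f_def) linarith
  ultimately show ?thesis unfolding lattice_box_def by blast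
qed

text \<open>Each coordinate of a lattice point at distance at most n from u is one of 2n + 2
  integers around the coordinate of u.\<close>

lemma lattice_overlap:
  fixes u :: "'a::euclidean_space" and n :: nat
  assumes K: "K \<subseteq> range lattice_point"
  shows "finite {k \<in> K. norm (u - k) \<le> real n} \<and> card {k \<in> K. norm (u - k) \<le> real n} \<le> (2 * n + 2) ^ DIM('a)"
proof -
  define G where "G = (\<Pi>\<^sub>E b\<in>Basis. {\<lfloor>u \<bullet> b\<rfloor> - int n..\<lfloor>u \<bullet> b\<rfloor> + int n + 1})"
  have G: "finite G" unfolding G_def by (intro finite_PiE) auto
  have cG: "card G = (2 * n + 2) ^ DIM('a)"
    unfolding G_def by (subst card_PiE) (auto simp: nat_add_distrib nat_mult_distrib)
  have sub: "{k \<in> K. norm (u - k) \<le> real n} \<subseteq> lattice_point ` G"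
  proof clarify
    fix k assume k: "k \<in> K" "norm (u - k) \<le> real n"
    then obtain f where f: "k = lattice_point f" using K by auto
    have "restrict f Basis \<in> G"
      unfolding G_def
    proof (rule PiE_I)
      fix b :: 'a assume b: "b \<in> Basis"
      have "\<bar>(u - k) \<bullet> b\<bar> \<le> real n" using Basis_le_norm[OF b, of "u - k"] k by linarith
      then have "\<bar>u \<bullet> b - of_int (f b)\<bar> \<le> real n" using b by (simp add: f inner_diff_left lattice_point_inner)
      then show "restrict f Basis b \<in> {\<lfloor>u \<bullet> b\<rfloor> - int n..\<lfloor>u \<bullet> b\<rfloor> + int n + 1}" using b by simp linarith
    qed simp
    moreover have "k = lattice_point (restrict f Basis)" by (simp add: f lattice_point_def)
    ultimately show "k \<in> lattice_point ` G" by blast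
  qed
  show ?thesis
    using card_mono[OF finite_imageI[OF G] sub] card_image_le[OF G, of lattice_point] cG finite_subset[OF sub finite_imageI[OF G]]
    by linarith
qed

text \<open>The translates of the unit cube by lattice points cover the support of g, so the
  integral over the whole space is at most an average over offsets z of lattice sums. It carries
  discrete estimates that are uniform in z over to integrals. Only an inequality results because
  closed cubes share faces.\<close>

lemma unit_cube_average:
  fixes g :: "'a::euclidean_space \<Rightarrow> ennreal"
  assumes [measurable]: "g \<in> borel_measurable borel" and E: "finite E"
    and cov: "\<And>y. g y \<noteq> 0 \<Longrightarrow> \<exists>k\<in>E. y - k \<in> cbox 0 One"
  shows "(\<integral>\<^sup>+y. g y \<partial>lborel) \<le> (\<integral>\<^sup>+z. indicator (cbox 0 One) z * (\<Sum>k\<in>E. g (z + k)) \<partial>lborel)"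
proof -
  have "(\<integral>\<^sup>+y. g y \<partial>lborel) \<le> (\<integral>\<^sup>+y. (\<Sum>k\<in>E. indicator (cbox 0 One) (y - k) * g y) \<partial>lborel)"
  proof (rule nn_integral_mono)
    fix y
    show "g y \<le> (\<Sum>k\<in>E. indicator (cbox 0 One) (y - k) * g y)"
    proof (cases "g y = 0")
      case False
      then obtain k where k: "k \<in> E" "y - k \<in> cbox 0 One" using cov by blast
      have "g y = indicator (cbox 0 One) (y - k) * g y" using k by simp
      also have "\<dots> \<le> (\<Sum>k\<in>E. indicator (cbox 0 One) (y - k) * g y)" by (rule member_le_sum[OF k(1) _ E]) simp
      finally show ?thesis .
    qed simp
  qed
  also have "\<dots> = (\<Sum>k\<in>E. \<integral>\<^sup>+y. indicator (cbox 0 One) (y - k) * g y \<partial>lborel)"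
    by (rule nn_integral_sum) simp
  also have "\<dots> = (\<Sum>k\<in>E. \<integral>\<^sup>+y. indicator (cbox 0 One) ((y + k) - k) * g (y + k) \<partial>lborel)"
    by (intro sum.cong nn_integral_lborel_shift[symmetric] refl) simp
  also have "\<dots> = (\<integral>\<^sup>+z. (\<Sum>k\<in>E. indicator (cbox 0 One) z * g (z + k)) \<partial>lborel)"
    by (subst nn_integral_sum) simp_all
  also have "\<dots> = (\<integral>\<^sup>+z. indicator (cbox 0 One) z * (\<Sum>k\<in>E. g (z + k)) \<partial>lborel)"
    by (simp add: sum_distrib_left)
  finally show ?thesis .
qed

lemma nn_integral_lborel_scale:
  fixes g :: "'a::euclidean_space \<Rightarrow> ennreal"
  assumes [measurable]: "g \<in> borel_measurable borel" and c: "c > 0"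
  shows "(\<integral>\<^sup>+x. g x \<partial>lborel) = ennreal (c ^ DIM('a)) * (\<integral>\<^sup>+x. g (c *\<^sub>R x) \<partial>lborel)"
proof -
  have "(\<integral>\<^sup>+x. g x \<partial>lborel) = (\<integral>\<^sup>+x. g x \<partial>density (distr lborel borel (\<lambda>x. 0 + c *\<^sub>R x)) (\<lambda>_. ennreal (\<bar>c\<bar> ^ DIM('a))))"
    using lborel_affine[of c "0::'a"] c by simp
  also have "\<dots> = ennreal (c ^ DIM('a)) * (\<integral>\<^sup>+x. g (c *\<^sub>R x) \<partial>lborel)"
    using c by (simp add: nn_integral_density nn_integral_distr nn_integral_cmult)
  finally show ?thesis .
qed

text \<open>The maximizers may be chosen independently for each index.\<close>

lemma sum_SUP_le:
  fixes g :: "'i \<Rightarrow> 'x \<Rightarrow> ennreal"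
  assumes F: "finite F" and S: "S \<noteq> {}"
    and b: "\<And>\<xi>. (\<And>j. j \<in> F \<Longrightarrow> \<xi> j \<in> S) \<Longrightarrow> c + (\<Sum>j\<in>F. g j (\<xi> j)) \<le> B"
  shows "c + (\<Sum>j\<in>F. SUP x\<in>S. g j x) \<le> B"
  using F b
proof (induction F arbitrary: c rule: finite_induct)
  case empty
  then show ?case by simp
next
  case (insert i F)
  have "g i x + (c + (\<Sum>j\<in>F. SUP x\<in>S. g j x)) \<le> B" if x: "x \<in> S" for x
  proof -
    have "(c + g i x) + (\<Sum>j\<in>F. SUP x\<in>S. g j x) \<le> B"
    proof (rule insert.IH)
      fix \<xi> assume xi: "\<And>j. j \<in> F \<Longrightarrow> \<xi> j \<in> S"
      have "c + (\<Sum>j\<in>insert i F. g j ((\<xi>(i := x)) j)) \<le> B" by (rule insert.prems) (use xi x in auto)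
      moreover have "(\<Sum>j\<in>F. g j ((\<xi>(i := x)) j)) = (\<Sum>j\<in>F. g j (\<xi> j))" using insert.hyps by (intro sum.cong) auto
      ultimately show "(c + g i x) + (\<Sum>j\<in>F. g j (\<xi> j)) \<le> B" using insert.hyps by (simp add: add.assoc)
    qed
    then show ?thesis by (simp add: add_ac)
  qed
  then have "(SUP x\<in>S. g i x + (c + (\<Sum>j\<in>F. SUP x\<in>S. g j x))) \<le> B" by (rule SUP_least)
  then have "(SUP x\<in>S. g i x) + (c + (\<Sum>j\<in>F. SUP x\<in>S. g j x)) \<le> B"
    by (simp only: ennreal_SUP_add_left[OF S])
  then show ?case using insert.hyps by (simp add: add_ac)
qed

section \<open>Linearity of the functional on smooth functions, and its pairing with bumps\<close>

context boundary_dual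
begin

lemma Y_add: "\<psi> \<in> Y M \<Longrightarrow> \<theta> \<in> Y M' \<Longrightarrow> (\<lambda>Q. \<psi> Q + \<theta> Q) \<in> Y (M + M')"
  unfolding Y_def by clarify (rule exI, rule conjI, erule (1) creg_add, simp)

lemma Y_cmult: "\<psi> \<in> Y M \<Longrightarrow> (\<lambda>Q. c * \<psi> Q) \<in> Y (\<bar>c\<bar> * M)"
  unfolding Y_def by clarify (rule exI, rule conjI, erule creg_cmult, simp)

lemma Y_I: "creg 1 M \<theta> \<Longrightarrow> (\<And>Q. Q \<in> frontier \<Omega> \<Longrightarrow> \<psi> Q = \<theta> Q) \<Longrightarrow> \<psi> \<in> Y M"
  unfolding Y_def by auto

lemma Y_X: "\<phi> \<in> D \<Longrightarrow> \<psi> \<in> Y M \<Longrightarrow> \<psi> \<in> X"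
  using dual_Y by (elim exE conjE) (elim ballE allE; blast)

lemma dual_add: "\<phi> \<in> D \<Longrightarrow> \<psi> \<in> Y M \<Longrightarrow> \<theta> \<in> Y M' \<Longrightarrow> \<phi> (\<lambda>Q. \<psi> Q + \<theta> Q) = \<phi> \<psi> + \<phi> \<theta>"
  by (rule D_add) (auto intro: Y_X)

lemma dual_cmult: "\<phi> \<in> D \<Longrightarrow> \<psi> \<in> Y M \<Longrightarrow> \<phi> (\<lambda>Q. c * \<psi> Q) = c * \<phi> \<psi>"
  by (rule D_mult) (auto intro: Y_X)

lemma dual_diff:
  assumes "\<phi> \<in> D" "\<psi> \<in> Y M" "\<theta> \<in> Y M'"
  shows "\<phi> (\<lambda>Q. \<psi> Q - \<theta> Q) = \<phi> \<psi> - \<phi> \<theta>"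
  using dual_add[OF assms(1,2) Y_cmult[OF assms(3), of "-1"]] dual_cmult[OF assms(1,3), of "-1"] by simp

text \<open>The functional acts on total functions, and its dependence on boundary values alone is a
  consequence of its boundedness: a function vanishing on the boundary belongs to
  \<open>Y 0\<close>.\<close>

lemma dual_zero:
  assumes \<phi>: "\<phi> \<in> D" and z: "\<And>Q. Q \<in> frontier \<Omega> \<Longrightarrow> \<psi> Q = 0"
  shows "\<phi> \<psi> = 0"
proof -
  have Y: "\<psi> \<in> Y 0" by (rule Y_I[where \<theta>="\<lambda>_. 0"]) (use z creg_zero in auto)
  obtain C where "\<forall>\<phi>\<in>D. \<forall>M. \<forall>\<psi>\<in>Y M. \<psi> \<in> X \<and> \<bar>\<phi> \<psi>\<bar> \<le> C * nD \<phi> * M" using dual_Y by (elim exE conjE) (rule that)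
  from this[rule_format, OF \<phi> Y] show ?thesis by simp
qed

lemma dual_cong:
  assumes \<phi>: "\<phi> \<in> D" and "\<theta> \<in> Y M" and z: "\<And>Q. Q \<in> frontier \<Omega> \<Longrightarrow> \<psi> Q = \<theta> Q"
  shows "\<phi> \<psi> = \<phi> \<theta>"
proof -
  have "\<psi> \<in> Y M" using assms(2) z by (auto simp: Y_def)
  then have "\<phi> (\<lambda>Q. \<psi> Q - \<theta> Q) = \<phi> \<psi> - \<phi> \<theta>" using assms by (intro dual_diff)
  moreover have "\<phi> (\<lambda>Q. \<psi> Q - \<theta> Q) = 0" by (rule dual_zero[OF \<phi>]) (use z in simp)
  ultimately show ?thesis by simp
qed

lemma Y_sum: "finite I \<Longrightarrow> (\<And>i. i \<in> I \<Longrightarrow> \<psi> i \<in> Y (M i)) \<Longrightarrow> (\<lambda>Q. \<Sum>i\<in>I. \<psi> i Q) \<in> Y (\<Sum>i\<in>I. M i)"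
proof (induction I rule: finite_induct)
  case empty
  then show ?case by (auto intro!: Y_I[where \<theta>="\<lambda>_. 0"] creg_zero)
qed (auto intro: Y_add)

lemma dual_sum:
  assumes \<phi>: "\<phi> \<in> D"
  shows "finite I \<Longrightarrow> (\<And>i. i \<in> I \<Longrightarrow> \<psi> i \<in> Y (M i)) \<Longrightarrow> \<phi> (\<lambda>Q. \<Sum>i\<in>I. \<psi> i Q) = (\<Sum>i\<in>I. \<phi> (\<psi> i))"
proof (induction I rule: finite_induct)
  case empty
  then show ?case using dual_zero[OF \<phi>] by simp
next
  case (insert i I)
  have "\<phi> (\<lambda>Q. \<psi> i Q + (\<Sum>i\<in>I. \<psi> i Q)) = \<phi> (\<psi> i) + \<phi> (\<lambda>Q. \<Sum>i\<in>I. \<psi> i Q)"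
    by (rule dual_add[OF \<phi> _ Y_sum[OF insert.hyps(1)]]) (use insert.prems in auto)
  then show ?case using insert by simp
qed

text \<open>With the kernel bump as profile this is the dyadic piece up to its scalar factor; other
  profiles give its derivatives and differences.\<close>

definition pot :: "(('a \<Rightarrow> real) \<Rightarrow> real) \<Rightarrow> int \<Rightarrow> ('a \<Rightarrow> real) \<Rightarrow> 'a \<Rightarrow> real" where
  "pot \<phi> j \<xi> x = \<phi> (\<lambda>Q. \<xi> (2 powr j *\<^sub>R (x - Q)))"

text \<open>Value, gradient and Lipschitz constant of the gradient scale with the powers 0, 1, 2 of
  2^j; the maximum with 1 bounds all three, also for j < 0.\<close>

lemma wavelet_Y:
  assumes "creg 1 M \<xi>"
  shows "(\<lambda>Q. \<xi> (2 powr j *\<^sub>R (x - Q))) \<in> Y (M * (max 1 (2 powr j))\<^sup>2)"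
proof (rule Y_I)
  have "creg 1 (M * (max 1 (2 powr j)) ^ Suc 1) (\<lambda>Q. \<xi> ((2 powr j *\<^sub>R x) + (- (2 powr j)) *\<^sub>R Q))"
    by (rule creg_affine[OF assms]) auto
  then show "creg 1 (M * (max 1 (2 powr j))\<^sup>2) (\<lambda>Q. \<xi> (2 powr j *\<^sub>R (x - Q)))"
    by (simp add: scaleR_diff_right numeral_2_eq_2)
qed simp

text \<open>A crude pointwise bound growing like 4^j for j > 0. It is applied at a fixed scale or
  for scales bounded above.\<close>

lemma pot_bound:
  "\<exists>C\<ge>0. \<forall>\<phi>\<in>D. \<forall>M \<xi> j x. creg 1 M \<xi> \<longrightarrow> \<bar>pot \<phi> j \<xi> x\<bar> \<le> C * nD \<phi> * M * (max 1 (2 powr j))\<^sup>2"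
proof -
  obtain C where C: "C \<ge> 0" "\<forall>\<phi>\<in>D. \<forall>M. \<forall>\<psi>\<in>Y M. \<psi> \<in> X \<and> \<bar>\<phi> \<psi>\<bar> \<le> C * nD \<phi> * M" using dual_Y by (elim exE conjE) (rule that)
  show ?thesis
    using C(1) conjunct2[OF C(2)[rule_format, OF _ wavelet_Y]]
    by (intro exI[of _ C]) (auto simp: pot_def mult.assoc)
qed

text \<open>A shift of x is a shift of the profile by 2^j h. So a difference of the pairing is the
  pairing with a difference quotient of the profile, again a bump with the same constant and one
  order less of smoothness.\<close>

lemma pot_diff_eq:
  assumes \<phi>: "\<phi> \<in> D" and xi: "creg 1 M \<xi>" and h: "h \<noteq> 0"
  shows "pot \<phi> j \<xi> (x + h) - pot \<phi> j \<xi> x =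
    (2 powr j * norm h) * pot \<phi> j (\<lambda>w. (\<xi> (w + 2 powr j *\<^sub>R h) - \<xi> w) / norm (2 powr j *\<^sub>R h)) x"
proof -
  let ?d = "\<lambda>Q. \<xi> (2 powr j *\<^sub>R (x + h - Q)) - \<xi> (2 powr j *\<^sub>R (x - Q))"
  have Yd: "?d \<in> Y (M * (max 1 (2 powr j))\<^sup>2 + \<bar>-1\<bar> * (M * (max 1 (2 powr j))\<^sup>2))"
    using Y_add[OF wavelet_Y[OF xi, of j "x + h"] Y_cmult[OF wavelet_Y[OF xi, of j x], of "-1"]] by simp
  have "pot \<phi> j \<xi> (x + h) - pot \<phi> j \<xi> x = \<phi> ?d"
    unfolding pot_def by (rule dual_diff[OF \<phi> wavelet_Y[OF xi] wavelet_Y[OF xi], symmetric])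
  moreover have "(\<lambda>Q. (\<xi> (2 powr j *\<^sub>R (x - Q) + 2 powr j *\<^sub>R h) - \<xi> (2 powr j *\<^sub>R (x - Q))) / norm (2 powr j *\<^sub>R h)) =
      (\<lambda>Q. (1 / (2 powr j * norm h)) * ?d Q)"
  proof -
    have "2 powr j *\<^sub>R (x + h - Q) = 2 powr j *\<^sub>R (x - Q) + 2 powr j *\<^sub>R h" for Q
      by (simp add: scaleR_diff_right scaleR_add_right)
    then show ?thesis by simp
  qed
  moreover have "\<phi> (\<lambda>Q. (1 / (2 powr j * norm h)) * ?d Q) = (1 / (2 powr j * norm h)) * \<phi> ?d"
    by (rule dual_cmult[OF \<phi> Yd])
  ultimately show ?thesis using h by (simp add: pot_def)
qed

lemma pot_continuous:
  assumes \<phi>: "\<phi> \<in> D" and xi: "creg 2 M \<xi>"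
  shows "continuous_on UNIV (pot \<phi> j \<xi>)"
proof -
  obtain C where C: "C \<ge> 0" "\<forall>\<phi>\<in>D. \<forall>M \<xi> j x. creg 1 M \<xi> \<longrightarrow> \<bar>pot \<phi> j \<xi> x\<bar> \<le> C * nD \<phi> * M * (max 1 (2 powr j))\<^sup>2"
    using pot_bound by (elim exE conjE) (rule that)
  note C2 = C(2)[rule_format, OF \<phi>]
  define L where "L = 2 powr j * (C * nD \<phi> * M * (max 1 (2 powr j))\<^sup>2)"
  have L0: "L \<ge> 0" unfolding L_def using C(1) nD_nonneg[OF \<phi>] creg_nonneg[OF xi] by simp
  have "\<bar>pot \<phi> j \<xi> (x + h) - pot \<phi> j \<xi> x\<bar> \<le> L * norm h" for x h
  proof (cases "h = 0")
    case False
    have 2: "creg (Suc 1) M \<xi>" using xi by (simp add: numeral_2_eq_2)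
    have "creg 1 M (\<lambda>w. (\<xi> (w + 2 powr j *\<^sub>R h) - \<xi> w) / norm (2 powr j *\<^sub>R h))"
      by (rule creg_diffquot[OF 2]) (use False in simp)
    from mult_left_mono[OF C2[OF this, of j x], of "2 powr j * norm h"] show ?thesis
      unfolding pot_diff_eq[OF \<phi> creg_SucD[OF 2] False] by (simp add: L_def abs_mult mult_ac)
  qed simp
  from this[of "y" "x - y" for x y] have "L-lipschitz_on UNIV (pot \<phi> j \<xi>)"
    using L0 by (intro lipschitz_onI) (auto simp: dist_norm)
  then show ?thesis by (rule lipschitz_on_continuous_on)
qed


text \<open>The extremal coefficients of l^p duality. The atomic sum with these coefficients pairs
  with \<phi> to the quantity T in question, while its norm is at most a constant times T^{1/q}; so
  T \<le> C \<open>nD \<phi>\<close> T^{1/q}, and dividing by T^{1/q} leaves T^{1/p}.\<close>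

lemma discrete_duality:
  assumes \<rho>: "\<rho> > 0"
  shows "\<exists>C\<ge>0. \<forall>\<phi>\<in>D. \<forall>Js Ks \<xi>. atomic_data 0 1 \<rho> N' Js Ks \<xi> \<longrightarrow>
    (\<Sum>j\<in>Js. \<Sum>x\<in>Ks j. (2 powr (real_of_int j * e) * \<bar>pot \<phi> j (\<xi> j) x\<bar>) powr p) \<le> C * nD \<phi> powr p"
proof -
  obtain C where C: "C \<ge> 0" "\<forall>\<phi>\<in>D. \<forall>Js Ks \<xi> a \<psi>. atomic_data 0 1 \<rho> N' Js Ks \<xi> \<longrightarrow>
    (\<forall>Q\<in>frontier \<Omega>. \<psi> Q = atomic_sum e Js Ks \<xi> a Q) \<longrightarrow>
    \<psi> \<in> X \<and> \<bar>\<phi> \<psi>\<bar> \<le> C * nD \<phi> * (\<Sum>j\<in>Js. \<Sum>x\<in>Ks j. \<bar>a j x\<bar> powr q) powr (1 / q)"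
    using dual_atoms[OF \<rho> zero_le_one, of 0 N'] by (elim exE conjE) (rule that)
  show ?thesis
  proof (intro exI[of _ "C powr p"] conjI ballI allI impI)
    fix \<phi> Js Ks and \<xi> :: "int \<Rightarrow> 'a \<Rightarrow> real"
    assume \<phi>: "\<phi> \<in> D" and ad: "atomic_data 0 1 \<rho> N' Js Ks \<xi>"
    have Js: "finite Js" and Ks: "\<And>j. j \<in> Js \<Longrightarrow> finite (Ks j)" and xi: "\<And>j. j \<in> Js \<Longrightarrow> creg 1 1 (\<xi> j)"
      using ad by (auto simp: atomic_data_def)
    define v where "v j x = 2 powr (real_of_int j * e) * \<bar>pot \<phi> j (\<xi> j) x\<bar>" for j x
    \<comment> \<open>The exponent p - 1 gives |a|^q = v^p because q(p - 1) = p; the sign makes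
      every term of the pairing equal to v^p.\<close>
    define a where "a j x = sgn (pot \<phi> j (\<xi> j) x) * v j x powr (p - 1)" for j x
    define T where "T = (\<Sum>j\<in>Js. \<Sum>x\<in>Ks j. v j x powr p)"
    have v0: "v j x \<ge> 0" for j x by (simp add: v_def)
    have T0: "T \<ge> 0" unfolding T_def by (intro sum_nonneg) auto
    define Mj where "Mj j x = \<bar>a j x * 2 powr (real_of_int j * e)\<bar> * (1 * (max 1 (2 powr real_of_int j))\<^sup>2)" for j x
    have Yjx: "(\<lambda>Q. a j x * 2 powr (real_of_int j * e) * \<xi> j (2 powr real_of_int j *\<^sub>R (x - Q))) \<in> Y (Mj j x)" if "j \<in> Js" for j x
      unfolding Mj_def by (rule Y_cmult[OF wavelet_Y[OF xi[OF that]]])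
    have Yj: "(\<lambda>Q. \<Sum>x\<in>Ks j. a j x * 2 powr (real_of_int j * e) * \<xi> j (2 powr real_of_int j *\<^sub>R (x - Q))) \<in> Y (\<Sum>x\<in>Ks j. Mj j x)" if "j \<in> Js" for j
      by (rule Y_sum[OF Ks[OF that] Yjx[OF that]])
    have va: "a j x * 2 powr (real_of_int j * e) * pot \<phi> j (\<xi> j) x = v j x powr p" for j x
    proof -
      have "a j x * 2 powr (real_of_int j * e) * pot \<phi> j (\<xi> j) x = v j x powr (p - 1) * v j x"
        by (simp add: a_def v_def abs_sgn)
      also have "\<dots> = v j x powr p"
        using v0[of j x] powr_mult_base[OF v0[of j x], of "p - 1"] by (simp add: mult.commute)
      finally show ?thesis .
    qed
    have "\<phi> (atomic_sum e Js Ks \<xi> a) = (\<Sum>j\<in>Js. \<phi> (\<lambda>Q. \<Sum>x\<in>Ks j. a j x * 2 powr (real_of_int j * e) * \<xi> j (2 powr real_of_int j *\<^sub>R (x - Q))))"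
      unfolding atomic_sum_def[abs_def] by (rule dual_sum[OF \<phi> Js Yj])
    also have "\<dots> = (\<Sum>j\<in>Js. \<Sum>x\<in>Ks j. \<phi> (\<lambda>Q. a j x * 2 powr (real_of_int j * e) * \<xi> j (2 powr real_of_int j *\<^sub>R (x - Q))))"
      by (intro sum.cong refl dual_sum[OF \<phi> Ks Yjx])
    also have "\<dots> = (\<Sum>j\<in>Js. \<Sum>x\<in>Ks j. a j x * 2 powr (real_of_int j * e) * pot \<phi> j (\<xi> j) x)"
      unfolding pot_def by (intro sum.cong refl dual_cmult[OF \<phi> wavelet_Y[OF xi]])
    also have "\<dots> = T" unfolding T_def va ..
    finally have \<phi>T: "\<phi> (atomic_sum e Js Ks \<xi> a) = T" .
    have an: "\<bar>a j x\<bar> powr q = v j x powr p" for j x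
    proof (cases "pot \<phi> j (\<xi> j) x = 0")
      case False
      then have "\<bar>a j x\<bar> = v j x powr (p - 1)" by (simp add: a_def abs_mult abs_sgn_eq)
      then show ?thesis using pq(2) by (simp add: powr_powr mult.commute)
    qed (simp add: a_def v_def)
    have "\<bar>\<phi> (atomic_sum e Js Ks \<xi> a)\<bar> \<le> C * nD \<phi> * (\<Sum>j\<in>Js. \<Sum>x\<in>Ks j. \<bar>a j x\<bar> powr q) powr (1 / q)"
      by (rule conjunct2[OF C(2)[rule_format, OF \<phi> ad]]) simp
    then have le: "T \<le> C * nD \<phi> * T powr (1 / q)"
      unfolding \<phi>T an T_def[symmetric] using T0 by simp
    have "T \<le> (C * nD \<phi>) powr p"
    proof (cases "T = 0")
      case False
      then have Tp: "T > 0" using T0 by simp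
      then have "T powr (1 / q) * T powr (1 / p) = T" by (simp add: pq(1) flip: powr_add)
      then have "T powr (1 / p) * T powr (1 / q) \<le> C * nD \<phi> * T powr (1 / q)" using le by (simp add: mult.commute)
      then have "T powr (1 / p) \<le> C * nD \<phi>" using Tp by (simp only: mult_le_cancel_right_pos powr_gt_zero)
      then have "(T powr (1 / p)) powr p \<le> (C * nD \<phi>) powr p" using p by (intro powr_mono2) auto
      then show ?thesis using p T0 by (simp add: powr_powr)
    qed simp
    then show "(\<Sum>j\<in>Js. \<Sum>x\<in>Ks j. (2 powr (real_of_int j * e) * \<bar>pot \<phi> j (\<xi> j) x\<bar>) powr p) \<le> C powr p * nD \<phi> powr p"
      using C(1) nD_nonneg[OF \<phi>] by (simp add: T_def v_def powr_mult)
  qed simp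
qed

text \<open>Rescaling by 2^j turns the centres into a unit lattice shifted by z, whose overlap
  number depends neither on j nor on z. The resulting uniformity in z is what the averaging
  needs.\<close>

lemma lattice_duality:
  assumes \<rho>: "\<rho> > 0"
  shows "\<exists>C\<ge>0. \<forall>\<phi>\<in>D. \<forall>Js \<xi> (E :: 'a set) z. finite Js \<longrightarrow> Js \<subseteq> {0..} \<longrightarrow> finite E \<longrightarrow> E \<subseteq> range lattice_point \<longrightarrow>
    (\<forall>j\<in>Js. creg 1 1 (\<xi> j) \<and> (\<forall>w. norm w > \<rho> \<longrightarrow> \<xi> j w = 0)) \<longrightarrow>
    (\<Sum>j\<in>Js. \<Sum>k\<in>E. (2 powr (real_of_int j * e) * \<bar>pot \<phi> j (\<xi> j) (2 powr (- real_of_int j) *\<^sub>R (z + k))\<bar>) powr p) \<le> C * nD \<phi> powr p"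
proof -
  define n where "n = nat \<lceil>\<rho>\<rceil>"
  have n: "\<rho> \<le> real n" unfolding n_def by linarith
  obtain C where C: "C \<ge> 0" "\<forall>\<phi>\<in>D. \<forall>Js Ks \<xi>. atomic_data 0 1 \<rho> ((2 * n + 2) ^ DIM('a)) Js Ks \<xi> \<longrightarrow>
    (\<Sum>j\<in>Js. \<Sum>x\<in>Ks j. (2 powr (real_of_int j * e) * \<bar>pot \<phi> j (\<xi> j) x\<bar>) powr p) \<le> C * nD \<phi> powr p"
    using discrete_duality[OF \<rho>, of "(2 * n + 2) ^ DIM('a)"] by (elim exE conjE) (rule that)
  show ?thesis
  proof (intro exI[of _ C] conjI[OF C(1)] ballI allI impI)
    fix \<phi> Js and E :: "'a set" and z :: 'a and \<xi> :: "int \<Rightarrow> 'a \<Rightarrow> real"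
    assume \<phi>: "\<phi> \<in> D" and Js: "finite Js" "Js \<subseteq> {0..}" and E: "finite E" "E \<subseteq> range lattice_point"
      and xi: "\<forall>j\<in>Js. creg 1 1 (\<xi> j) \<and> (\<forall>w. norm w > \<rho> \<longrightarrow> \<xi> j w = 0)"
    define T where "T j k = 2 powr (- real_of_int j) *\<^sub>R (z + k)" for j :: int and k :: 'a
    have inj: "inj_on (T j) E" for j by (auto simp: inj_on_def T_def)
    have ad: "atomic_data 0 1 \<rho> ((2 * n + 2) ^ DIM('a)) Js (\<lambda>j. T j ` E) \<xi>"
      unfolding atomic_data_def
    proof (intro conjI ballI allI)
      fix j w
      have "{x \<in> T j ` E. norm (w - x) \<le> \<rho> / 2 powr real_of_int j} \<subseteq> T j ` {k \<in> E. norm ((2 powr real_of_int j *\<^sub>R w - z) - k) \<le> real n}"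
      proof clarify
        fix k assume k: "k \<in> E" "norm (w - T j k) \<le> \<rho> / 2 powr real_of_int j"
        have "(2 powr real_of_int j *\<^sub>R w - z) - k = 2 powr real_of_int j *\<^sub>R (w - T j k)"
          by (simp add: T_def scaleR_diff_right diff_diff_eq flip: powr_add)
        then have "norm ((2 powr real_of_int j *\<^sub>R w - z) - k) = 2 powr real_of_int j * norm (w - T j k)"
          by simp
        also have "\<dots> \<le> 2 powr real_of_int j * (\<rho> / 2 powr real_of_int j)" using k(2) by (intro mult_left_mono) auto
        also have "\<dots> \<le> real n" using n by simp
        finally show "T j k \<in> T j ` {k \<in> E. norm ((2 powr real_of_int j *\<^sub>R w - z) - k) \<le> real n}" using k(1) by blast
      qed
      moreover have f: "finite {k \<in> E. norm ((2 powr real_of_int j *\<^sub>R w - z) - k) \<le> real n}" using E by simp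
      ultimately have "card {x \<in> T j ` E. norm (w - x) \<le> \<rho> / 2 powr real_of_int j} \<le> card (T j ` {k \<in> E. norm ((2 powr real_of_int j *\<^sub>R w - z) - k) \<le> real n})"
        by (intro card_mono) auto
      also have "\<dots> \<le> card {k \<in> E. norm ((2 powr real_of_int j *\<^sub>R w - z) - k) \<le> real n}"
        by (rule card_image_le[OF f])
      also have "\<dots> \<le> (2 * n + 2) ^ DIM('a)" using lattice_overlap[OF E(2)] by blast
      finally show "card {x \<in> T j ` E. norm (w - x) \<le> \<rho> / 2 powr real_of_int j} \<le> (2 * n + 2) ^ DIM('a)" .
    qed (use Js E xi in auto)
    have "(\<Sum>j\<in>Js. \<Sum>x\<in>T j ` E. (2 powr (real_of_int j * e) * \<bar>pot \<phi> j (\<xi> j) x\<bar>) powr p) \<le> C * nD \<phi> powr p"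
      by (rule C(2)[rule_format, OF \<phi> ad])
    then show "(\<Sum>j\<in>Js. \<Sum>k\<in>E. (2 powr (real_of_int j * e) * \<bar>pot \<phi> j (\<xi> j) (2 powr (- real_of_int j) *\<^sub>R (z + k))\<bar>) powr p) \<le> C * nD \<phi> powr p"
      by (simp only: sum.reindex[OF inj] comp_def) (simp only: T_def)
  qed
qed

text \<open>Duality needs one order less; the second order makes the pairing continuous in x, hence
  measurable.\<close>

definition bumps :: "real \<Rightarrow> ('a \<Rightarrow> real) set" where
  "bumps \<rho> = {\<xi>. creg 2 1 \<xi> \<and> (\<forall>w. norm w > \<rho> \<longrightarrow> \<xi> w = 0)}"

section \<open>Energy of the dyadic pieces at high and low frequencies\<close>

lemma pot_support:
  assumes "\<phi> \<in> D" "\<xi> \<in> bumps \<rho>" "\<And>Q. Q \<in> frontier \<Omega> \<Longrightarrow> norm Q \<le> R" "norm x > R + \<rho> * 2 powr (- real_of_int j)"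
  shows "pot \<phi> j \<xi> x = 0"
  unfolding pot_def
proof (rule dual_zero[OF assms(1)])
  fix Q assume "Q \<in> frontier \<Omega>"
  then have "norm (x - Q) > \<rho> * 2 powr (- real_of_int j)"
    using assms(3)[of Q] assms(4) norm_triangle_ineq2[of x Q] by linarith
  then have "2 powr real_of_int j * norm (x - Q) > 2 powr real_of_int j * (\<rho> * 2 powr (- real_of_int j))" by (intro mult_strict_left_mono) auto
  moreover have "2 powr real_of_int j * (\<rho> * 2 powr (- real_of_int j)) = \<rho>" by (simp add: powr_minus)
  ultimately have "norm (2 powr real_of_int j *\<^sub>R (x - Q)) > \<rho>" by simp
  then show "\<xi> (2 powr real_of_int j *\<^sub>R (x - Q)) = 0" using assms(2) by (simp add: bumps_def)
qed

lemma pot_power_measurable: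
  assumes "\<phi> \<in> D" "\<xi> \<in> bumps \<rho>"
  shows "(\<lambda>x. ennreal (\<bar>pot \<phi> j \<xi> x\<bar> powr p)) \<in> borel_measurable borel"
proof -
  have "continuous_on UNIV (pot \<phi> j \<xi>)" by (rule pot_continuous) (use assms in \<open>auto simp: bumps_def\<close>)
  from borel_measurable_continuous_onI[OF this] show ?thesis by simp
qed

text \<open>After the dilation y = 2^j x, which accounts for the summand n in the exponent, the
  integral over y is an average over offsets z in the unit cube of sums over lattice points. For
  each z duality bounds the sum over scales and lattice points together. The profile may be a
  different one at each scale.\<close>

lemma high_frequency_energy:
  assumes \<rho>: "\<rho> > 0"
  shows "\<exists>C\<ge>0. \<forall>\<phi>\<in>D. \<forall>Js \<xi>. finite Js \<longrightarrow> Js \<subseteq> {0..} \<longrightarrow> (\<forall>j\<in>Js. \<xi> j \<in> bumps \<rho>) \<longrightarrow>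
    (\<Sum>j\<in>Js. ennreal (2 powr (j * (e * p + DIM('a)))) * (pint p (pot \<phi> j (\<xi> j)))) \<le> ennreal (C * nD \<phi> powr p)"
proof -
  obtain C where C: "C \<ge> 0" "\<forall>\<phi>\<in>D. \<forall>Js \<xi> (E :: 'a set) z. finite Js \<longrightarrow> Js \<subseteq> {0..} \<longrightarrow> finite E \<longrightarrow> E \<subseteq> range lattice_point \<longrightarrow>
    (\<forall>j\<in>Js. creg 1 1 (\<xi> j) \<and> (\<forall>w. norm w > \<rho> \<longrightarrow> \<xi> j w = 0)) \<longrightarrow>
    (\<Sum>j\<in>Js. \<Sum>k\<in>E. (2 powr (real_of_int j * e) * \<bar>pot \<phi> j (\<xi> j) (2 powr (- real_of_int j) *\<^sub>R (z + k))\<bar>) powr p) \<le> C * nD \<phi> powr p"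
    using lattice_duality[OF \<rho>] by (elim exE conjE) (rule that)
  obtain R where R: "R > 0" "\<And>Q. Q \<in> frontier \<Omega> \<Longrightarrow> norm Q \<le> R" by (rule frontier_radius) (rule that)
  show ?thesis
  proof (intro exI[of _ C] conjI[OF C(1)] ballI allI impI)
    fix \<phi> Js and \<xi> :: "int \<Rightarrow> 'a \<Rightarrow> real"
    assume \<phi>: "\<phi> \<in> D" and Js: "finite Js" "Js \<subseteq> {0..}" and xi: "\<forall>j\<in>Js. \<xi> j \<in> bumps \<rho>"
    have c1: "\<forall>j\<in>Js. creg 1 1 (\<xi> j) \<and> (\<forall>w. norm w > \<rho> \<longrightarrow> \<xi> j w = 0)"
      using xi creg_le[of 2 1 _ 1] by (auto simp: bumps_def)
    define g where "g j y = ennreal ((2 powr (real_of_int j * e) * \<bar>pot \<phi> j (\<xi> j) (2 powr (- real_of_int j) *\<^sub>R y)\<bar>) powr p)" for j and y :: 'a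
    \<comment> \<open>The dilated supports have radius 2^j R + \<rho>. Their sum is a simple
      majorant of the largest one, so a single finite lattice box serves all scales.\<close>
    define m where "m = \<lceil>(\<Sum>j\<in>Js. 2 powr j * R + \<rho>)\<rceil> + 1"
    define E :: "'a set" where "E = lattice_box m"
    have E: "finite E" "E \<subseteq> range lattice_point" by (auto simp: E_def finite_lattice_box) (auto simp: lattice_box_def)
    have geq: "g j y = ennreal (2 powr (j * (e * p))) * ennreal (\<bar>pot \<phi> j (\<xi> j) (2 powr (- real_of_int j) *\<^sub>R y)\<bar> powr p)" for j y
      by (simp add: g_def powr_mult powr_powr ennreal_mult' mult.assoc)
    have gm: "g j \<in> borel_measurable borel" if "j \<in> Js" for j
    proof -
      have "(\<lambda>y. ennreal (\<bar>pot \<phi> j (\<xi> j) (2 powr (- real_of_int j) *\<^sub>R y)\<bar> powr p)) \<in> borel_measurable borel"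
        by (rule measurable_compose[OF _ pot_power_measurable[OF \<phi> xi[rule_format, OF that]]]) simp
      then show ?thesis unfolding geq[abs_def] by (intro borel_measurable_times_ennreal borel_measurable_const)
    qed
    have cov: "\<exists>k\<in>E. y - k \<in> cbox 0 One" if j: "j \<in> Js" and "g j y \<noteq> 0" for j y
    proof -
      have "norm (2 powr (- real_of_int j) *\<^sub>R y) \<le> R + \<rho> * 2 powr (- real_of_int j)"
        using pot_support[OF \<phi> _ R(2)] xi that by (force simp: g_def)
      then have "2 powr real_of_int j * norm (2 powr (- real_of_int j) *\<^sub>R y) \<le> 2 powr real_of_int j * (R + \<rho> * 2 powr (- real_of_int j))"
        by (intro mult_left_mono) auto
      moreover have "2 powr real_of_int j * norm (2 powr (- real_of_int j) *\<^sub>R y) = norm y" by (simp add: powr_minus field_simps)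
      moreover have "2 powr real_of_int j * (R + \<rho> * 2 powr (- real_of_int j)) = 2 powr j * R + \<rho>" by (simp add: powr_minus field_simps)
      ultimately have "norm y \<le> 2 powr j * R + \<rho>" by (simp only:)
      also have "\<dots> \<le> (\<Sum>j\<in>Js. 2 powr j * R + \<rho>)"
        using R \<rho> by (intro member_le_sum[OF j _ Js(1)]) auto
      finally have "norm y \<le> real_of_int m - 1" unfolding m_def by linarith
      then show ?thesis unfolding E_def by (rule lattice_box_cover)
    qed
    have "(\<Sum>j\<in>Js. ennreal (2 powr (j * (e * p + DIM('a)))) * (pint p (pot \<phi> j (\<xi> j)))) = (\<Sum>j\<in>Js. \<integral>\<^sup>+y. g j y \<partial>lborel)"
    proof (rule sum.cong[OF refl])
      fix j assume j: "j \<in> Js"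
      have pm: "(\<lambda>x. ennreal (\<bar>pot \<phi> j (\<xi> j) x\<bar> powr p)) \<in> borel_measurable lborel"
        using pot_power_measurable[OF \<phi> xi[rule_format, OF j]] by simp
      have "(\<integral>\<^sup>+y. g j y \<partial>lborel) = ennreal ((2 powr real_of_int j) ^ DIM('a)) * (\<integral>\<^sup>+x. g j (2 powr real_of_int j *\<^sub>R x) \<partial>lborel)"
        by (rule nn_integral_lborel_scale[OF gm[OF j]]) simp
      also have "(\<integral>\<^sup>+x. g j (2 powr real_of_int j *\<^sub>R x) \<partial>lborel) = (\<integral>\<^sup>+x. ennreal (2 powr (j * (e * p))) * ennreal (\<bar>pot \<phi> j (\<xi> j) x\<bar> powr p) \<partial>lborel)"
        by (simp add: geq flip: powr_add)
      also have "\<dots> = ennreal (2 powr (j * (e * p))) * (pint p (pot \<phi> j (\<xi> j)))"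
        by (rule nn_integral_cmult[OF pm])
      also have "ennreal ((2 powr real_of_int j) ^ DIM('a)) * \<dots> = ennreal (2 powr (j * (e * p + DIM('a)))) * (pint p (pot \<phi> j (\<xi> j)))"
      proof -
        have "(2 powr real_of_int j) ^ DIM('a) * 2 powr (j * (e * p)) = 2 powr (j * (e * p + DIM('a)))"
          by (simp add: distrib_left powr_add powr_powr flip: powr_realpow)
        then show ?thesis by (simp add: mult.assoc[symmetric] flip: ennreal_mult')
      qed
      finally show "ennreal (2 powr (j * (e * p + DIM('a)))) * (pint p (pot \<phi> j (\<xi> j))) = (\<integral>\<^sup>+y. g j y \<partial>lborel)" by simp
    qed
    also have "\<dots> \<le> (\<Sum>j\<in>Js. \<integral>\<^sup>+z. indicator (cbox 0 One) z * (\<Sum>k\<in>E. g j (z + k)) \<partial>lborel)"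
      by (intro sum_mono unit_cube_average gm E cov)
    also have "\<dots> = (\<integral>\<^sup>+z. (\<Sum>j\<in>Js. indicator (cbox 0 One) z * (\<Sum>k\<in>E. g j (z + k))) \<partial>lborel)"
    proof (rule nn_integral_sum[symmetric])
      fix j assume "j \<in> Js"
      note [measurable] = gm[OF this]
      show "(\<lambda>z. indicator (cbox 0 One) z * (\<Sum>k\<in>E. g j (z + k))) \<in> borel_measurable lborel" by simp
    qed
    also have "\<dots> \<le> (\<integral>\<^sup>+(z::'a). ennreal (C * nD \<phi> powr p) * indicator (cbox 0 One) z \<partial>lborel)"
    proof (rule nn_integral_mono)
      fix z :: 'a
      have "(\<Sum>j\<in>Js. \<Sum>k\<in>E. g j (z + k)) = ennreal (\<Sum>j\<in>Js. \<Sum>k\<in>E. (2 powr (real_of_int j * e) * \<bar>pot \<phi> j (\<xi> j) (2 powr (- real_of_int j) *\<^sub>R (z + k))\<bar>) powr p)"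
        by (simp add: g_def sum_ennreal sum_nonneg)
      also have "\<dots> \<le> ennreal (C * nD \<phi> powr p)"
        by (intro ennreal_leI C(2)[rule_format, OF \<phi> Js E]) (use c1 in auto)
      finally show "(\<Sum>j\<in>Js. indicator (cbox 0 One) z * (\<Sum>k\<in>E. g j (z + k))) \<le> ennreal (C * nD \<phi> powr p) * indicator (cbox 0 One) z"
        by (simp add: indicator_def)
    qed
    also have "\<dots> = ennreal (C * nD \<phi> powr p)"
      by (simp add: nn_integral_cmult_indicator emeasure_lborel_cbox_eq)
    finally show "(\<Sum>j\<in>Js. ennreal (2 powr (j * (e * p + DIM('a)))) * (pint p (pot \<phi> j (\<xi> j)))) \<le> ennreal (C * nD \<phi> powr p)" .
  qed
qed


text \<open>For j < 0 the pairing is bounded by a constant times the dual norm and lives in a ball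
  of volume of order 2^{-jn}. The weight 2^{j(ep + n)} leaves 2^{jep}, summable towards minus
  infinity exactly when e > 0.\<close>

lemma low_frequency_energy:
  assumes \<rho>: "\<rho> > 0"
  shows "\<exists>C\<ge>0. \<forall>\<phi>\<in>D. \<forall>j<0. \<forall>\<xi>\<in>bumps \<rho>.
    ennreal (2 powr (j * (e * p + DIM('a)))) * (pint p (pot \<phi> j \<xi>)) \<le> ennreal (C * 2 powr (j * (e * p)) * nD \<phi> powr p)"
proof -
  obtain C where C: "C \<ge> 0" "\<forall>\<phi>\<in>D. \<forall>M \<xi> j x. creg 1 M \<xi> \<longrightarrow> \<bar>pot \<phi> j \<xi> x\<bar> \<le> C * nD \<phi> * M * (max 1 (2 powr j))\<^sup>2"
    using pot_bound by (elim exE conjE) (rule that)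
  obtain R where R: "R > 0" "\<And>Q. Q \<in> frontier \<Omega> \<Longrightarrow> norm Q \<le> R" by (rule frontier_radius) (rule that)
  define V where "V = unit_ball_vol (real DIM('a)) * (R + \<rho>) ^ DIM('a)"
  have V: "V \<ge> 0" using R \<rho> by (simp add: V_def)
  show ?thesis
  proof (intro exI[of _ "C powr p * V"] conjI ballI allI impI)
    show "0 \<le> C powr p * V" using V by simp
    fix \<phi> \<xi> and j :: int assume \<phi>: "\<phi> \<in> D" and j: "j < 0" and xi: "\<xi> \<in> bumps \<rho>"
    let ?r = "(R + \<rho>) * 2 powr (- real_of_int j)"
    have r0: "?r \<ge> 0" using R \<rho> by simp
    have t: "2 powr real_of_int j \<le> 1" using j powr_mono[of "real_of_int j" 0 2] by simp
    have t': "1 \<le> 2 powr (- real_of_int j)" using j powr_mono[of 0 "- real_of_int j" 2] by simp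
    have b: "\<bar>pot \<phi> j \<xi> x\<bar> powr p \<le> (C * nD \<phi>) powr p" for x
    proof -
      have "\<bar>pot \<phi> j \<xi> x\<bar> \<le> C * nD \<phi> * 1 * (max 1 (2 powr j))\<^sup>2"
        by (rule C(2)[rule_format, OF \<phi>]) (use xi creg_le[of 2 1 \<xi> 1] in \<open>auto simp: bumps_def\<close>)
      moreover have "max 1 (2 powr real_of_int j) = 1" using t by simp
      ultimately have "\<bar>pot \<phi> j \<xi> x\<bar> \<le> C * nD \<phi>" by simp
      then show ?thesis using p by (intro powr_mono2) auto
    qed
    have z: "pot \<phi> j \<xi> x = 0" if "x \<notin> cball 0 ?r" for x
    proof (rule pot_support[OF \<phi> xi R(2)])
      have "R + \<rho> * 2 powr (- real_of_int j) \<le> ?r" using R t' by (simp add: distrib_right)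
      then show "norm x > R + \<rho> * 2 powr (- real_of_int j)" using that by simp
    qed
    have "pint p (pot \<phi> j \<xi>) \<le> (\<integral>\<^sup>+(x::'a). ennreal ((C * nD \<phi>) powr p) * indicator (cball 0 ?r) x \<partial>lborel)"
    proof (rule nn_integral_mono)
      fix x :: 'a
      show "ennreal (\<bar>pot \<phi> j \<xi> x\<bar> powr p) \<le> ennreal ((C * nD \<phi>) powr p) * indicator (cball 0 ?r) x"
      proof (cases "x \<in> cball 0 ?r")
        case True
        then show ?thesis using ennreal_leI[OF b[of x]] by simp
      qed (simp add: z del: mem_cball)
    qed
    also have "\<dots> = ennreal ((C * nD \<phi>) powr p) * emeasure lborel (cball (0::'a) ?r)"
      by (rule nn_integral_cmult_indicator) simp
    also have "emeasure lborel (cball (0::'a) ?r) = ennreal (unit_ball_vol (real DIM('a)) * ?r ^ DIM('a))"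
      by (rule emeasure_cball[OF r0])
    also have "unit_ball_vol (real DIM('a)) * ?r ^ DIM('a) = V * 2 powr (- (j * real DIM('a)))"
    proof -
      have "(2 powr (- real_of_int j)) ^ DIM('a) = 2 powr (- (j * real DIM('a)))"
        by (simp add: powr_powr flip: powr_realpow)
      then show ?thesis by (simp add: V_def power_mult_distrib)
    qed
    finally have "ennreal (2 powr (j * (e * p + DIM('a)))) * (pint p (pot \<phi> j \<xi>))
      \<le> ennreal (2 powr (j * (e * p + DIM('a)))) * (ennreal ((C * nD \<phi>) powr p) * ennreal (V * 2 powr (- (j * real DIM('a)))))"
      by (rule mult_left_mono) simp
    also have "\<dots> = ennreal (2 powr (j * (e * p + DIM('a))) * ((C * nD \<phi>) powr p * (V * 2 powr (- (j * real DIM('a))))))"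
      using V by (simp add: ennreal_mult)
    also have "2 powr (j * (e * p + DIM('a))) * ((C * nD \<phi>) powr p * (V * 2 powr (- (j * real DIM('a))))) = C powr p * V * 2 powr (j * (e * p)) * nD \<phi> powr p"
      by (simp add: powr_mult distrib_left powr_add powr_minus)
    finally show "ennreal (2 powr (j * (e * p + DIM('a)))) * (pint p (pot \<phi> j \<xi>))
      \<le> ennreal (C powr p * V * 2 powr (j * (e * p)) * nD \<phi> powr p)" .
  qed
qed

text \<open>\<open>A j\<close> is a supremum over all bumps. As the profiles in the energy estimate
  may be chosen scale by scale, the sum of suprema obeys the same bound as the sum for any fixed
  choice. The low frequencies in I enter through K alone.\<close>

lemma potential_coefficients:
  assumes \<rho>: "\<rho> > 0" and K: "K \<ge> 0" "\<And>F. finite F \<Longrightarrow> F \<subseteq> I \<inter> {..<0} \<Longrightarrow> (\<Sum>j\<in>F. 2 powr (real_of_int j * (e * p))) \<le> K"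
  shows "\<exists>C\<ge>0. \<forall>\<phi>\<in>D. \<exists>A. (\<forall>j. 0 \<le> A j) \<and>
    (\<forall>j. \<forall>\<xi>\<in>bumps \<rho>. (pint p (pot \<phi> j \<xi>)) \<le> ennreal (2 powr (- (j * (e * p + DIM('a)))) * A j)) \<and>
    (\<forall>F. finite F \<longrightarrow> F \<subseteq> I \<longrightarrow> (\<Sum>j\<in>F. A j) \<le> C * nD \<phi> powr p)"
proof -
  obtain C where C: "C \<ge> 0" "\<forall>\<phi>\<in>D. \<forall>Js \<xi>. finite Js \<longrightarrow> Js \<subseteq> {0..} \<longrightarrow> (\<forall>j\<in>Js. \<xi> j \<in> bumps \<rho>) \<longrightarrow>
    (\<Sum>j\<in>Js. ennreal (2 powr (j * (e * p + DIM('a)))) * (pint p (pot \<phi> j (\<xi> j)))) \<le> ennreal (C * nD \<phi> powr p)"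
    using high_frequency_energy[OF \<rho>] by (elim exE conjE) (rule that)
  obtain C' where C': "C' \<ge> 0" "\<forall>\<phi>\<in>D. \<forall>j<0. \<forall>\<xi>\<in>bumps \<rho>.
    ennreal (2 powr (j * (e * p + DIM('a)))) * (pint p (pot \<phi> j \<xi>)) \<le> ennreal (C' * 2 powr (j * (e * p)) * nD \<phi> powr p)"
    using low_frequency_energy[OF \<rho>] by (elim exE conjE) (rule that)
  have ne: "bumps \<rho> \<noteq> {}" using creg_zero[of 1 2] by (auto simp: bumps_def intro!: exI[of _ "\<lambda>_. 0"])
  show ?thesis
  proof (intro exI[of _ "C + C' * K"] conjI ballI)
    show "0 \<le> C + C' * K" using C C' K by simp
    fix \<phi> assume \<phi>: "\<phi> \<in> D"
    define g where "g j \<xi> = ennreal (2 powr (real_of_int j * (e * p + DIM('a)))) * (pint p (pot \<phi> j \<xi>))" for j \<xi>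
    define S where "S j = (SUP \<xi>\<in>bumps \<rho>. g j \<xi>)" for j
    define A where "A j = enn2real (S j)" for j
    have hi: "(\<Sum>j\<in>F. S j) \<le> ennreal (C * nD \<phi> powr p)" if "finite F" "F \<subseteq> {0..}" for F
    proof -
      have "0 + (\<Sum>j\<in>F. SUP \<xi>\<in>bumps \<rho>. g j \<xi>) \<le> ennreal (C * nD \<phi> powr p)"
        by (rule sum_SUP_le[OF that(1) ne]) (use C(2)[rule_format, OF \<phi> that] in \<open>auto simp: g_def\<close>)
      then show ?thesis by (simp add: S_def)
    qed
    have lo: "S j \<le> ennreal (C' * 2 powr (j * (e * p)) * nD \<phi> powr p)" if "j < 0" for j
      unfolding S_def g_def by (rule SUP_least) (use C'(2) \<phi> that in blast)
    have fin: "S j = ennreal (A j)" for j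
    proof -
      have "S j < top"
      proof (cases "j < 0")
        case True
        then show ?thesis using lo[of j] le_less_trans ennreal_less_top by blast
      next
        case False
        then show ?thesis using hi[of "{j}"] le_less_trans ennreal_less_top by force
      qed
      then show ?thesis by (simp add: A_def)
    qed
    have A0: "0 \<le> A j" for j by (simp add: A_def)
    show "\<exists>A. (\<forall>j. 0 \<le> A j) \<and>
      (\<forall>j. \<forall>\<xi>\<in>bumps \<rho>. (pint p (pot \<phi> j \<xi>)) \<le> ennreal (2 powr (- (j * (e * p + DIM('a)))) * A j)) \<and>
      (\<forall>F. finite F \<longrightarrow> F \<subseteq> I \<longrightarrow> (\<Sum>j\<in>F. A j) \<le> (C + C' * K) * nD \<phi> powr p)"
    proof (intro exI[of _ A] conjI allI ballI impI A0)
      fix j \<xi> assume "\<xi> \<in> bumps \<rho>"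
      then have "g j \<xi> \<le> ennreal (A j)" unfolding fin[symmetric] S_def by (rule SUP_upper)
      then have "ennreal (2 powr (- (j * (e * p + DIM('a))))) * g j \<xi> \<le> ennreal (2 powr (- (j * (e * p + DIM('a))))) * ennreal (A j)"
        by (rule mult_left_mono) simp
      moreover have "ennreal (2 powr (- (j * (e * p + DIM('a))))) * g j \<xi> = pint p (pot \<phi> j \<xi>)"
      proof -
        have "ennreal (2 powr (- (j * (e * p + DIM('a))))) * ennreal (2 powr (real_of_int j * (e * p + DIM('a)))) = 1"
          by (simp flip: ennreal_mult' powr_add)
        then show ?thesis by (simp add: g_def mult.assoc[symmetric])
      qed
      ultimately show "pint p (pot \<phi> j \<xi>) \<le> ennreal (2 powr (- (j * (e * p + DIM('a)))) * A j)"
        by (simp add: ennreal_mult')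
    next
      fix F assume F: "finite F" "F \<subseteq> I"
      have "ennreal (\<Sum>j\<in>F \<inter> {0..}. A j) = (\<Sum>j\<in>F \<inter> {0..}. S j)" using A0 by (simp add: fin sum_ennreal)
      also have "\<dots> \<le> ennreal (C * nD \<phi> powr p)" using F by (intro hi) auto
      finally have 1: "(\<Sum>j\<in>F \<inter> {0..}. A j) \<le> C * nD \<phi> powr p" using C(1) by (simp add: ennreal_le_iff)
      have "(\<Sum>j\<in>F \<inter> {..<0}. A j) \<le> (\<Sum>j\<in>F \<inter> {..<0}. C' * 2 powr (j * (e * p)) * nD \<phi> powr p)"
      proof (rule sum_mono)
        fix j assume "j \<in> F \<inter> {..<0}"
        then show "A j \<le> C' * 2 powr (j * (e * p)) * nD \<phi> powr p" using lo[of j] C'(1) by (simp add: fin ennreal_le_iff)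
      qed
      also have "\<dots> = C' * (\<Sum>j\<in>F \<inter> {..<0}. 2 powr (real_of_int j * (e * p))) * nD \<phi> powr p"
        by (simp add: sum_distrib_left sum_distrib_right)
      also have "\<dots> \<le> C' * K * nD \<phi> powr p" using F C'(1) by (intro mult_right_mono mult_left_mono K) auto
      finally have 2: "(\<Sum>j\<in>F \<inter> {..<0}. A j) \<le> C' * K * nD \<phi> powr p" .
      have "F = (F \<inter> {0..}) \<union> (F \<inter> {..<0})" by auto
      then have "(\<Sum>j\<in>F. A j) = (\<Sum>j\<in>F \<inter> {0..}. A j) + (\<Sum>j\<in>F \<inter> {..<0}. A j)"
        using F(1) by (subst (1) \<open>F = _\<close>, intro sum.union_disjoint) auto
      then show "(\<Sum>j\<in>F. A j) \<le> (C + C' * K) * nD \<phi> powr p" using 1 2 by (simp add: distrib_right)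
    qed
  qed
qed

end

section \<open>Dyadic decomposition of the Riesz kernel\<close>

lemma telescoping_int:
  fixes f :: "int \<Rightarrow> real"
  shows "(\<Sum>j\<in>{a..a + int k - 1}. f j - f (j + 1)) = f a - f (a + int k)"
proof (induction k)
  case (Suc k)
  have "{a..a + int (Suc k) - 1} = insert (a + int k) {a..a + int k - 1}" by auto
  then show ?case using Suc by (simp add: add_ac)
qed simp

text \<open>The second summand in the base only serves to keep it positive; it vanishes where the last
  factor does not, so that the base may be replaced by \<open>w \<bullet> w\<close>.\<close>

definition kernel_bump :: "real \<Rightarrow> 'a::euclidean_space \<Rightarrow> real" where
  "kernel_bump \<gamma> w = (w \<bullet> w + step_fun (16 * (w \<bullet> w))) powr (- \<gamma> / 2) * (step_fun (w \<bullet> w) - step_fun (4 * (w \<bullet> w)))"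

lemma ck_kernel_bump: "ck k (kernel_bump \<gamma> :: 'a::euclidean_space \<Rightarrow> real)"
proof -
  have pos: "w \<bullet> w + step_fun (16 * (w \<bullet> w)) > 0" for w :: 'a
  proof (cases "w = 0")
    case False
    then have "w \<bullet> w > 0" by simp
    then show ?thesis using step_fun_nonneg[of "16 * (w \<bullet> w)"] by linarith
  qed (simp add: step_fun_1)
  have s: "ck k (\<lambda>w::'a. step_fun (c * (w \<bullet> w)))" for c
    by (intro ck_compose[OF ck_step_fun] ck_cmult ck_norm2)
  show ?thesis
    unfolding kernel_bump_def[abs_def]
    by (intro ck_mult ck_powr ck_add ck_diff ck_norm2 s pos) (use s[of 1] in simp)
qed

lemma kernel_bump_support: "norm w > 2 \<Longrightarrow> kernel_bump \<gamma> w = 0" "norm w < 1 / 2 \<Longrightarrow> kernel_bump \<gamma> w = 0"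
proof -
  assume "norm w > 2"
  then have "(norm w)\<^sup>2 \<ge> 2\<^sup>2" by (intro power_mono) auto
  then have "w \<bullet> w \<ge> 4" by (simp add: power2_norm_eq_inner)
  then show "kernel_bump \<gamma> w = 0" by (simp add: kernel_bump_def step_fun_0)
next
  assume "norm w < 1 / 2"
  then have "(norm w)\<^sup>2 \<le> (1 / 2)\<^sup>2" by (intro power_mono) auto
  then have "4 * (w \<bullet> w) \<le> 1" by (simp add: power2_norm_eq_inner power_divide)
  then show "kernel_bump \<gamma> w = 0" by (simp add: kernel_bump_def step_fun_1)
qed

text \<open>With h_j the cut-off at radius of order 2^{-j}, each term is |x|^{-\<gamma>} (h_j -
  h_{j+1}), and the sum telescopes; the conditions on a and b make the first cut-off 1 and the one
  after the last 0. Thus only finitely many scales are needed at a given x.\<close>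

lemma kernel_bump_sum:
  fixes x :: "'a::euclidean_space" and a b :: int and \<gamma> :: real
  assumes x: "x \<noteq> 0" and ab: "a \<le> b + 1" and a: "2 powr a * norm x \<le> 1" and b: "2 powr b * norm x \<ge> 1"
  shows "(\<Sum>j\<in>{a..b}. 2 powr (j * \<gamma>) * kernel_bump \<gamma> (2 powr j *\<^sub>R x)) = norm x powr (- \<gamma>)"
proof -
  define h where "h j = step_fun ((2 powr j * norm x)\<^sup>2)" for j :: int
  have e: "2 powr (j * \<gamma>) * kernel_bump \<gamma> (2 powr j *\<^sub>R x) = norm x powr (- \<gamma>) * (h j - h (j + 1))" for j
  proof -
    define t where "t = 2 powr real_of_int j * norm x"
    have t: "t > 0" using x by (simp add: t_def)
    have w: "(2 powr j *\<^sub>R x) \<bullet> (2 powr j *\<^sub>R x) = t\<^sup>2"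
      by (simp add: t_def power2_norm_eq_inner[symmetric] power_mult_distrib power2_eq_square)
    have h: "h j = step_fun (t\<^sup>2)" "h (j + 1) = step_fun (4 * t\<^sup>2)"
      by (simp_all add: h_def t_def powr_add power_mult_distrib mult_ac)
    show ?thesis
    proof (cases "h j = h (j + 1)")
      case True
      then show ?thesis unfolding kernel_bump_def w h by simp
    next
      case False
      then have "4 * t\<^sup>2 > 1" using step_fun_1[of "t\<^sup>2"] step_fun_1[of "4 * t\<^sup>2"] h by force
      then have "step_fun (16 * t\<^sup>2) = 0" by (intro step_fun_0) simp
      then have "(t\<^sup>2 + step_fun (16 * t\<^sup>2)) powr (- \<gamma> / 2) = (t powr 2) powr (- \<gamma> / 2)"
        using t by simp
      also have "\<dots> = t powr (- \<gamma>)" by (simp add: powr_powr)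
      also have "\<dots> = 2 powr (- (j * \<gamma>)) * norm x powr (- \<gamma>)"
        by (simp add: t_def powr_mult powr_powr)
      finally show ?thesis unfolding kernel_bump_def w h by (simp flip: powr_add)
    qed
  qed
  define k where "k = nat (b + 1 - a)"
  have k: "b = a + int k - 1" using ab by (simp add: k_def)
  have "(\<Sum>j\<in>{a..b}. 2 powr (j * \<gamma>) * kernel_bump \<gamma> (2 powr j *\<^sub>R x)) = norm x powr (- \<gamma>) * (\<Sum>j\<in>{a..a + int k - 1}. h j - h (j + 1))"
    unfolding e sum_distrib_left k ..
  also have "\<dots> = norm x powr (- \<gamma>) * (h a - h (b + 1))"
    unfolding telescoping_int by (simp add: k)
  also have "h a = 1"
  proof -
    have "(2 powr a * norm x)\<^sup>2 \<le> 1\<^sup>2" using a by (intro power_mono) auto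
    then show ?thesis unfolding h_def by (intro step_fun_1) simp
  qed
  also have "h (b + 1) = 0"
  proof -
    have "2\<^sup>2 \<le> (2 powr (b + 1) * norm x)\<^sup>2" using b by (intro power_mono) (auto simp: powr_add)
    then show ?thesis unfolding h_def by (intro step_fun_0) simp
  qed
  finally show ?thesis by simp
qed

lemma creg_directional_zero:
  assumes der: "\<And>x. (f has_derivative D x) (at x)" and U: "open U" "\<And>x. x \<in> U \<Longrightarrow> f x = (0::real)" and x: "x \<in> U"
  shows "D x v = 0"
proof -
  have "((\<lambda>x. 0) has_derivative (\<lambda>v. 0)) (at x)" by simp
  then have "(f has_derivative (\<lambda>v. 0)) (at x)"
    by (rule has_derivative_transform_within_open[OF _ U(1) x]) (use U in auto)
  from has_derivative_unique[OF der this] show ?thesis by simp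
qed

text \<open>Order 4 allows either a second difference, or a derivative followed by a first
  difference, and still leaves order 2, as demanded of bumps.\<close>

lemma kernel_bump_regular:
  obtains M and D :: "'a::euclidean_space \<Rightarrow> 'a \<Rightarrow> real" where "M > 0" "creg 4 M (kernel_bump \<gamma> :: 'a \<Rightarrow> real)"
    "\<And>w. (kernel_bump \<gamma> has_derivative D w) (at w)" "\<And>b. norm b \<le> 1 \<Longrightarrow> creg 3 M (\<lambda>w. D w b)"
    "\<And>w b. norm w > 2 \<Longrightarrow> D w b = 0" "\<And>w b. norm w < 1 / 2 \<Longrightarrow> D w b = 0"
proof -
  have "\<exists>M. creg 4 M (kernel_bump \<gamma> :: 'a \<Rightarrow> real)"
    by (rule ck_imp_creg[OF ck_kernel_bump, of 2]) (rule kernel_bump_support)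
  then obtain M0 where M0: "creg 4 M0 (kernel_bump \<gamma> :: 'a \<Rightarrow> real)" by (rule exE)
  define M where "M = max 1 M0"
  have M: "M > 0" "creg 4 M (kernel_bump \<gamma> :: 'a \<Rightarrow> real)" using creg_mono[OF M0, of M] by (auto simp: M_def)
  then have "creg (Suc 3) M (kernel_bump \<gamma> :: 'a \<Rightarrow> real)" by (simp add: eval_nat_numeral)
  then obtain D where D: "\<And>w::'a. (kernel_bump \<gamma> has_derivative D w) (at w)" "\<And>b. norm b \<le> 1 \<Longrightarrow> creg 3 M (\<lambda>w. D w b)"
    by (rule creg_SucE) (rule that)
  have o: "open {w::'a. norm w > 2}" "open {w::'a. norm w < 1 / 2}"
    by (intro open_Collect_less continuous_intros)+
  show ?thesis
  proof (rule that[OF M D(1)])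
    show "creg 3 M (\<lambda>w. D w b)" if "norm b \<le> 1" for b by (rule D(2)[OF that])
    show "D w b = 0" if "norm w > 2" for w b
      by (rule creg_directional_zero[OF D(1) o(1)]) (use that kernel_bump_support(1) in auto)
    show "D w b = 0" if "norm w < 1 / 2" for w b
      by (rule creg_directional_zero[OF D(1) o(2)]) (use that kernel_bump_support(2) in auto)
  qed
qed

lemma sum_powr_le:
  assumes "\<theta> > 0" "finite F" "F \<subseteq> {..J::int}"
  shows "(\<Sum>j\<in>F. 2 powr (real_of_int j * \<theta>)) \<le> 2 powr (J * \<theta>) * (2 + 1 / (1 - 2 powr (- \<theta>)))"
proof -
  have p: "0 \<le> 2 powr (- \<theta>)" "2 powr (- \<theta>) < 1" using assms(1) powr_less_mono[of "- \<theta>" 0 2] by auto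
  have "(\<Sum>j\<in>F. 2 powr (real_of_int j * \<theta>)) = (\<Sum>i\<in>(\<lambda>j. j - J) ` F. 2 powr (real_of_int (i + J) * \<theta>))"
    by (subst sum.reindex) (auto simp: inj_on_def)
  also have "\<dots> = 2 powr (J * \<theta>) * (\<Sum>i\<in>(\<lambda>j. j - J) ` F. 2 powr (real_of_int i * \<theta>))"
    by (simp add: sum_distrib_left algebra_simps flip: powr_add)
  \<comment> \<open>The shifted indices are at most 0. The ratio 1/2 is a dummy for the half of the
    two-sided series that contains no index except 0.\<close>
  also have "\<dots> \<le> 2 powr (J * \<theta>) * (\<Sum>i\<in>(\<lambda>j. j - J) ` F. if i \<ge> 0 then (1/2) ^ nat i else (2 powr (- \<theta>)) ^ nat (- i))"
  proof (intro mult_left_mono sum_mono)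
    fix i assume "i \<in> (\<lambda>j. j - J) ` F"
    then have "i \<le> 0" using assms(3) by auto
    then show "2 powr (real_of_int i * \<theta>) \<le> (if i \<ge> 0 then (1/2) ^ nat i else (2 powr (- \<theta>)) ^ nat (- i))"
      by (auto simp: powr_powr mult.commute simp flip: powr_realpow)
  qed simp
  also have "\<dots> \<le> 2 powr (J * \<theta>) * (1 / (1 - 1/2) + 1 / (1 - 2 powr (- \<theta>)))"
    by (intro mult_left_mono sum_two_sided_geometric) (use p assms in auto)
  finally show ?thesis by simp
qed


lemma small_dyadic:
  assumes "r > 0"
  shows "\<exists>J::int. \<forall>j\<le>J. 2 powr j * r < 1 / 2"
proof (intro exI allI impI)
  fix j assume j: "j \<le> \<lfloor>log 2 (1 / (2 * r))\<rfloor> - 1"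
  have "2 powr real_of_int j < 2 powr (log 2 (1 / (2 * r)))" using j by (intro powr_less_mono) linarith+
  also have "\<dots> = 1 / (2 * r)" using assms by simp
  finally show "2 powr j * r < 1 / 2" using assms by (simp add: field_simps)
qed

lemma large_dyadic:
  assumes "r > 0"
  shows "\<exists>J::int. \<forall>j\<ge>J. 2 powr j * r > 2"
proof (intro exI allI impI)
  fix j assume j: "j \<ge> \<lceil>log 2 (2 / r)\<rceil> + 1"
  have "2 / r = 2 powr (log 2 (2 / r))" using assms by simp
  also have "\<dots> < 2 powr real_of_int j" using j by (intro powr_less_mono) linarith+
  finally show "2 powr j * r > 2" using assms by (simp add: field_simps)
qed

context boundary_dual
begin

section \<open>Derivatives and differences of the pieces\<close>

lemma pot_shift: "pot \<phi> j \<xi> (x + h) = pot \<phi> j (\<lambda>w. \<xi> (w + 2 powr j *\<^sub>R h)) x"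
proof -
  have "2 powr j *\<^sub>R (x + h - Q) = 2 powr j *\<^sub>R (x - Q) + 2 powr j *\<^sub>R h" for Q
    by (simp add: scaleR_diff_right scaleR_add_right)
  then show ?thesis by (simp add: pot_def)
qed

lemma pot_add:
  "\<phi> \<in> D \<Longrightarrow> creg 1 M \<xi> \<Longrightarrow> creg 1 M' \<zeta> \<Longrightarrow> pot \<phi> j (\<lambda>w. \<xi> w + \<zeta> w) x = pot \<phi> j \<xi> x + pot \<phi> j \<zeta> x"
  unfolding pot_def by (rule dual_add[OF _ wavelet_Y wavelet_Y])

lemma pot_diff:
  "\<phi> \<in> D \<Longrightarrow> creg 1 M \<xi> \<Longrightarrow> creg 1 M' \<zeta> \<Longrightarrow> pot \<phi> j (\<lambda>w. \<xi> w - \<zeta> w) x = pot \<phi> j \<xi> x - pot \<phi> j \<zeta> x"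
  unfolding pot_def by (rule dual_diff[OF _ wavelet_Y wavelet_Y])

lemma pot_cmult:
  "\<phi> \<in> D \<Longrightarrow> creg 1 M \<xi> \<Longrightarrow> pot \<phi> j (\<lambda>w. c * \<xi> w) x = c * pot \<phi> j \<xi> x"
  unfolding pot_def by (rule dual_cmult[OF _ wavelet_Y])

text \<open>Differentiation under the pairing: the remainder of the difference quotient of the
  profile is a C^{1,1} function with constant of order |t|, so the boundedness of \<phi> on such
  functions makes its contribution tend to 0.\<close>

lemma pot_derivative:
  assumes \<phi>: "\<phi> \<in> D" and xi: "creg 3 M \<xi>" and der: "\<And>w. (\<xi> has_derivative E w) (at w)"
    and Eb: "creg 1 M' (\<lambda>w. E w b)" and b: "norm b \<le> 1"
  shows "((\<lambda>t. pot \<phi> j \<xi> (x + t *\<^sub>R b)) has_real_derivative 2 powr j * pot \<phi> j (\<lambda>w. E w b) x) (at 0)"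
proof -
  obtain C where C: "C \<ge> 0" "\<forall>\<phi>\<in>D. \<forall>M \<xi> j x. creg 1 M \<xi> \<longrightarrow> \<bar>pot \<phi> j \<xi> x\<bar> \<le> C * nD \<phi> * M * (max 1 (2 powr j))\<^sup>2"
    using pot_bound by (elim exE conjE) (rule that)
  define T where "T = 2 powr real_of_int j"
  define L where "L = T * (C * nD \<phi> * (M * T) * (max 1 T)\<^sup>2)"
  have T: "T > 0" by (simp add: T_def)
  have xi': "creg (Suc (Suc 1)) M \<xi>" "creg 1 M \<xi>" using xi creg_le[OF xi, of 1] by (simp_all add: eval_nat_numeral)
  have bd: "\<bar>(pot \<phi> j \<xi> (x + t *\<^sub>R b) - pot \<phi> j \<xi> x) / t - T * pot \<phi> j (\<lambda>w. E w b) x\<bar> \<le> L * \<bar>t\<bar>" if t: "t \<noteq> 0" for t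
  proof -
    have tT: "t * T \<noteq> 0" using t T by simp
    define R where "R w = (\<xi> (w + (t * T) *\<^sub>R b) - \<xi> w) / (t * T) - E w b" for w
    have R: "creg 1 (M * \<bar>t * T\<bar>) R" unfolding R_def[abs_def] by (rule creg_diffquot_remainder[OF xi'(1) der b tT])
    have "pot \<phi> j \<xi> (x + t *\<^sub>R b) = pot \<phi> j (\<lambda>w. \<xi> (w + (t * T) *\<^sub>R b)) x"
      unfolding pot_shift by (simp add: T_def mult.commute)
    then have "pot \<phi> j \<xi> (x + t *\<^sub>R b) - pot \<phi> j \<xi> x = pot \<phi> j (\<lambda>w. \<xi> (w + (t * T) *\<^sub>R b) - \<xi> w) x"
      using pot_diff[OF \<phi> creg_translate[OF xi'(2)] xi'(2)] by simp
    also have "(\<lambda>w. \<xi> (w + (t * T) *\<^sub>R b) - \<xi> w) = (\<lambda>w. (t * T) * (R w + E w b))"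
      using tT by (simp add: R_def)
    also have "pot \<phi> j (\<lambda>w. (t * T) * (R w + E w b)) x = (t * T) * (pot \<phi> j R x + pot \<phi> j (\<lambda>w. E w b) x)"
      using pot_cmult[OF \<phi> creg_add[OF R Eb]] pot_add[OF \<phi> R Eb] by simp
    finally have "(pot \<phi> j \<xi> (x + t *\<^sub>R b) - pot \<phi> j \<xi> x) / t - T * pot \<phi> j (\<lambda>w. E w b) x = T * pot \<phi> j R x"
      using t by (simp add: field_simps)
    then have "\<bar>(pot \<phi> j \<xi> (x + t *\<^sub>R b) - pot \<phi> j \<xi> x) / t - T * pot \<phi> j (\<lambda>w. E w b) x\<bar> = T * \<bar>pot \<phi> j R x\<bar>"
      using T by (simp add: abs_mult)
    also have "\<dots> \<le> T * (C * nD \<phi> * (M * \<bar>t * T\<bar>) * (max 1 T)\<^sup>2)"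
      using C(2)[rule_format, OF \<phi> R, of j x] T by (intro mult_left_mono) (auto simp: T_def)
    also have "\<dots> = L * \<bar>t\<bar>" using T by (simp add: L_def abs_mult mult_ac)
    finally show ?thesis .
  qed
  have "(\<lambda>t. ((pot \<phi> j \<xi> (x + t *\<^sub>R b) - pot \<phi> j \<xi> x) / t) - T * pot \<phi> j (\<lambda>w. E w b) x) \<midarrow>0\<rightarrow> 0"
  proof (rule Lim_null_comparison)
    show "\<forall>\<^sub>F t in at 0. norm ((pot \<phi> j \<xi> (x + t *\<^sub>R b) - pot \<phi> j \<xi> x) / t - T * pot \<phi> j (\<lambda>w. E w b) x) \<le> L * \<bar>t\<bar>"
      using bd by (auto simp: eventually_at_filter)
    show "(\<lambda>t. L * \<bar>t\<bar>) \<midarrow>0\<rightarrow> 0" by (auto intro!: tendsto_eq_intros)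
  qed
  then have "(\<lambda>t. (pot \<phi> j \<xi> (x + t *\<^sub>R b) - pot \<phi> j \<xi> x) / t) \<midarrow>0\<rightarrow> T * pot \<phi> j (\<lambda>w. E w b) x"
    by (rule LIM_zero_cancel)
  then show ?thesis by (simp add: DERIV_def T_def)
qed

text \<open>Two difference quotients in succession, with steps v and -v for v = 2^j h, give the
  second difference centred at w. The profile loses two orders and its support grows by |v|.\<close>

lemma pot_second_difference:
  assumes \<phi>: "\<phi> \<in> D" and xi: "creg 4 M \<xi>" and h: "h \<noteq> 0" and z: "\<And>w. norm w > r \<Longrightarrow> \<xi> w = 0"
  obtains \<zeta> where "creg 2 M \<zeta>" "\<And>w::'a. norm w > r + norm (2 powr j *\<^sub>R h) \<Longrightarrow> \<zeta> w = 0"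
    "\<And>x. pot \<phi> j \<xi> (x + h) - 2 * pot \<phi> j \<xi> x + pot \<phi> j \<xi> (x - h) = - ((2 powr j * norm h)\<^sup>2) * pot \<phi> j \<zeta> x"
proof -
  define v where "v = 2 powr j *\<^sub>R h"
  have v: "v \<noteq> 0" "norm v = 2 powr j * norm h" using h by (simp_all add: v_def)
  define q where "q w = (\<xi> (w + v) - \<xi> w) / norm v" for w
  \<comment> \<open>The step -v in the second quotient recentres the forward difference and is
    responsible for the minus sign in the resulting identity.\<close>
  define \<zeta> where "\<zeta> w = (q (w + (- v)) - q w) / norm (- v)" for w
  have q: "creg 3 M q" unfolding q_def[abs_def] by (rule creg_diffquot) (use xi v in \<open>simp_all add: eval_nat_numeral\<close>)
  have \<zeta>: "creg 2 M \<zeta>" unfolding \<zeta>_def[abs_def] by (rule creg_diffquot) (use q v in \<open>simp_all add: eval_nat_numeral\<close>)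
  have \<zeta>eq: "\<xi> (w + v) - 2 * \<xi> w + \<xi> (w - v) = - ((norm v)\<^sup>2) * \<zeta> w" for w
    using v(1) by (simp add: \<zeta>_def q_def power2_eq_square field_simps)
  show ?thesis
  proof (rule that[OF \<zeta>])
    fix w :: 'a assume "norm w > r + norm (2 powr j *\<^sub>R h)"
    then have "norm w > r + norm v" by (simp add: v_def)
    then have "norm w > r" "norm (w + v) > r" "norm (w - v) > r"
      using norm_triangle_ineq2[of w v] norm_triangle_ineq2[of w "- v"] norm_ge_zero[of v] by (auto simp del: norm_ge_zero)
    then have "- ((norm v)\<^sup>2) * \<zeta> w = 0" using \<zeta>eq[of w] z by simp
    then show "\<zeta> w = 0" using v(1) by simp
  next
    fix x
    have c: "creg 1 M \<xi>" "creg 1 M \<zeta>" using creg_le[OF xi, of 1] creg_le[OF \<zeta>, of 1] by simp_all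
    have s: "pot \<phi> j \<xi> (x + h) = pot \<phi> j (\<lambda>w. \<xi> (w + v)) x" "pot \<phi> j \<xi> (x - h) = pot \<phi> j (\<lambda>w. \<xi> (w - v)) x"
      using pot_shift[of \<phi> j \<xi> x h] pot_shift[of \<phi> j \<xi> x "- h"] by (simp_all add: v_def)
    have c': "creg 1 M (\<lambda>w. \<xi> (w + v))" "creg 1 M (\<lambda>w. \<xi> (w - v))"
      using creg_translate[OF c(1), of v] creg_translate[OF c(1), of "- v"] by simp_all
    have "pot \<phi> j \<xi> (x + h) - 2 * pot \<phi> j \<xi> x + pot \<phi> j \<xi> (x - h) = pot \<phi> j (\<lambda>w. \<xi> (w + v) - 2 * \<xi> w + \<xi> (w - v)) x"
      unfolding s pot_add[OF \<phi> creg_diff[OF c'(1) creg_cmult[OF c(1), of 2]] c'(2)] pot_diff[OF \<phi> c'(1) creg_cmult[OF c(1), of 2]] pot_cmult[OF \<phi> c(1)] ..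
    also have "\<dots> = - ((norm v)\<^sup>2) * pot \<phi> j \<zeta> x" unfolding \<zeta>eq by (rule pot_cmult[OF \<phi> c(2)])
    finally show "pot \<phi> j \<xi> (x + h) - 2 * pot \<phi> j \<xi> x + pot \<phi> j \<xi> (x - h) = - ((2 powr j * norm h)\<^sup>2) * pot \<phi> j \<zeta> x"
      by (simp add: v)
  qed
qed

lemma pot_first_difference:
  assumes \<phi>: "\<phi> \<in> D" and xi: "creg 3 M \<xi>" and h: "h \<noteq> 0" and z: "\<And>w. norm w > r \<Longrightarrow> \<xi> w = 0"
  obtains \<zeta> where "creg 2 M \<zeta>" "\<And>w::'a. norm w > r + norm (2 powr j *\<^sub>R h) \<Longrightarrow> \<zeta> w = 0"
    "\<And>x. pot \<phi> j \<xi> (x + h) - pot \<phi> j \<xi> x = (2 powr j * norm h) * pot \<phi> j \<zeta> x"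
proof -
  define v where "v = 2 powr j *\<^sub>R h"
  have v: "v \<noteq> 0" using h by (simp add: v_def)
  have c: "creg 1 M \<xi>" using creg_le[OF xi, of 1] by simp
  have q: "creg 2 M (\<lambda>w. (\<xi> (w + v) - \<xi> w) / norm v)" by (rule creg_diffquot) (use xi v in \<open>simp_all add: eval_nat_numeral\<close>)
  show ?thesis
  proof (rule that[OF q])
    fix w :: 'a assume "norm w > r + norm (2 powr j *\<^sub>R h)"
    then have "norm w > r + norm v" by (simp add: v_def)
    then have "norm w > r" "norm (w + v) > r"
      using norm_triangle_ineq2[of w "- v"] norm_ge_zero[of v] by (auto simp del: norm_ge_zero)
    then show "(\<xi> (w + v) - \<xi> w) / norm v = 0" using z by simp
  qed (use pot_diff_eq[OF \<phi> c h] in \<open>simp add: v_def\<close>)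
qed

section \<open>Scales at which the pieces vanish\<close>

lemma pot_vanish_low:
  assumes "\<phi> \<in> D" "\<And>Q. Q \<in> frontier \<Omega> \<Longrightarrow> norm Q \<le> R" "\<And>w. norm w < 1 / 2 \<Longrightarrow> \<xi> w = 0" "2 powr j * (norm x + R) < 1 / 2"
  shows "pot \<phi> j \<xi> x = 0"
  unfolding pot_def
proof (rule dual_zero[OF assms(1)])
  fix Q assume "Q \<in> frontier \<Omega>"
  then have "norm (x - Q) \<le> norm x + R" using assms(2)[of Q] norm_triangle_ineq4[of x Q] by linarith
  then have "2 powr j * norm (x - Q) \<le> 2 powr j * (norm x + R)" by (intro mult_left_mono) auto
  from le_less_trans[OF this assms(4)] show "\<xi> (2 powr j *\<^sub>R (x - Q)) = 0" by (intro assms(3)) simp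
qed

lemma pot_vanish_high:
  assumes "\<phi> \<in> D" "\<And>Q. Q \<in> frontier \<Omega> \<Longrightarrow> \<delta> \<le> norm (x - Q)" "\<And>w. norm w > 2 \<Longrightarrow> \<xi> w = 0" "2 powr j * \<delta> > 2"
  shows "pot \<phi> j \<xi> x = 0"
  unfolding pot_def
proof (rule dual_zero[OF assms(1)])
  fix Q assume "Q \<in> frontier \<Omega>"
  then have "2 powr j * \<delta> \<le> 2 powr j * norm (x - Q)" using assms(2) by (intro mult_left_mono) auto
  from less_le_trans[OF assms(4) this] show "\<xi> (2 powr j *\<^sub>R (x - Q)) = 0" by (intro assms(3)) simp
qed

lemma frontier_distance:
  assumes "x \<notin> frontier \<Omega>"
  obtains \<delta> where "\<delta> > 0" "\<And>Q. Q \<in> frontier \<Omega> \<Longrightarrow> \<delta> \<le> norm (x - Q)"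
proof (cases "frontier \<Omega> = {}")
  case True
  then show ?thesis using that[of 1] by simp
next
  case False
  then have "infdist x (frontier \<Omega>) > 0" using assms compact_frontier by (intro infdist_pos_not_in_closed) (auto intro: compact_imp_closed)
  then show ?thesis using that[of "infdist x (frontier \<Omega>)"] infdist_le by (metis dist_norm)
qed

text \<open>The profile lives in an annulus, so only scales comparable to some distance |x - Q| are
  active, and over the compact boundary these distances are bounded above and away from 0.\<close>

lemma pot_finite_off_frontier:
  assumes \<phi>: "\<phi> \<in> D" and x: "x \<notin> frontier \<Omega>" and z: "\<And>w. norm w > 2 \<Longrightarrow> \<xi> w = 0" "\<And>w. norm w < 1 / 2 \<Longrightarrow> \<xi> w = 0"
  shows "finite {j. pot \<phi> j \<xi> x \<noteq> 0}"
proof -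
  obtain R where R: "R > 0" "\<And>Q. Q \<in> frontier \<Omega> \<Longrightarrow> norm Q \<le> R" by (rule frontier_radius) (rule that)
  obtain \<delta> where \<delta>: "\<delta> > 0" "\<And>Q. Q \<in> frontier \<Omega> \<Longrightarrow> \<delta> \<le> norm (x - Q)" by (rule frontier_distance[OF x]) (rule that)
  have xR: "norm x + R > 0" using R(1) by (simp add: add_nonneg_pos)
  obtain J1 :: int where J1: "\<forall>j\<le>J1. 2 powr j * (norm x + R) < 1 / 2" using small_dyadic[OF xR] by (rule exE)
  obtain J2 :: int where J2: "\<forall>j\<ge>J2. 2 powr j * \<delta> > 2" using large_dyadic[OF \<delta>(1)] by (rule exE)
  have lo: "pot \<phi> j \<xi> x = 0" if "j \<le> J1" for j
    by (rule pot_vanish_low[where R=R, OF \<phi> R(2) z(2)]) (use J1 that in auto)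
  have hi: "pot \<phi> j \<xi> x = 0" if "j \<ge> J2" for j
    by (rule pot_vanish_high[where \<delta>=\<delta>, OF \<phi> \<delta>(2) z(1)]) (use J2 that in auto)
  have "j \<in> {J1..J2}" if "pot \<phi> j \<xi> x \<noteq> 0" for j
    using that lo[of j] hi[of j] by (cases "j \<le> J1"; cases "j \<ge> J2") auto
  then have "{j. pot \<phi> j \<xi> x \<noteq> 0} \<subseteq> {J1..J2}" by blast
  then show ?thesis by (rule finite_subset) simp
qed

lemma pot_locally_low:
  assumes \<phi>: "\<phi> \<in> D" and z: "\<And>w. norm w < 1 / 2 \<Longrightarrow> \<xi> w = 0"
  shows "\<exists>J::int. \<forall>j<J. \<forall>x. norm x \<le> r \<longrightarrow> pot \<phi> j \<xi> x = 0"
proof -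
  obtain R where R: "R > 0" "\<And>Q. Q \<in> frontier \<Omega> \<Longrightarrow> norm Q \<le> R" by (rule frontier_radius) (rule that)
  have rR: "\<bar>r\<bar> + R > 0" using R(1) by (simp add: add_nonneg_pos)
  obtain J1 :: int where J1: "\<forall>j\<le>J1. 2 powr j * (\<bar>r\<bar> + R) < 1 / 2" using small_dyadic[OF rR] by (rule exE)
  have "pot \<phi> j \<xi> x = 0" if "j < J1" "norm x \<le> r" for j x
  proof (rule pot_vanish_low[where R=R, OF \<phi> R(2) z])
    have "2 powr j * (norm x + R) \<le> 2 powr j * (\<bar>r\<bar> + R)" using that(2) by (intro mult_left_mono) auto
    also have "\<dots> < 1 / 2" using J1[rule_format, of j] that(1) by simp
    finally show "2 powr j * (norm x + R) < 1 / 2" .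
  qed
  then show ?thesis by (intro exI[of _ J1]) auto
qed

lemma frontier_null:
  assumes "DIM('b) < DIM('a)"
  shows "AE x in lborel. x \<notin> frontier \<Omega>"
proof -
  have "negligible (\<Psi> i ` ball 0 r\<^sub>0)" if "i < N" for i
  proof (rule negligible_differentiable_image_lowdim[OF assms])
    have "C2_parametrization (ball 0 r\<^sub>0) (\<Psi> i)" using atlas that by (simp add: boundary_atlas_def)
    then show "\<Psi> i differentiable_on ball 0 r\<^sub>0"
      unfolding C2_parametrization_def C2_derivs_on_def
      by (intro differentiable_at_imp_differentiable_on) (auto simp: differentiable_def)
  qed
  then have "negligible (\<Union>i<N. \<Psi> i ` ball 0 r\<^sub>0)" by (intro negligible_Union) auto
  moreover have "frontier \<Omega> \<subseteq> (\<Union>i<N. \<Psi> i ` ball 0 r\<^sub>0)" using atlas by (simp add: boundary_atlas_def)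
  ultimately have "negligible (frontier \<Omega>)" by (rule negligible_subset)
  then have "AE x in lebesgue. x \<notin> frontier \<Omega>" by (intro AE_not_in) (simp add: negligible_iff_null_sets)
  then show ?thesis by (simp add: AE_completion_iff)
qed

end

section \<open>Estimates of the layer potential\<close>

locale layer_setting = boundary_dual +
  fixes \<alpha> :: real
  assumes alpha: "1 / 2 < \<alpha>" "\<alpha> < 1" and s_lower: "- 2 * \<alpha> + 1 - 1 / p < s"
    and dim: "DIM('a) \<ge> 3" "DIM('a) = DIM('b) + 1"
begin

definition \<sigma> where "\<sigma> = s + 2 * \<alpha> - 1 + 1 / p"

definition \<gamma> where "\<gamma> = real DIM('a) - 2 * \<alpha>"

definition c\<^sub>\<alpha> where "c\<^sub>\<alpha> = pi powr (2 * \<alpha> - real DIM('a) / 2) * Gamma (real DIM('a) / 2 - \<alpha>) / Gamma \<alpha>"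

lemma sigma: "0 < \<sigma>" "\<sigma> < 2"
proof -
  have "1 / p < 1" using p by simp
  then show "0 < \<sigma>" "\<sigma> < 2" using s_lower s alpha by (auto simp: \<sigma>_def)
qed

lemma gamma_pos: "\<gamma> > 0"
  using alpha dim by (simp add: \<gamma>_def)

lemma c_pos: "c\<^sub>\<alpha> > 0"
  using alpha dim by (simp add: c\<^sub>\<alpha>_def Gamma_real_pos)

text \<open>Balances the energy decay 2^{-j(ep + n)} of the pairings against the factor
  2^{j\<gamma>p} of the kernel pieces, which leaves 2^{-j\<sigma>p}. It rests on the boundary having
  dimension n - 1.\<close>

lemma exponent: "e * p + real DIM('a) = (\<sigma> + \<gamma>) * p"
proof -
  have "real DIM('b) / q = real DIM('b) * (1 - 1 / p)" unfolding pq(1)[symmetric] by simp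
  then show ?thesis using p dim(2) by (simp add: e_def \<sigma>_def \<gamma>_def field_simps)
qed

lemma riesz_kernel_eq: "riesz_kernel \<alpha> (x :: 'a) = c\<^sub>\<alpha> * norm x powr (- \<gamma>)"
  by (simp add: riesz_kernel_def c\<^sub>\<alpha>_def \<gamma>_def)

lemma dim_less: "DIM('b) < DIM('a)"
  using dim by simp

definition piece :: "(('a \<Rightarrow> real) \<Rightarrow> real) \<Rightarrow> int \<Rightarrow> 'a \<Rightarrow> real" where
  "piece \<phi> j x = c\<^sub>\<alpha> * 2 powr (j * \<gamma>) * pot \<phi> j (kernel_bump \<gamma>) x"

text \<open>Pieces, derivatives and their differences are all pairings with bumps from one bounded
  family, so a single coefficient sequence fulfils all requirements of a dyadic family. The set I is
  kept general: only the sum over its negative scales distinguishes the local from the global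
  estimate.\<close>

lemma potential_family:
  assumes K: "K \<ge> 0" "\<And>F. finite F \<Longrightarrow> F \<subseteq> I \<inter> {..<0} \<Longrightarrow> (\<Sum>j\<in>F. 2 powr (real_of_int j * (e * p))) \<le> K"
  shows "\<exists>C\<ge>0. \<forall>\<phi>\<in>D. \<exists>Gs A. dyadic_family \<sigma> p (\<lambda>j x. if j \<in> I then piece \<phi> j x else 0) Gs A (C * nD \<phi> powr p) \<and>
    (\<forall>j b x. j \<notin> I \<longrightarrow> Gs j b x = 0)"
proof -
  obtain M and E :: "'a \<Rightarrow> 'a \<Rightarrow> real" where M: "M > 0" "creg 4 M (kernel_bump \<gamma> :: 'a \<Rightarrow> real)"
    and E: "\<And>w. (kernel_bump \<gamma> has_derivative E w) (at w)" "\<And>b. norm b \<le> 1 \<Longrightarrow> creg 3 M (\<lambda>w. E w b)"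
      "\<And>w b. norm w > 2 \<Longrightarrow> E w b = 0" "\<And>w b. norm w < 1 / 2 \<Longrightarrow> E w b = 0"
    by (rule kernel_bump_regular[of \<gamma>]) (rule that)
  \<comment> \<open>Radius 3: the profiles have radius 2, and differences are used only for steps
    with 2^j |h| \<le> 1.\<close>
  have ex: "\<exists>C\<ge>0. \<forall>\<phi>\<in>D. \<exists>A. (\<forall>j. 0 \<le> A j) \<and>
    (\<forall>j. \<forall>\<xi>\<in>bumps 3. (pint p (pot \<phi> j \<xi>)) \<le> ennreal (2 powr (- (j * (e * p + DIM('a)))) * A j)) \<and>
    (\<forall>F. finite F \<longrightarrow> F \<subseteq> I \<longrightarrow> (\<Sum>j\<in>F. A j) \<le> C * nD \<phi> powr p)"
    by (rule potential_coefficients[OF _ K(1)]) (use K(2) in auto)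
  obtain C where C: "C \<ge> 0" "\<forall>\<phi>\<in>D. \<exists>A. (\<forall>j. 0 \<le> A j) \<and>
    (\<forall>j. \<forall>\<xi>\<in>bumps 3. (pint p (pot \<phi> j \<xi>)) \<le> ennreal (2 powr (- (j * (e * p + DIM('a)))) * A j)) \<and>
    (\<forall>F. finite F \<longrightarrow> F \<subseteq> I \<longrightarrow> (\<Sum>j\<in>F. A j) \<le> C * nD \<phi> powr p)"
    using ex by (elim exE conjE) (rule that)
  define L where "L = (c\<^sub>\<alpha> * M) powr p"
  show ?thesis
  proof (intro exI[of _ "L * C"] conjI ballI)
    show "0 \<le> L * C" using C(1) by (simp add: L_def)
    fix \<phi> assume \<phi>: "\<phi> \<in> D"
    obtain A where A: "\<And>j. 0 \<le> A j"
      "\<And>j \<xi>. \<xi> \<in> bumps 3 \<Longrightarrow> (pint p (pot \<phi> j \<xi>)) \<le> ennreal (2 powr (- (j * (e * p + DIM('a)))) * A j)"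
      "\<And>F. finite F \<Longrightarrow> F \<subseteq> I \<Longrightarrow> (\<Sum>j\<in>F. A j) \<le> C * nD \<phi> powr p"
      using bspec[OF C(2) \<phi>] by (elim exE conjE, rule_tac that) (elim allE ballE, assumption | simp)+
    \<comment> \<open>As for the atoms, \<theta> collects the factors 2^j of a derivative and the
      powers of 2^j |h| of a difference. Division by M makes the profile an admissible bump.\<close>
    have en: "pint p g \<le> ennreal (\<theta> powr p * (2 powr (- (j * \<sigma> * p)) * (L * A j)))"
      if g: "\<And>x. \<bar>g x\<bar> = c\<^sub>\<alpha> * 2 powr (j * \<gamma>) * \<theta> * \<bar>pot \<phi> j \<xi> x\<bar>" and th: "\<theta> \<ge> 0"
        and xi: "creg 2 M \<xi>" "\<And>w. norm w > 3 \<Longrightarrow> \<xi> w = 0" for j \<theta> \<xi> g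
    proof -
      define \<zeta> where "\<zeta> w = (1 / M) * \<xi> w" for w
      have "creg 2 1 \<zeta>" unfolding \<zeta>_def[abs_def] by (rule creg_mono[OF creg_cmult[OF xi(1)]]) (use M in auto)
      then have \<zeta>: "\<zeta> \<in> bumps 3" using xi(2) by (simp add: bumps_def \<zeta>_def)
      have "pot \<phi> j \<zeta> x = (1 / M) * pot \<phi> j \<xi> x" for x
        unfolding \<zeta>_def[abs_def] by (rule pot_cmult[OF \<phi> creg_le[OF xi(1)]]) simp
      then have px: "\<bar>pot \<phi> j \<xi> x\<bar> = M * \<bar>pot \<phi> j \<zeta> x\<bar>" for x using M(1) by (simp add: abs_mult)
      have gx: "\<bar>g x\<bar> powr p = (L * 2 powr (j * \<gamma> * p) * \<theta> powr p) * \<bar>pot \<phi> j \<zeta> x\<bar> powr p" for x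
        unfolding g px L_def using c_pos M(1) th by (simp add: powr_mult powr_powr mult_ac)
      have "pint p g = (\<integral>\<^sup>+x. ennreal (L * 2 powr (j * \<gamma> * p) * \<theta> powr p) * ennreal (\<bar>pot \<phi> j \<zeta> x\<bar> powr p) \<partial>lborel)"
        unfolding gx by (simp add: L_def ennreal_mult')
      also have "\<dots> = ennreal (L * 2 powr (j * \<gamma> * p) * \<theta> powr p) * (pint p (pot \<phi> j \<zeta>))"
        by (rule nn_integral_cmult) (use pot_power_measurable[OF \<phi> \<zeta>] in simp)
      also have "\<dots> \<le> ennreal (L * 2 powr (j * \<gamma> * p) * \<theta> powr p) * ennreal (2 powr (- (j * (e * p + DIM('a)))) * A j)"
        by (intro mult_left_mono A(2)[OF \<zeta>]) simp
      also have "\<dots> = ennreal ((L * 2 powr (j * \<gamma> * p) * \<theta> powr p) * (2 powr (- (j * (e * p + DIM('a)))) * A j))"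
        by (rule ennreal_mult'[symmetric]) (simp add: L_def)
      also have "(L * 2 powr (j * \<gamma> * p) * \<theta> powr p) * (2 powr (- (j * (e * p + DIM('a)))) * A j) = \<theta> powr p * (2 powr (- (j * \<sigma> * p)) * (L * A j))"
      proof -
        have "2 powr (j * \<gamma> * p) * 2 powr (- (j * (e * p + DIM('a)))) = 2 powr (- (j * \<sigma> * p))"
          unfolding exponent by (simp add: algebra_simps flip: powr_add)
        then show ?thesis by (simp add: mult_ac)
      qed
      finally show ?thesis .
    qed
    have kb: "creg 2 M (kernel_bump \<gamma> :: 'a \<Rightarrow> real)" "creg 3 M (kernel_bump \<gamma> :: 'a \<Rightarrow> real)"
      using creg_le[OF M(2), of 2] creg_le[OF M(2), of 3] by simp_all
    define G where "G j b x = c\<^sub>\<alpha> * 2 powr (real_of_int j * \<gamma>) * (2 powr j * pot \<phi> j (\<lambda>w. E w b) x)" for j b x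
    have Eb: "creg 2 M (\<lambda>w. E w b)" "creg 3 M (\<lambda>w. E w b)" "creg 1 M (\<lambda>w. E w b)" if "b \<in> Basis" for b
      using E(2)[of b] that creg_le[OF E(2)[of b], of 1] creg_le[OF E(2)[of b], of 2] by simp_all
    have th1: "(2 powr j) powr p * (2 powr (- (j * \<sigma> * p)) * X) = 2 powr (- (j * (\<sigma> - 1) * p)) * X" for j :: int and X
    proof -
      have "(2 powr j) powr p * 2 powr (- (j * \<sigma> * p)) = 2 powr (- (j * (\<sigma> - 1) * p))"
        by (simp add: powr_powr algebra_simps flip: powr_add)
      then show ?thesis by (simp add: mult.assoc[symmetric])
    qed
    \<comment> \<open>The factor \<mu> is 1 for the pieces and 2^j for their derivatives.\<close>
    have diff: "pint p (delta c (\<lambda>x. c\<^sub>\<alpha> * 2 powr (j * \<gamma>) * \<mu> * pot \<phi> j \<xi> x) h)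
        \<le> ennreal ((\<mu> * (2 powr j * norm h) powr (1 + c)) powr p * (2 powr (- (j * \<sigma> * p)) * (L * A j)))"
      if c: "c \<in> {0, 1}" and xi: "creg 3 M \<xi>" "c = 1 \<Longrightarrow> creg 4 M \<xi>" "\<And>w. norm w > 2 \<Longrightarrow> \<xi> w = 0"
        and h: "2 powr j * norm h \<le> 1" and mu: "\<mu> \<ge> 0" for c j \<xi> h \<mu>
    proof (cases "h = 0")
      case True
      then have "delta c g h = (\<lambda>x. 0)" for g :: "'a \<Rightarrow> real" by (simp add: delta_def fun_eq_iff algebra_simps)
      then show ?thesis by simp
    next
      case False
      obtain \<zeta> where \<zeta>: "creg 2 M \<zeta>" "\<And>w. norm w > 2 + norm (2 powr j *\<^sub>R h) \<Longrightarrow> \<zeta> w = 0"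
        "\<And>x. \<bar>delta c (pot \<phi> j \<xi>) h x\<bar> = (2 powr j * norm h) powr (1 + c) * \<bar>pot \<phi> j \<zeta> x\<bar>"
      proof (cases "c = 0")
        case True
        obtain \<zeta> where \<zeta>: "creg 2 M \<zeta>" "\<And>w. norm w > 2 + norm (2 powr j *\<^sub>R h) \<Longrightarrow> \<zeta> w = 0"
          "\<And>x. pot \<phi> j \<xi> (x + h) - pot \<phi> j \<xi> x = (2 powr j * norm h) * pot \<phi> j \<zeta> x"
          by (rule pot_first_difference[where j=j, OF \<phi> xi(1) False xi(3)]) (assumption | rule that)+
        show ?thesis by (rule that[OF \<zeta>(1,2)]) (simp_all add: delta_def True \<zeta>(3) abs_mult)
      next
        case c0: False
        then have c1: "c = 1" using c by simp
        obtain \<zeta> where \<zeta>: "creg 2 M \<zeta>" "\<And>w. norm w > 2 + norm (2 powr j *\<^sub>R h) \<Longrightarrow> \<zeta> w = 0"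
          "\<And>x. pot \<phi> j \<xi> (x + h) - 2 * pot \<phi> j \<xi> x + pot \<phi> j \<xi> (x - h) = - ((2 powr j * norm h)\<^sup>2) * pot \<phi> j \<zeta> x"
          by (rule pot_second_difference[where j=j, OF \<phi> xi(2)[OF c1] False xi(3)]) (assumption | rule that)+
        show ?thesis
        proof (rule that[OF \<zeta>(1,2)])
          fix x
          have "delta c (pot \<phi> j \<xi>) h x = - ((2 powr j * norm h)\<^sup>2) * pot \<phi> j \<zeta> x"
            unfolding \<zeta>(3)[symmetric] by (simp add: delta_def c1)
          then show "\<bar>delta c (pot \<phi> j \<xi>) h x\<bar> = (2 powr j * norm h) powr (1 + c) * \<bar>pot \<phi> j \<zeta> x\<bar>"
            using False by (simp add: abs_mult c1 powr_numeral)
        qed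
      qed
      have d: "delta c (\<lambda>x. k * pot \<phi> j \<xi> x) h x = k * delta c (pot \<phi> j \<xi>) h x" for k x
        by (simp add: delta_def algebra_simps)
      show ?thesis
        by (rule en[where \<xi>=\<zeta>]) (use \<zeta> h mu c_pos in \<open>auto simp: d abs_mult\<close>)
    qed
    have pc: "continuous_on UNIV (pot \<phi> j \<xi>)" if "creg 2 M \<xi>" for j \<xi> by (rule pot_continuous[OF \<phi> that])
    have fin: "AE x in lborel. finite {j \<in> I. k j * pot \<phi> j \<xi> x \<noteq> 0}"
      if "\<And>w. norm w > 2 \<Longrightarrow> \<xi> w = 0" "\<And>w. norm w < 1 / 2 \<Longrightarrow> \<xi> w = 0" for \<xi> and k :: "int \<Rightarrow> real"
      using frontier_null[OF dim_less]
    proof eventually_elim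
      case (elim x)
      show ?case by (rule finite_subset[OF _ pot_finite_off_frontier[OF \<phi> elim that]]) auto
    qed
    have low: "\<exists>J. \<forall>j<J. \<forall>x. j \<in> I \<longrightarrow> norm x \<le> r \<longrightarrow> k j * pot \<phi> j \<xi> x = 0"
      if "\<And>w. norm w < 1 / 2 \<Longrightarrow> \<xi> w = 0" for \<xi> r and k :: "int \<Rightarrow> real"
      using pot_locally_low[where \<xi>=\<xi> and r=r, OF \<phi> that] by auto
    have "dyadic_family \<sigma> p (\<lambda>j x. if j \<in> I then piece \<phi> j x else 0) (\<lambda>j b x. if j \<in> I then G j b x else 0)
      (\<lambda>j. if j \<in> I then L * A j else 0) (L * C * nD \<phi> powr p)"
    proof (rule dyadic_family_on[OF p sigma])
      show "continuous_on UNIV (piece \<phi> j)" for j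
        unfolding piece_def[abs_def] by (intro continuous_intros pc kb)
      show "pint p (piece \<phi> j) \<le> ennreal (2 powr (- (j * \<sigma> * p)) * (L * A j))" for j
        using en[where \<theta>=1 and \<xi>="kernel_bump \<gamma>" and j=j and g="piece \<phi> j"] kb c_pos
        by (simp add: piece_def abs_mult kernel_bump_support)
      show "pint p (delta c (piece \<phi> j) h) \<le> ennreal (((2 powr j * norm h) powr (1 + c)) powr p * (2 powr (- (j * \<sigma> * p)) * (L * A j)))"
        if "c \<in> {0, 1}" "2 powr j * norm h \<le> 1" for c j h
        using diff[OF that(1) kb(2) M(2) kernel_bump_support(1) that(2), of 1] by (simp add: piece_def[abs_def])
      fix b :: 'a assume b: "b \<in> Basis"
      show "continuous_on UNIV (G j b)" for j
        unfolding G_def[abs_def] by (intro continuous_intros pc Eb b)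
      show "((\<lambda>u. piece \<phi> j (x + u *\<^sub>R b)) has_real_derivative G j b x) (at 0)" for j x
        unfolding G_def piece_def by (intro DERIV_cmult pot_derivative[OF \<phi> kb(2) E(1) Eb(3)[OF b]]) (use b in simp)
      show "pint p (G j b) \<le> ennreal (2 powr (- (j * (\<sigma> - 1) * p)) * (L * A j))" for j
        unfolding th1[symmetric]
        by (rule en[where \<xi>="\<lambda>w. E w b"]) (use Eb[OF b] c_pos E(3) in \<open>auto simp: G_def abs_mult\<close>)
      show "pint p (delta 0 (G j b) h) \<le> ennreal ((2 powr j * norm h) powr p * (2 powr (- (j * (\<sigma> - 1) * p)) * (L * A j)))"
        if "2 powr j * norm h \<le> 1" for j h
        using diff[OF _ Eb(2)[OF b] _ E(3) that, of 0 "2 powr j"] unfolding th1[symmetric]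
        by (simp add: G_def[abs_def] powr_mult mult_ac)
      show "AE x in lborel. finite {j \<in> I. G j b x \<noteq> 0}"
        unfolding G_def mult.assoc[symmetric] by (rule fin) (auto simp: E)
      show "\<exists>J. \<forall>j<J. \<forall>x. j \<in> I \<longrightarrow> norm x \<le> r \<longrightarrow> G j b x = 0" for r
        unfolding G_def mult.assoc[symmetric] by (rule low) (auto simp: E)
    next
      show "0 \<le> L * A j" for j using A(1) by (simp add: L_def)
      show "(\<Sum>j\<in>S. L * A j) \<le> L * C * nD \<phi> powr p" if "finite S" "S \<subseteq> I" for S
        unfolding sum_distrib_left[symmetric] mult.assoc using that by (intro mult_left_mono A(3)) (auto simp: L_def)
      show "AE x in lborel. finite {j \<in> I. piece \<phi> j x \<noteq> 0}"
        unfolding piece_def by (rule fin) (auto simp: kernel_bump_support)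
      show "\<exists>J. \<forall>j<J. \<forall>x. j \<in> I \<longrightarrow> norm x \<le> r \<longrightarrow> piece \<phi> j x = 0" for r
        unfolding piece_def by (rule low) (auto simp: kernel_bump_support)
    qed
    then show "\<exists>Gs A. dyadic_family \<sigma> p (\<lambda>j x. if j \<in> I then piece \<phi> j x else 0) Gs A (L * C * nD \<phi> powr p) \<and>
      (\<forall>j b x. j \<notin> I \<longrightarrow> Gs j b x = 0)"
      by (intro exI conjI) auto
  qed
qed

text \<open>As a function of Q the kernel is singular at x, but on the boundary it agrees with a
  finite sum of smooth bumps. Linearity of \<phi> applies to that sum, and the values off the
  boundary do not matter.\<close>

lemma dysum_piece:
  assumes \<phi>: "\<phi> \<in> D" and x: "x \<notin> frontier \<Omega>"
  shows "dysum (piece \<phi>) x = layer_potential \<alpha> \<Omega> \<phi> x"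
proof -
  obtain M and E :: "'a \<Rightarrow> 'a \<Rightarrow> real" where M: "creg 4 M (kernel_bump \<gamma> :: 'a \<Rightarrow> real)"
    by (rule kernel_bump_regular[of \<gamma>]) (rule that)
  have M1: "creg 1 M (kernel_bump \<gamma> :: 'a \<Rightarrow> real)" using creg_le[OF M, of 1] by simp
  obtain R where R: "R > 0" "\<And>Q. Q \<in> frontier \<Omega> \<Longrightarrow> norm Q \<le> R" by (rule frontier_radius) (rule that)
  obtain \<delta> where \<delta>: "\<delta> > 0" "\<And>Q. Q \<in> frontier \<Omega> \<Longrightarrow> \<delta> \<le> norm (x - Q)" by (rule frontier_distance[OF x]) (rule that)
  have xR: "norm x + R > 0" using R(1) by (simp add: add_nonneg_pos)
  obtain J1 :: int where J1: "\<forall>j\<le>J1. 2 powr j * (norm x + R) < 1 / 2" using small_dyadic[OF xR] by (rule exE)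
  obtain b :: int where b: "\<forall>j\<ge>b. 2 powr j * \<delta> > 2" using large_dyadic[OF \<delta>(1)] by (rule exE)
  \<comment> \<open>Keeps the index range nonempty, as the telescoping sum wants it.\<close>
  define a where "a = min J1 b"
  have lo: "piece \<phi> j x = 0" if "j < a" for j
  proof -
    have "pot \<phi> j (kernel_bump \<gamma>) x = 0"
      by (rule pot_vanish_low[where R=R, OF \<phi>]) (use R J1 that kernel_bump_support in \<open>auto simp: a_def\<close>)
    then show ?thesis by (simp add: piece_def)
  qed
  have hi: "piece \<phi> j x = 0" if "j > b" for j
  proof -
    have "pot \<phi> j (kernel_bump \<gamma>) x = 0"
      by (rule pot_vanish_high[where \<delta>=\<delta>, OF \<phi>]) (use \<delta> b that kernel_bump_support in auto)
    then show ?thesis by (simp add: piece_def)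
  qed
  let ?w = "\<lambda>j Q. c\<^sub>\<alpha> * 2 powr (real_of_int j * \<gamma>) * kernel_bump \<gamma> (2 powr real_of_int j *\<^sub>R (x - Q))"
  have Yj: "?w j \<in> Y (\<bar>c\<^sub>\<alpha> * 2 powr (real_of_int j * \<gamma>)\<bar> * (M * (max 1 (2 powr real_of_int j))\<^sup>2))" for j
    by (rule Y_cmult[OF wavelet_Y[OF M1]])
  have "dysum (piece \<phi>) x = (\<Sum>j\<in>{a..b}. piece \<phi> j x)"
    by (rule dysum_eq) (use lo hi in \<open>auto simp: not_le\<close>)
  also have "\<dots> = (\<Sum>j\<in>{a..b}. \<phi> (?w j))"
    unfolding piece_def pot_def by (intro sum.cong refl dual_cmult[OF \<phi> wavelet_Y[OF M1], symmetric])
  also have "\<dots> = \<phi> (\<lambda>Q. \<Sum>j\<in>{a..b}. ?w j Q)"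
    by (rule dual_sum[OF \<phi> _ Yj, symmetric]) simp
  also have "\<dots> = \<phi> (\<lambda>Q. riesz_kernel \<alpha> (x - Q))"
  proof (rule dual_cong[OF \<phi> Y_sum[OF _ Yj], symmetric])
    fix Q assume Q: "Q \<in> frontier \<Omega>"
    have n: "\<delta> \<le> norm (x - Q)" "norm (x - Q) \<le> norm x + R"
      using \<delta>(2)[OF Q] R(2)[OF Q] norm_triangle_ineq4[of x Q] by linarith+
    have "2 powr a * norm (x - Q) \<le> 2 powr a * (norm x + R)" using n by (intro mult_left_mono) auto
    also have "\<dots> < 1 / 2" using J1[rule_format, of a] by (simp add: a_def)
    finally have 1: "2 powr a * norm (x - Q) \<le> 1" by simp
    have "1 \<le> 2 powr b * \<delta>" using b[rule_format, of b] by simp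
    also have "\<dots> \<le> 2 powr b * norm (x - Q)" using n by (intro mult_left_mono) auto
    finally have 2: "2 powr b * norm (x - Q) \<ge> 1" .
    have "x - Q \<noteq> 0" using n \<delta>(1) by auto
    then have "(\<Sum>j\<in>{a..b}. 2 powr (j * \<gamma>) * kernel_bump \<gamma> (2 powr j *\<^sub>R (x - Q))) = norm (x - Q) powr (- \<gamma>)"
      by (intro kernel_bump_sum 1 2) (simp_all add: a_def)
    moreover have "(\<Sum>j\<in>{a..b}. ?w j Q) = c\<^sub>\<alpha> * (\<Sum>j\<in>{a..b}. 2 powr (j * \<gamma>) * kernel_bump \<gamma> (2 powr j *\<^sub>R (x - Q)))"
      by (simp add: sum_distrib_left mult.assoc)
    ultimately show "riesz_kernel \<alpha> (x - Q) = (\<Sum>j\<in>{a..b}. ?w j Q)" by (simp only: riesz_kernel_eq)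
  qed simp
  also have "\<dots> = layer_potential \<alpha> \<Omega> \<phi> x" using x by (simp add: layer_potential_def)
  finally show ?thesis .
qed

text \<open>At distance more than 1 from the boundary only scales j \<le> 1 are active, and the
  factors 2^{j\<gamma>} sum geometrically there. Together with local integrability this makes the
  potential a tempered distribution.\<close>

lemma potential_bounded_at_infinity:
  assumes \<phi>: "\<phi> \<in> D"
  obtains r B where "B \<ge> 0" "\<And>x. norm x > r \<Longrightarrow> \<bar>dysum (piece \<phi>) x\<bar> \<le> B"
proof -
  obtain M and E :: "'a \<Rightarrow> 'a \<Rightarrow> real" where M: "creg 4 M (kernel_bump \<gamma> :: 'a \<Rightarrow> real)"
    by (rule kernel_bump_regular[of \<gamma>]) (rule that)
  have M1: "creg 1 M (kernel_bump \<gamma> :: 'a \<Rightarrow> real)" using creg_le[OF M, of 1] by simp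
  obtain C where C: "C \<ge> 0" "\<forall>\<phi>\<in>D. \<forall>M \<xi> j x. creg 1 M \<xi> \<longrightarrow> \<bar>pot \<phi> j \<xi> x\<bar> \<le> C * nD \<phi> * M * (max 1 (2 powr j))\<^sup>2"
    using pot_bound by (elim exE conjE) (rule that)
  obtain R where R: "R > 0" "\<And>Q. Q \<in> frontier \<Omega> \<Longrightarrow> norm Q \<le> R" by (rule frontier_radius) (rule that)
  \<comment> \<open>For j \<le> 1 the factor of \<open>pot_bound\<close> is at most 2^2 = 4.\<close>
  define K where "K = c\<^sub>\<alpha> * (C * nD \<phi> * M * 4)"
  have K0: "K \<ge> 0" using c_pos C(1) nD_nonneg[OF \<phi>] creg_nonneg[OF M] by (simp add: K_def)
  define G where "G = 2 powr (real_of_int 1 * \<gamma>) * (2 + 1 / (1 - 2 powr (- \<gamma>)))"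
  have G0: "G \<ge> 0" using sum_powr_le[OF gamma_pos finite.emptyI, of 1] by (simp add: G_def)
  show ?thesis
  proof (rule that[of "K * G" "R + 1"])
    show "0 \<le> K * G" using K0 G0 by simp
    fix x :: 'a assume x: "norm x > R + 1"
    have xf: "x \<notin> frontier \<Omega>" using x R by force
    have d: "1 \<le> norm (x - Q)" if "Q \<in> frontier \<Omega>" for Q
      using x R(2)[OF that] norm_triangle_ineq2[of x Q] by linarith
    define S where "S = {j. pot \<phi> j (kernel_bump \<gamma>) x \<noteq> 0}"
    have S: "finite S" unfolding S_def by (rule pot_finite_off_frontier[OF \<phi> xf kernel_bump_support])
    have S1: "S \<subseteq> {..1}"
    proof
      fix j assume j: "j \<in> S"
      have "\<not> j > 1"
      proof
        assume "j > 1"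
        then have "2 powr 1 < 2 powr real_of_int j" by (intro powr_less_mono) auto
        then have "pot \<phi> j (kernel_bump \<gamma>) x = 0"
          by (intro pot_vanish_high[where \<delta>=1, OF \<phi> d kernel_bump_support(1)]) auto
        then show False using j by (simp add: S_def)
      qed
      then show "j \<in> {..1}" by simp
    qed
    have "dysum (piece \<phi>) x = (\<Sum>j\<in>S. piece \<phi> j x)"
      by (rule dysum_eq[OF S]) (simp add: S_def piece_def)
    then have "\<bar>dysum (piece \<phi>) x\<bar> \<le> (\<Sum>j\<in>S. \<bar>piece \<phi> j x\<bar>)" by simp
    also have "\<dots> \<le> (\<Sum>j\<in>S. K * 2 powr (real_of_int j * \<gamma>))"
    proof (rule sum_mono)
      fix j assume "j \<in> S"
      then have "2 powr real_of_int j \<le> 2 powr 1" using S1 by (intro powr_mono) auto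
      then have "(max 1 (2 powr real_of_int j))\<^sup>2 \<le> 2\<^sup>2" by (intro power_mono) auto
      then have "C * nD \<phi> * M * (max 1 (2 powr real_of_int j))\<^sup>2 \<le> C * nD \<phi> * M * 4"
        using C(1) nD_nonneg[OF \<phi>] creg_nonneg[OF M] by (intro mult_left_mono) auto
      then have "\<bar>pot \<phi> j (kernel_bump \<gamma>) x\<bar> \<le> C * nD \<phi> * M * 4"
        using C(2)[rule_format, OF \<phi> M1, of j x] by linarith
      then have "c\<^sub>\<alpha> * 2 powr (real_of_int j * \<gamma>) * \<bar>pot \<phi> j (kernel_bump \<gamma>) x\<bar> \<le> c\<^sub>\<alpha> * 2 powr (real_of_int j * \<gamma>) * (C * nD \<phi> * M * 4)"
        using c_pos by (intro mult_left_mono) auto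
      then show "\<bar>piece \<phi> j x\<bar> \<le> K * 2 powr (real_of_int j * \<gamma>)"
        using c_pos by (simp add: piece_def K_def abs_mult mult_ac)
    qed
    also have "\<dots> = K * (\<Sum>j\<in>S. 2 powr (real_of_int j * \<gamma>))" by (simp add: sum_distrib_left)
    also have "\<dots> \<le> K * G" unfolding G_def by (rule mult_left_mono[OF sum_powr_le[OF gamma_pos S S1] K0])
    finally show "\<bar>dysum (piece \<phi>) x\<bar> \<le> K * G" .
  qed
qed

section \<open>The local and the global estimate\<close>

lemma norm_power: "C \<ge> 0 \<Longrightarrow> \<phi> \<in> D \<Longrightarrow> (C * nD \<phi> powr p) powr (1 / p) = C powr (1 / p) * nD \<phi>"
  using p nD_nonneg[of \<phi>] by (simp add: powr_mult powr_powr)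

text \<open>The quotient norm asks for an extension of the potential from the ball to the whole
  space. The sum over scales j \<ge> J is one: pieces with j < J vanish on the ball, because there
  every point is too close to the boundary for their annuli, and the remaining sum has bounded
  support. Finitely many negative scales remain, so no condition on e arises.\<close>

lemma local_estimate:
  assumes "R > 0"
  shows "\<exists>c. \<forall>\<phi>\<in>D. layer_potential \<alpha> \<Omega> \<phi> \<in> besov_on (ball 0 R) \<sigma> p \<and>
    besov_on_norm (ball 0 R) \<sigma> p (layer_potential \<alpha> \<Omega> \<phi>) \<le> c * nD \<phi>"
proof -
  obtain R1 where R1: "R1 > 0" "\<And>Q. Q \<in> frontier \<Omega> \<Longrightarrow> norm Q \<le> R1" by (rule frontier_radius) (rule that)
  have RR: "R + R1 > 0" using assms R1 by simp
  obtain J :: int where J: "\<forall>j\<le>J. 2 powr j * (R + R1) < 1 / 2" using small_dyadic[OF RR] by (rule exE)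
  define I where "I = {J..}"
  define Fs where "Fs \<phi> j x = (if j \<in> I then piece \<phi> j x else 0)" for \<phi> j x
  have ex: "\<exists>C\<ge>0. \<forall>\<phi>\<in>D. \<exists>Gs A. dyadic_family \<sigma> p (Fs \<phi>) Gs A (C * nD \<phi> powr p) \<and> (\<forall>j b x. j \<notin> I \<longrightarrow> Gs j b x = 0)"
    unfolding Fs_def[abs_def]
  proof (rule potential_family[of "\<Sum>j\<in>{J..<0}. 2 powr (real_of_int j * (e * p))"])
    show "(\<Sum>j\<in>F. 2 powr (real_of_int j * (e * p))) \<le> (\<Sum>j\<in>{J..<0}. 2 powr (real_of_int j * (e * p)))"
      if "F \<subseteq> I \<inter> {..<0}" for F
      using that by (intro sum_mono2) (auto simp: I_def)
  qed (auto intro: sum_nonneg)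
  then obtain C where C: "C \<ge> 0" "\<forall>\<phi>\<in>D. \<exists>Gs A. dyadic_family \<sigma> p (Fs \<phi>) Gs A (C * nD \<phi> powr p) \<and> (\<forall>j b x. j \<notin> I \<longrightarrow> Gs j b x = 0)"
    by (elim exE conjE) (rule that)
  let ?C2 = "besov_const J DIM('a) \<sigma> p"
  show ?thesis
  proof (intro exI[of _ "?C2 * C powr (1 / p)"] ballI)
    fix \<phi> assume \<phi>: "\<phi> \<in> D"
    obtain Gs A where GA: "dyadic_family \<sigma> p (Fs \<phi>) Gs A (C * nD \<phi> powr p) \<and> (\<forall>j b x. j \<notin> I \<longrightarrow> Gs j b x = 0)"
      using bspec[OF C(2) \<phi>] by (elim exE) (rule that)
    note df = conjunct1[OF GA]
    define F where "F = dysum (Fs \<phi>)"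
    have Fi: "set_integrable lebesgue K F" if "compact K" for K
      unfolding F_def by (rule dyadic_family.F_locally_integrable[OF df that])
    obtain M and E :: "'a \<Rightarrow> 'a \<Rightarrow> real" where M: "M > 0" "creg 4 M (kernel_bump \<gamma> :: 'a \<Rightarrow> real)"
      by (rule kernel_bump_regular[of \<gamma>]) (rule that)
    have F0: "F x = 0" if x: "norm x > R1 + 2 * 2 powr (- real_of_int J)" for x
    proof -
      have "Fs \<phi> j x = 0" for j
      proof (cases "j \<in> I")
        case True
        then have "2 powr (- real_of_int j) \<le> 2 powr (- real_of_int J)" by (intro powr_mono) (auto simp: I_def)
        then have n: "norm x > R1 + 2 * 2 powr (- real_of_int j)" using x by linarith
        have "pot \<phi> j (kernel_bump \<gamma>) x = 0"
          unfolding pot_def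
        proof (rule dual_zero[OF \<phi>])
          fix Q assume "Q \<in> frontier \<Omega>"
          then have "norm (x - Q) > 2 * 2 powr (- real_of_int j)"
            using R1(2)[of Q] n norm_triangle_ineq2[of x Q] by linarith
          then have "2 powr real_of_int j * norm (x - Q) > 2 powr real_of_int j * (2 * 2 powr (- real_of_int j))" by (intro mult_strict_left_mono) auto
          moreover have "2 powr real_of_int j * (2 * 2 powr (- real_of_int j)) = 2" by (simp add: powr_minus)
          ultimately show "kernel_bump \<gamma> (2 powr real_of_int j *\<^sub>R (x - Q)) = 0" by (intro kernel_bump_support(1)) simp
        qed
        then show ?thesis by (simp add: Fs_def piece_def)
      qed (simp add: Fs_def)
      then show ?thesis unfolding F_def using dysum_eq[of "{}" "Fs \<phi>" x] by simp
    qed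
    have tm: "dist_of F \<in> tempered_distributions"
      by (rule dist_of_tempered_bounded_support[OF locally_integrable_measurable[OF Fi] Fi F0])
    have bes: "dist_of F \<in> besov \<sigma> p" "besov_norm \<sigma> p (dist_of F) \<le> ?C2 * (C * nD \<phi> powr p) powr (1 / p)"
      unfolding F_def using dyadic_family.besov_estimate[OF df tm[unfolded F_def], of J] conjunct2[OF GA] by (auto simp: Fs_def I_def)
    have eq: "layer_potential \<alpha> \<Omega> \<phi> x = F x" if "x \<notin> frontier \<Omega>" "x \<in> ball 0 R" for x
    proof -
      have "piece \<phi> j x = Fs \<phi> j x" for j
      proof (cases "j \<in> I")
        case False
        have "2 powr j * (norm x + R1) \<le> 2 powr j * (R + R1)" using that(2) by (intro mult_left_mono) auto
        also have "\<dots> < 1 / 2" using J[rule_format, of j] False by (simp add: I_def)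
        finally have "pot \<phi> j (kernel_bump \<gamma>) x = 0"
          by (intro pot_vanish_low[where R=R1, OF \<phi>] R1 kernel_bump_support)
        then show ?thesis using False by (simp add: piece_def Fs_def)
      qed (simp add: Fs_def)
      then have "dysum (piece \<phi>) x = F x" by (simp add: F_def dysum_def)
      then show ?thesis using dysum_piece[OF \<phi> that(1)] by simp
    qed
    have "AE x in lebesgue. x \<notin> frontier \<Omega>" using frontier_null[OF dim_less] by (rule AE_completion)
    then have "AE x in lebesgue. x \<in> ball 0 R \<longrightarrow> layer_potential \<alpha> \<Omega> \<phi> x = F x"
      by eventually_elim (use eq in blast)
    then have rep: "represents_on (ball 0 R) (layer_potential \<alpha> \<Omega> \<phi>) (dist_of F)"
      by (intro represents_on_dist_of Fi)
    have n: "besov_norm \<sigma> p (dist_of F) \<le> ?C2 * C powr (1 / p) * nD \<phi>"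
      using bes(2) unfolding norm_power[OF C(1) \<phi>] by (simp add: mult.assoc)
    show "layer_potential \<alpha> \<Omega> \<phi> \<in> besov_on (ball 0 R) \<sigma> p \<and>
      besov_on_norm (ball 0 R) \<sigma> p (layer_potential \<alpha> \<Omega> \<phi>) \<le> ?C2 * C powr (1 / p) * nD \<phi>"
      using besov_on_norm_le[OF bes(1) rep n] bes(1) rep by (auto simp: besov_on_def)
  qed
qed

text \<open>For e > 0 the low-frequency contributions 2^{jep} form a convergent geometric series, so
  all scales can be kept, and the sum is the potential itself off the null set formed by the
  boundary.\<close>

lemma global_estimate:
  assumes e: "e > 0"
  shows "\<exists>c. \<forall>\<phi>\<in>D. \<exists>T\<in>homog_besov \<sigma> p. represents_on UNIV (layer_potential \<alpha> \<Omega> \<phi>) T \<and>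
    homog_besov_norm \<sigma> p T \<le> c * nD \<phi>"
proof -
  have ep: "e * p > 0" using e p by simp
  have ex: "\<exists>C\<ge>0. \<forall>\<phi>\<in>D. \<exists>Gs A. dyadic_family \<sigma> p (\<lambda>j x. if j \<in> UNIV then piece \<phi> j x else 0) Gs A (C * nD \<phi> powr p) \<and> (\<forall>j b x. j \<notin> UNIV \<longrightarrow> Gs j b x = 0)"
  proof (rule potential_family[of "2 powr (real_of_int 0 * (e * p)) * (2 + 1 / (1 - 2 powr (- (e * p))))"])
    show "0 \<le> 2 powr (real_of_int 0 * (e * p)) * (2 + 1 / (1 - 2 powr (- (e * p))))"
      using sum_powr_le[OF ep finite.emptyI, of 0] by simp
    show "(\<Sum>j\<in>F. 2 powr (real_of_int j * (e * p))) \<le> 2 powr (real_of_int 0 * (e * p)) * (2 + 1 / (1 - 2 powr (- (e * p))))"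
      if "finite F" "F \<subseteq> UNIV \<inter> {..<0}" for F
      using that by (intro sum_powr_le[OF ep]) auto
  qed
  then obtain C where C: "C \<ge> 0" "\<forall>\<phi>\<in>D. \<exists>Gs A. dyadic_family \<sigma> p (\<lambda>j x. if j \<in> UNIV then piece \<phi> j x else 0) Gs A (C * nD \<phi> powr p) \<and> (\<forall>j b x. j \<notin> UNIV \<longrightarrow> Gs j b x = 0)"
    by (elim exE conjE) (rule that)
  let ?C2 = "homog_const DIM('a) \<sigma> p powr (1 / p)"
  show ?thesis
  proof (intro exI[of _ "?C2 * C powr (1 / p)"] ballI)
    fix \<phi> assume \<phi>: "\<phi> \<in> D"
    obtain Gs A where GA: "dyadic_family \<sigma> p (\<lambda>j x. if j \<in> UNIV then piece \<phi> j x else 0) Gs A (C * nD \<phi> powr p) \<and> (\<forall>j b x. j \<notin> UNIV \<longrightarrow> Gs j b x = 0)"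
      using bspec[OF C(2) \<phi>] by (elim exE) (rule that)
    have "(\<lambda>j x. if j \<in> UNIV then piece \<phi> j x else 0) = piece \<phi>" by (simp add: fun_eq_iff)
    with conjunct1[OF GA] have df: "dyadic_family \<sigma> p (piece \<phi>) Gs A (C * nD \<phi> powr p)" by (simp only:)
    define F where "F = dysum (piece \<phi>)"
    have Fi: "set_integrable lebesgue K F" if "compact K" for K
      unfolding F_def by (rule dyadic_family.F_locally_integrable[OF df that])
    obtain r B where "B \<ge> 0" "\<And>x. norm x > r \<Longrightarrow> \<bar>dysum (piece \<phi>) x\<bar> \<le> B"
      by (rule potential_bounded_at_infinity[OF \<phi>]) (rule that)
    note rB = this[folded F_def]
    have tm: "dist_of F \<in> tempered_distributions"
      by (rule dist_of_tempered[OF locally_integrable_measurable[OF Fi] Fi[OF compact_cball]]) (use rB in auto)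
    note bes = dyadic_family.homog_estimate[OF df tm[unfolded F_def], folded F_def]
    have "AE x in lebesgue. x \<notin> frontier \<Omega>" using frontier_null[OF dim_less] by (rule AE_completion)
    then have "AE x in lebesgue. x \<in> UNIV \<longrightarrow> layer_potential \<alpha> \<Omega> \<phi> x = F x"
      by eventually_elim (simp add: F_def dysum_piece[OF \<phi>])
    then have rep: "represents_on UNIV (layer_potential \<alpha> \<Omega> \<phi>) (dist_of F)"
      by (intro represents_on_dist_of Fi)
    have n: "homog_besov_norm \<sigma> p (dist_of F) \<le> ?C2 * C powr (1 / p) * nD \<phi>"
      using bes(2) unfolding norm_power[OF C(1) \<phi>] by (simp add: mult.assoc)
    show "\<exists>T\<in>homog_besov \<sigma> p. represents_on UNIV (layer_potential \<alpha> \<Omega> \<phi>) T \<and> homog_besov_norm \<sigma> p T \<le> ?C2 * C powr (1 / p) * nD \<phi>"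
      by (intro bexI[of _ "dist_of F"] conjI rep n bes(1))
  qed
qed

text \<open>With n - 1 the dimension of the boundary, ep = p(n - 1 + s) - (n - 1), so the condition
  on p is the positivity of e once n - 1 + s > 0, which follows from s > -2 and n \<ge> 3.\<close>

lemma e_pos:
  assumes "p > (real DIM('a) - 1) / (real DIM('a) + s - 1)"
  shows "e > 0"
proof -
  have "1 / p < 1" using p by simp
  then have "s > -2" using s by simp
  then have pos: "real DIM('a) + s - 1 > 0" using dim by simp
  have "real DIM('b) < p * (real DIM('b) + s)"
    using assms pos dim by (simp add: divide_less_eq)
  moreover have "e * p = p * (real DIM('b) + s) - real DIM('b)"
  proof -
    have "real DIM('b) / q = real DIM('b) * (1 - 1 / p)" unfolding pq(1)[symmetric] by simp
    then show ?thesis using p by (simp add: e_def field_simps)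
  qed
  ultimately have "e * p > 0" by simp
  then show ?thesis using p by (simp add: zero_less_mult_iff)
qed

end

theorem theorem1p2:
  fixes \<Omega> :: "(real ^ 'n) set"
    and \<alpha> p s r\<^sub>0 :: real
    and N :: nat
    and P :: "nat \<Rightarrow> real ^ 'n"
    and \<Psi> :: "nat \<Rightarrow> real ^ 'm \<Rightarrow> real ^ 'n"
  assumes "CARD('n) \<ge> 3" and "CARD('n) = CARD('m) + 1"
    and "bounded \<Omega>" and "C2_domain \<Omega>"
    and "boundary_atlas \<Omega> r\<^sub>0 N P \<Psi>"
    and "1 / 2 < \<alpha>" and "\<alpha> < 1" and "1 < p"
    and "- 2 * \<alpha> + 1 - 1 / p < s" and "s < 0"
  shows "(\<forall>\<phi>\<in>bdry_besov_dual r\<^sub>0 N \<Psi> s p.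
            layer_potential \<alpha> \<Omega> \<phi> \<in> besov_loc (s + 2 * \<alpha> - 1 + 1 / p) p) \<and>
         (\<forall>R>0. \<Omega> \<subseteq> ball 0 R \<longrightarrow>
            (\<exists>c. \<forall>\<phi>\<in>bdry_besov_dual r\<^sub>0 N \<Psi> s p.
               besov_on_norm (ball 0 R) (s + 2 * \<alpha> - 1 + 1 / p) p (layer_potential \<alpha> \<Omega> \<phi>)
                 \<le> c * bdry_besov_dual_norm r\<^sub>0 N \<Psi> s p \<phi>)) \<and>
         (p > (real CARD('n) - 1) / (real CARD('n) + s - 1) \<longrightarrow>
            (\<exists>c. \<forall>\<phi>\<in>bdry_besov_dual r\<^sub>0 N \<Psi> s p.
               \<exists>T\<in>homog_besov (s + 2 * \<alpha> - 1 + 1 / p) p.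
                 represents_on UNIV (layer_potential \<alpha> \<Omega> \<phi>) T \<and>
                 homog_besov_norm (s + 2 * \<alpha> - 1 + 1 / p) p T
                   \<le> c * bdry_besov_dual_norm r\<^sub>0 N \<Psi> s p \<phi>))"
proof -
  \<comment> \<open>Together with \<alpha> < 1 this turns the lower bound on s into s > -2, the
    range in which the dual space is defined.\<close>
  have "1 / p < 1" using assms(8) by simp
  then have "-2 < s" using assms by linarith
  then interpret layer_setting \<Omega> r\<^sub>0 N P \<Psi> p s \<alpha>
    using assms by unfold_locales auto
  have loc: "\<exists>c. \<forall>\<phi>\<in>bdry_besov_dual r\<^sub>0 N \<Psi> s p. layer_potential \<alpha> \<Omega> \<phi> \<in> besov_on (ball 0 R) (s + 2 * \<alpha> - 1 + 1 / p) p \<and>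
    besov_on_norm (ball 0 R) (s + 2 * \<alpha> - 1 + 1 / p) p (layer_potential \<alpha> \<Omega> \<phi>) \<le> c * bdry_besov_dual_norm r\<^sub>0 N \<Psi> s p \<phi>" if "R > 0" for R
    using local_estimate[OF that] unfolding \<sigma>_def .
  show ?thesis
  proof (intro conjI ballI allI impI)
    fix \<phi> assume "\<phi> \<in> bdry_besov_dual r\<^sub>0 N \<Psi> s p"
    then show "layer_potential \<alpha> \<Omega> \<phi> \<in> besov_loc (s + 2 * \<alpha> - 1 + 1 / p) p"
      unfolding besov_loc_def mem_Collect_eq by (intro allI impI) (drule loc, elim exE, drule (1) bspec, erule conjunct1)
  next
    fix R :: real assume "R > 0"
    from loc[OF this] show "\<exists>c. \<forall>\<phi>\<in>bdry_besov_dual r\<^sub>0 N \<Psi> s p.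
      besov_on_norm (ball 0 R) (s + 2 * \<alpha> - 1 + 1 / p) p (layer_potential \<alpha> \<Omega> \<phi>) \<le> c * bdry_besov_dual_norm r\<^sub>0 N \<Psi> s p \<phi>"
      by (elim exE) (intro exI ballI, drule (1) bspec, erule conjunct2)
  next
    assume "p > (real CARD('n) - 1) / (real CARD('n) + s - 1)"
    then have "e > 0" by (intro e_pos) simp
    from global_estimate[OF this] show "\<exists>c. \<forall>\<phi>\<in>bdry_besov_dual r\<^sub>0 N \<Psi> s p. \<exists>T\<in>homog_besov (s + 2 * \<alpha> - 1 + 1 / p) p.
      represents_on UNIV (layer_potential \<alpha> \<Omega> \<phi>) T \<and>
      homog_besov_norm (s + 2 * \<alpha> - 1 + 1 / p) p T \<le> c * bdry_besov_dual_norm r\<^sub>0 N \<Psi> s p \<phi>"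
      unfolding \<sigma>_def .
  qed
qed

end
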